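(* If $K$ is a knot with crossing number $c(K)=n$, then $\mathtt{str}(K)\leq 2^{n-1}-1$.
   Context: Knots are classical knots in $S^3$, and $c(K)$ is the minimal crossing number. Given a knot diagram with $k$ crossings, choose a non-crossing starting point and a direction and traverse the knot, labeling the crossings $1,2,\ldots,k$ in the order in which they are first encountered; listing the labels of the crossings met in one full traversal gives a $2k$-tuple, a knot word of the diagram. The diagram is straight if, for some choice of starting point and direction, its knot word has the form $(1,2,\ldots,k,\sigma(1),\ldots,\sigma(k))$ with $\sigma\in S_k$, the symmetric group on $k$ elements. The straight number $\mathtt{str}(K)$ is the minimum $k$ such that $K$ has a $k$-crossing straight diagram (every knot has a straight diagram).
   Formalization: For the unknot (n = 0) the printed bound 2^(n-1)-1 = -1/2 fails since str = 0; there the bound is read as 0, and for every n ≥ 1 the bound is exactly the printed one. *)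

theory Defs
  imports
    "HOL-Analysis.Analysis"
    "HOL-Library.Extended_Nat"
    "HOL-Combinatorics.Permutations"
begin

text \<open>
  Three-space is \<open>complex \<times> real\<close> (projection plane times height), and the 3-sphere is the unit
  sphere of \<open>(complex \<times> real) \<times> real\<close>.
\<close>

type_synonym space3 = "complex \<times> real"
type_synonym space4 = "space3 \<times> real"

abbreviation S3 :: "space4 set" where
  "S3 \<equiv> sphere 0 1"

text \<open>Inverse stereographic projection from the north pole \<open>(0, 1)\<close>.\<close>

definition inv_stereo :: "space3 \<Rightarrow> space4" where
  "inv_stereo x = ((2 / (1 + (norm x)\<^sup>2)) *\<^sub>R x, ((norm x)\<^sup>2 - 1) / (1 + (norm x)\<^sup>2))"

definition ambient_isotopic :: "space4 set \<Rightarrow> space4 set \<Rightarrow> bool" where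
  "ambient_isotopic K L \<longleftrightarrow>
     (\<exists>H :: real \<Rightarrow> space4 \<Rightarrow> space4.
        continuous_on ({0..1} \<times> S3) (\<lambda>(t, x). H t x) \<and>
        (\<forall>t\<in>{0..1}. \<exists>G. homeomorphism S3 S3 (H t) G) \<and>
        (\<forall>x\<in>S3. H 0 x = x) \<and>
        H 1 ` K = L)"

definition piecewise_linear_path :: "(real \<Rightarrow> 'a::real_normed_vector) \<Rightarrow> bool" where
  "piecewise_linear_path g \<longleftrightarrow>
     path g \<and>
     (\<exists>B. finite B \<and>
        (\<forall>t\<in>{0<..<1} - B. \<exists>v. \<forall>\<^sub>F s in at t. g s = g t + (s - t) *\<^sub>R v))"

definition polygonal_loop :: "(real \<Rightarrow> space3) \<Rightarrow> bool" where
  "polygonal_loop g \<longleftrightarrow>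
     piecewise_linear_path g \<and> simple_path g \<and> pathfinish g = pathstart g"

definition represents :: "(real \<Rightarrow> space3) \<Rightarrow> space4 set \<Rightarrow> bool" where
  "represents g K \<longleftrightarrow> ambient_isotopic (inv_stereo ` path_image g) K"

text \<open>Classical knots are tame: wild simple closed curves, which have no diagram, are excluded.\<close>

definition knot :: "space4 set \<Rightarrow> bool" where
  "knot K \<longleftrightarrow>
     K \<subseteq> S3 \<and> K homeomorphic sphere (0::complex) 1 \<and>
     (\<exists>g. polygonal_loop g \<and> represents g K)"

text \<open>
  A diagram is given by a polygonal knot in general position with respect to the vertical
  projection \<open>fst\<close>; the heights \<open>snd\<close> carry the over/under information.  A loop is traversed
  once by the times in \<open>{0..<1}\<close>.
\<close>

definition shadow :: "(real \<Rightarrow> space3) \<Rightarrow> real \<Rightarrow> complex" where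
  "shadow g t = fst (g t)"

definition crossing_times :: "(real \<Rightarrow> space3) \<Rightarrow> real set" where
  "crossing_times g = {t \<in> {0..<1}. \<exists>s\<in>{0..<1}. s \<noteq> t \<and> shadow g s = shadow g t}"

definition crossings :: "(real \<Rightarrow> space3) \<Rightarrow> complex set" where
  "crossings g = shadow g ` crossing_times g"

text \<open>
  Finitely many crossings, all of them transverse double points that are not projections of
  corners (at a corner of the projection the derivative does not exist).  The parametrisation is
  required to start away from the crossings, which is no restriction on the closed curve.
\<close>

definition knot_diagram :: "(real \<Rightarrow> space3) \<Rightarrow> bool" where
  "knot_diagram g \<longleftrightarrow>
     polygonal_loop g \<and>
     finite (crossings g) \<and>
     0 \<notin> crossing_times g \<and>
     (\<forall>p\<in>crossings g. card {t \<in> {0..<1}. shadow g t = p} = 2) \<and>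
     (\<forall>s\<in>crossing_times g. \<forall>t\<in>crossing_times g. s \<noteq> t \<and> shadow g s = shadow g t \<longrightarrow>
        (\<exists>v w. (shadow g has_vector_derivative v) (at s) \<and>
               (shadow g has_vector_derivative w) (at t) \<and>
               \<not> collinear {0, v, w}))"

definition num_crossings :: "(real \<Rightarrow> space3) \<Rightarrow> nat" where
  "num_crossings g = card (crossings g)"

text \<open>
  \<open>label_of ps p\<close> is the position of \<open>p\<close>, counted from 1, among the distinct entries of \<open>ps\<close>
  in order of first occurrence.
\<close>

definition label_of :: "'a list \<Rightarrow> 'a \<Rightarrow> nat" where
  "label_of ps p = Suc (card (set (takeWhile (\<lambda>q. q \<noteq> p) ps)))"

definition crossing_sequence :: "(real \<Rightarrow> space3) \<Rightarrow> complex list" where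
  "crossing_sequence g = map (shadow g) (sorted_list_of_set (crossing_times g))"

definition knot_word :: "(real \<Rightarrow> space3) \<Rightarrow> nat list" where
  "knot_word g = map (label_of (crossing_sequence g)) (crossing_sequence g)"

definition straight_word :: "nat \<Rightarrow> nat list \<Rightarrow> bool" where
  "straight_word k w \<longleftrightarrow>
     (\<exists>\<sigma>. \<sigma> permutes {1..k} \<and> w = [1..<Suc k] @ map \<sigma> [1..<Suc k])"

definition straight_diagram :: "(real \<Rightarrow> space3) \<Rightarrow> bool" where
  "straight_diagram g \<longleftrightarrow>
     knot_diagram g \<and>
     (\<exists>a\<in>{0..<1} - crossing_times g.
        \<exists>h\<in>{shiftpath a g, reversepath (shiftpath a g)}.
          straight_word (num_crossings g) (knot_word h))"

text \<open>
  The minima are taken in \<^typ>\<open>enat\<close>, so that a finite value entails the existence of a diagram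
  attaining it (the infimum of the empty set is \<open>\<infinity>\<close>).
\<close>

definition crossing_number :: "space4 set \<Rightarrow> enat" where
  "crossing_number K =
     Inf {enat (num_crossings g) | g. knot_diagram g \<and> represents g K}"

definition straight_number :: "space4 set \<Rightarrow> enat" where
  "straight_number K =
     Inf {enat (num_crossings g) | g. straight_diagram g \<and> represents g K}"

end

theory Submission
  imports Defs
begin

text \<open>
  Divide the closed curve of a diagram into two arcs, the first of which has no self-crossings.
  If the second arc has none either, then the diagram is straight.  Otherwise go along the second
  arc from one of its ends up to its first self-crossing, passing some crossings with the first
  arc, and push the strand that is crossed there by a finger back along the way and over the end
  of the arc.  This turns one self-crossing into a mixed one and adds two mixed crossings for each
  one that was passed, and from the better of the two ends at most half of them are passed; hence
  the number of mixed crossings plus one is at most doubled for each self-crossing.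
  A minimal diagram with \<open>n \<ge> 3\<close> crossings contains three consecutive passages through distinct
  crossings, so one may start with three mixed crossings and \<open>n - 3\<close> self-crossings, which gives
  \<open>4 \<cdot> 2 ^ (n - 3) - 1\<close> crossings.  Such passages exist since, in a minimal diagram, the two
  passages through a crossing are never consecutive (the loop between them can be removed); the
  case \<open>n = 2\<close> does not occur because, by the Jordan curve theorem, the word \<open>1212\<close> is impossible.
\<close>


section \<open>Ambient isotopy\<close>

text \<open>The isotopies are the costly part: an ambient isotopy of the sphere has to be exhibited.
  Each one used here is composed of triangle moves, which replace one edge of a polygon by the other
  two edges of a triangle that the rest of the knot avoids. Avoiding is a condition in space, so the
  tip of a finger is put above (or below) the whole knot, and near its base the finger is higher
  (lower) than the strand that it is pulled off.

  The doubling comes from an invariant. Passing one mixed crossing adds two mixed crossings and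
  leaves one less ahead, so the number of mixed crossings plus twice the number of those ahead does
  not change, and the final step adds one. Hence m mixed crossings, at most m/2 of them ahead,
  become at most 2m + 1. Kinks have to be passed as well, because a triangle can only follow a
  straight segment; they cost nothing.

  Crossings are recorded as ordered pairs of times with equal projection. A move keeps the
  parametrisation outside the piece that it changes, so surviving crossings keep their times, and
  the bookkeeping concerns finite relations on the reals.\<close>

text \<open>Time is reversed, and the inverse \<open>G\<close> of the final map is applied first, so
  that the new isotopy starts at the identity.\<close>

lemma ambient_isotopic_sym:
  assumes "ambient_isotopic K L" "K \<subseteq> S3"
  shows "ambient_isotopic L K"
proof -
  obtain H where cont: "continuous_on ({0..1} \<times> S3) (\<lambda>(t, x). H t x)"
    and hom: "\<And>t. t \<in> {0..1::real} \<Longrightarrow> \<exists>G. homeomorphism S3 S3 (H t) G"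
    and id: "\<And>x. x \<in> S3 \<Longrightarrow> H 0 x = x" and im: "H 1 ` K = L"
    using assms(1) unfolding ambient_isotopic_def by blast
  obtain G where G: "homeomorphism S3 S3 (H 1) G" using hom[of 1] by auto
  let ?J = "\<lambda>t x. H (1 - t) (G x)"
  have GS: "G ` S3 = S3" and Gc: "continuous_on S3 G" and HG: "\<And>x. x \<in> S3 \<Longrightarrow> H 1 (G x) = x"
    and GH: "\<And>x. x \<in> S3 \<Longrightarrow> G (H 1 x) = x"
    using G unfolding homeomorphism_def by auto
  have "continuous_on ({0..1::real} \<times> S3) (\<lambda>z. (1 - fst z, G (snd z)))"
    by (intro continuous_on_Pair continuous_on_diff continuous_on_const continuous_on_fst continuous_on_id
        continuous_on_snd continuous_on_compose2[OF Gc]) auto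
  moreover have "(\<lambda>z. (1 - fst z, G (snd z))) ` ({0..1::real} \<times> S3) \<subseteq> {0..1} \<times> S3"
    using GS by auto
  ultimately have "continuous_on ({0..1} \<times> S3) ((\<lambda>(t, x). H t x) \<circ> (\<lambda>z. (1 - fst z, G (snd z))))"
    using continuous_on_compose[OF _ continuous_on_subset[OF cont]] by blast
  then have 1: "continuous_on ({0..1} \<times> S3) (\<lambda>(t, x). ?J t x)"
    by (simp add: o_def case_prod_beta)
  have 2: "\<exists>G'. homeomorphism S3 S3 (?J t) G'" if t: "t \<in> {0..1}" for t :: real
  proof -
    obtain G' where "homeomorphism S3 S3 (H (1 - t)) G'" using hom[of "1 - t"] t by auto
    from homeomorphism_compose[OF homeomorphism_symD[OF G] this]
    show ?thesis by (auto simp: o_def)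
  qed
  have "?J 1 ` L = K"
    unfolding im[symmetric] image_image using assms(2) GH id by (force simp: subset_iff image_iff)
  then show ?thesis
    unfolding ambient_isotopic_def using 1 2 HG by (intro exI[of _ ?J]) auto
qed

text \<open>The second isotopy is applied after the final map \<open>H 1\<close> of the first one,
  which makes the two halves agree at time 1/2.\<close>

lemma ambient_isotopic_trans:
  assumes "ambient_isotopic K L" "ambient_isotopic L M" "K \<subseteq> S3"
  shows "ambient_isotopic K M"
proof -
  obtain H where cont: "continuous_on ({0..1} \<times> S3) (\<lambda>(t, x). H t x)"
    and hom: "\<And>t. t \<in> {0..1::real} \<Longrightarrow> \<exists>G. homeomorphism S3 S3 (H t) G"
    and id: "\<And>x. x \<in> S3 \<Longrightarrow> H 0 x = x" and im: "H 1 ` K = L"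
    using assms(1) unfolding ambient_isotopic_def by blast
  obtain H' where cont': "continuous_on ({0..1} \<times> S3) (\<lambda>(t, x). H' t x)"
    and hom': "\<And>t. t \<in> {0..1::real} \<Longrightarrow> \<exists>G. homeomorphism S3 S3 (H' t) G"
    and id': "\<And>x. x \<in> S3 \<Longrightarrow> H' 0 x = x" and im': "H' 1 ` L = M"
    using assms(2) unfolding ambient_isotopic_def by blast
  obtain G where G: "homeomorphism S3 S3 (H 1) G" using hom[of 1] by auto
  have H1: "H 1 x \<in> S3" if "x \<in> S3" for x using G that unfolding homeomorphism_def by blast
  have H1c: "continuous_on S3 (H 1)" using G unfolding homeomorphism_def by auto
  let ?J = "\<lambda>t x. if t \<le> 1/2 then H (2 * t) x else H' (2 * t - 1) (H 1 x)"
  have eq: "{0..1} \<times> S3 = {0..1/2} \<times> S3 \<union> {1/2..1::real} \<times> S3" by auto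
  have "continuous_on ({0..1/2} \<times> S3 \<union> {1/2..1::real} \<times> S3)
      (\<lambda>z. if fst z \<le> 1/2 then H (2 * fst z) (snd z) else H' (2 * fst z - 1) (H 1 (snd z)))"
  proof (rule continuous_on_cases)
    show "closed ({0..1/2::real} \<times> S3)" "closed ({1/2..1::real} \<times> S3)"
      by (auto intro!: closed_Times)
    have "continuous_on ({0..1/2} \<times> S3) ((\<lambda>(t, x). H t x) \<circ> (\<lambda>z. (2 * fst z, snd z)))"
      by (intro continuous_on_compose continuous_intros continuous_on_subset[OF cont]) auto
    then show "continuous_on ({0..1/2} \<times> S3) (\<lambda>z. H (2 * fst z) (snd z))" by (simp add: o_def)
    have "continuous_on ({1/2..1} \<times> S3) ((\<lambda>(t, x). H' t x) \<circ> (\<lambda>z. (2 * fst z - 1, H 1 (snd z))))"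
      by (intro continuous_on_compose continuous_intros continuous_on_subset[OF cont']
          continuous_on_compose2[OF H1c]) (use H1 in auto)
    then show "continuous_on ({1/2..1} \<times> S3) (\<lambda>z. H' (2 * fst z - 1) (H 1 (snd z)))"
      by (simp add: o_def)
    show "\<forall>z. z \<in> {0..1/2} \<times> S3 \<and> \<not> fst z \<le> 1/2 \<or> z \<in> {1/2..1} \<times> S3 \<and> fst z \<le> 1/2 \<longrightarrow>
        H (2 * fst z) (snd z) = H' (2 * fst z - 1) (H 1 (snd z))"
    proof (intro allI impI)
      fix z :: "real \<times> space4"
      assume "z \<in> {0..1/2} \<times> S3 \<and> \<not> fst z \<le> 1/2 \<or> z \<in> {1/2..1} \<times> S3 \<and> fst z \<le> 1/2"
      then have *: "2 * fst z = 1" "snd z \<in> S3" by auto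
      show "H (2 * fst z) (snd z) = H' (2 * fst z - 1) (H 1 (snd z))"
        unfolding *(1) using id'[OF H1[OF *(2)]] by simp
    qed
  qed
  then have 1: "continuous_on ({0..1} \<times> S3) (\<lambda>(t, x). ?J t x)"
    by (simp add: eq case_prod_beta)
  have 2: "\<exists>G'. homeomorphism S3 S3 (?J t) G'" if t: "t \<in> {0..1}" for t :: real
  proof (cases "t \<le> 1/2")
    case True then show ?thesis using hom[of "2 * t"] t by auto
  next
    case False
    obtain G' where "homeomorphism S3 S3 (H' (2 * t - 1)) G'" using hom'[of "2 * t - 1"] t False by auto
    from homeomorphism_compose[OF G this]
    show ?thesis using False by (auto simp: o_def)
  qed
  have "?J 1 ` K = M" using im im' by auto
  then show ?thesis
    unfolding ambient_isotopic_def using 1 2 id by (intro exI[of _ ?J]) auto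
qed

lemma ambient_isotopic_refl: "ambient_isotopic K K"
  unfolding ambient_isotopic_def
  by (intro exI[of _ "\<lambda>t x. x"]) (auto simp: case_prod_beta intro!: continuous_intros exI[of _ "\<lambda>x. x"] homeomorphismI)

section \<open>Stereographic coordinates and isotopies with compact support\<close>

text \<open>At the north pole division by zero gives the value 0, which is why
  \<open>snd z < 1\<close> is assumed where \<open>stereo\<close> is inverted.\<close>

definition stereo :: "space4 \<Rightarrow> space3" where
  "stereo z = (1 / (1 - snd z)) *\<^sub>R fst z"

lemma norm_space4: "(norm z)\<^sup>2 = (norm (fst z))\<^sup>2 + (snd z)\<^sup>2" for z :: space4
  by (cases z) (simp add: norm_Pair)

lemma S3_iff: "z \<in> S3 \<longleftrightarrow> (norm (fst z))\<^sup>2 + (snd z)\<^sup>2 = 1" for z :: space4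
  using norm_space4[of z] by (simp add: power2_eq_1_iff) (smt (verit) norm_ge_zero power2_eq_1_iff)

lemma inv_stereo_in_S3: "inv_stereo x \<in> S3"
proof -
  define N where "N = (norm x)\<^sup>2"
  have N: "1 + N > 0" unfolding N_def by (smt (verit) zero_le_power2)
  have "(norm ((2 / (1 + N)) *\<^sub>R x))\<^sup>2 + ((N - 1) / (1 + N))\<^sup>2 = 1"
  proof -
    have "(norm ((2 / (1 + N)) *\<^sub>R x))\<^sup>2 = 4 * N / (1 + N)\<^sup>2"
      unfolding norm_scaleR power_mult_distrib by (simp add: N_def power_divide)
    moreover have "4 * N / (1 + N)\<^sup>2 + ((N - 1) / (1 + N))\<^sup>2 = ((1 + N)\<^sup>2) / (1 + N)\<^sup>2"
      by (simp add: power_divide add_divide_distrib[symmetric]) (simp add: power2_eq_square algebra_simps)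
    ultimately show ?thesis using N by simp
  qed
  then show ?thesis unfolding S3_iff by (simp add: inv_stereo_def N_def)
qed

lemma one_minus_snd_inv_stereo: "1 - snd (inv_stereo x) = 2 / (1 + (norm x)\<^sup>2)"
proof -
  have "1 + (norm x)\<^sup>2 > 0" by (smt (verit) zero_le_power2)
  then show ?thesis by (simp add: inv_stereo_def field_simps)
qed

lemma stereo_inv_stereo [simp]: "stereo (inv_stereo x) = x"
proof -
  have "1 + (norm x)\<^sup>2 > 0" by (smt (verit) zero_le_power2)
  then have "(1 / (2 / (1 + (norm x)\<^sup>2))) * (2 / (1 + (norm x)\<^sup>2)) = 1" by simp
  then show ?thesis unfolding stereo_def one_minus_snd_inv_stereo
    by (simp only: inv_stereo_def fst_conv scaleR_scaleR scaleR_one)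
qed

lemma norm_stereo: "(norm (stereo z))\<^sup>2 = (1 + snd z) / (1 - snd z)" if "z \<in> S3" "snd z < 1"
proof -
  have "(norm (fst z))\<^sup>2 = (1 + snd z) * (1 - snd z)" using that(1) unfolding S3_iff
    by (simp add: algebra_simps power2_eq_square)
  then show ?thesis using that(2)
    by (simp add: stereo_def power_mult_distrib power_divide) (simp add: power2_eq_square)
qed

lemma inv_stereo_stereo: "inv_stereo (stereo z) = z" if "z \<in> S3" "snd z < 1"
proof -
  have 1: "1 + (norm (stereo z))\<^sup>2 = 2 / (1 - snd z)" using that(2)
    by (simp add: norm_stereo[OF that] field_simps)
  have 2: "(norm (stereo z))\<^sup>2 - 1 = 2 * snd z / (1 - snd z)" using that(2)
    by (simp add: norm_stereo[OF that] field_simps)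
  show ?thesis unfolding inv_stereo_def 1 2 using that(2)
    by (simp add: stereo_def prod_eq_iff)
qed

lemma continuous_on_inv_stereo: "continuous_on A inv_stereo"
proof -
  have "1 + (norm x)\<^sup>2 \<noteq> 0" for x :: space3 by (smt (verit) zero_le_power2)
  then show ?thesis unfolding inv_stereo_def[abs_def] by (intro continuous_intros) auto
qed

text \<open>A family of bijections of space that fixes everything outside a ball extends to the
  sphere by the identity near the north pole. Bijectivity suffices at each time: a continuous
  bijection of the compact sphere is a homeomorphism.\<close>

lemma ambient_isotopic_compact_support:
  fixes F :: "real \<Rightarrow> space3 \<Rightarrow> space3"
  assumes cont: "continuous_on ({0..1} \<times> UNIV) (\<lambda>(t, x). F t x)"
    and bij: "\<And>t. t \<in> {0..1} \<Longrightarrow> bij (F t)"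
    and F0: "\<And>x. F 0 x = x"
    and r: "r > 0" and supp: "\<And>t x. t \<in> {0..1} \<Longrightarrow> norm x \<ge> r \<Longrightarrow> F t x = x"
  shows "ambient_isotopic (inv_stereo ` X) (inv_stereo ` F 1 ` X)"
proof -
  \<comment> \<open>The sphere of radius \<open>r\<close> in space corresponds to the height
    \<open>c\<close> on the 3-sphere.\<close>
  define c where "c = (r\<^sup>2 - 1) / (r\<^sup>2 + 1)"
  have r1: "r\<^sup>2 + 1 > 0" by (smt (verit) zero_le_power2)
  have c1: "c < 1" unfolding c_def using r1 by (simp add: field_simps)
  have far: "snd (inv_stereo x) \<ge> c \<longleftrightarrow> norm x \<ge> r" for x
  proof -
    have "snd (inv_stereo x) \<ge> c \<longleftrightarrow> 1 - snd (inv_stereo x) \<le> 1 - c" by auto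
    also have "1 - c = 2 / (1 + r\<^sup>2)" using r1 by (simp add: c_def field_simps)
    also have "1 - snd (inv_stereo x) \<le> 2 / (1 + r\<^sup>2) \<longleftrightarrow> 1 + r\<^sup>2 \<le> 1 + (norm x)\<^sup>2"
      unfolding one_minus_snd_inv_stereo
      by (smt (verit) divide_less_cancel divide_strict_left_mono frac_le mult_pos_pos zero_le_power2)
    also have "\<dots> \<longleftrightarrow> norm x \<ge> r" using r by (simp add: power_mono_iff)
    finally show ?thesis .
  qed
  have far': "norm (stereo z) \<ge> r \<longleftrightarrow> snd z \<ge> c" if "z \<in> S3" "snd z < 1" for z
    using far[of "stereo z"] inv_stereo_stereo[OF that] by simp
  \<comment> \<open>The two branches meet where \<open>snd z = c\<close>; there
    \<open>stereo z\<close> has norm \<open>r\<close> and is fixed by \<open>F t\<close>, so they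
    agree.\<close>
  define H where "H = (\<lambda>t z. if snd z \<ge> c then z else inv_stereo (F t (stereo z)))"
  \<comment> \<open>A bijection that fixes the outside of a ball pointwise maps the ball onto
    itself.\<close>
  have near: "norm (F t x) < r \<longleftrightarrow> norm x < r" if t: "t \<in> {0..1}" for t x
    using supp[OF t] bij[OF t] by (metis bij_pointE linorder_not_less)
  have lt1: "snd (inv_stereo x) < 1" for x
  proof -
    have "2 / (1 + (norm x)\<^sup>2) > 0" by (smt (verit) zero_le_power2 divide_pos_pos)
    then show ?thesis using one_minus_snd_inv_stereo[of x] by linarith
  qed
  have HX: "H t (inv_stereo x) = inv_stereo (F t x)" if "t \<in> {0..1}" for t x
    using that far supp by (auto simp: H_def)
  have contH: "continuous_on ({0..1} \<times> S3) (\<lambda>(t, x). H t x)"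
  proof -
    have eq: "{0..1} \<times> S3 = {0..1} \<times> {z \<in> S3. snd z \<ge> c} \<union> {0..1::real} \<times> {z \<in> S3. snd z \<le> c}"
      by auto
    have "continuous_on ({0..1} \<times> {z \<in> S3. snd z \<ge> c} \<union> {0..1::real} \<times> {z \<in> S3. snd z \<le> c})
      (\<lambda>z. if snd (snd z) \<ge> c then snd z else inv_stereo (F (fst z) (stereo (snd z))))"
    proof (rule continuous_on_cases)
      have "closed (S3 \<inter> {z :: space4. snd z \<ge> c})" "closed (S3 \<inter> {z :: space4. snd z \<le> c})"
        by (intro closed_Int closed_sphere closed_Collect_le continuous_on_const continuous_on_snd continuous_on_id)+
      then show "closed ({0..1::real} \<times> {z \<in> S3. snd z \<ge> c})" "closed ({0..1::real} \<times> {z \<in> S3. snd z \<le> c})"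
        by (simp_all add: closed_Times Int_def)
      show "continuous_on ({0..1::real} \<times> {z \<in> S3. snd z \<ge> c}) snd" by (intro continuous_intros)
      have "continuous_on ({0..1::real} \<times> {z \<in> S3. snd z \<le> c}) (\<lambda>z. (fst z, stereo (snd z)))"
        unfolding stereo_def using c1 by (intro continuous_intros) auto
      then have "continuous_on ({0..1::real} \<times> {z \<in> S3. snd z \<le> c})
          (inv_stereo \<circ> ((\<lambda>(t, x). F t x) \<circ> (\<lambda>z. (fst z, stereo (snd z)))))"
        by (intro continuous_on_compose continuous_on_inv_stereo continuous_on_subset[OF cont]) auto
      then show "continuous_on ({0..1::real} \<times> {z \<in> S3. snd z \<le> c})
          (\<lambda>z. inv_stereo (F (fst z) (stereo (snd z))))" by (simp add: o_def)
      show "\<forall>z. z \<in> {0..1} \<times> {z \<in> S3. c \<le> snd z} \<and> \<not> c \<le> snd (snd z) \<or>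
        z \<in> {0..1::real} \<times> {z \<in> S3. snd z \<le> c} \<and> c \<le> snd (snd z) \<longrightarrow>
        snd z = inv_stereo (F (fst z) (stereo (snd z)))"
        using far' c1 supp inv_stereo_stereo by (auto simp: S3_iff)
    qed
    then show ?thesis by (simp add: H_def case_prod_beta eq)
  qed
  have hom: "\<exists>G. homeomorphism S3 S3 (H t) G" if t: "t \<in> {0..1}" for t
  proof (rule homeomorphism_compact)
    show "compact S3" by simp
    have "continuous_on S3 ((\<lambda>(t, x). H t x) \<circ> (\<lambda>x. (t, x)))"
      by (intro continuous_on_compose continuous_intros continuous_on_subset[OF contH]) (use t in auto)
    then show "continuous_on S3 (H t)" by (simp add: o_def)
    have st: "norm (stereo z) < r" if "z \<in> S3" "snd z < c" for z
      using far'[of z] that c1 by force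
    have inS: "H t z \<in> S3" if "z \<in> S3" for z using that inv_stereo_in_S3 by (auto simp: H_def)
    have lo: "snd (H t z) < c" if "z \<in> S3" "snd z < c" for z
    proof -
      have "norm (F t (stereo z)) < r" using st[OF that] near[OF t] by blast
      then have "snd (inv_stereo (F t (stereo z))) < c" using far by (meson linorder_not_le)
      then show ?thesis using that(2) by (simp add: H_def)
    qed
    show "H t ` S3 = S3"
    proof
      show "H t ` S3 \<subseteq> S3" using inS by auto
      show "S3 \<subseteq> H t ` S3"
      proof
        fix z :: space4 assume z: "z \<in> S3"
        show "z \<in> H t ` S3"
        proof (cases "snd z \<ge> c")
          case True then show ?thesis using z by (intro image_eqI[of _ _ z]) (auto simp: H_def)
        next
          case False
          obtain y where y: "F t y = stereo z" using bij[OF t] by (metis bij_pointE)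
          have "H t (inv_stereo y) = z" unfolding HX[OF t] y using z False c1 by (simp add: inv_stereo_stereo)
          then show ?thesis using inv_stereo_in_S3 by blast
        qed
      qed
    qed
    show "inj_on (H t) S3"
    proof (rule inj_onI)
      fix y z assume yz: "y \<in> S3" "z \<in> S3" "H t y = H t z"
      show "y = z"
      proof (cases "snd y \<ge> c \<or> snd z \<ge> c")
        case True
        then show ?thesis using lo[OF yz(1)] lo[OF yz(2)] yz(3) by (force simp: H_def)
      next
        case False
        then have "inv_stereo (F t (stereo y)) = inv_stereo (F t (stereo z))"
          using yz(3) by (simp add: H_def)
        then have "F t (stereo y) = F t (stereo z)" by (metis stereo_inv_stereo)
        then have e: "stereo y = stereo z" using bij_is_inj[OF bij[OF t]] by (simp add: inj_eq)
        have "snd y < 1" "snd z < 1" using False c1 by linarith+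
        then show ?thesis using e yz inv_stereo_stereo by metis
      qed
    qed
  qed
  have im: "H 1 ` inv_stereo ` X = inv_stereo ` F 1 ` X" by (simp add: HX image_image)
  have "H 0 z = z" if "z \<in> S3" for z
    using that c1 F0 inv_stereo_stereo[of z] by (simp add: H_def)
  then show ?thesis unfolding ambient_isotopic_def
    by (intro exI[of _ H] conjI ballI contH hom im)
qed

section \<open>Triangle moves\<close>

text \<open>Every line parallel to \<open>v\<close> is mapped to itself. By the slope condition
  \<open>\<phi>\<close> drops more slowly along the line than the parameter grows, so the map is
  strictly increasing on the line at every time; surjectivity is the intermediate value
  theorem.\<close>

lemma ambient_isotopic_shear:
  fixes v :: space3
  assumes cont: "continuous_on UNIV \<phi>"
    and nonneg: "\<And>x. 0 \<le> \<phi> x"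
    and supp: "\<And>x. norm x \<ge> r \<Longrightarrow> \<phi> x = 0" and r: "r > 0"
    and slope: "\<And>x s. s > 0 \<Longrightarrow> \<phi> (x + s *\<^sub>R v) > \<phi> x - s"
  shows "ambient_isotopic (inv_stereo ` X) (inv_stereo ` (\<lambda>x. x + \<phi> x *\<^sub>R v) ` X)"
proof -
  define F where "F = (\<lambda>t x. x + (t * \<phi> x) *\<^sub>R v)"
  have "\<exists>B. \<forall>x. \<phi> x \<le> B"
  proof -
    have "compact (\<phi> ` cball 0 r)"
      by (intro compact_continuous_image continuous_on_subset[OF cont]) auto
    then obtain B where B: "\<And>y. y \<in> \<phi> ` cball 0 r \<Longrightarrow> norm y \<le> B"
      using compact_imp_bounded bounded_iff by metis
    have "\<phi> x \<le> max B 0" for x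
      using B[of "\<phi> x"] supp[of x] by (cases "norm x \<ge> r") force+
    then show ?thesis by blast
  qed
  then obtain B where B: "\<And>x. \<phi> x \<le> B" by blast
  have inj: "x = y" if t: "t \<in> {0..1}" and eq: "F t x = F t y" and le: "\<phi> y \<le> \<phi> x" for t x y
  proof (rule ccontr)
    assume "x \<noteq> y"
    define s where "s = t * \<phi> x - t * \<phi> y"
    have y: "y = x + s *\<^sub>R v" using eq unfolding F_def s_def by (simp add: algebra_simps)
    with \<open>x \<noteq> y\<close> have "s \<noteq> 0" by auto
    moreover have "s \<ge> 0" using t le by (simp add: s_def mult_left_mono)
    ultimately have s0: "s > 0" by simp
    have "\<phi> x - \<phi> y < s" using slope[OF s0, of x] y by simp
    moreover have "s \<le> \<phi> x - \<phi> y"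
      unfolding s_def right_diff_distrib[symmetric] using t le by (simp add: mult_left_le_one_le)
    ultimately show False by simp
  qed
  have "ambient_isotopic (inv_stereo ` X) (inv_stereo ` F 1 ` X)"
  proof (rule ambient_isotopic_compact_support[OF _ _ _ r])
    have "continuous_on ({0..1} \<times> UNIV) (\<lambda>z. snd z + (fst z * \<phi> (snd z)) *\<^sub>R v)"
      by (intro continuous_on_add continuous_on_scaleR continuous_on_mult continuous_on_fst continuous_on_snd
          continuous_on_id continuous_on_const continuous_on_compose2[OF cont]) auto
    then show "continuous_on ({0..1} \<times> UNIV) (\<lambda>(t, x). F t x)" by (simp add: F_def case_prod_beta)
    show "F 0 x = x" for x by (simp add: F_def)
    show "F t x = x" if "norm x \<ge> r" for t x using supp[OF that] by (simp add: F_def)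
    show "bij (F t)" if t: "t \<in> {0..1}" for t
    proof (rule bijI)
      show "inj (F t)" using inj[OF t] by (metis injI linorder_le_cases)
      show "surj (F t)"
      proof -
        have "\<exists>x. y = F t x" for y
        proof -
          \<comment> \<open>The preimage of \<open>y\<close> is sought as
            \<open>y - s *\<^sub>R v\<close>. Then \<open>s\<close> has to be the displacement of
            that point, a number between 0 and a bound of \<open>\<phi>\<close>.\<close>
          let ?f = "\<lambda>s. s - t * \<phi> (y - s *\<^sub>R v)"
          have "\<exists>s. 0 \<le> s \<and> s \<le> max B 0 \<and> ?f s = 0"
          proof (rule IVT')
            show "?f 0 \<le> 0" using t nonneg by simp
            have "t * \<phi> (y - max B 0 *\<^sub>R v) \<le> 1 * max B 0"
              using t nonneg B[of "y - max B 0 *\<^sub>R v"] by (intro mult_mono) auto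
            then show "0 \<le> ?f (max B 0)" by simp
            show "continuous_on {0..max B 0} ?f"
              by (intro continuous_intros continuous_on_compose2[OF cont]) auto
          qed auto
          then obtain s where "s = t * \<phi> (y - s *\<^sub>R v)" by auto
          then have "y = F t (y - s *\<^sub>R v)" unfolding F_def by (metis diff_add_cancel)
          then show ?thesis by blast
        qed
        then show ?thesis by (auto simp: surj_def)
      qed
    qed
  qed
  then show ?thesis by (simp add: F_def)
qed

text \<open>Gauge of the thin bipyramid around the triangle with base from \<open>-e\<close> to \<open>e\<close> and apex \<open>v\<close>,
  in terms of the coordinates \<open>\<alpha>\<close>, \<open>\<beta>\<close> along \<open>e\<close>, \<open>v\<close> and of the norm \<open>\<omega>\<close> of the orthogonal part.\<close>

definition gauge3 :: "real \<Rightarrow> real \<Rightarrow> real \<Rightarrow> real \<Rightarrow> real" where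
  "gauge3 \<delta> \<alpha> \<beta> \<omega> = \<bar>\<alpha>\<bar> + max (\<beta> / (1 + \<delta>)) (- \<beta> / \<delta>) + \<omega> / \<delta>"

text \<open>The bipyramid grows with \<open>\<delta>\<close>, so finitely many requirements on its
  thinness are met by the smallest of the values.\<close>

lemma gauge3_antimono:
  assumes "0 < \<delta>" "\<delta> \<le> \<delta>'" "\<omega> \<ge> 0"
  shows "gauge3 \<delta>' \<alpha> \<beta> \<omega> \<le> gauge3 \<delta> \<alpha> \<beta> \<omega>"
proof -
  have "\<omega> / \<delta>' \<le> \<omega> / \<delta>" using assms by (simp add: frac_le)
  moreover have "max (\<beta> / (1 + \<delta>')) (- \<beta> / \<delta>') \<le> max (\<beta> / (1 + \<delta>)) (- \<beta> / \<delta>)"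
  proof (cases "\<beta> \<ge> 0")
    case True
    then have "\<beta> / (1 + \<delta>') \<le> \<beta> / (1 + \<delta>)" "- \<beta> / \<delta>' \<le> 0" "\<beta> / (1 + \<delta>) \<ge> 0"
      using assms by (auto simp: frac_le)
    then show ?thesis by linarith
  next
    case False
    then have "- \<beta> / \<delta>' \<le> - \<beta> / \<delta>" using assms by (intro frac_le) auto
    moreover have "\<beta> / (1 + \<delta>') \<le> 0" "- \<beta> / \<delta> \<ge> 0"
      using False assms by (auto simp: divide_nonpos_pos)
    ultimately have "- \<beta> / \<delta>' \<le> - \<beta> / \<delta>" "\<beta> / (1 + \<delta>') \<le> 0" "- \<beta> / \<delta> \<ge> 0"
      by auto
    then show ?thesis by linarith
  qed
  ultimately show ?thesis unfolding gauge3_def by linarith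
qed

text \<open>The rate \<open>1 / (1 + \<delta>)\<close> is below 1. This is what the shear with
  displacement \<open>max 0 (1 - gauge)\<close> demands.\<close>

lemma gauge3_slope:
  assumes "0 < \<delta>" "s > 0"
  shows "gauge3 \<delta> \<alpha> (\<beta> + s) \<omega> \<le> gauge3 \<delta> \<alpha> \<beta> \<omega> + s / (1 + \<delta>)"
proof -
  have "(\<beta> + s) / (1 + \<delta>) = \<beta> / (1 + \<delta>) + s / (1 + \<delta>)" by (simp add: add_divide_distrib)
  moreover have "- (\<beta> + s) / \<delta> \<le> - \<beta> / \<delta>" using assms by (intro divide_right_mono) auto
  moreover have "s / (1 + \<delta>) \<ge> 0" using assms by auto
  ultimately show ?thesis unfolding gauge3_def by linarith
qed

text \<open>A ray leaving a base vertex of the triangle into a direction outside the triangle misses all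
  sufficiently thin bipyramids.\<close>

lemma gauge3_ray:
  assumes out: "\<not> (\<omega> = 0 \<and> 0 \<le> \<beta> \<and> \<beta> \<le> \<alpha>)" and "\<omega> \<ge> 0"
  shows "\<exists>\<delta>>0. \<forall>r\<ge>0. gauge3 \<delta> (-1 + r * \<alpha>) (r * \<beta>) (r * \<omega>) \<ge> 1"
proof -
  \<comment> \<open>The gauge is 1 at the vertex, and
    \<open>\<bar>-1 + r * \<alpha>\<bar> \<ge> 1 - r * \<alpha>\<close>. What remains to be bounded
    below is linear in \<open>r \<ge> 0\<close>, so a condition on the direction alone
    suffices.\<close>
  have "\<exists>\<delta>>0. - \<alpha> + max (\<beta> / (1 + \<delta>)) (- \<beta> / \<delta>) + \<omega> / \<delta> \<ge> 0"
  proof -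
    consider "\<omega> > 0" | "\<omega> = 0" "\<beta> < 0" | "\<omega> = 0" "\<beta> \<ge> 0" "\<beta> > \<alpha>" using assms by linarith
    then show ?thesis
    proof cases
      case 1
      define \<delta> where "\<delta> = \<omega> / (1 + \<bar>\<alpha>\<bar> + \<bar>\<beta>\<bar>)"
      have d: "\<delta> > 0" using 1 unfolding \<delta>_def by (intro divide_pos_pos) auto
      have "\<omega> / \<delta> = 1 + \<bar>\<alpha>\<bar> + \<bar>\<beta>\<bar>" using 1 unfolding \<delta>_def by (simp add: field_simps)
      moreover have "max (\<beta> / (1 + \<delta>)) (- \<beta> / \<delta>) \<ge> - \<bar>\<beta>\<bar>"
      proof -
        have "\<bar>\<beta>\<bar> / (1 + \<delta>) \<le> \<bar>\<beta>\<bar>" using d by (simp add: divide_le_eq mult_nonneg_nonneg algebra_simps)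
        then have "\<bar>\<beta> / (1 + \<delta>)\<bar> \<le> \<bar>\<beta>\<bar>" using d by simp
        then show ?thesis by linarith
      qed
      ultimately have "- \<alpha> + max (\<beta> / (1 + \<delta>)) (- \<beta> / \<delta>) + \<omega> / \<delta> \<ge> 0" by linarith
      then show ?thesis using d by blast
    next
      case 2
      define \<delta> where "\<delta> = - \<beta> / (1 + \<bar>\<alpha>\<bar>)"
      have d: "\<delta> > 0" using 2 unfolding \<delta>_def by (intro divide_pos_pos) auto
      have "- \<beta> / \<delta> = 1 + \<bar>\<alpha>\<bar>" using 2 unfolding \<delta>_def by (simp add: field_simps)
      then show ?thesis using d 2 by (intro exI[of _ \<delta>]) auto
    next
      case 3
      show ?thesis
      proof (cases "\<alpha> \<le> 0")
        case True
        then show ?thesis using 3 by (intro exI[of _ 1]) auto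
      next
        case False
        \<comment> \<open>With this value the ray starts exactly along an upper edge of the
          bipyramid.\<close>
        define \<delta> where "\<delta> = \<beta> / \<alpha> - 1"
        have d: "\<delta> > 0" using 3 False unfolding \<delta>_def by (simp add: field_simps)
        have "\<beta> / (1 + \<delta>) = \<alpha>" using 3 False unfolding \<delta>_def by (simp add: field_simps)
        then show ?thesis using d 3 by (intro exI[of _ \<delta>]) auto
      qed
    qed
  qed
  then obtain \<delta> where d: "\<delta> > 0" and g: "- \<alpha> + max (\<beta> / (1 + \<delta>)) (- \<beta> / \<delta>) + \<omega> / \<delta> \<ge> 0" by blast
  have "gauge3 \<delta> (-1 + r * \<alpha>) (r * \<beta>) (r * \<omega>) \<ge> 1" if "r \<ge> 0" for r
  proof -
    have "r * max (\<beta> / (1 + \<delta>)) (- \<beta> / \<delta>) = max (r * \<beta> / (1 + \<delta>)) (- (r * \<beta>) / \<delta>)"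
      using that by (simp add: max_mult_distrib_left)
    then have "0 \<le> - (r * \<alpha>) + max (r * \<beta> / (1 + \<delta>)) (- (r * \<beta>) / \<delta>) + r * \<omega> / \<delta>"
      using mult_nonneg_nonneg[OF that g] by (simp add: algebra_simps)
    then show ?thesis unfolding gauge3_def by linarith
  qed
  then show ?thesis using d by blast
qed

text \<open>The pointwise form of thinness. For a segment that misses the triangle, compactness
  turns it into a single bipyramid that misses the segment.\<close>

lemma gauge3_outside:
  assumes out: "\<not> (\<omega> = 0 \<and> 0 \<le> \<beta> \<and> \<bar>\<alpha>\<bar> + \<beta> \<le> 1)" and "\<omega> \<ge> 0"
  shows "\<exists>\<delta>>0. gauge3 \<delta> \<alpha> \<beta> \<omega> > 1"
proof -
  have mx: "max (\<beta> / (1 + \<delta>)) (- \<beta> / \<delta>) \<ge> 0" if "\<delta> > 0" for \<delta> using that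
    by (cases "\<beta> \<ge> 0") (auto simp: le_max_iff_disj divide_nonpos_pos)
  consider "\<omega> > 0" | "\<omega> = 0" "\<beta> < 0" | "\<omega> = 0" "\<beta> \<ge> 0" "\<bar>\<alpha>\<bar> + \<beta> > 1" using assms by linarith
  then show ?thesis
  proof cases
    case 1
    then have "\<omega> / (\<omega> / 2) = 2" "\<omega> / 2 > 0" by auto
    then show ?thesis using mx[of "\<omega> / 2"] unfolding gauge3_def by (intro exI[of _ "\<omega> / 2"]) linarith
  next
    case 2
    then have "- \<beta> / (- \<beta> / 2) = 2" "- \<beta> / 2 > 0" by auto
    then have "max (\<beta> / (1 + - \<beta> / 2)) (- \<beta> / (- \<beta> / 2)) \<ge> 2" by linarith
    moreover have "\<omega> / (- \<beta> / 2) = 0" using 2 by simp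
    ultimately have "gauge3 (- \<beta> / 2) \<alpha> \<beta> \<omega> > 1" unfolding gauge3_def by linarith
    then show ?thesis using \<open>- \<beta> / 2 > 0\<close> by blast
  next
    case 3
    show ?thesis
    proof (cases "\<bar>\<alpha>\<bar> > 1")
      case True then show ?thesis using 3 mx[of 1] unfolding gauge3_def by (intro exI[of _ 1]) auto
    next
      case False
      \<comment> \<open>\<open>h\<close> is the excess over the triangle. The
        \<open>\<delta>\<close> chosen below gives away at most half of it, by
        \<open>1 / (1 + \<delta>) \<ge> 1 - \<delta>\<close>.\<close>
      define h where "h = \<bar>\<alpha>\<bar> + \<beta> - 1"
      have h: "h > 0" "\<beta> > 0" "h \<le> \<beta>" using 3 False unfolding h_def by auto
      define \<delta> where "\<delta> = h / (2 * \<beta>)"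
      have d: "\<delta> > 0" using h unfolding \<delta>_def by simp
      have "\<beta> * (1 - \<delta>) = \<beta> - h / 2" using h unfolding \<delta>_def by (simp add: field_simps)
      moreover have "\<beta> / (1 + \<delta>) \<ge> \<beta> * (1 - \<delta>)"
      proof -
        have "(1 - \<delta>) * (1 + \<delta>) \<le> 1" by (simp add: algebra_simps)
        then have "\<beta> * ((1 - \<delta>) * (1 + \<delta>)) \<le> \<beta> * 1" using h by (intro mult_left_mono) auto
        then show ?thesis using d by (simp add: le_divide_eq mult.assoc)
      qed
      ultimately have "\<beta> / (1 + \<delta>) \<ge> \<beta> - h / 2" by simp
      then have "max (\<beta> / (1 + \<delta>)) (- \<beta> / \<delta>) \<ge> \<beta> - h / 2" by simp
      moreover have "\<omega> / \<delta> = 0" using 3 by simp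
      ultimately have "gauge3 \<delta> \<alpha> \<beta> \<omega> > 1" unfolding gauge3_def using h(1) h_def by linarith
      then show ?thesis using d by blast
    qed
  qed
qed

lemma in_convex_hull_3:
  assumes "z = x *\<^sub>R a + y *\<^sub>R b + t *\<^sub>R c" "0 \<le> x" "0 \<le> y" "0 \<le> t" "x + y + t = 1"
  shows "z \<in> convex hull {a, b, c}"
  unfolding convex_hull_3 using assms by blast

text \<open>A shear along the median \<open>v\<close> with the displacement
  \<open>max 0 (1 - gauge)\<close>. On the base this tent has height
  \<open>1 - \<bar>k\<bar>\<close> at \<open>m + k *\<^sub>R e\<close>, so the base is bent into the
  other two sides, while all points of gauge at least 1 stay where they are. The remaining segments
  are kept out by making the bipyramid thin. Segments through \<open>a\<close> or \<open>b\<close>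
  need an argument of their own, since these vertices lie on the boundary of every
  bipyramid.\<close>

lemma triangle_move:
  fixes a b c :: space3
  assumes fin: "finite \<F>" and segs: "\<And>S. S \<in> \<F> \<Longrightarrow> \<exists>x y. S = closed_segment x y"
    and nc: "\<not> collinear {a, b, c}"
    and int: "\<Union>\<F> \<inter> convex hull {a, b, c} \<subseteq> {a, b}"
  shows "ambient_isotopic (inv_stereo ` (\<Union>\<F> \<union> closed_segment a b))
           (inv_stereo ` (\<Union>\<F> \<union> closed_segment a c \<union> closed_segment c b))"
proof -
  define m where "m = (1/2) *\<^sub>R (a + b)"
  define e where "e = (1/2) *\<^sub>R (b - a)"
  define v where "v = c - m"
  have a: "a = m - e" and b: "b = m + e" and c: "c = m + v"
    unfolding m_def e_def v_def by (simp_all add: scaleR_right_diff_distrib scaleR_right_distrib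
        scaleR_left_distrib[symmetric] algebra_simps)
  have ind: "independent {e, v}" and ev: "e \<noteq> v"
  proof -
    have e0: "e \<noteq> 0" using nc a b by auto
    have nv: "v \<noteq> k *\<^sub>R e" for k
    proof
      assume v: "v = k *\<^sub>R e"
      have "collinear {a, b, c}" unfolding collinear_alt
        by (rule exI[of _ m], rule exI[of _ e]) (auto simp: a b c v intro: exI[of _ "-1"] exI[of _ 1])
      then show False using nc by simp
    qed
    have "v \<notin> span {e}" using nv by (auto simp: span_singleton)
    then have "independent {v, e}" using e0 by (simp add: independent_insert)
    then show "independent {e, v}" by (simp add: insert_commute)
    show "e \<noteq> v" using nv[of 1] by auto
  qed
  obtain \<alpha> where \<alpha>: "linear \<alpha>" "\<alpha> e = (1::real)" "\<alpha> v = 0"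
    using linear_independent_extend[OF ind, of "\<lambda>x. if x = e then 1 else 0"] ev by auto
  obtain \<beta> where \<beta>: "linear \<beta>" "\<beta> e = (0::real)" "\<beta> v = 1"
    using linear_independent_extend[OF ind, of "\<lambda>x. if x = v then 1 else 0"] ev by auto
  \<comment> \<open>\<open>\<alpha>\<close> and \<open>\<beta>\<close> are arbitrary linear
    extensions of the coordinates in the plane of the triangle, so \<open>w\<close> is a projection
    that kills this plane, not necessarily the orthogonal one.\<close>
  define w where "w = (\<lambda>y. y - \<alpha> y *\<^sub>R e - \<beta> y *\<^sub>R v)"
  note lin = linear_add[OF \<alpha>(1)] linear_add[OF \<beta>(1)] linear_diff[OF \<alpha>(1)] linear_diff[OF \<beta>(1)]
    linear_cmul[OF \<alpha>(1)] linear_cmul[OF \<beta>(1)] linear_neg[OF \<alpha>(1)] linear_neg[OF \<beta>(1)]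
    \<alpha>(2,3) \<beta>(2,3)
  have w_scale: "w (r *\<^sub>R y) = r *\<^sub>R w y" for r y by (simp add: w_def lin algebra_simps)
  have w_e: "w (y + r *\<^sub>R e) = w y" for r y by (simp add: w_def lin algebra_simps)
  have w_v: "w (y + r *\<^sub>R v) = w y" for r y by (simp add: w_def lin algebra_simps)
  define P where "P = (\<lambda>\<delta> y. gauge3 \<delta> (\<alpha> y) (\<beta> y) (norm (w y)))"
  have P_antimono: "P \<delta>' y \<le> P \<delta> y" if "0 < \<delta>" "\<delta> \<le> \<delta>'" for \<delta> \<delta>' y
    unfolding P_def using gauge3_antimono[OF that] by simp
  have cont\<alpha>: "continuous_on A \<alpha>" and cont\<beta>: "continuous_on A \<beta>" for A
    using \<alpha>(1) \<beta>(1) linear_continuous_on linear_conv_bounded_linear by blast+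
  have contP: "continuous_on A (P \<delta>)" if "\<delta> > 0" for A \<delta>
    unfolding P_def gauge3_def w_def using that
    by (intro continuous_on_add continuous_on_max continuous_on_divide continuous_on_norm continuous_on_diff
        continuous_on_scaleR continuous_on_const continuous_on_id continuous_on_minus continuous_on_rabs cont\<alpha> cont\<beta>) auto
  have inT: "m + y \<in> convex hull {a, b, c}" if "w y = 0" "0 \<le> \<beta> y" "\<bar>\<alpha> y\<bar> + \<beta> y \<le> 1" for y
  proof -
    have y: "y = \<alpha> y *\<^sub>R e + \<beta> y *\<^sub>R v" using that(1) by (simp add: w_def algebra_simps)
    have "m + (\<alpha> y *\<^sub>R e + \<beta> y *\<^sub>R v) = ((1 - \<beta> y - \<alpha> y) / 2) *\<^sub>R a + ((1 - \<beta> y + \<alpha> y) / 2) *\<^sub>R b + \<beta> y *\<^sub>R c"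
    proof -
      have "x1 *\<^sub>R a + x2 *\<^sub>R b + x3 *\<^sub>R c = (x1 + x2 + x3) *\<^sub>R m + ((x2 - x1) *\<^sub>R e + x3 *\<^sub>R v)" for x1 x2 x3
        unfolding a b c by (simp add: algebra_simps)
      from this[of "(1 - \<beta> y - \<alpha> y) / 2" "(1 - \<beta> y + \<alpha> y) / 2" "\<beta> y"] show ?thesis
        by (simp add: field_simps)
    qed
    then have "m + y = ((1 - \<beta> y - \<alpha> y) / 2) *\<^sub>R a + ((1 - \<beta> y + \<alpha> y) / 2) *\<^sub>R b + \<beta> y *\<^sub>R c"
      using y by simp
    then show ?thesis by (rule in_convex_hull_3) (use that in \<open>auto simp: field_simps\<close>)
  qed
  \<comment> \<open>The sign treats both base vertices at once: \<open>\<sigma> = 1\<close> stands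
    for \<open>a = m - e\<close> and \<open>\<sigma> = -1\<close> for
    \<open>b = m + e\<close>.\<close>
  have avoid: "\<exists>\<delta>>0. \<forall>z\<in>closed_segment p y. P \<delta> (z - m) \<ge> 1"
    if seg: "closed_segment p y \<inter> convex hull {a, b, c} \<subseteq> {a, b}" and p: "p = m - \<sigma> *\<^sub>R e" and \<sigma>: "\<sigma> = 1 \<or> \<sigma> = -1" for p y \<sigma>
  proof (cases "y = p")
    case True
    have "P 1 (p - m) = 1" unfolding P_def p using \<sigma> by (auto simp: gauge3_def w_def lin)
    then show ?thesis using True by (intro exI[of _ 1]) auto
  next
    case False
    let ?d = "y - p"
    have zm: "p + r *\<^sub>R ?d - m = r *\<^sub>R ?d + (- \<sigma>) *\<^sub>R e" for r by (simp add: p algebra_simps)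
    have wr: "w (r *\<^sub>R ?d + (- \<sigma>) *\<^sub>R e) = r *\<^sub>R w ?d" for r unfolding w_e w_scale ..
    have al: "\<bar>\<alpha> (r *\<^sub>R ?d + (- \<sigma>) *\<^sub>R e)\<bar> = \<bar>- 1 + r * (\<sigma> * \<alpha> ?d)\<bar>" for r
    proof -
      have "\<alpha> (r *\<^sub>R ?d + (- \<sigma>) *\<^sub>R e) = r * \<alpha> ?d - \<sigma>" by (simp only: lin) simp
      then show ?thesis using \<sigma> by auto
    qed
    have be: "\<beta> (r *\<^sub>R ?d + (- \<sigma>) *\<^sub>R e) = r * \<beta> ?d" for r by (simp only: lin) simp
    have "\<not> (norm (w ?d) = 0 \<and> 0 \<le> \<beta> ?d \<and> \<beta> ?d \<le> \<sigma> * \<alpha> ?d)"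
    proof
      assume *: "norm (w ?d) = 0 \<and> 0 \<le> \<beta> ?d \<and> \<beta> ?d \<le> \<sigma> * \<alpha> ?d"
      \<comment> \<open>If the direction pointed into the triangle, the point at this
        \<open>r\<close> would still be on the segment, as \<open>r \<le> 1\<close>, and in the
        triangle, as \<open>r * (\<sigma> * \<alpha> ?d) < 1\<close>. So it would be a base vertex,
        which forces the segment to be degenerate.\<close>
      define r where "r = 1 / (1 + \<sigma> * \<alpha> ?d)"
      have r: "0 < r" "r \<le> 1" "r * (\<sigma> * \<alpha> ?d) < 1" using * by (auto simp: r_def)
      let ?z = "p + r *\<^sub>R ?d"
      have zseg: "?z \<in> closed_segment p y" using r unfolding closed_segment_def
        by (intro CollectI exI[of _ r]) (auto simp: algebra_simps)
      have rb: "r * \<beta> ?d \<le> r * (\<sigma> * \<alpha> ?d)" "0 \<le> r * \<beta> ?d" using r * by (auto simp: mult_left_mono)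
      have "m + (r *\<^sub>R ?d + (- \<sigma>) *\<^sub>R e) \<in> convex hull {a, b, c}"
      proof (rule inT)
        show "w (r *\<^sub>R ?d + (- \<sigma>) *\<^sub>R e) = 0" unfolding wr using * by simp
        show "0 \<le> \<beta> (r *\<^sub>R ?d + (- \<sigma>) *\<^sub>R e)" unfolding be by (rule rb(2))
        show "\<bar>\<alpha> (r *\<^sub>R ?d + (- \<sigma>) *\<^sub>R e)\<bar> + \<beta> (r *\<^sub>R ?d + (- \<sigma>) *\<^sub>R e) \<le> 1"
          unfolding be al using rb r by linarith
      qed
      then have "?z \<in> convex hull {a, b, c}" unfolding zm[symmetric] by simp
      then have "?z = a \<or> ?z = b" using seg zseg by blast
      then have "?z - m = - e \<or> ?z - m = e" unfolding a b by auto
      then have "\<bar>\<alpha> (?z - m)\<bar> = 1"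
      proof
        assume eq: "?z - m = - e"
        show ?thesis unfolding eq by (simp only: lin abs_minus_cancel abs_one)
      next
        assume eq: "?z - m = e"
        show ?thesis unfolding eq by (simp only: lin abs_minus_cancel abs_one)
      qed
      then have "\<bar>- 1 + r * (\<sigma> * \<alpha> ?d)\<bar> = 1" unfolding zm al .
      then have "r * (\<sigma> * \<alpha> ?d) = 0" using r rb by linarith
      then have "\<alpha> ?d = 0" using r \<sigma> by auto
      moreover have "\<beta> ?d = 0" using * \<open>\<alpha> ?d = 0\<close> by (metis antisym mult_zero_right)
      moreover have "w ?d = 0" using * by simp
      ultimately have "?d = 0" by (simp add: w_def)
      then show False using False by simp
    qed
    from gauge3_ray[OF this] obtain \<delta> where d: "\<delta> > 0"
      and g: "\<And>r. r \<ge> 0 \<Longrightarrow> gauge3 \<delta> (-1 + r * (\<sigma> * \<alpha> ?d)) (r * \<beta> ?d) (r * norm (w ?d)) \<ge> 1" by auto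
    have "P \<delta> (z - m) \<ge> 1" if "z \<in> closed_segment p y" for z
    proof -
      obtain r where r: "0 \<le> r" "z = p + r *\<^sub>R ?d" using \<open>z \<in> closed_segment p y\<close>
        unfolding closed_segment_def by (auto simp: algebra_simps)
      show ?thesis using g[OF r(1)] r(1) unfolding r(2) zm P_def gauge3_def al be wr by simp
    qed
    then show ?thesis using d by blast
  qed
  have avoid_S: "\<exists>\<delta>>0. \<forall>z\<in>S. P \<delta> (z - m) \<ge> 1" if S: "S \<in> \<F>" for S
  proof -
    obtain x y where xy: "S = closed_segment x y" using segs[OF S] by blast
    have SI: "S \<inter> convex hull {a, b, c} \<subseteq> {a, b}" using int S by blast
    \<comment> \<open>A segment containing a base vertex is cut there, because the ray argument
      needs the vertex as an end point.\<close>
    have via: ?thesis if p: "p \<in> S" "p = m - \<sigma> *\<^sub>R e" "\<sigma> = 1 \<or> \<sigma> = -1" for p \<sigma>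
    proof -
      have "S = closed_segment p x \<union> closed_segment p y"
        using Un_closed_segment[of p x y] p(1) xy by (simp add: closed_segment_commute)
      moreover from this obtain \<delta>1 where 1: "\<delta>1 > 0" "\<forall>z\<in>closed_segment p x. P \<delta>1 (z - m) \<ge> 1"
        using avoid[OF _ p(2,3), of x] SI by auto
      moreover from calculation(1) obtain \<delta>2 where 2: "\<delta>2 > 0" "\<forall>z\<in>closed_segment p y. P \<delta>2 (z - m) \<ge> 1"
        using avoid[OF _ p(2,3), of y] SI by auto
      moreover have "P \<delta>1 z \<le> P (min \<delta>1 \<delta>2) z" "P \<delta>2 z \<le> P (min \<delta>1 \<delta>2) z" for z
        using P_antimono[of "min \<delta>1 \<delta>2"] 1 2 by auto
      ultimately have "\<forall>z\<in>S. P (min \<delta>1 \<delta>2) (z - m) \<ge> 1"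
        by (metis Un_iff order_trans)
      moreover have "min \<delta>1 \<delta>2 > 0" using 1 2 by simp
      ultimately show ?thesis by blast
    qed
    consider "a \<in> S" | "b \<in> S" | "a \<notin> S" "b \<notin> S" by blast
    then show ?thesis
    proof cases
      case 1 then show ?thesis using via[of a 1] a by simp
    next
      case 2 then show ?thesis using via[of b "-1"] b by simp
    next
      case 3
      have "\<exists>\<delta>>0. P \<delta> (z - m) > 1" if "z \<in> S" for z
      proof -
        have "z \<notin> convex hull {a, b, c}" using that 3 SI by blast
        then have "\<not> (w (z - m) = 0 \<and> 0 \<le> \<beta> (z - m) \<and> \<bar>\<alpha> (z - m)\<bar> + \<beta> (z - m) \<le> 1)" using inT[of "z - m"] by auto
        then show ?thesis unfolding P_def using gauge3_outside[of "norm (w (z - m))" "\<beta> (z - m)" "\<alpha> (z - m)"] by simp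
      qed
      then obtain D where D: "\<And>z. z \<in> S \<Longrightarrow> D z > 0" "\<And>z. z \<in> S \<Longrightarrow> P (D z) (z - m) > 1" by metis
      have opn: "open {y. P (D z) (y - m) > 1}" if "z \<in> S" for z
        by (intro open_Collect_less continuous_on_const continuous_on_compose2[OF contP[OF D(1)[OF that], of UNIV]]
            continuous_on_diff continuous_on_id) auto
      have "compact S" unfolding xy by simp
      moreover have "\<And>z. z \<in> S \<Longrightarrow> open ((\<lambda>z. {y. P (D z) (y - m) > 1}) z)" using opn by simp
      moreover have "S \<subseteq> (\<Union>z\<in>S. {y. P (D z) (y - m) > 1})" using D(2) by blast
      ultimately obtain Z where Z: "Z \<subseteq> S" "finite Z" "S \<subseteq> (\<Union>z\<in>Z. {y. P (D z) (y - m) > 1})"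
        by (rule compactE_image)
      define \<delta> where "\<delta> = Min (insert 1 (D ` Z))"
      have "\<delta> > 0" unfolding \<delta>_def using Z D(1) by auto
      moreover have "P \<delta> (y - m) \<ge> 1" if "y \<in> S" for y
      proof -
        obtain z where z: "z \<in> Z" "P (D z) (y - m) > 1" using Z(3) \<open>y \<in> S\<close> by blast
        have le: "\<delta> \<le> D z" unfolding \<delta>_def using Z(2) z(1) by (intro Min_le) auto
        show ?thesis using P_antimono[OF \<open>\<delta> > 0\<close> le, of "y - m"] z(2) by linarith
      qed
      ultimately show ?thesis by blast
    qed
  qed
  then obtain D where D: "\<And>S. S \<in> \<F> \<Longrightarrow> D S > 0" "\<And>S z. S \<in> \<F> \<Longrightarrow> z \<in> S \<Longrightarrow> P (D S) (z - m) \<ge> 1" by metis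
  define \<delta> where "\<delta> = Min (insert 1 (D ` \<F>))"
  have d0: "\<delta> > 0" unfolding \<delta>_def using fin D(1) by auto
  have Pout: "P \<delta> (z - m) \<ge> 1" if "z \<in> \<Union>\<F>" for z
  proof -
    obtain S where S: "S \<in> \<F>" "z \<in> S" using \<open>z \<in> \<Union>\<F>\<close> by blast
    have le: "\<delta> \<le> D S" unfolding \<delta>_def using fin S by (intro Min_le) auto
    show ?thesis using P_antimono[OF d0 le, of "z - m"] D(2)[OF S] by linarith
  qed
  define \<phi> where "\<phi> = (\<lambda>x. max 0 (1 - P \<delta> (x - m)))"
  \<comment> \<open>Radius of a ball around the origin that contains the bipyramid.\<close>
  define r where "r = norm m + (norm e + (1 + \<delta>) * norm v + \<delta>)"
  have "ambient_isotopic (inv_stereo ` X) (inv_stereo ` (\<lambda>x. x + \<phi> x *\<^sub>R v) ` X)" for X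
  proof (rule ambient_isotopic_shear)
    show "continuous_on UNIV \<phi>" unfolding \<phi>_def
      by (intro continuous_on_max continuous_on_const continuous_on_diff continuous_on_id
          continuous_on_compose2[OF contP[OF d0, of UNIV]]) auto
    show "0 \<le> \<phi> x" for x unfolding \<phi>_def by simp
    show "r > 0" unfolding r_def using d0 by (intro add_nonneg_pos) (auto intro!: add_nonneg_nonneg mult_nonneg_nonneg)
    show "\<phi> x = 0" if "norm x \<ge> r" for x
    proof (rule ccontr)
      assume "\<phi> x \<noteq> 0"
      define y where "y = x - m"
      have P1: "P \<delta> y < 1" using \<open>\<phi> x \<noteq> 0\<close> unfolding \<phi>_def y_def by (simp add: max_def split: if_splits)
      have mx: "max (\<beta> y / (1 + \<delta>)) (- \<beta> y / \<delta>) \<ge> 0" using d0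
        by (cases "\<beta> y \<ge> 0") (auto simp: le_max_iff_disj divide_nonpos_pos)
      have "\<omega> / \<delta> \<ge> 0" if "\<omega> \<ge> 0" for \<omega> using d0 that by simp
      then have 1: "\<bar>\<alpha> y\<bar> < 1" "\<beta> y / (1 + \<delta>) < 1" "- \<beta> y / \<delta> < 1" "norm (w y) / \<delta> < 1"
        using P1 mx unfolding P_def gauge3_def
        by (smt (verit) norm_ge_zero max.cobounded1 max.cobounded2)+
      then have 2: "\<bar>\<beta> y\<bar> \<le> 1 + \<delta>" "norm (w y) \<le> \<delta>" using d0 by (auto simp: field_simps)
      have "x = m + (\<alpha> y *\<^sub>R e + \<beta> y *\<^sub>R v + w y)" by (simp add: w_def y_def)
      then have "norm x \<le> norm m + (norm (\<alpha> y *\<^sub>R e) + norm (\<beta> y *\<^sub>R v) + norm (w y))"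
        by (metis norm_triangle_mono norm_triangle_ineq order_refl)
      also have "norm (\<alpha> y *\<^sub>R e) \<le> norm e" using 1 by (simp add: mult_left_le_one_le)
      also have "norm (\<beta> y *\<^sub>R v) \<le> (1 + \<delta>) * norm v" using 2 by (simp add: mult_right_mono)
      finally have le: "norm x \<le> norm m + (norm e + (1 + \<delta>) * norm v + norm (w y))" by simp
      have "norm (w y) < \<delta>" using 1(4) d0 by simp
      with le that show False unfolding r_def by linarith
    qed
    show "\<phi> (x + s *\<^sub>R v) > \<phi> x - s" if s: "s > 0" for x s
    proof -
      have "P \<delta> ((x - m) + s *\<^sub>R v) \<le> P \<delta> (x - m) + s / (1 + \<delta>)"
        unfolding P_def w_v using gauge3_slope[OF d0 s] by (simp add: lin)
      moreover have "s / (1 + \<delta>) < s" using s d0 by (simp add: divide_less_eq)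
      moreover have eq: "x + s *\<^sub>R v - m = (x - m) + s *\<^sub>R v" by simp
      ultimately show ?thesis unfolding \<phi>_def eq using s by linarith
    qed
  qed
  note this[of "\<Union>\<F> \<union> closed_segment a b"]
  also have "(\<lambda>x. x + \<phi> x *\<^sub>R v) ` (\<Union>\<F> \<union> closed_segment a b) = \<Union>\<F> \<union> (closed_segment a c \<union> closed_segment c b)"
  proof -
    have "(\<lambda>x. x + \<phi> x *\<^sub>R v) ` \<Union>\<F> = (\<lambda>x. x) ` \<Union>\<F>" by (rule image_cong[OF refl]) (use Pout in \<open>simp add: \<phi>_def\<close>)
    moreover have "(\<lambda>x. x + \<phi> x *\<^sub>R v) ` closed_segment a b = closed_segment a c \<union> closed_segment c b"
    proof -
      have \<phi>e: "\<phi> (m + k *\<^sub>R e) = 1 - \<bar>k\<bar>" if "\<bar>k\<bar> \<le> 1" for k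
        using that unfolding \<phi>_def P_def gauge3_def by (simp add: lin w_def)
      have left: "closed_segment a m = (\<lambda>k. m + (- k) *\<^sub>R e) ` {0..1}"
        by (subst closed_segment_commute) (simp add: closed_segment_image_interval a algebra_simps)
      have right: "closed_segment m b = (\<lambda>k. m + k *\<^sub>R e) ` {0..1}"
        by (simp add: closed_segment_image_interval b algebra_simps)
      have mm: "m \<in> closed_segment a b"
        unfolding m_def closed_segment_def by (intro CollectI exI[of _ "1/2"]) (auto simp: algebra_simps)
      have seg_ac: "closed_segment a c = (\<lambda>k. m + (- k) *\<^sub>R e + (1 - k) *\<^sub>R v) ` {0..1}"
        by (subst closed_segment_commute) (simp add: closed_segment_image_interval a c algebra_simps)
      have seg_cb: "closed_segment c b = (\<lambda>k. m + k *\<^sub>R e + (1 - k) *\<^sub>R v) ` {0..1}"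
        unfolding closed_segment_image_interval b c by (simp add: algebra_simps)
      have "closed_segment a b = closed_segment a m \<union> closed_segment m b"
        using Un_closed_segment[OF mm] by simp
      then have eq: "closed_segment a b = (\<lambda>k. m + (- k) *\<^sub>R e) ` {0..1} \<union> (\<lambda>k. m + k *\<^sub>R e) ` {0..1}"
        unfolding left right .
      have e1: "(m + (- k) *\<^sub>R e) + \<phi> (m + (- k) *\<^sub>R e) *\<^sub>R v = m + (- k) *\<^sub>R e + (1 - k) *\<^sub>R v" if "k \<in> {0..1}" for k
        using that \<phi>e[of "- k"] by simp
      have e2: "(m + k *\<^sub>R e) + \<phi> (m + k *\<^sub>R e) *\<^sub>R v = m + k *\<^sub>R e + (1 - k) *\<^sub>R v" if "k \<in> {0..1}" for k
        using that \<phi>e[of k] by simp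
      show ?thesis unfolding eq seg_ac seg_cb image_Un image_image
        by (intro arg_cong2[of _ _ _ _ "(\<union>)"] image_cong e1 e2 refl)
    qed
    ultimately show ?thesis by (simp add: image_Un)
  qed
  finally show ?thesis by (simp add: Un_assoc)
qed

section \<open>Isotopy of subsets of space\<close>

text \<open>Images under \<open>inv_stereo\<close> lie in the sphere, so symmetry and transitivity
  hold for this relation without side conditions.\<close>

definition isotopic3 :: "space3 set \<Rightarrow> space3 set \<Rightarrow> bool" where
  "isotopic3 X Y \<longleftrightarrow> ambient_isotopic (inv_stereo ` X) (inv_stereo ` Y)"

lemma isotopic3_refl: "isotopic3 X X"
  unfolding isotopic3_def by (rule ambient_isotopic_refl)

lemma isotopic3_sym: "isotopic3 X Y \<Longrightarrow> isotopic3 Y X"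
  unfolding isotopic3_def using inv_stereo_in_S3 by (blast intro: ambient_isotopic_sym)

lemma isotopic3_trans [trans]: "isotopic3 X Y \<Longrightarrow> isotopic3 Y Z \<Longrightarrow> isotopic3 X Z"
  unfolding isotopic3_def using inv_stereo_in_S3 by (blast intro: ambient_isotopic_trans)

text \<open>Degenerate segments are allowed, so single points are covered. Finiteness is what lets
  one bipyramid be thin enough for all pieces.\<close>

definition polyhedral :: "'a::real_vector set \<Rightarrow> bool" where
  "polyhedral X \<longleftrightarrow> (\<exists>\<F>. finite \<F> \<and> (\<forall>S\<in>\<F>. \<exists>x y. S = closed_segment x y) \<and> X = \<Union>\<F>)"

lemma polyhedral_segment [intro, simp]: "polyhedral (closed_segment x y)"
  unfolding polyhedral_def by (rule exI[of _ "{closed_segment x y}"]) auto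

lemma polyhedral_empty [intro, simp]: "polyhedral {}"
  unfolding polyhedral_def by (rule exI[of _ "{}"]) auto

lemma polyhedral_Un [intro, simp]: "polyhedral X \<Longrightarrow> polyhedral Y \<Longrightarrow> polyhedral (X \<union> Y)"
  unfolding polyhedral_def
  apply (elim exE conjE)
  subgoal for \<F> \<G> by (rule exI[of _ "\<F> \<union> \<G>"]) auto
  done

lemma isotopic3_triangle:
  assumes "polyhedral X" "\<not> collinear {a, b, c}" "X \<inter> convex hull {a, b, c} \<subseteq> {a, b}"
  shows "isotopic3 (X \<union> closed_segment a b) (X \<union> closed_segment a c \<union> closed_segment c b)"
proof -
  obtain \<F> where F: "finite \<F>" "\<forall>S\<in>\<F>. \<exists>x y. S = closed_segment x y" "X = \<Union>\<F>"
    using assms(1) unfolding polyhedral_def by blast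
  show ?thesis unfolding isotopic3_def F(3)
    by (rule triangle_move) (use assms F in auto)
qed

text \<open>Two triangle moves: the edge from \<open>l\<close> to \<open>k\<close> is replaced by
  the path through \<open>w\<close>, and then the edges from \<open>w\<close> to \<open>k\<close>
  and from \<open>k\<close> to \<open>r\<close> by the edge from \<open>w\<close> to
  \<open>r\<close>. Two triangles are used because \<open>l\<close>, \<open>k\<close>,
  \<open>r\<close> need not be collinear in space: at a crossing the projection has no corner, but
  the height may have one.\<close>

lemma isotopic3_cone:
  assumes X: "polyhedral X"
    and nc: "\<not> collinear {l, k, w}" "\<not> collinear {k, r, w}"
    and l: "X \<inter> convex hull {l, k, w} \<subseteq> {l}" and r: "X \<inter> convex hull {k, r, w} \<subseteq> {r}"
    and lkr: "closed_segment k r \<inter> convex hull {l, k, w} \<subseteq> {k}"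
    and krl: "closed_segment l w \<inter> convex hull {k, r, w} \<subseteq> {w}"
  shows "isotopic3 (X \<union> (closed_segment l k \<union> closed_segment k r))
    (X \<union> (closed_segment l w \<union> closed_segment w r))"
proof -
  have "isotopic3 ((X \<union> closed_segment k r) \<union> closed_segment l k)
      ((X \<union> closed_segment k r) \<union> closed_segment l w \<union> closed_segment w k)"
    by (rule isotopic3_triangle) (use X nc l lkr in auto)
  also have "(X \<union> closed_segment k r) \<union> closed_segment l w \<union> closed_segment w k =
      (X \<union> closed_segment l w) \<union> closed_segment w k \<union> closed_segment k r" by blast
  also have "isotopic3 \<dots> ((X \<union> closed_segment l w) \<union> closed_segment w r)"
  proof (rule isotopic3_sym, rule isotopic3_triangle)
    show "polyhedral (X \<union> closed_segment l w)" using X by simp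
    have eq: "{w, r, k} = {k, r, w}" by blast
    show "\<not> collinear {w, r, k}" unfolding eq by (rule nc(2))
    show "(X \<union> closed_segment l w) \<inter> convex hull {w, r, k} \<subseteq> {w, r}"
      unfolding eq using r krl by blast
  qed
  finally show ?thesis by (simp add: Un_ac)
qed

section \<open>Affine pieces of paths\<close>

definition affine_on :: "(real \<Rightarrow> 'a::real_normed_vector) \<Rightarrow> real set \<Rightarrow> bool" where
  "affine_on g S \<longleftrightarrow> (\<exists>p v. \<forall>t\<in>S. g t = p + t *\<^sub>R v)"

lemma affine_on_subset: "affine_on g T \<Longrightarrow> S \<subseteq> T \<Longrightarrow> affine_on g S"
  unfolding affine_on_def by blast

lemma affine_on_image:
  assumes "affine_on g {s..t}" "s \<le> t"
  shows "g ` {s..t} = closed_segment (g s) (g t)"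
proof -
  obtain p v where pv: "\<And>u. u \<in> {s..t} \<Longrightarrow> g u = p + u *\<^sub>R v" using assms unfolding affine_on_def by blast
  have "g ` {s..t} = (\<lambda>u. p + u *\<^sub>R v) ` {s..t}" using pv by auto
  also have "\<dots> = (\<lambda>u. p + u *\<^sub>R v) ` closed_segment s t" using assms(2) by (simp add: closed_segment_eq_real_ivl)
  also have "\<dots> = ((+) p) ` ((\<lambda>u. u *\<^sub>R v) ` closed_segment s t)" by (simp add: image_image)
  also have "(\<lambda>u. u *\<^sub>R v) ` closed_segment s t = closed_segment (s *\<^sub>R v) (t *\<^sub>R v)"
    by (rule closed_segment_linear_image[symmetric]) (simp add: linear_iff scaleR_left_distrib)
  also have "(+) p ` \<dots> = closed_segment (p + s *\<^sub>R v) (p + t *\<^sub>R v)" by (simp add: closed_segment_translation)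
  finally show ?thesis using pv assms(2) by simp
qed

lemma locally_affine_derivative:
  fixes g :: "real \<Rightarrow> 'a::real_normed_vector"
  assumes "\<forall>\<^sub>F s in at t. g s = g t + (s - t) *\<^sub>R v"
  shows "(g has_vector_derivative v) (at t)"
proof -
  have "((\<lambda>s. g t + (s - t) *\<^sub>R v) has_vector_derivative v) (at t)"
    by (auto intro!: derivative_eq_intros)
  moreover have "\<forall>\<^sub>F s in nhds t. g t + (s - t) *\<^sub>R v = g s"
    using assms unfolding eventually_at_filter by (auto elim!: eventually_mono)
  then obtain T where "open T" "t \<in> T" "\<And>s. s \<in> T \<Longrightarrow> g t + (s - t) *\<^sub>R v = g s"
    unfolding eventually_nhds by blast
  ultimately show ?thesis by (blast intro: has_vector_derivative_transform_within_open)
qed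

text \<open>Slope and intercept are locally constant on the open interval, hence constant by
  connectedness; the end points follow by continuity.\<close>

lemma affine_on_of_locally_affine:
  fixes g :: "real \<Rightarrow> 'a::real_normed_vector"
  assumes cont: "continuous_on {s..t} g" and st: "s < t"
    and loc: "\<And>u. u \<in> {s<..<t} \<Longrightarrow> \<exists>v. \<forall>\<^sub>F x in at u. g x = g u + (x - u) *\<^sub>R v"
  shows "affine_on g {s..t}"
proof -
  obtain V where V: "\<And>u. u \<in> {s<..<t} \<Longrightarrow> \<forall>\<^sub>F x in at u. g x = g u + (x - u) *\<^sub>R V u" using loc by metis
  let ?f = "\<lambda>u. (V u, g u - u *\<^sub>R V u)"
  have "\<forall>\<^sub>F x in at u within {s<..<t}. ?f u = ?f x" if u: "u \<in> {s<..<t}" for u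
  proof -
    have "\<forall>\<^sub>F x in nhds u. g x = g u + (x - u) *\<^sub>R V u"
      using V[OF u] unfolding eventually_at_filter by (auto elim!: eventually_mono)
    then obtain T where T: "open T" "u \<in> T" "\<And>x. x \<in> T \<Longrightarrow> g x = g u + (x - u) *\<^sub>R V u"
      unfolding eventually_nhds by blast
    have "?f u = ?f x" if x: "x \<in> T \<inter> {s<..<t}" for x
    proof -
      have "\<forall>\<^sub>F y in at x. y \<in> T" using x T(1) eventually_at_topological by blast
      then have "\<forall>\<^sub>F y in at x. g y = g x + (y - x) *\<^sub>R V u"
      proof eventually_elim
        case (elim y)
        show ?case using T(3)[OF elim] T(3)[of x] x by (simp add: scaleR_left_diff_distrib)
      qed
      then have "(g has_vector_derivative V u) (at x)" by (rule locally_affine_derivative)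
      moreover have "(g has_vector_derivative V x) (at x)" using V x by (intro locally_affine_derivative) auto
      ultimately have "V u = V x" by (rule vector_derivative_unique_at)
      then show ?thesis using T(3)[of x] x by (simp add: algebra_simps)
    qed
    then show ?thesis unfolding eventually_at_topological using T u by blast
  qed
  then have loc1: "\<forall>u\<in>{s<..<t}. \<forall>\<^sub>F x in at u within {s<..<t}. ?f u = ?f x" by blast
  have const: "?f u = ?f x" if "u \<in> {s<..<t}" "x \<in> {s<..<t}" for u x
    by (rule connected_local_const[OF _ that loc1]) simp
  define m where "m = (s + t) / 2"
  have m: "m \<in> {s<..<t}" using st by (simp add: m_def)
  have eq: "g u - u *\<^sub>R V m = g m - m *\<^sub>R V m" if "u \<in> {s<..<t}" for u
  proof -
    have "V u = V m" "g u - u *\<^sub>R V u = g m - m *\<^sub>R V m" using const[OF that m] by blast+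
    then show ?thesis by simp
  qed
  have "g u = (g m - m *\<^sub>R V m) + u *\<^sub>R V m" if u: "u \<in> {s..t}" for u
  proof -
    have "continuous_on {s..t} (\<lambda>u. g u - u *\<^sub>R V m)" by (intro continuous_on_diff continuous_on_scaleR cont continuous_on_id continuous_on_const)
    then have "continuous_on (closure {s<..<t}) (\<lambda>u. g u - u *\<^sub>R V m)" using st by simp
    then have "g u - u *\<^sub>R V m = g m - m *\<^sub>R V m"
      by (rule continuous_constant_on_closure) (use eq u st in simp_all)
    then show ?thesis by (simp add: algebra_simps)
  qed
  then show ?thesis unfolding affine_on_def by blast
qed

section \<open>Piecewise linear paths and diagrams\<close>

lemma piecewise_linear_path_breaks:
  fixes g :: "real \<Rightarrow> 'a::real_normed_vector"
  assumes "piecewise_linear_path g"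
  shows "\<exists>B. finite B \<and> (\<forall>s t. 0 \<le> s \<longrightarrow> s < t \<longrightarrow> t \<le> 1 \<longrightarrow> {s<..<t} \<inter> B = {} \<longrightarrow> affine_on g {s..t})"
proof -
  obtain B where B: "finite B" "\<forall>t\<in>{0<..<1} - B. \<exists>v. \<forall>\<^sub>F s in at t. g s = g t + (s - t) *\<^sub>R v"
    and cont: "continuous_on {0..1} g"
    using assms unfolding piecewise_linear_path_def path_def by blast
  have "affine_on g {s..t}" if "0 \<le> s" "s < t" "t \<le> 1" "{s<..<t} \<inter> B = {}" for s t
  proof (rule affine_on_of_locally_affine)
    show "continuous_on {s..t} g" using continuous_on_subset[OF cont] that by auto
    show "s < t" by fact
    fix u assume "u \<in> {s<..<t}"
    then have "u \<in> {0<..<1} - B" using that by auto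
    then show "\<exists>v. \<forall>\<^sub>F x in at u. g x = g u + (x - u) *\<^sub>R v" using B(2) by blast
  qed
  then show ?thesis using B(1) by blast
qed

lemma affine_on_singleton: "affine_on g {s}"
  unfolding affine_on_def by (intro exI[of _ "g s"] exI[of _ 0]) auto

text \<open>Induction on the number of break points inside the interval.\<close>

lemma polyhedral_piecewise_linear_image:
  fixes g :: "real \<Rightarrow> 'a::real_normed_vector"
  assumes "piecewise_linear_path g" "0 \<le> s" "s \<le> t" "t \<le> 1"
  shows "polyhedral (g ` {s..t})"
proof -
  obtain B where B: "finite B"
    and aff: "\<And>s t. 0 \<le> s \<Longrightarrow> s < t \<Longrightarrow> t \<le> 1 \<Longrightarrow> {s<..<t} \<inter> B = {} \<Longrightarrow> affine_on g {s..t}"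
    using piecewise_linear_path_breaks[OF assms(1)] by blast
  have "polyhedral (g ` {s..t})" if "0 \<le> s" "s \<le> t" "t \<le> 1" "card (B \<inter> {s<..<t}) = n" for n s t
    using that
  proof (induction n arbitrary: s t rule: less_induct)
    case (less n)
    show ?case
    proof (cases "B \<inter> {s<..<t} = {}")
      case True
      have "affine_on g {s..t}"
      proof (cases "s = t")
        case False
        have "{s<..<t} \<inter> B = {}" using True by blast
        then show ?thesis using aff[of s t] less.prems False by simp
      qed (simp add: affine_on_singleton)
      then show ?thesis using affine_on_image less.prems(2) by (metis polyhedral_segment)
    next
      case False
      then obtain b where b: "b \<in> B" "s < b" "b < t" by auto
      have "B \<inter> {s<..<b} \<subset> B \<inter> {s<..<t}" using b by auto
      moreover have "B \<inter> {b<..<t} \<subset> B \<inter> {s<..<t}" using b by auto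
      ultimately have "card (B \<inter> {s<..<b}) < n" "card (B \<inter> {b<..<t}) < n"
        using less.prems(4) B by (metis psubset_card_mono finite_Int)+
      then have "polyhedral (g ` {s..b})" "polyhedral (g ` {b..t})"
        using less.IH b less.prems by auto
      moreover have "{s..t} = {s..b} \<union> {b..t}" using b by auto
      ultimately show ?thesis by (simp add: image_Un)
    qed
  qed
  then show ?thesis using assms by blast
qed

section \<open>Bending a path\<close>

text \<open>The corner \<open>w\<close> is reached at the middle of the interval. The path outside
  the interval is untouched together with its parametrisation, so crossings elsewhere keep their
  times.\<close>

definition bend :: "(real \<Rightarrow> 'a::real_normed_vector) \<Rightarrow> real \<Rightarrow> real \<Rightarrow> 'a \<Rightarrow> real \<Rightarrow> 'a" where
  "bend g s t w u =
    (if u < s \<or> t < u then g u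
     else if u \<le> (s + t) / 2 then linepath (g s) w ((u - s) / ((t - s) / 2))
     else linepath w (g t) ((u - (s + t) / 2) / ((t - s) / 2)))"

context
  fixes g :: "real \<Rightarrow> 'a::real_normed_vector" and s t :: real and w :: 'a
  assumes st: "s < t"
begin

lemma bend_outside: "u \<le> s \<or> t \<le> u \<Longrightarrow> bend g s t w u = g u"
  using st by (auto simp: bend_def linepath_def field_simps)

lemma bend_left: "u \<in> {s..(s + t) / 2} \<Longrightarrow> bend g s t w u = linepath (g s) w ((u - s) / ((t - s) / 2))"
  using st by (auto simp: bend_def)

lemma bend_right: "u \<in> {(s + t) / 2..t} \<Longrightarrow> bend g s t w u = linepath w (g t) ((u - (s + t) / 2) / ((t - s) / 2))"
proof (cases "u = (s + t) / 2")
  case True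
  have "((s + t) / 2 - s) / ((t - s) / 2) = 1" using st by (simp add: field_simps)
  then have "bend g s t w ((s + t) / 2) = w" using st by (simp add: bend_def linepath_1')
  then show ?thesis unfolding True by (simp add: linepath_0')
qed (use st in \<open>auto simp: bend_def\<close>)

lemma affine_on_bend_left: "affine_on (bend g s t w) {s..(s + t) / 2}"
  unfolding affine_on_def
proof (intro exI ballI)
  fix u assume "u \<in> {s..(s + t) / 2}"
  then show "bend g s t w u = (g s - (s / ((t - s) / 2)) *\<^sub>R (w - g s)) + u *\<^sub>R ((1 / ((t - s) / 2)) *\<^sub>R (w - g s))"
    by (simp only: bend_left) (simp add: linepath_def scaleR_right_diff_distrib scaleR_left_diff_distrib diff_divide_distrib algebra_simps)
qed

lemma affine_on_bend_right: "affine_on (bend g s t w) {(s + t) / 2..t}"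
  unfolding affine_on_def
proof (intro exI ballI)
  fix u assume "u \<in> {(s + t) / 2..t}"
  then show "bend g s t w u = (w - (((s + t) / 2) / ((t - s) / 2)) *\<^sub>R (g t - w)) + u *\<^sub>R ((1 / ((t - s) / 2)) *\<^sub>R (g t - w))"
    by (simp only: bend_right) (simp add: linepath_def scaleR_right_diff_distrib scaleR_left_diff_distrib diff_divide_distrib algebra_simps)
qed

lemma bend_mid: "bend g s t w ((s + t) / 2) = w"
  using st bend_right[of "(s + t) / 2"] by (simp add: linepath_def)

lemma bend_image_left: "bend g s t w ` {s..(s + t) / 2} = closed_segment (g s) w"
  using affine_on_image[OF affine_on_bend_left] st bend_mid bend_outside[of s] by simp

lemma bend_image_right: "bend g s t w ` {(s + t) / 2..t} = closed_segment w (g t)"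
  using affine_on_image[OF affine_on_bend_right] st bend_mid bend_outside[of t] by simp

lemma bend_image:
  assumes "0 \<le> s" "t \<le> 1"
  shows "path_image (bend g s t w) =
    g ` {0..s} \<union> g ` {t..1} \<union> (closed_segment (g s) w \<union> closed_segment w (g t))"
proof -
  have "{0..1} = {0..s} \<union> {t..1} \<union> ({s..(s + t) / 2} \<union> {(s + t) / 2..t})" using assms st by auto
  moreover have "bend g s t w ` {0..s} = g ` {0..s}" "bend g s t w ` {t..1} = g ` {t..1}"
    by (auto intro!: image_cong simp: bend_outside)
  ultimately show ?thesis unfolding path_image_def
    by (simp only: image_Un bend_image_left bend_image_right)
qed

end

lemma affine_on_continuous: "affine_on g S \<Longrightarrow> continuous_on S g"
proof -
  assume "affine_on g S"
  then obtain p v where pv: "\<And>u. u \<in> S \<Longrightarrow> g u = p + u *\<^sub>R v" unfolding affine_on_def by blast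
  have "continuous_on S (\<lambda>u. p + u *\<^sub>R v)" by (intro continuous_intros)
  then show ?thesis using pv by (simp cong: continuous_on_cong)
qed

lemma affine_on_locally_affine:
  assumes "affine_on g {s..t}" "u \<in> {s<..<t}"
  shows "\<exists>v. \<forall>\<^sub>F x in at u. g x = g u + (x - u) *\<^sub>R v"
proof -
  obtain p v where pv: "\<And>u. u \<in> {s..t} \<Longrightarrow> g u = p + u *\<^sub>R v" using assms(1) unfolding affine_on_def by blast
  have "\<forall>\<^sub>F x in at u. x \<in> {s<..<t}" using assms(2) by (intro eventually_at_in_open') auto
  then have "\<forall>\<^sub>F x in at u. g x = g u + (x - u) *\<^sub>R v"
    by eventually_elim (use pv assms(2) in \<open>simp add: scaleR_left_diff_distrib\<close>)
  then show ?thesis by blast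
qed

lemma piecewise_linear_path_bend:
  fixes g :: "real \<Rightarrow> 'a::real_normed_vector"
  assumes g: "piecewise_linear_path g" and st: "0 \<le> s" "s < t" "t \<le> 1"
  shows "piecewise_linear_path (bend g s t w)"
proof -
  obtain B where B: "finite B" "\<And>t. t \<in> {0<..<1} - B \<Longrightarrow> \<exists>v. \<forall>\<^sub>F s in at t. g s = g t + (s - t) *\<^sub>R v"
    and cont: "continuous_on {0..1} g"
    using g unfolding piecewise_linear_path_def path_def by blast
  let ?h = "bend g s t w" and ?m = "(s + t) / 2"
  have c1: "continuous_on ({0..s} \<union> {s..?m}) ?h"
  proof (rule continuous_on_closed_Un)
    have "continuous_on {0..s} g" by (rule continuous_on_subset[OF cont]) (use st in auto)
    then show "continuous_on {0..s} ?h" by (rule continuous_on_eq) (simp add: bend_outside[OF st(2)])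
    show "continuous_on {s..?m} ?h" by (rule affine_on_continuous[OF affine_on_bend_left[OF st(2)]])
  qed auto
  have c2: "continuous_on ({?m..t} \<union> {t..1}) ?h"
  proof (rule continuous_on_closed_Un)
    have "continuous_on {t..1} g" by (rule continuous_on_subset[OF cont]) (use st in auto)
    then show "continuous_on {t..1} ?h" by (rule continuous_on_eq) (simp add: bend_outside[OF st(2)])
    show "continuous_on {?m..t} ?h" by (rule affine_on_continuous[OF affine_on_bend_right[OF st(2)]])
  qed auto
  have "continuous_on (({0..s} \<union> {s..?m}) \<union> ({?m..t} \<union> {t..1})) ?h"
    by (rule continuous_on_closed_Un[OF _ _ c1 c2]) auto
  moreover have "{0..1} = ({0..s} \<union> {s..?m}) \<union> ({?m..t} \<union> {t..1})" using st by auto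
  ultimately have path: "path ?h" unfolding path_def by simp
  have "\<exists>v. \<forall>\<^sub>F x in at u. ?h x = ?h u + (x - u) *\<^sub>R v" if u: "u \<in> {0<..<1} - (B \<union> {s, ?m, t})" for u
  proof -
    consider "u \<in> {s<..<?m}" | "u \<in> {?m<..<t}" | "u < s \<or> t < u" using u by fastforce
    then show ?thesis
    proof cases
      case 1 then show ?thesis by (rule affine_on_locally_affine[OF affine_on_bend_left[OF st(2)]])
    next
      case 2 then show ?thesis by (rule affine_on_locally_affine[OF affine_on_bend_right[OF st(2)]])
    next
      case 3
      obtain v where v: "\<forall>\<^sub>F x in at u. g x = g u + (x - u) *\<^sub>R v" using B(2)[of u] u by blast
      have "\<forall>\<^sub>F x in at u. x \<in> {..<s} \<union> {t<..}" using 3 by (intro eventually_at_in_open') auto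
      then have "\<forall>\<^sub>F x in at u. ?h x = ?h u + (x - u) *\<^sub>R v" using v
      proof eventually_elim
        case (elim x)
        have "?h x = g x" "?h u = g u" using elim(1) 3 by (auto intro!: bend_outside[OF st(2)])
        then show ?case using elim(2) by simp
      qed
      then show ?thesis by blast
    qed
  qed
  then show ?thesis unfolding piecewise_linear_path_def using path B(1)
    by (intro conjI exI[of _ "B \<union> {s, ?m, t}"]) auto
qed

section \<open>Diagrams as relations between times\<close>

text \<open>Each crossing appears as two ordered pairs. The order makes it possible to say which
  passage lies on which arc, and the double point condition becomes single-valuedness.\<close>

definition coinc :: "(real \<Rightarrow> space3) \<Rightarrow> (real \<times> real) set" where
  "coinc g = {(s, t). s \<in> {0..<1} \<and> t \<in> {0..<1} \<and> s \<noteq> t \<and> shadow g s = shadow g t}"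

definition transverse :: "(real \<Rightarrow> space3) \<Rightarrow> real \<Rightarrow> real \<Rightarrow> bool" where
  "transverse g s t \<longleftrightarrow> (\<exists>v w. (shadow g has_vector_derivative v) (at s) \<and>
     (shadow g has_vector_derivative w) (at t) \<and> \<not> collinear {0, v, w})"

lemma coincI: "s \<in> {0..<1} \<Longrightarrow> t \<in> {0..<1} \<Longrightarrow> s \<noteq> t \<Longrightarrow> shadow g s = shadow g t \<Longrightarrow> (s, t) \<in> coinc g"
  unfolding coinc_def by simp

lemma coincD:
  assumes "(s, t) \<in> coinc g"
  shows "s \<in> {0..<1}" "t \<in> {0..<1}" "s \<noteq> t" "shadow g s = shadow g t"
  using assms unfolding coinc_def by simp_all

lemma coinc_sym: "(s, t) \<in> coinc g \<longleftrightarrow> (t, s) \<in> coinc g"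
  unfolding coinc_def by auto

lemma crossing_times_eq: "crossing_times g = Domain (coinc g)"
  unfolding crossing_times_def coinc_def Domain_iff
  by (rule set_eqI) (simp del: atLeastLessThan_iff, metis)

text \<open>A form of the definition that can be checked pair by pair after a move.
  Single-valuedness says that no three times project to one point, and simplicity of the loop
  reduces to the two passages of a crossing being different points of space.\<close>

lemma knot_diagram_iff:
  "knot_diagram g \<longleftrightarrow> piecewise_linear_path g \<and> g 1 = g 0 \<and> finite (coinc g) \<and> single_valued (coinc g) \<and>
     (\<forall>s t. (s, t) \<in> coinc g \<longrightarrow> s \<noteq> 0 \<and> g s \<noteq> g t \<and> transverse g s t)"
  (is "_ \<longleftrightarrow> ?R")
proof
  assume kd: "knot_diagram g"
  then have poly: "polygonal_loop g" and fin: "finite (crossings g)" and z: "0 \<notin> crossing_times g"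
    and two: "\<And>p. p \<in> crossings g \<Longrightarrow> card {t \<in> {0..<1}. shadow g t = p} = 2"
    and tr: "\<And>s t. s \<in> crossing_times g \<Longrightarrow> t \<in> crossing_times g \<Longrightarrow> s \<noteq> t \<Longrightarrow> shadow g s = shadow g t \<Longrightarrow> transverse g s t"
    unfolding knot_diagram_def transverse_def by blast+
  have pl: "piecewise_linear_path g" and sp: "simple_path g" and cl: "g 1 = g 0"
    using poly unfolding polygonal_loop_def pathfinish_def pathstart_def by auto
  let ?S = "\<lambda>p. {t \<in> {0..<1}. shadow g t = p}"
  have finS: "finite (?S p)" if "p \<in> crossings g" for p
    using two[OF that] by (metis (lifting) card.infinite zero_neq_numeral)
  have crp: "shadow g s \<in> crossings g" if "(s, t) \<in> coinc g" for s t
    unfolding crossings_def crossing_times_eq using that by blast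
  have "coinc g \<subseteq> (\<Union>p\<in>crossings g. ?S p \<times> ?S p)"
  proof
    fix z assume "z \<in> coinc g"
    moreover obtain s t where st: "z = (s, t)" by (cases z)
    ultimately have *: "(s, t) \<in> coinc g" by simp
    show "z \<in> (\<Union>p\<in>crossings g. ?S p \<times> ?S p)"
      unfolding st using crp[OF *] coincD[OF *] by (intro UN_I[of "shadow g s"]) auto
  qed
  moreover have "finite (\<Union>p\<in>crossings g. ?S p \<times> ?S p)" using fin finS by blast
  ultimately have finc: "finite (coinc g)" by (rule finite_subset)
  have "single_valued (coinc g)"
  proof (rule single_valuedI)
    fix s t t' assume st: "(s, t) \<in> coinc g" "(s, t') \<in> coinc g"
    have "{s, t, t'} \<subseteq> ?S (shadow g s)" using coincD[OF st(1)] coincD[OF st(2)] by auto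
    then have "card {s, t, t'} \<le> 2" using card_mono[OF finS[OF crp[OF st(1)]]] two[OF crp[OF st(1)]] by metis
    then show "t = t'" using coincD(3)[OF st(1)] coincD(3)[OF st(2)] by (auto simp: card_insert_if split: if_splits)
  qed
  moreover have "s \<noteq> 0 \<and> g s \<noteq> g t \<and> transverse g s t" if st: "(s, t) \<in> coinc g" for s t
  proof -
    have s: "s \<in> crossing_times g" "t \<in> crossing_times g"
      unfolding crossing_times_eq using st coinc_sym[of s t g] by blast+
    moreover have "g s \<noteq> g t" using sp coincD[OF st] unfolding simple_path_def loop_free_def by force
    ultimately show ?thesis using z tr coincD[OF st] by blast
  qed
  ultimately show ?R using pl cl finc by blast
next
  assume R: ?R
  have fin: "finite (coinc g)" and sv: "single_valued (coinc g)" and pl: "piecewise_linear_path g" and cl: "g 1 = g 0"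
    and c: "\<And>s t. (s, t) \<in> coinc g \<Longrightarrow> s \<noteq> 0 \<and> g s \<noteq> g t \<and> transverse g s t" using R by auto
  have fd: "finite (crossing_times g)" unfolding crossing_times_eq Domain_fst using fin by simp
  have inj: "s = t" if "s \<in> {0..<1}" "t \<in> {0..<1}" "g s = g t" for s t
    using coincI[of s t g] c that unfolding shadow_def by force
  have "loop_free g" unfolding loop_free_def
  proof (intro ballI impI)
    fix x y :: real assume xy: "x \<in> {0..1}" "y \<in> {0..1}" "g x = g y"
    consider "x = 1" "y = 1" | "x = 1" "y \<in> {0..<1}" | "x \<in> {0..<1}" "y = 1" | "x \<in> {0..<1}" "y \<in> {0..<1}"
      using xy(1,2) by fastforce
    then show "x = y \<or> x = 0 \<and> y = 1 \<or> x = 1 \<and> y = 0"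
    proof cases
      case 2
      then have "0 = y" using inj[of 0 y] xy(3) cl by simp
      then show ?thesis using 2 by simp
    next
      case 3
      then have "x = 0" using inj[of x 0] xy(3) cl by simp
      then show ?thesis using 3 by simp
    next
      case 4
      then show ?thesis using inj[OF 4 xy(3)] by simp
    qed simp
  qed
  moreover have "path g" using pl unfolding piecewise_linear_path_def by blast
  ultimately have "polygonal_loop g" using pl cl
    unfolding polygonal_loop_def simple_path_def pathfinish_def pathstart_def by auto
  moreover have "finite (crossings g)" unfolding crossings_def using fd by simp
  moreover have "0 \<notin> crossing_times g" unfolding crossing_times_eq using c by blast
  moreover have "card {t \<in> {0..<1}. shadow g t = p} = 2" if p: "p \<in> crossings g" for p
  proof -
    obtain s t where st: "(s, t) \<in> coinc g" "p = shadow g s"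
      using p unfolding crossings_def crossing_times_eq by blast
    have "{t \<in> {0..<1}. shadow g t = p} = {s, t}"
    proof
      show "{s, t} \<subseteq> {t \<in> {0..<1}. shadow g t = p}" using coincD[OF st(1)] st(2) by auto
      show "{t \<in> {0..<1}. shadow g t = p} \<subseteq> {s, t}"
      proof
        fix u assume u: "u \<in> {t \<in> {0..<1}. shadow g t = p}"
        show "u \<in> {s, t}"
        proof (cases "u = s")
          case False
          then have "(s, u) \<in> coinc g" using u st coincD[OF st(1)] by (intro coincI) auto
          then show ?thesis using sv st(1) unfolding single_valued_def by blast
        qed simp
      qed
    qed
    then show ?thesis using coincD(3)[OF st(1)] by simp
  qed
  moreover have "transverse g s t"
    if "s \<in> crossing_times g" "t \<in> crossing_times g" "s \<noteq> t \<and> shadow g s = shadow g t" for s t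
  proof -
    have "(s, t) \<in> coinc g" using that by (intro coincI) (auto simp: crossing_times_def)
    then show ?thesis using c by blast
  qed
  ultimately show "knot_diagram g" unfolding knot_diagram_def transverse_def by blast
qed

lemma card_coinc:
  assumes "knot_diagram g"
  shows "card (coinc g) = 2 * num_crossings g"
proof -
  have fin: "finite (coinc g)" and sv: "single_valued (coinc g)" using assms unfolding knot_diagram_iff by blast+
  have two: "\<And>p. p \<in> crossings g \<Longrightarrow> card {t \<in> {0..<1}. shadow g t = p} = 2" and fc: "finite (crossings g)"
    using assms unfolding knot_diagram_def by blast+
  have "inj_on fst (coinc g)"
    using sv unfolding single_valued_def inj_on_def by auto
  then have "card (coinc g) = card (crossing_times g)"
    unfolding crossing_times_eq Domain_fst by (simp add: card_image)
  also have "crossing_times g = (\<Union>p\<in>crossings g. {t \<in> {0..<1}. shadow g t = p})"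
  proof
    show "crossing_times g \<subseteq> (\<Union>p\<in>crossings g. {t \<in> {0..<1}. shadow g t = p})"
      unfolding crossings_def crossing_times_def by blast
    show "(\<Union>p\<in>crossings g. {t \<in> {0..<1}. shadow g t = p}) \<subseteq> crossing_times g"
    proof
      fix u assume "u \<in> (\<Union>p\<in>crossings g. {t \<in> {0..<1}. shadow g t = p})"
      then obtain s where s: "s \<in> crossing_times g" "u \<in> {0..<1}" "shadow g u = shadow g s"
        unfolding crossings_def by auto
      then show "u \<in> crossing_times g" unfolding crossing_times_def
        by (cases "u = s") auto
    qed
  qed
  also have "card \<dots> = (\<Sum>p\<in>crossings g. card {t \<in> {0..<1}. shadow g t = p})"
    using fc two by (intro card_UN_disjoint) (auto intro: card_ge_0_finite)
  also have "\<dots> = 2 * num_crossings g" using two by (simp add: num_crossings_def)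
  finally show ?thesis .
qed

lemma noncollinear_independent:
  fixes a b c :: "'a::euclidean_space"
  assumes "\<not> collinear {a, b, c}" and eq: "x *\<^sub>R (a - b) + y *\<^sub>R (c - b) = 0"
  shows "x = 0 \<and> y = 0"
proof -
  have *: "\<not> collinear {0, a - b, c - b}"
    using assms(1) by (subst (asm) collinear_3) (simp_all add: NO_MATCH_def)
  then have nz: "a - b \<noteq> 0" "c - b \<noteq> 0" and np: "\<And>k. c - b \<noteq> k *\<^sub>R (a - b)"
    unfolding collinear_lemma by blast+
  have "y = 0"
  proof (rule ccontr)
    assume y: "y \<noteq> 0"
    have "y *\<^sub>R (c - b) = (- x) *\<^sub>R (a - b)" using eq by (simp add: eq_neg_iff_add_eq_0 add.commute)
    then have "(1 / y) *\<^sub>R (y *\<^sub>R (c - b)) = (1 / y) *\<^sub>R ((- x) *\<^sub>R (a - b))" by simp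
    then have "c - b = ((1 / y) * (- x)) *\<^sub>R (a - b)" using y by simp
    then show False using np by blast
  qed
  then show ?thesis using eq nz(1) by simp
qed

lemma shadow_bend: "shadow (bend g s t w) u = bend (shadow g) s t (fst w) u"
  unfolding shadow_def bend_def linepath_def by simp

text \<open>The two edge vectors at \<open>w\<close> are independent, so in these coordinates points
  of different edges agree only if both are \<open>w\<close>.\<close>

lemma bend_inj:
  fixes f :: "real \<Rightarrow> 'a::euclidean_space"
  assumes st: "s < t" and nc: "\<not> collinear {f s, w, f t}" and u: "u \<in> {s..t}" "u' \<in> {s..t}"
    and eq: "bend f s t w u = bend f s t w u'"
  shows "u = u'"
proof -
  have ind: "x = 0 \<and> y = 0" if "x *\<^sub>R (f s - w) + y *\<^sub>R (f t - w) = 0" for x y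
    using noncollinear_independent[OF nc that] .
  have L: "bend f s t w u = w + (1 - (u - s) / ((t - s) / 2)) *\<^sub>R (f s - w)" if "u \<in> {s..(s + t) / 2}" for u
    unfolding bend_left[OF st that] by (simp add: linepath_def algebra_simps)
  have R: "bend f s t w u = w + ((u - (s + t) / 2) / ((t - s) / 2)) *\<^sub>R (f t - w)" if "u \<in> {(s + t) / 2..t}" for u
    unfolding bend_right[OF st that] by (simp add: linepath_def algebra_simps)
  have h: "(t - s) / 2 > 0" using st by simp
  have LR: "u = u'" if "u \<in> {s..(s + t) / 2}" "u' \<in> {(s + t) / 2..t}" "bend f s t w u = bend f s t w u'" for u u'
  proof -
    have "(1 - (u - s) / ((t - s) / 2)) *\<^sub>R (f s - w) + (- ((u' - (s + t) / 2) / ((t - s) / 2))) *\<^sub>R (f t - w) = 0"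
      using that(3) unfolding L[OF that(1)] R[OF that(2)] by simp
    from ind[OF this] have e: "(u - s) / ((t - s) / 2) = 1" "(u' - (s + t) / 2) / ((t - s) / 2) = 0" by linarith+
    have "u - s = (t - s) / 2" "u' - (s + t) / 2 = 0"
      using e h by (metis less_irrefl divide_eq_1_iff, metis less_irrefl divide_eq_0_iff)
    then show ?thesis by (simp add: field_simps)
  qed
  have LL: "u = u'" if "u \<in> {s..(s + t) / 2}" "u' \<in> {s..(s + t) / 2}" "bend f s t w u = bend f s t w u'" for u u'
  proof -
    have "((u' - s) / ((t - s) / 2) - (u - s) / ((t - s) / 2)) *\<^sub>R (f s - w) + 0 *\<^sub>R (f t - w) = 0"
      using that(3) unfolding L[OF that(1)] L[OF that(2)] by (simp add: algebra_simps)
    from ind[OF this] show ?thesis using h by simp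
  qed
  have RR: "u = u'" if "u \<in> {(s + t) / 2..t}" "u' \<in> {(s + t) / 2..t}" "bend f s t w u = bend f s t w u'" for u u'
  proof -
    have "0 *\<^sub>R (f s - w) + ((u' - (s + t) / 2) / ((t - s) / 2) - (u - (s + t) / 2) / ((t - s) / 2)) *\<^sub>R (f t - w) = 0"
      using that(3) unfolding R[OF that(1)] R[OF that(2)] by (simp add: algebra_simps)
    from ind[OF this] show ?thesis using h by simp
  qed
  have "{s..t} = {s..(s + t) / 2} \<union> {(s + t) / 2..t}" using st by auto
  then consider "u \<in> {s..(s + t) / 2}" "u' \<in> {s..(s + t) / 2}" | "u \<in> {s..(s + t) / 2}" "u' \<in> {(s + t) / 2..t}"
    | "u' \<in> {s..(s + t) / 2}" "u \<in> {(s + t) / 2..t}" | "u \<in> {(s + t) / 2..t}" "u' \<in> {(s + t) / 2..t}"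
    using u by blast
  then show ?thesis using LL LR RR eq by cases metis+
qed

lemma bend_derivative_outside:
  assumes st: "s < t" and u: "u < s \<or> t < u" and d: "(f has_vector_derivative v) (at u)"
  shows "(bend f s t w has_vector_derivative v) (at u)"
proof (rule has_vector_derivative_transform_within_open[OF d])
  show "open ({..<s} \<union> {t<..})" by auto
  show "u \<in> {..<s} \<union> {t<..}" using u by auto
  show "f x = bend f s t w x" if "x \<in> {..<s} \<union> {t<..}" for x
    using that bend_outside[OF st, of x f w] by auto
qed

lemma shadow_bend_fun: "shadow (bend g s t w) = bend (shadow g) s t (fst w)"
  by (rule ext) (rule shadow_bend)

text \<open>\<open>N\<close> lists the crossings of the new piece with the rest, the time on the new
  piece first. The assumption \<open>new\<close> rules out triple points: a strand met by the new
  piece may have had a crossing at that time only with the removed piece. The new piece does not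
  cross itself, because its two edges are not collinear.\<close>

lemma bend_diagram:
  assumes kd: "knot_diagram g" and st: "0 < s" "s < t" "t < 1"
    and s: "s \<notin> crossing_times g" and t: "t \<notin> crossing_times g"
    and nc: "\<not> collinear {shadow g s, fst w, shadow g t}"
    and N: "\<And>\<sigma> \<tau>. \<sigma> \<in> {s<..<t} \<Longrightarrow> \<tau> \<in> {0..<1} - {s<..<t} \<Longrightarrow>
        shadow (bend g s t w) \<sigma> = shadow g \<tau> \<longleftrightarrow> (\<sigma>, \<tau>) \<in> N"
    and Nsub: "N \<subseteq> {s<..<t} \<times> ({0<..<1} - {s..t})"
    and fin: "finite N" and sv: "single_valued N" "single_valued (N\<inverse>)"
    and new: "\<And>\<sigma> \<tau> u. (\<sigma>, \<tau>) \<in> N \<Longrightarrow> (\<tau>, u) \<in> coinc g \<Longrightarrow> u \<in> {s<..<t}"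
    and ne: "\<And>\<sigma> \<tau>. (\<sigma>, \<tau>) \<in> N \<Longrightarrow> bend g s t w \<sigma> \<noteq> g \<tau>"
    and tr: "\<And>\<sigma> \<tau>. (\<sigma>, \<tau>) \<in> N \<Longrightarrow> \<exists>v x. (bend (shadow g) s t (fst w) has_vector_derivative v) (at \<sigma>) \<and>
        (shadow g has_vector_derivative x) (at \<tau>) \<and> \<not> collinear {0, v, x}"
  shows "coinc (bend g s t w) = coinc g \<inter> (- {s<..<t}) \<times> (- {s<..<t}) \<union> N \<union> N\<inverse>"
    and "knot_diagram (bend g s t w)"
proof -
  let ?h = "bend g s t w" and ?O = "- {s<..<t}"
  have kd': "piecewise_linear_path g" "g 1 = g 0" "finite (coinc g)" "single_valued (coinc g)"
    and cg: "\<And>a b. (a, b) \<in> coinc g \<Longrightarrow> a \<noteq> 0 \<and> g a \<noteq> g b \<and> transverse g a b"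
    using kd unfolding knot_diagram_iff by blast+
  have out: "?h u = g u" if "u \<notin> {s<..<t}" for u using bend_outside[OF st(2), of u g w] that by force
  have sout: "shadow ?h u = shadow g u" if "u \<notin> {s<..<t}" for u using out[OF that] by (simp add: shadow_def)
  show co: "coinc ?h = coinc g \<inter> ?O \<times> ?O \<union> N \<union> N\<inverse>"
  proof (rule set_eqI)
    fix z :: "real \<times> real"
    obtain a b where z: "z = (a, b)" by (cases z)
    have NI: "\<sigma> \<in> {s<..<t} \<and> \<tau> \<notin> {s<..<t} \<and> \<tau> \<in> {0..<1} \<and> \<sigma> \<in> {0..<1} \<and> \<sigma> \<noteq> \<tau>" if "(\<sigma>, \<tau>) \<in> N" for \<sigma> \<tau>
      using Nsub that st by fastforce
    consider (oo) "a \<notin> {s<..<t}" "b \<notin> {s<..<t}" | (io) "a \<in> {s<..<t}" "b \<notin> {s<..<t}"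
      | (oi) "a \<notin> {s<..<t}" "b \<in> {s<..<t}" | (ii) "a \<in> {s<..<t}" "b \<in> {s<..<t}" by blast
    then show "z \<in> coinc ?h \<longleftrightarrow> z \<in> coinc g \<inter> ?O \<times> ?O \<union> N \<union> N\<inverse>"
    proof cases
      case oo
      then have "(a, b) \<in> coinc ?h \<longleftrightarrow> (a, b) \<in> coinc g" unfolding coinc_def using sout by simp
      moreover have "(a, b) \<notin> N" "(b, a) \<notin> N" using NI oo by blast+
      ultimately show ?thesis unfolding z using oo by auto
    next
      case io
      have "(a, b) \<in> coinc ?h \<longleftrightarrow> (a, b) \<in> N"
      proof
        assume h: "(a, b) \<in> coinc ?h"
        then have "shadow ?h a = shadow g b" "b \<in> {0..<1}" using coincD[OF h] sout[OF io(2)] by auto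
        then show "(a, b) \<in> N" using N[of a b] io by blast
      next
        assume h: "(a, b) \<in> N"
        then have "shadow ?h a = shadow ?h b" using N[of a b] NI[OF h] sout by auto
        then show "(a, b) \<in> coinc ?h" using NI[OF h] by (intro coincI) auto
      qed
      moreover have "(b, a) \<notin> N" using NI io by blast
      ultimately show ?thesis unfolding z using io by auto
    next
      case oi
      have "(a, b) \<in> coinc ?h \<longleftrightarrow> (b, a) \<in> N"
      proof
        assume h: "(a, b) \<in> coinc ?h"
        then have "shadow ?h b = shadow g a" "a \<in> {0..<1}" using coincD[OF h] sout[OF oi(1)] by auto
        then show "(b, a) \<in> N" using N[of b a] oi by blast
      next
        assume h: "(b, a) \<in> N"
        then have "shadow ?h b = shadow ?h a" using N[of b a] NI[OF h] sout by auto
        then show "(a, b) \<in> coinc ?h" using NI[OF h] by (intro coincI) auto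
      qed
      moreover have "(a, b) \<notin> N" using NI oi by blast
      ultimately show ?thesis unfolding z using oi by auto
    next
      case ii
      have "(a, b) \<notin> coinc ?h"
      proof
        assume h: "(a, b) \<in> coinc ?h"
        have "a = b" using coincD(4)[OF h] ii unfolding shadow_bend
          by (intro bend_inj[OF st(2) nc]) auto
        then show False using coincD(3)[OF h] by simp
      qed
      moreover have "(a, b) \<notin> N" "(b, a) \<notin> N" using NI ii by blast+
      ultimately show ?thesis unfolding z using ii by auto
    qed
  qed
  have nst: "u \<noteq> s \<and> u \<noteq> t" if "(u, u') \<in> coinc g" for u u'
    using s t that unfolding crossing_times_eq by blast
  have old: "a \<noteq> 0 \<and> ?h a \<noteq> ?h b \<and> transverse ?h a b" if ab: "(a, b) \<in> coinc g" "a \<notin> {s<..<t}" "b \<notin> {s<..<t}" for a b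
  proof -
    have "(b, a) \<in> coinc g" using ab(1) coinc_sym by blast
    then have o: "a < s \<or> t < a" "b < s \<or> t < b" using nst[OF ab(1)] nst[of b a] ab(2,3) by force+
    obtain v x where "(shadow g has_vector_derivative v) (at a)" "(shadow g has_vector_derivative x) (at b)"
      "\<not> collinear {0, v, x}" using cg[OF ab(1)] unfolding transverse_def by blast
    then have "transverse ?h a b" unfolding transverse_def shadow_bend_fun
      using bend_derivative_outside[OF st(2) o(1)] bend_derivative_outside[OF st(2) o(2)] by blast
    then show ?thesis using cg[OF ab(1)] out ab by auto
  qed
  have nw: "\<sigma> \<noteq> 0 \<and> \<tau> \<noteq> 0 \<and> ?h \<sigma> \<noteq> ?h \<tau> \<and> transverse ?h \<sigma> \<tau> \<and> transverse ?h \<tau> \<sigma>" if n: "(\<sigma>, \<tau>) \<in> N" for \<sigma> \<tau>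
  proof -
    have m: "\<sigma> \<in> {s<..<t}" "\<tau> \<in> {0<..<1}" "\<tau> \<notin> {s..t}" using Nsub n by auto
    then have o: "\<tau> < s \<or> t < \<tau>" by auto
    obtain v x where vx: "(bend (shadow g) s t (fst w) has_vector_derivative v) (at \<sigma>)"
        "(shadow g has_vector_derivative x) (at \<tau>)" "\<not> collinear {0, v, x}" using tr[OF n] by blast
    have "\<not> collinear {0, x, v}" using vx(3) by (simp add: insert_commute)
    then have "transverse ?h \<sigma> \<tau>" "transverse ?h \<tau> \<sigma>" unfolding transverse_def shadow_bend_fun
      using vx bend_derivative_outside[OF st(2) o vx(2)] by blast+
    moreover have "?h \<tau> = g \<tau>" using m by (intro out) auto
    ultimately show ?thesis using m ne[OF n] st by auto
  qed
  have svh: "single_valued (coinc ?h)"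
  proof (rule single_valuedI)
    fix x y y' assume xy: "(x, y) \<in> coinc ?h" "(x, y') \<in> coinc ?h"
    have a: "(x, y) \<in> coinc g \<and> x \<notin> {s<..<t} \<and> y \<notin> {s<..<t} \<or> (x, y) \<in> N \<or> (y, x) \<in> N" if "(x, y) \<in> coinc ?h" for x y
      using that unfolding co by auto
    have i: "x \<in> {s<..<t} \<and> y \<notin> {s<..<t}" if "(x, y) \<in> N" for x y using Nsub that by fastforce
    have svN: "y = y'" if "(x, y) \<in> N" "(x, y') \<in> N" for x y y' using sv(1) that unfolding single_valued_def by blast
    have svN': "y = y'" if "(y, x) \<in> N" "(y', x) \<in> N" for x y y' using sv(2) that unfolding single_valued_def by blast
    have svg: "y = y'" if "(x, y) \<in> coinc g" "(x, y') \<in> coinc g" for x y y' using kd'(4) that unfolding single_valued_def by blast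
    show "y = y'" using a[OF xy(1)] a[OF xy(2)] i svN svN' svg new by metis
  qed
  have "finite (coinc ?h)" unfolding co using kd'(3) fin by simp
  moreover have "piecewise_linear_path ?h" using kd'(1) st by (intro piecewise_linear_path_bend) auto
  moreover have "?h 1 = ?h 0" using out[of 1] out[of 0] st kd'(2) by auto
  moreover have "a \<noteq> 0 \<and> ?h a \<noteq> ?h b \<and> transverse ?h a b" if "(a, b) \<in> coinc ?h" for a b
    using that old nw unfolding co by fastforce
  ultimately show "knot_diagram ?h" unfolding knot_diagram_iff using svh by blast
qed

section \<open>Finger moves\<close>

text \<open>The two sides of the thin triangle with base from \<open>(0, -\<epsilon>)\<close> to \<open>(0, \<epsilon>)\<close> and apex
  \<open>(1 + \<epsilon>, \<epsilon>\<^sup>2 / 2)\<close>; a side contains the apex but not its base vertex.\<close>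

definition low_side :: "real \<Rightarrow> real \<Rightarrow> real \<Rightarrow> bool" where
  "low_side \<epsilon> X Y \<longleftrightarrow> 0 < X \<and> X \<le> 1 + \<epsilon> \<and> Y = - \<epsilon> + (\<epsilon> + \<epsilon>\<^sup>2 / 2) * X / (1 + \<epsilon>)"

definition up_side :: "real \<Rightarrow> real \<Rightarrow> real \<Rightarrow> bool" where
  "up_side \<epsilon> X Y \<longleftrightarrow> 0 < X \<and> X \<le> 1 + \<epsilon> \<and> Y = \<epsilon> - (\<epsilon> - \<epsilon>\<^sup>2 / 2) * X / (1 + \<epsilon>)"

text \<open>The point (1, 0) lies inside the triangle, close to the apex, and the ray is a branch of
  the curve that leaves it in the direction (\<open>f1\<close>, \<open>f2\<close>). It leaves the
  triangle through exactly one side: the upper one if \<open>f2 > 0\<close>, the lower one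
  otherwise. A ray along the axis would pass through the apex of a symmetric triangle; this is why
  the apex is raised by \<open>\<epsilon>\<^sup>2 / 2\<close>. The last two conclusions say that the
  determinant of the ray and the side does not vanish, so the crossing is transverse.\<close>

lemma ray_meets_side:
  fixes f1 f2 \<eta> :: real
  assumes f: "f2 \<noteq> 0 \<or> f1 > 0" and \<eta>: "\<eta> > 0"
  shows "\<forall>\<^sub>F \<epsilon> in at_right 0. \<exists>x\<^sub>0 up. 0 < x\<^sub>0 \<and> x\<^sub>0 < \<eta> \<and> 1 + x\<^sub>0 * f1 < 1 + \<epsilon> \<and>
    (\<forall>x\<in>{0<..<\<eta>}. (low_side \<epsilon> (1 + x * f1) (x * f2) \<longleftrightarrow> \<not> up \<and> x = x\<^sub>0) \<and>
       (up_side \<epsilon> (1 + x * f1) (x * f2) \<longleftrightarrow> up \<and> x = x\<^sub>0)) \<and>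
    (up \<longrightarrow> (1 + \<epsilon>) * f2 + (\<epsilon> - \<epsilon>\<^sup>2 / 2) * f1 \<noteq> 0) \<and>
    (\<not> up \<longrightarrow> (1 + \<epsilon>) * f2 - (\<epsilon> + \<epsilon>\<^sup>2 / 2) * f1 \<noteq> 0)"
proof -
  \<comment> \<open>\<open>A\<close> and \<open>B\<close> are the vertical distances from (1, 0) to
    the lower and to the upper side; \<open>l\<close> and \<open>u\<close> are the rates at which
    these distances change along the ray.\<close>
  define A where "A = (\<lambda>\<epsilon>::real. (\<epsilon>\<^sup>2 / 2) / (1 + \<epsilon>))"
  define l where "l = (\<lambda>\<epsilon>::real. f2 - (\<epsilon> + \<epsilon>\<^sup>2 / 2) * f1 / (1 + \<epsilon>))"
  define B where "B = (\<lambda>\<epsilon>::real. (3 * \<epsilon>\<^sup>2 / 2) / (1 + \<epsilon>))"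
  define u where "u = (\<lambda>\<epsilon>::real. - f2 - (\<epsilon> - \<epsilon>\<^sup>2 / 2) * f1 / (1 + \<epsilon>))"
  have nz: "1 + \<epsilon> \<noteq> 0" if "\<epsilon> > 0" for \<epsilon> :: real using that by simp
  have lows: "low_side \<epsilon> (1 + x * f1) (x * f2) \<longleftrightarrow> 0 < 1 + x * f1 \<and> 1 + x * f1 \<le> 1 + \<epsilon> \<and> A \<epsilon> + x * l \<epsilon> = 0"
    if "\<epsilon> > 0" for \<epsilon> x
  proof -
    have "x * f2 - (- \<epsilon> + (\<epsilon> + \<epsilon>\<^sup>2 / 2) * (1 + x * f1) / (1 + \<epsilon>)) = A \<epsilon> + x * l \<epsilon>"
    proof -
      define m where "m = \<epsilon>\<^sup>2 / 2"
      define q where "q = inverse (1 + \<epsilon>)"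
      have h: "\<epsilon> * \<epsilon> = 2 * m" "(1 + \<epsilon>) * q = 1" "\<epsilon>\<^sup>2 / 2 = m" "3 * \<epsilon>\<^sup>2 / 2 = 3 * m"
        using nz[OF that] by (simp_all add: m_def q_def power2_eq_square)
      show ?thesis unfolding A_def B_def l_def u_def unfolding h(3,4) unfolding divide_inverse q_def[symmetric] using h(1,2) by algebra
    qed
    then show ?thesis unfolding low_side_def by auto
  qed
  have ups: "up_side \<epsilon> (1 + x * f1) (x * f2) \<longleftrightarrow> 0 < 1 + x * f1 \<and> 1 + x * f1 \<le> 1 + \<epsilon> \<and> B \<epsilon> + x * u \<epsilon> = 0"
    if "\<epsilon> > 0" for \<epsilon> x
  proof -
    have "(\<epsilon> - (\<epsilon> - \<epsilon>\<^sup>2 / 2) * (1 + x * f1) / (1 + \<epsilon>)) - x * f2 = B \<epsilon> + x * u \<epsilon>"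
    proof -
      define m where "m = \<epsilon>\<^sup>2 / 2"
      define q where "q = inverse (1 + \<epsilon>)"
      have h: "\<epsilon> * \<epsilon> = 2 * m" "(1 + \<epsilon>) * q = 1" "\<epsilon>\<^sup>2 / 2 = m" "3 * \<epsilon>\<^sup>2 / 2 = 3 * m"
        using nz[OF that] by (simp_all add: m_def q_def power2_eq_square)
      show ?thesis unfolding A_def B_def l_def u_def unfolding h(3,4) unfolding divide_inverse q_def[symmetric] using h(1,2) by algebra
    qed
    then show ?thesis unfolding up_side_def by auto
  qed
  \<comment> \<open>The sum of both distances is the width of the triangle at that abscissa and
    vanishes at the apex. So a point that is on one side and at positive distance from the other
    lies before the apex.\<close>
  have sum: "(A \<epsilon> + x * l \<epsilon>) + (B \<epsilon> + x * u \<epsilon>) = 2 * \<epsilon> * (\<epsilon> - x * f1) / (1 + \<epsilon>)" if "\<epsilon> > 0" for \<epsilon> x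
    proof -
      define m where "m = \<epsilon>\<^sup>2 / 2"
      define q where "q = inverse (1 + \<epsilon>)"
      have h: "\<epsilon> * \<epsilon> = 2 * m" "(1 + \<epsilon>) * q = 1" "\<epsilon>\<^sup>2 / 2 = m" "3 * \<epsilon>\<^sup>2 / 2 = 3 * m"
        using nz[OF that] by (simp_all add: m_def q_def power2_eq_square)
      show ?thesis unfolding A_def B_def l_def u_def unfolding h(3,4) unfolding divide_inverse q_def[symmetric] using h(1,2) by algebra
    qed
  have AB: "A \<epsilon> > 0" "B \<epsilon> > 0" if "\<epsilon> > 0" for \<epsilon> using that unfolding A_def B_def by auto
  have limA: "(A \<longlongrightarrow> 0) (at_right 0)" "(B \<longlongrightarrow> 0) (at_right 0)"
    unfolding A_def B_def by (auto intro!: tendsto_eq_intros)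
  have liml: "(l \<longlongrightarrow> f2) (at_right 0)" and limu: "(u \<longlongrightarrow> - f2) (at_right 0)"
    unfolding l_def u_def by (auto intro!: tendsto_eq_intros)
  have det: "(1 + \<epsilon>) * f2 + (\<epsilon> - \<epsilon>\<^sup>2 / 2) * f1 = - (1 + \<epsilon>) * u \<epsilon>"
    "(1 + \<epsilon>) * f2 - (\<epsilon> + \<epsilon>\<^sup>2 / 2) * f1 = (1 + \<epsilon>) * l \<epsilon>" if "\<epsilon> > 0" for \<epsilon>
    unfolding l_def u_def using nz[OF that] by (simp_all add: field_simps)
  have pos: "\<forall>\<^sub>F \<epsilon> in at_right (0::real). \<epsilon> > 0" by (simp add: eventually_at_right_less)
  \<comment> \<open>Up to \<open>X0\<close> the ray stays to the right of the base,
    \<open>1 + x * f1 > 0\<close>.\<close>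
  define X0 where "X0 = min \<eta> (1 / (2 * (1 + \<bar>f1\<bar>)))"
  have X0: "X0 > 0" "X0 \<le> \<eta>" using \<eta> unfolding X0_def by auto
  have posX: "1 + x * f1 > 0" if "0 < x" "x < X0" for x
  proof -
    have "x * (1 + \<bar>f1\<bar>) < 1" using that unfolding X0_def by (simp add: field_simps)
    moreover have "x * \<bar>f1\<bar> \<le> x * (1 + \<bar>f1\<bar>)" using that by (simp add: mult_left_mono)
    moreover have "x * f1 \<ge> - (x * \<bar>f1\<bar>)" using that by (metis abs_ge_minus_self abs_mult abs_of_pos minus_le_iff)
    ultimately show ?thesis by linarith
  qed
  text \<open>The side that is crossed first is crossed before the ray can leave through the other one.\<close>
  have up: ?thesis if f2: "f2 > 0"
  proof -
    have 1: "\<forall>\<^sub>F \<epsilon> in at_right 0. l \<epsilon> > 0" using order_tendstoD(1)[OF liml f2] .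
    have 2: "\<forall>\<^sub>F \<epsilon> in at_right 0. u \<epsilon> < 0" using order_tendstoD(2)[OF limu, of 0] f2 by simp
    have "((\<lambda>\<epsilon>. B \<epsilon> / (- u \<epsilon>)) \<longlongrightarrow> 0 / (- (- f2))) (at_right 0)"
      using f2 by (intro tendsto_divide limA tendsto_minus limu) auto
    then have 3: "\<forall>\<^sub>F \<epsilon> in at_right 0. B \<epsilon> / (- u \<epsilon>) < X0" using X0 by (intro order_tendstoD) auto
    show ?thesis using pos 1 2 3
    proof eventually_elim
      case (elim \<epsilon>)
      define x where "x = B \<epsilon> / (- u \<epsilon>)"
      have x: "0 < x" "x < X0" using elim AB[OF elim(1)] unfolding x_def by (auto simp: divide_pos_neg)
      have L: "A \<epsilon> + y * l \<epsilon> > 0" if "y > 0" for y using elim AB[OF elim(1)] that by (intro add_pos_pos) auto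
      have U: "B \<epsilon> + y * u \<epsilon> = 0 \<longleftrightarrow> y = x" for y using elim unfolding x_def by (auto simp: field_simps)
      have "2 * \<epsilon> * (\<epsilon> - x * f1) / (1 + \<epsilon>) > 0" using sum[OF elim(1), of x] L[OF x(1)] U[of x] by linarith
      then have lt: "x * f1 < \<epsilon>" using elim(1) by (simp add: zero_less_divide_iff zero_less_mult_iff)
      show ?case
      proof (intro exI[of _ x] exI[of _ True] conjI ballI)
        fix y assume y: "y \<in> {0<..<\<eta>}"
        show "low_side \<epsilon> (1 + y * f1) (y * f2) \<longleftrightarrow> \<not> True \<and> y = x"
          unfolding lows[OF elim(1)] using L[of y] y by simp
        show "up_side \<epsilon> (1 + y * f1) (y * f2) \<longleftrightarrow> True \<and> y = x"
          unfolding ups[OF elim(1)] U using posX[OF x] lt by auto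
      qed (use x X0 lt elim det[OF elim(1)] in auto)
    qed
  qed
  have low: ?thesis if f2: "f2 < 0"
  proof -
    have 1: "\<forall>\<^sub>F \<epsilon> in at_right 0. l \<epsilon> < 0" using order_tendstoD(2)[OF liml f2] .
    have 2: "\<forall>\<^sub>F \<epsilon> in at_right 0. u \<epsilon> > 0" using order_tendstoD(1)[OF limu, of 0] f2 by simp
    have "((\<lambda>\<epsilon>. A \<epsilon> / (- l \<epsilon>)) \<longlongrightarrow> 0 / (- f2)) (at_right 0)"
      using f2 by (intro tendsto_divide limA tendsto_minus liml) auto
    then have 3: "\<forall>\<^sub>F \<epsilon> in at_right 0. A \<epsilon> / (- l \<epsilon>) < X0" using X0 by (intro order_tendstoD) auto
    show ?thesis using pos 1 2 3
    proof eventually_elim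
      case (elim \<epsilon>)
      define x where "x = A \<epsilon> / (- l \<epsilon>)"
      have x: "0 < x" "x < X0" using elim AB[OF elim(1)] unfolding x_def by (auto simp: divide_pos_neg)
      have U: "B \<epsilon> + y * u \<epsilon> > 0" if "y > 0" for y using elim AB[OF elim(1)] that by (intro add_pos_pos) auto
      have L: "A \<epsilon> + y * l \<epsilon> = 0 \<longleftrightarrow> y = x" for y using elim unfolding x_def by (auto simp: field_simps)
      have "2 * \<epsilon> * (\<epsilon> - x * f1) / (1 + \<epsilon>) > 0" using sum[OF elim(1), of x] U[OF x(1)] L[of x] by linarith
      then have lt: "x * f1 < \<epsilon>" using elim(1) by (simp add: zero_less_divide_iff zero_less_mult_iff)
      show ?case
      proof (intro exI[of _ x] exI[of _ False] conjI ballI)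
        fix y assume y: "y \<in> {0<..<\<eta>}"
        show "low_side \<epsilon> (1 + y * f1) (y * f2) \<longleftrightarrow> \<not> False \<and> y = x"
          unfolding lows[OF elim(1)] L using posX[OF x] lt by auto
        show "up_side \<epsilon> (1 + y * f1) (y * f2) \<longleftrightarrow> False \<and> y = x"
          unfolding ups[OF elim(1)] using U[of y] y by simp
      qed (use x X0 lt elim det[OF elim(1)] in auto)
    qed
  qed
  \<comment> \<open>The ray continues the axis. It meets the lower side at the abscissa
    \<open>(1 + \<epsilon>) / (1 + \<epsilon> / 2)\<close>, between 1 and the apex, whereas the
    upper side would meet the axis only beyond the apex.\<close>
  have ax: ?thesis if f2: "f2 = 0" and f1: "f1 > 0"
  proof -
    have "\<forall>\<^sub>F \<epsilon> in at_right (0::real). \<epsilon> < min 1 (X0 * f1)" using X0 f1 by (intro order_tendstoD(2)[OF tendsto_ident_at]) auto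
    then show ?thesis using pos
    proof eventually_elim
      case (elim \<epsilon>)
      have e: "0 < \<epsilon>" "\<epsilon> < 1" "\<epsilon> < X0 * f1" using elim by auto
      have e2: "\<epsilon>\<^sup>2 / 2 < \<epsilon>" "\<epsilon>\<^sup>2 > 0" using e by (simp_all add: power2_eq_square)
      have l: "l \<epsilon> < 0" and u: "u \<epsilon> < 0"
      proof -
        have "(\<epsilon> + \<epsilon>\<^sup>2 / 2) * f1 / (1 + \<epsilon>) > 0" "(\<epsilon> - \<epsilon>\<^sup>2 / 2) * f1 / (1 + \<epsilon>) > 0"
          by (intro divide_pos_pos mult_pos_pos; insert e e2 f1; linarith)+
        then show "l \<epsilon> < 0" "u \<epsilon> < 0" unfolding l_def u_def f2 by linarith+
      qed
      define x where "x = A \<epsilon> / (- l \<epsilon>)"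
      have x0: "0 < x" using AB[OF e(1)] l unfolding x_def by (auto simp: divide_pos_neg)
      have L: "A \<epsilon> + y * l \<epsilon> = 0 \<longleftrightarrow> y = x" for y using l unfolding x_def by (auto simp: field_simps)
      have xe: "x = (\<epsilon>\<^sup>2 / 2) / ((\<epsilon> + \<epsilon>\<^sup>2 / 2) * f1)" 
      proof -
        have "(a / d) / (- (0 - b / d)) = a / b" if "d \<noteq> 0" for a b d :: real using that by simp
        from this[OF nz[OF e(1)]] show ?thesis unfolding x_def A_def l_def f2 .
      qed
      have lt: "x * f1 < \<epsilon>"
      proof -
        have "x * f1 = (\<epsilon>\<^sup>2 / 2) / (\<epsilon> + \<epsilon>\<^sup>2 / 2)" unfolding xe using f1 by simp
        also have "\<dots> < \<epsilon>"
        proof -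
          define m where "m = \<epsilon>\<^sup>2 / 2"
          have m: "m > 0" "\<epsilon> * \<epsilon> = 2 * m" using e2 by (simp_all add: m_def power2_eq_square)
          have "\<epsilon> * m > 0" using e m by simp
          then have "m < \<epsilon> * (\<epsilon> + m)" unfolding distrib_left m(2) using m(1) by linarith
          then show ?thesis unfolding m_def[symmetric] using e m by (simp add: pos_divide_less_eq)
        qed
        finally show ?thesis .
      qed
      then have "x * f1 < X0 * f1" using e by linarith
      then have x: "x < X0" using f1 by simp
      have nU: "\<not> up_side \<epsilon> (1 + y * f1) (y * f2)" if "y > 0" for y
      proof
        assume "up_side \<epsilon> (1 + y * f1) (y * f2)"
        then have y: "y * f1 \<le> \<epsilon>" "B \<epsilon> + y * u \<epsilon> = 0" unfolding ups[OF e(1)] by auto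
        have "B \<epsilon> + y * u \<epsilon> = (3 * \<epsilon>\<^sup>2 / 2 - (\<epsilon> - \<epsilon>\<^sup>2 / 2) * (y * f1)) / (1 + \<epsilon>)"
    proof -
      define m where "m = \<epsilon>\<^sup>2 / 2"
      define q where "q = inverse (1 + \<epsilon>)"
      have h: "\<epsilon> * \<epsilon> = 2 * m" "(1 + \<epsilon>) * q = 1" "\<epsilon>\<^sup>2 / 2 = m" "3 * \<epsilon>\<^sup>2 / 2 = 3 * m"
        using nz[OF e(1)] by (simp_all add: m_def q_def power2_eq_square)
      show ?thesis unfolding A_def B_def l_def u_def f2 unfolding h(3,4) unfolding divide_inverse q_def[symmetric] by (simp add: algebra_simps)
    qed
        then have "3 * \<epsilon>\<^sup>2 / 2 = (\<epsilon> - \<epsilon>\<^sup>2 / 2) * (y * f1)" using y(2) e by simp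
        also have "\<dots> \<le> (\<epsilon> - \<epsilon>\<^sup>2 / 2) * \<epsilon>" using y(1) e2 by (intro mult_left_mono) auto
        also have "\<dots> \<le> \<epsilon> * \<epsilon>" using e by (intro mult_right_mono) auto
        finally show False using e2 by (simp add: power2_eq_square)
      qed
      show ?case
      proof (intro exI[of _ x] exI[of _ False] conjI ballI)
        fix y assume y: "y \<in> {0<..<\<eta>}"
        show "low_side \<epsilon> (1 + y * f1) (y * f2) \<longleftrightarrow> \<not> False \<and> y = x"
          unfolding lows[OF e(1)] L using posX[OF x0 x] lt by auto
        show "up_side \<epsilon> (1 + y * f1) (y * f2) \<longleftrightarrow> False \<and> y = x" using nU[of y] y by simp
      qed (use x0 x X0 lt e l det[OF e(1)] in auto)
    qed
  qed
  show ?thesis using up low ax f by linarith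
qed

text \<open>Needed for the heights: \<open>(1 + x * f1) / (1 + \<epsilon>)\<close> is the weight of
  the apex at such a point of the triangle. For thin triangles it is close to 1, or larger, wherever
  the ray is within the strip, so the finger has almost the height of its tip there.\<close>

lemma ray_stays_near:
  fixes f1 f2 \<theta> :: real
  assumes f: "f2 \<noteq> 0 \<or> f1 > 0" and \<theta>: "\<theta> < 1"
  shows "\<forall>\<^sub>F \<epsilon> in at_right 0. \<forall>x\<ge>0. \<bar>x * f2\<bar> \<le> \<epsilon> \<longrightarrow> (1 + x * f1) / (1 + \<epsilon>) > \<theta>"
proof (cases "f2 = 0")
  case True
  have "((\<lambda>\<epsilon>::real. 1 / (1 + \<epsilon>)) \<longlongrightarrow> 1 / (1 + 0)) (at_right 0)" by (intro tendsto_intros) auto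
  then have "\<forall>\<^sub>F \<epsilon> in at_right (0::real). 1 / (1 + \<epsilon>) > \<theta>" using \<theta> by (intro order_tendstoD) auto
  then show ?thesis using eventually_at_right_less[of "0::real"]
  proof eventually_elim
    case (elim \<epsilon>)
    have "1 / (1 + \<epsilon>) \<le> (1 + x * f1) / (1 + \<epsilon>)" if "x \<ge> 0" for x
      using elim f True that by (intro divide_right_mono) auto
    then show ?case using elim by force
  qed
next
  case False
  define C where "C = \<bar>f1\<bar> / \<bar>f2\<bar>"
  have "((\<lambda>\<epsilon>::real. (1 - C * \<epsilon>) / (1 + \<epsilon>)) \<longlongrightarrow> (1 - C * 0) / (1 + 0)) (at_right 0)" by (intro tendsto_intros) auto
  then have "\<forall>\<^sub>F \<epsilon> in at_right (0::real). (1 - C * \<epsilon>) / (1 + \<epsilon>) > \<theta>" using \<theta> by (intro order_tendstoD) auto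
  then show ?thesis using eventually_at_right_less[of "0::real"]
  proof eventually_elim
    case (elim \<epsilon>)
    have "(1 - C * \<epsilon>) / (1 + \<epsilon>) \<le> (1 + x * f1) / (1 + \<epsilon>)" if "x \<ge> 0" "\<bar>x * f2\<bar> \<le> \<epsilon>" for x
    proof -
      have "x \<le> \<epsilon> / \<bar>f2\<bar>" using that False by (simp add: abs_mult field_simps)
      then have "x * \<bar>f1\<bar> \<le> (\<epsilon> / \<bar>f2\<bar>) * \<bar>f1\<bar>" by (intro mult_right_mono) auto
      moreover have "x * f1 \<ge> - (x * \<bar>f1\<bar>)" using that(1) by (metis abs_ge_minus_self abs_mult abs_of_nonneg minus_le_iff)
      ultimately have "1 - C * \<epsilon> \<le> 1 + x * f1" unfolding C_def by (simp add: mult.commute)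
      then show ?thesis using elim by (intro divide_right_mono) auto
    qed
    then show ?case using elim by force
  qed
qed

text \<open>Cramer's rule, with \<open>D\<close> the determinant of \<open>u\<close> and
  \<open>b\<close>.\<close>

lemma plane_coordinates:
  fixes u b :: complex
  assumes "\<not> collinear {0, u, b}"
  shows "\<exists>X Y :: complex \<Rightarrow> real. linear X \<and> linear Y \<and> X u = 1 \<and> X b = 0 \<and> Y u = 0 \<and> Y b = 1 \<and>
    (\<forall>z. z = X z *\<^sub>R u + Y z *\<^sub>R b)"
proof -
  define D where "D = Re u * Im b - Im u * Re b"
  have D: "D \<noteq> 0"
  proof
    assume D: "D = 0"
    have "collinear {0, u, b}"
    proof (cases "u = 0")
      case False
      define n where "n = (Re u)\<^sup>2 + (Im u)\<^sup>2"
      have n: "n \<noteq> 0" using False unfolding n_def by (simp add: complex_eq_iff sum_power2_eq_zero_iff)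
      define c where "c = (Re u * Re b + Im u * Im b) / n"
      have "n * Re b = (Re u * Re b + Im u * Im b) * Re u - Im u * D"
        "n * Im b = (Re u * Re b + Im u * Im b) * Im u + Re u * D"
        unfolding n_def D_def by (simp_all add: algebra_simps power2_eq_square)
      then have "b = c *\<^sub>R u" using n D unfolding c_def by (simp add: complex_eq_iff field_simps)
      then show ?thesis unfolding collinear_lemma by blast
    qed (simp add: collinear_lemma)
    then show False using assms by simp
  qed
  define X where "X = (\<lambda>z. (Re z * Im b - Im z * Re b) / D)"
  define Y where "Y = (\<lambda>z. (Re u * Im z - Im u * Re z) / D)"
  show ?thesis
  proof (intro exI conjI allI)
    show "linear X" "linear Y" unfolding X_def Y_def by (auto intro!: linearI simp: field_simps add_divide_distrib diff_divide_distrib)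
    show "X u = 1" "X b = 0" "Y u = 0" "Y b = 1" unfolding X_def Y_def using D by (simp_all add: D_def)
    fix z
    have "D * Re z = (Re z * Im b - Im z * Re b) * Re u + (Re u * Im z - Im u * Re z) * Re b"
      "D * Im z = (Re z * Im b - Im z * Re b) * Im u + (Re u * Im z - Im u * Re z) * Im b"
      unfolding D_def by (simp_all add: algebra_simps)
    then have "Re z = X z * Re u + Y z * Re b" "Im z = X z * Im u + Y z * Im b"
      unfolding X_def Y_def using D by (simp_all add: nonzero_eq_divide_eq mult.commute flip: add_divide_distrib)
    then show "z = X z *\<^sub>R u + Y z *\<^sub>R b" by (simp add: complex_eq_iff)
  qed
qed

lemma affine_on_right:
  assumes "affine_on g {s..t}" "s \<le> t"
  obtains v where "\<And>x. 0 \<le> x \<Longrightarrow> x \<le> t - s \<Longrightarrow> g (s + x) = g s + x *\<^sub>R v"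
proof -
  obtain p v where pv: "\<And>u. u \<in> {s..t} \<Longrightarrow> g u = p + u *\<^sub>R v" using assms(1) unfolding affine_on_def by blast
  have "g (s + x) = g s + x *\<^sub>R v" if "0 \<le> x" "x \<le> t - s" for x
    using pv[of "s + x"] pv[of s] that assms(2) by (simp add: scaleR_left_distrib)
  then show ?thesis using that by blast
qed

lemma affine_on_left:
  assumes "affine_on g {s..t}" "s \<le> t"
  obtains v where "\<And>x. 0 \<le> x \<Longrightarrow> x \<le> t - s \<Longrightarrow> g (t - x) = g t - x *\<^sub>R v"
proof -
  obtain p v where pv: "\<And>u. u \<in> {s..t} \<Longrightarrow> g u = p + u *\<^sub>R v" using assms(1) unfolding affine_on_def by blast
  have "g (t - x) = g t - x *\<^sub>R v" if "0 \<le> x" "x \<le> t - s" for x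
    using pv[of "t - x"] pv[of t] that assms(2) by (simp add: scaleR_left_diff_distrib)
  then show ?thesis using that by blast
qed

lemma affine_on_shadow: "affine_on g S \<Longrightarrow> affine_on (shadow g) S"
  unfolding affine_on_def shadow_def by (metis fst_add fst_scaleR)

lemma affine_on_snd: "affine_on g S \<Longrightarrow> affine_on (\<lambda>t. snd (g t)) S"
  unfolding affine_on_def by (metis snd_add snd_scaleR)

text \<open>A one-sided affine piece has the two-sided derivative as its slope. Applied on both
  sides of a crossing, this shows that the projection is straight there.\<close>

lemma right_derivative_affine:
  fixes f :: "real \<Rightarrow> 'a::euclidean_space"
  assumes d: "(f has_vector_derivative v) (at t)" and \<delta>: "\<delta> > 0"
    and aff: "\<And>x. 0 \<le> x \<Longrightarrow> x \<le> \<delta> \<Longrightarrow> f (t + x) = f t + x *\<^sub>R w"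
  shows "w = v"
proof -
  have "(f has_vector_derivative v) (at t within {t..t + \<delta>})" using d by (rule has_vector_derivative_at_within)
  moreover have "((\<lambda>u. f t + (u - t) *\<^sub>R w) has_vector_derivative w) (at t within {t..t + \<delta>})"
    by (auto intro!: derivative_eq_intros)
  then have "(f has_vector_derivative w) (at t within {t..t + \<delta>})"
  proof (rule has_vector_derivative_transform[rotated 2])
    fix u assume u: "u \<in> {t..t + \<delta>}"
    show "f u = f t + (u - t) *\<^sub>R w" using aff[of "u - t"] u by simp
  qed (use \<delta> in simp)
  ultimately have "vector_derivative f (at t within {t..t + \<delta>}) = v" "vector_derivative f (at t within {t..t + \<delta>}) = w"
    using \<delta> by (intro vector_derivative_within_closed_interval; simp)+
  then show ?thesis by simp
qed

lemma left_derivative_affine: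
  fixes f :: "real \<Rightarrow> 'a::euclidean_space"
  assumes d: "(f has_vector_derivative v) (at t)" and \<delta>: "\<delta> > 0"
    and aff: "\<And>x. 0 \<le> x \<Longrightarrow> x \<le> \<delta> \<Longrightarrow> f (t - x) = f t - x *\<^sub>R w"
  shows "w = v"
proof -
  have "(f has_vector_derivative v) (at t within {t - \<delta>..t})" using d by (rule has_vector_derivative_at_within)
  moreover have "((\<lambda>u. f t - (t - u) *\<^sub>R w) has_vector_derivative w) (at t within {t - \<delta>..t})"
    by (auto intro!: derivative_eq_intros)
  then have "(f has_vector_derivative w) (at t within {t - \<delta>..t})"
  proof (rule has_vector_derivative_transform[rotated 2])
    fix u assume u: "u \<in> {t - \<delta>..t}"
    show "f u = f t - (t - u) *\<^sub>R w" using aff[of "t - u"] u by simp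
  qed (use \<delta> in simp)
  ultimately have "vector_derivative f (at t within {t - \<delta>..t}) = v" "vector_derivative f (at t within {t - \<delta>..t}) = w"
    using \<delta> by (intro vector_derivative_within_closed_interval; simp)+
  then show ?thesis by simp
qed

text \<open>The factor 2 leaves room: if \<open>C \<subseteq> P\<close>, then the open intervals of
  radius \<open>\<delta>\<close> around the points of \<open>C\<close> are pairwise
  disjoint.\<close>

lemma finite_separation:
  fixes P C :: "real set"
  assumes "finite P" "finite C" "\<eta> > 0"
  obtains \<delta> where "\<delta> > 0" "\<delta> \<le> \<eta>" "\<And>c x. c \<in> C \<Longrightarrow> x \<in> P \<Longrightarrow> x \<noteq> c \<Longrightarrow> 2 * \<delta> \<le> \<bar>x - c\<bar>"
proof -
  define D where "D = insert \<eta> ((\<lambda>(c, x). \<bar>x - c\<bar> / 2) ` {(c, x). c \<in> C \<and> x \<in> P \<and> x \<noteq> c})"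
  have "finite {(c, x). c \<in> C \<and> x \<in> P \<and> x \<noteq> c}"
    by (rule finite_subset[of _ "C \<times> P"]) (use assms in auto)
  then have fin: "finite D" unfolding D_def by simp
  have "Min D > 0" using fin assms(3) by (subst Min_gr_iff) (auto simp: D_def)
  moreover have "Min D \<le> \<eta>" using fin by (intro Min_le) (auto simp: D_def)
  moreover have "2 * Min D \<le> \<bar>x - c\<bar>" if "c \<in> C" "x \<in> P" "x \<noteq> c" for c x
  proof -
    have "\<bar>x - c\<bar> / 2 \<in> D" unfolding D_def using that by (intro insertI2 image_eqI[of _ _ "(c, x)"]) auto
    then have "Min D \<le> \<bar>x - c\<bar> / 2" using fin by (intro Min_le)
    then show ?thesis by simp
  qed
  ultimately show ?thesis using that by blast
qed

text \<open>The last conclusion says that the finger straddles the segment: its sides meet the axis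
  only beyond (1, 0), hence never the segment along which it is pushed.\<close>

lemma side_bounds:
  assumes "0 < \<epsilon>" "\<epsilon> \<le> 1" "low_side \<epsilon> X Y \<or> up_side \<epsilon> X Y"
  shows "0 < X" "X \<le> 1 + \<epsilon>" "\<bar>Y\<bar> \<le> \<epsilon>" "Y = 0 \<Longrightarrow> X > 1"
proof -
  define \<kappa> where "\<kappa> = X / (1 + \<epsilon>)"
  show X: "0 < X" "X \<le> 1 + \<epsilon>" using assms(3) unfolding low_side_def up_side_def by auto
  have \<kappa>: "0 < \<kappa>" "\<kappa> \<le> 1" "X = \<kappa> * (1 + \<epsilon>)" using X assms(1) by (auto simp: \<kappa>_def)
  define \<mu> where "\<mu> = \<epsilon>\<^sup>2 / 2"
  have \<mu>: "0 < \<mu>" "\<mu> < \<epsilon>" "\<epsilon> * \<epsilon> = 2 * \<mu>" using assms(1,2) by (auto simp: \<mu>_def power2_eq_square)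
  have Y: "Y = - \<epsilon> + (\<epsilon> + \<mu>) * \<kappa> \<or> Y = \<epsilon> - (\<epsilon> - \<mu>) * \<kappa>"
    using assms(3) unfolding low_side_def up_side_def \<kappa>_def \<mu>_def by auto
  have b: "0 \<le> (\<epsilon> + \<mu>) * \<kappa>" "(\<epsilon> + \<mu>) * \<kappa> \<le> \<epsilon> + \<mu>" "0 \<le> (\<epsilon> - \<mu>) * \<kappa>" "(\<epsilon> - \<mu>) * \<kappa> \<le> \<epsilon> - \<mu>"
    using \<kappa> \<mu> assms(1) by (auto simp: mult_left_le)
  then show "\<bar>Y\<bar> \<le> \<epsilon>" using Y \<mu> by linarith
  assume "Y = 0"
  then have "\<epsilon> = (\<epsilon> + \<mu>) * \<kappa> \<or> \<epsilon> = (\<epsilon> - \<mu>) * \<kappa>" using Y by linarith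
  moreover have "(\<epsilon> - \<mu>) * \<kappa> < \<epsilon>" using b \<mu> by linarith
  ultimately have eq: "(\<epsilon> + \<mu>) * \<kappa> = \<epsilon>" by linarith
  have "(\<epsilon> + \<mu>) * X = \<epsilon> * (1 + \<epsilon>)" unfolding \<kappa>(3) using eq by (metis mult.assoc)
  also have "\<dots> = \<epsilon> + 2 * \<mu>" using \<mu>(3) by (simp add: distrib_left)
  finally have "(\<epsilon> + \<mu>) * X > (\<epsilon> + \<mu>) * 1" using \<mu> by simp
  then show "X > 1" using \<mu> assms(1) by (simp add: mult_less_cancel_left)
qed

lemma collinear_fst: "\<not> collinear {fst a, fst b, fst c} \<Longrightarrow> \<not> collinear {a, b, c}"
  for a b c :: "'a::real_vector \<times> 'b::real_vector"
proof
  assume n: "\<not> collinear {fst a, fst b, fst c}" and "collinear {a, b, c}"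
  then obtain u v where "\<forall>x\<in>{a, b, c}. \<exists>k. x = u + k *\<^sub>R v" unfolding collinear_alt by blast
  then have "\<forall>x\<in>{fst a, fst b, fst c}. \<exists>k. x = fst u + k *\<^sub>R fst v"
    by (metis (no_types, lifting) fst_add fst_scaleR insertE insertI1 insertI2 singletonD)
  then show False using n unfolding collinear_alt by blast
qed

text \<open>The strand through \<open>t2\<close> is bent near \<open>t2\<close> into a thin triangle
  that follows the straight segment between the times \<open>e\<close> and \<open>t1\<close> and
  ends just beyond \<open>shadow g e\<close>. A pair in \<open>\<Omega>\<close> is a branch of the
  curve leaving that point, given by a time and a direction of travel; the branch along the segment
  itself, \<open>(e, 1)\<close>, is left out. The finger trades its crossing with the segment for
  one crossing with each branch, at the time \<open>S \<omega>\<close> on the finger and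
  \<open>T \<omega>\<close> on the branch. There is one branch if \<open>e\<close> is no crossing
  time, and there are three if a second strand passes over or under the point.\<close>

lemma finger_move:
  fixes g :: "real \<Rightarrow> space3" and \<Omega> :: "(real \<times> real) set"
  assumes kd: "knot_diagram g" and cr: "(t1, t2) \<in> coinc g"
    and e: "0 < e" "e < t1" and aff: "affine_on g {e..t1}" and t2: "t2 \<notin> {e..t1}"
    and inner: "\<And>\<tau>. \<tau> \<in> {e<..<t1} \<Longrightarrow> \<tau> \<notin> crossing_times g"
    and \<Omega>: "finite \<Omega>" "(e, -1) \<in> \<Omega>"
    and \<Omega>D: "\<And>\<tau> \<sigma>. (\<tau>, \<sigma>) \<in> \<Omega> \<Longrightarrow> (\<sigma> = 1 \<or> \<sigma> = -1) \<and> shadow g \<tau> = shadow g e \<and> \<tau> \<in> {0<..<1} \<and> (\<tau> = e \<longrightarrow> \<sigma> = -1)"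
    and \<Omega>I: "\<And>\<tau>. \<tau> \<in> {0..<1} \<Longrightarrow> shadow g \<tau> = shadow g e \<Longrightarrow> \<tau> \<noteq> e \<Longrightarrow> (\<tau>, 1) \<in> \<Omega> \<and> (\<tau>, -1) \<in> \<Omega>"
    and \<eta>: "\<eta> > 0"
  shows "\<exists>g' S T. knot_diagram g' \<and> isotopic3 (path_image g) (path_image g') \<and>
    (\<forall>\<tau>. \<bar>\<tau> - t2\<bar> \<ge> \<eta> \<longrightarrow> g' \<tau> = g \<tau>) \<and>
    coinc g' = coinc g - {(t1, t2), (t2, t1)} \<union> (\<lambda>\<omega>. (S \<omega>, T \<omega>)) ` \<Omega> \<union> (\<lambda>\<omega>. (T \<omega>, S \<omega>)) ` \<Omega> \<and>
    (\<forall>\<omega>\<in>\<Omega>. \<bar>S \<omega> - t2\<bar> < \<eta> \<and> (\<exists>x. 0 < x \<and> x < \<eta> \<and> T \<omega> = fst \<omega> + snd \<omega> * x))"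
proof -
  note kd' = kd[unfolded knot_diagram_iff]
  have pl: "piecewise_linear_path g" and cl: "g 1 = g 0" and finc: "finite (coinc g)"
    and sv: "\<And>x y y'. (x, y) \<in> coinc g \<Longrightarrow> (x, y') \<in> coinc g \<Longrightarrow> y = y'"
    and c0: "\<And>s t. (s, t) \<in> coinc g \<Longrightarrow> s \<noteq> 0 \<and> g s \<noteq> g t \<and> transverse g s t"
    using kd' unfolding single_valued_def by blast+
  have cr': "(t2, t1) \<in> coinc g" using cr coinc_sym by blast
  have t1: "t1 \<in> {0<..<1}" and t2': "t2 \<in> {0<..<1}" and t12: "t1 \<noteq> t2" and s12: "shadow g t1 = shadow g t2"
    using coincD[OF cr] c0[OF cr] c0[OF cr'] by auto
  define p where "p = shadow g t1"
  obtain v b where v: "(shadow g has_vector_derivative v) (at t1)" and b: "(shadow g has_vector_derivative b) (at t2)"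
    and vb: "\<not> collinear {0, v, b}" using c0[OF cr] unfolding transverse_def by blast
  obtain v' where v': "\<And>x. 0 \<le> x \<Longrightarrow> x \<le> t1 - e \<Longrightarrow> shadow g (t1 - x) = shadow g t1 - x *\<^sub>R v'"
    by (rule affine_on_left[OF affine_on_shadow[OF aff]]) (use e in auto)
  have "v' = v" by (rule left_derivative_affine[OF v, of "t1 - e"]) (use e v' in auto)
  then have seg: "shadow g (t1 - x) = p - x *\<^sub>R v" if "0 \<le> x" "x \<le> t1 - e" for x
    using v' that unfolding p_def by simp
  \<comment> \<open>In the coordinates \<open>X\<close>, \<open>Y\<close> based at the crossing, the
    segment becomes the piece from (0, 0) to (1, 0), and the strand through \<open>t2\<close> runs
    along the second axis.\<close>
  define u where "u = (e - t1) *\<^sub>R v"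
  have pe: "shadow g e = p + u" using seg[of "t1 - e"] e by (simp add: u_def scaleR_left_diff_distrib)
  have ub: "\<not> collinear {0, u, b}"
  proof
    assume "collinear {0, u, b}"
    then have "collinear {0, v, b}" unfolding collinear_lemma u_def using e
      by (metis diff_gt_0_iff_gt diff_self eq_iff_diff_eq_0 less_irrefl scaleR_eq_0_iff scaleR_scaleR)
    then show False using vb by simp
  qed
  obtain X Y :: "complex \<Rightarrow> real" where XY: "linear X" "linear Y" "X u = 1" "X b = 0" "Y u = 0" "Y b = 1"
    "\<And>z. z = X z *\<^sub>R u + Y z *\<^sub>R b" using plane_coordinates[OF ub] by blast
  note lin = linear_add[OF XY(1)] linear_add[OF XY(2)] linear_diff[OF XY(1)] linear_diff[OF XY(2)]
    linear_cmul[OF XY(1)] linear_cmul[OF XY(2)] linear_neg[OF XY(1)] linear_neg[OF XY(2)] XY(3-6)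
  have Xv: "X v = - 1 / (t1 - e)" and Yv: "Y v = 0"
  proof -
    have "(e - t1) * X v = 1" "(e - t1) * Y v = 0"
      using XY(3,5) unfolding u_def linear_cmul[OF XY(1)] linear_cmul[OF XY(2)] by simp_all
    then show "X v = - 1 / (t1 - e)" "Y v = 0" using e by (simp_all add: field_simps)
  qed
  define x where "x = (\<lambda>\<tau>. X (shadow g \<tau> - p))"
  define y where "y = (\<lambda>\<tau>. Y (shadow g \<tau> - p))"
  have xy: "shadow g \<tau> = p + (x \<tau> *\<^sub>R u + y \<tau> *\<^sub>R b)" for \<tau>
    unfolding x_def y_def using XY(7)[of "shadow g \<tau> - p"] by (simp add: algebra_simps)
  have xseg: "x (t1 - r * (t1 - e)) = r \<and> y (t1 - r * (t1 - e)) = 0" if "0 \<le> r" "r \<le> 1" for r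
  proof -
    have "r * (t1 - e) \<le> t1 - e" using that e by (simp add: mult_left_le_one_le)
    moreover have "0 \<le> r * (t1 - e)" using that e by simp
    ultimately have "shadow g (t1 - r * (t1 - e)) = p - (r * (t1 - e)) *\<^sub>R v" by (intro seg)
    moreover have "r *\<^sub>R u = - ((r * (t1 - e)) *\<^sub>R v)" by (simp add: u_def algebra_simps)
    ultimately have "shadow g (t1 - r * (t1 - e)) - p = r *\<^sub>R u" by simp
    then show ?thesis unfolding x_def y_def by (simp only: lin; simp)
  qed
  have seg_time: "\<exists>r. 0 \<le> r \<and> r \<le> 1 \<and> \<tau> = t1 - r * (t1 - e)" if "\<tau> \<in> {e..t1}" for \<tau>
    using that e by (intro exI[of _ "(t1 - \<tau>) / (t1 - e)"]) (auto simp: divide_le_eq)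
  obtain B where B: "finite B" "\<And>s t. 0 \<le> s \<Longrightarrow> s < t \<Longrightarrow> t \<le> 1 \<Longrightarrow> {s<..<t} \<inter> B = {} \<Longrightarrow> affine_on g {s..t}"
    using piecewise_linear_path_breaks[OF pl] by blast
  \<comment> \<open>\<open>C\<close> collects the times near which the picture is studied,
    \<open>P\<close> also those that have to be kept away from them: breaks, crossings and the base
    point.\<close>
  define C where "C = {e, t1, t2} \<union> fst ` \<Omega>"
  define P where "P = B \<union> crossing_times g \<union> {0, 1} \<union> C"
  have finC: "finite C" "finite P"
    unfolding P_def C_def crossing_times_eq Domain_fst using \<Omega>(1) B(1) finc by auto
  obtain \<delta> where \<delta>: "\<delta> > 0" "\<delta> \<le> \<eta>" and sep: "\<And>c q. c \<in> C \<Longrightarrow> q \<in> P \<Longrightarrow> q \<noteq> c \<Longrightarrow> 2 * \<delta> \<le> \<bar>q - c\<bar>"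
    using finite_separation[OF finC(2,1) \<eta>] by metis
  have C01: "c \<in> {0<..<1}" if "c \<in> C" for c using that \<Omega>D t1 t2' e unfolding C_def by fastforce
  have Cin: "0 \<le> c - \<delta>" "c + \<delta> \<le> 1" if "c \<in> C" for c
    using sep[OF that, of 0] sep[OF that, of 1] C01[OF that] \<delta> unfolding P_def by auto
  have noB: "q \<notin> P" if "c \<in> C" "q \<noteq> c" "\<bar>q - c\<bar> < 2 * \<delta>" for c q using sep[of c q] that by force
  have noC: "\<tau> \<notin> crossing_times g" if "c \<in> C" "\<tau> \<noteq> c" "\<bar>\<tau> - c\<bar> < 2 * \<delta>" for c \<tau>
    using noB[OF that] unfolding P_def by blast
  have affR: "affine_on g {c..c + \<delta>}" and affL: "affine_on g {c - \<delta>..c}" if "c \<in> C" for c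
    using noB[OF that] Cin[OF that] C01[OF that] \<delta> unfolding P_def by (auto intro!: B(2))
  have inC: "e \<in> C" "t1 \<in> C" "t2 \<in> C" "\<And>\<omega>. \<omega> \<in> \<Omega> \<Longrightarrow> fst \<omega> \<in> C" unfolding C_def by auto
  have CP: "C \<subseteq> P" unfolding P_def by blast
  \<comment> \<open>The one-sided slopes of the projection at \<open>t2\<close> are both
    \<open>b\<close>, so it is straight through \<open>t2\<close>; the height may still bend
    there.\<close>
  have g2: "shadow g (t2 + r) = p + r *\<^sub>R b" if "\<bar>r\<bar> \<le> \<delta>" for r
  proof -
    obtain b1 where b1: "\<And>x. 0 \<le> x \<Longrightarrow> x \<le> t2 + \<delta> - t2 \<Longrightarrow> shadow g (t2 + x) = shadow g t2 + x *\<^sub>R b1"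
      by (rule affine_on_right[OF affine_on_shadow[OF affR[OF inC(3)]]]) (use \<delta> in auto)
    obtain b2 where b2: "\<And>x. 0 \<le> x \<Longrightarrow> x \<le> t2 - (t2 - \<delta>) \<Longrightarrow> shadow g (t2 - x) = shadow g t2 - x *\<^sub>R b2"
      by (rule affine_on_left[OF affine_on_shadow[OF affL[OF inC(3)]]]) (use \<delta> in auto)
    have "b1 = b" using right_derivative_affine[OF b \<delta>(1), of b1] b1 by simp
    moreover have "b2 = b" using left_derivative_affine[OF b \<delta>(1), of b2] b2 by simp
    ultimately show ?thesis using b1[of r] b2[of "- r"] that s12 by (cases "r \<ge> 0") (auto simp: p_def)
  qed
  have xy2: "x (t2 + r) = 0 \<and> y (t2 + r) = r" if "\<bar>r\<bar> \<le> \<delta>" for r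
    unfolding x_def y_def g2[OF that] by (simp add: lin)
  \<comment> \<open>Past \<open>t1\<close> the curve continues on the far side of the strand through
    \<open>t2\<close>, where the finger does not reach.\<close>
  have x1: "x (t1 + r) < 0" if "0 < r" "r \<le> \<delta>" for r
  proof -
    obtain b1 where b1: "\<And>x. 0 \<le> x \<Longrightarrow> x \<le> t1 + \<delta> - t1 \<Longrightarrow> shadow g (t1 + x) = shadow g t1 + x *\<^sub>R b1"
      by (rule affine_on_right[OF affine_on_shadow[OF affR[OF inC(2)]]]) (use \<delta> in auto)
    have "b1 = v" using right_derivative_affine[OF v \<delta>(1), of b1] b1 by simp
    then have "shadow g (t1 + r) - p = r *\<^sub>R v" using b1[of r] that unfolding p_def by simp
    then show ?thesis unfolding x_def using that e by (simp add: lin Xv divide_neg_pos)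
  qed
  have "\<exists>F. \<forall>r. 0 \<le> r \<longrightarrow> r \<le> \<delta> \<longrightarrow> shadow g (fst \<omega> + snd \<omega> * r) = p + u + r *\<^sub>R F" if \<omega>: "\<omega> \<in> \<Omega>" for \<omega>
  proof -
    have d: "snd \<omega> = 1 \<or> snd \<omega> = -1" "shadow g (fst \<omega>) = p + u" using \<Omega>D[of "fst \<omega>" "snd \<omega>"] \<omega> pe by auto
    obtain b1 where b1: "\<And>x. 0 \<le> x \<Longrightarrow> x \<le> fst \<omega> + \<delta> - fst \<omega> \<Longrightarrow> shadow g (fst \<omega> + x) = shadow g (fst \<omega>) + x *\<^sub>R b1"
      by (rule affine_on_right[OF affine_on_shadow[OF affR[OF inC(4)[OF \<omega>]]]]) (use \<delta> in auto)
    obtain b2 where b2: "\<And>x. 0 \<le> x \<Longrightarrow> x \<le> fst \<omega> - (fst \<omega> - \<delta>) \<Longrightarrow> shadow g (fst \<omega> - x) = shadow g (fst \<omega>) - x *\<^sub>R b2"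
      by (rule affine_on_left[OF affine_on_shadow[OF affL[OF inC(4)[OF \<omega>]]]]) (use \<delta> in auto)
    show ?thesis
    proof (cases "snd \<omega> = 1")
      case True
      then show ?thesis using b1 d by (intro exI[of _ b1]) auto
    next
      case False
      then have "snd \<omega> = -1" using d by simp
      then show ?thesis using b2 d by (intro exI[of _ "- b2"]) auto
    qed
  qed
  then obtain F where F: "\<And>\<omega> r. \<omega> \<in> \<Omega> \<Longrightarrow> 0 \<le> r \<Longrightarrow> r \<le> \<delta> \<Longrightarrow> shadow g (fst \<omega> + snd \<omega> * r) = p + u + r *\<^sub>R F \<omega>"
    by metis
  have xyF: "x (fst \<omega> + snd \<omega> * r) = 1 + r * X (F \<omega>) \<and> y (fst \<omega> + snd \<omega> * r) = r * Y (F \<omega>)"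
    if "\<omega> \<in> \<Omega>" "0 \<le> r" "r \<le> \<delta>" for \<omega> r
    unfolding x_def y_def F[OF that] by (simp add: lin)
  have ray_noC: "fst \<omega> + snd \<omega> * r \<notin> crossing_times g" "fst \<omega> + snd \<omega> * r \<in> {0<..<1}"
    if "\<omega> \<in> \<Omega>" "0 < r" "r < \<delta>" for \<omega> r
  proof -
    have d: "snd \<omega> = 1 \<or> snd \<omega> = -1" using \<Omega>D[of "fst \<omega>" "snd \<omega>"] that by auto
    show "fst \<omega> + snd \<omega> * r \<notin> crossing_times g" using d that by (intro noC[OF inC(4)[OF that(1)]]) auto
    show "fst \<omega> + snd \<omega> * r \<in> {0<..<1}" using d that Cin[OF inC(4)[OF that(1)]] by auto
  qed
  \<comment> \<open>A branch pointing back along the segment would overlap it, so times close to but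
    different from \<open>fst \<omega>\<close> would be crossing times. The number \<open>r\<close>
    is chosen such that the overlapping point lies on the segment and its two times differ.\<close>
  have Fdir: "Y (F \<omega>) \<noteq> 0 \<or> X (F \<omega>) > 0" if \<omega>: "\<omega> \<in> \<Omega>" for \<omega>
  proof (rule ccontr)
    assume "\<not> (Y (F \<omega>) \<noteq> 0 \<or> X (F \<omega>) > 0)"
    then have F0: "Y (F \<omega>) = 0" "X (F \<omega>) \<le> 0" by auto
    define k where "k = - X (F \<omega>)"
    have k: "k \<ge> 0" using F0 by (simp add: k_def)
    define r where "r = min (\<delta> / 2) (min 1 (\<delta> / (2 * (t1 - e))) / (1 + k))"
    have r: "0 < r" "r < \<delta>" "r * k \<le> 1" "r * k * (t1 - e) < \<delta>"
    proof -
      show "0 < r" "r < \<delta>" using \<delta> k e by (auto simp: r_def)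
      have "r \<le> min 1 (\<delta> / (2 * (t1 - e))) / (1 + k)" unfolding r_def by (rule min.cobounded2)
      then have "r * (1 + k) \<le> min 1 (\<delta> / (2 * (t1 - e)))" using k by (subst (asm) pos_le_divide_eq) auto
      then have rk: "r * k \<le> min 1 (\<delta> / (2 * (t1 - e)))" using \<open>0 < r\<close> by (simp add: distrib_left)
      then show "r * k \<le> 1" by simp
      have "r * k \<le> \<delta> / (2 * (t1 - e))" using rk by simp
      then have "r * k * (t1 - e) \<le> \<delta> / 2" using e by (simp add: field_simps)
      then show "r * k * (t1 - e) < \<delta>" using \<delta> by simp
    qed
    let ?\<tau> = "fst \<omega> + snd \<omega> * r" and ?\<tau>' = "t1 - (1 - r * k) * (t1 - e)"
    have \<tau>': "?\<tau>' = e + r * k * (t1 - e)" by (simp add: algebra_simps)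
    have "x ?\<tau> = 1 - r * k \<and> y ?\<tau> = 0" using xyF[OF \<omega>, of r] r F0 by (simp add: k_def)
    moreover have "x ?\<tau>' = 1 - r * k \<and> y ?\<tau>' = 0" using xseg[of "1 - r * k"] r k by simp
    ultimately have "shadow g ?\<tau> = shadow g ?\<tau>'" using xy[of ?\<tau>] xy[of ?\<tau>'] by simp
    moreover have "?\<tau> \<noteq> ?\<tau>'"
    proof (cases "fst \<omega> = e")
      case True
      then have "snd \<omega> = -1" using \<Omega>D[of "fst \<omega>" "snd \<omega>"] \<omega> by auto
      moreover have "0 \<le> r * k * (t1 - e)" using r k e by simp
      ultimately show ?thesis unfolding \<tau>' True using r by auto
    next
      case False
      then have "2 * \<delta> \<le> \<bar>fst \<omega> - e\<bar>" using sep[OF inC(1)] inC(4)[OF \<omega>] CP by blast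
      moreover have "snd \<omega> = 1 \<or> snd \<omega> = -1" using \<Omega>D[of "fst \<omega>" "snd \<omega>"] \<omega> by auto
      moreover have "0 \<le> r * k * (t1 - e)" using r k e by simp
      ultimately show ?thesis unfolding \<tau>' using r by auto
    qed
    moreover have "?\<tau>' \<in> {0..<1}"
    proof -
      have "r * k * (t1 - e) \<le> t1 - e" using r k e by (simp add: mult_left_le_one_le)
      moreover have "0 \<le> r * k * (t1 - e)" using r k e by simp
      moreover have "t1 < 1" using t1 by simp
      ultimately show ?thesis unfolding \<tau>' atLeastLessThan_iff using e by linarith
    qed
    moreover have "?\<tau> \<in> {0..<1}" using ray_noC(2)[OF \<omega> r(1,2)] by auto
    ultimately have "(?\<tau>, ?\<tau>') \<in> coinc g" by (intro coincI)
    then show False using ray_noC(1)[OF \<omega> r(1,2)] unfolding crossing_times_eq by blast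
  qed
  \<comment> \<open>Times away from the segment and from all special points. \<open>D\<close> is
    positive exactly off the segment, so by compactness the far part keeps a distance
    \<open>D0\<close> from it, and a finger with \<open>\<epsilon> < D0\<close> does not meet
    it.\<close>
  define far where "far = {0..1} - ({e - \<delta><..<t1 + \<delta>} \<union> (\<Union>c\<in>C. {c - \<delta><..<c + \<delta>}))"
  have far01: "\<tau> \<in> far \<Longrightarrow> \<tau> \<in> {0..1}" for \<tau> unfolding far_def by blast
  define D where "D = (\<lambda>\<tau>. max (max (- x \<tau>) (x \<tau> - 1)) \<bar>y \<tau>\<bar>)"
  \<comment> \<open>Otherwise a far time would coincide with a time of the segment. Inside, the
    segment has no crossings, and the partners of its ends belong to \<open>C\<close>. Coincidences
    live on the half-open range, hence time 1 is replaced by 0.\<close>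
  have Dpos: "D \<tau> > 0" if \<tau>: "\<tau> \<in> far" for \<tau>
  proof (rule ccontr)
    assume "\<not> D \<tau> > 0"
    then have D: "0 \<le> x \<tau>" "x \<tau> \<le> 1" "y \<tau> = 0" unfolding D_def by auto
    define \<tau>1 where "\<tau>1 = (if \<tau> = 1 then 0 else \<tau>)"
    define \<tau>2 where "\<tau>2 = t1 - x \<tau> * (t1 - e)"
    have "shadow g \<tau>1 = shadow g \<tau>" using cl unfolding \<tau>1_def shadow_def by simp
    also have "\<dots> = shadow g \<tau>2" unfolding \<tau>2_def xy[of \<tau>] xy[of "t1 - x \<tau> * (t1 - e)"] using xseg[OF D(1,2)] D(3) by simp
    finally have eq: "shadow g \<tau>1 = shadow g \<tau>2" .
    have 2: "\<tau>2 \<in> {e..t1}" using D e by (auto simp: \<tau>2_def mult_left_le_one_le)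
      (metis D(1,2) diff_ge_0_iff_ge less_eq_real_def mult_left_le_one_le le_diff_eq add.commute diff_le_eq)
    have ne: "\<tau>1 \<noteq> \<tau>2" "\<tau>1 \<in> {0..<1}" using \<tau> 2 e \<delta> far01[OF \<tau>] unfolding far_def \<tau>1_def by auto
    have 3: "\<tau>2 \<in> {0..<1}" using 2 e t1 by auto
    have co: "(\<tau>2, \<tau>1) \<in> coinc g" using ne 3 eq by (intro coincI) auto
    then have "\<tau>2 \<notin> {e<..<t1}" using inner unfolding crossing_times_eq by blast
    then consider "\<tau>2 = e" | "\<tau>2 = t1" using 2 by fastforce
    then have "\<tau>1 \<in> C"
    proof cases
      case 1
      then show ?thesis using \<Omega>I[OF ne(2)] eq ne(1) inC(4) by force
    next
      case 2
      then show ?thesis using sv[OF co, of t2] cr inC(3) by simp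
    qed
    then show False using \<tau> C01[of \<tau>1] \<delta> unfolding far_def \<tau>1_def by (auto split: if_splits)
  qed
  have contg: "continuous_on {0..1} g" using pl unfolding piecewise_linear_path_def path_def by blast
  have contXY: "continuous_on A X" "continuous_on A Y" for A
    using XY(1,2) linear_continuous_on linear_conv_bounded_linear by blast+
  have "compact far"
  proof -
    have "far = {0..1} \<inter> (- ({e - \<delta><..<t1 + \<delta>} \<union> (\<Union>c\<in>C. {c - \<delta><..<c + \<delta>})))" unfolding far_def by blast
    then show ?thesis by (simp only:) (intro compact_Int_closed closed_Compl open_Un open_UN ballI open_greaterThanLessThan compact_Icc)
  qed
  moreover have "continuous_on far D"
  proof -
    have cs: "continuous_on far (\<lambda>\<tau>. shadow g \<tau> - p)" unfolding shadow_def
      by (intro continuous_on_diff continuous_on_fst continuous_on_const continuous_on_subset[OF contg]) (use far01 in blast)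
    show ?thesis unfolding D_def x_def y_def
      by (intro continuous_on_max continuous_on_minus continuous_on_diff continuous_on_const continuous_on_rabs
          continuous_on_compose2[OF contXY(1)[of UNIV] cs] continuous_on_compose2[OF contXY(2)[of UNIV] cs]) auto
  qed
  ultimately obtain D0 where D0: "D0 > 0" "\<And>\<tau>. \<tau> \<in> far \<Longrightarrow> D0 \<le> D \<tau>"
  proof (cases "far = {}")
    case False
    then obtain \<tau>0 where "\<tau>0 \<in> far" "\<forall>\<tau>\<in>far. D \<tau>0 \<le> D \<tau>"
      using continuous_attains_inf[OF \<open>compact far\<close> False \<open>continuous_on far D\<close>] by blast
    then show ?thesis using that[of "D \<tau>0"] Dpos by blast
  qed (use that[of 1] in auto)
  \<comment> \<open>Every time is far, on the segment, just past \<open>t1\<close>, near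
    \<open>t2\<close>, or on a branch. Both comparisons of the finger with the knot, in the
    projection and in space, go through this list.\<close>
  have kinds: "\<tau> \<in> far \<or> (\<exists>r. 0 \<le> r \<and> r \<le> 1 \<and> \<tau> = t1 - r * (t1 - e)) \<or> (\<exists>r. 0 < r \<and> r \<le> \<delta> \<and> \<tau> = t1 + r) \<or>
      (\<exists>r. \<bar>r\<bar> \<le> \<delta> \<and> \<tau> = t2 + r) \<or> (\<exists>\<omega>\<in>\<Omega>. \<exists>r. 0 \<le> r \<and> r < \<delta> \<and> \<tau> = fst \<omega> + snd \<omega> * r)"
    if \<tau>: "\<tau> \<in> {0..<1}" for \<tau>
  proof (cases "\<tau> \<in> far")
    case False
    then consider "\<tau> \<in> {e - \<delta><..<t1 + \<delta>}" | c where "c \<in> C" "\<bar>\<tau> - c\<bar> < \<delta>"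
      using \<tau> unfolding far_def by fastforce
    then consider "\<tau> \<in> {e - \<delta><..<e}" | "\<tau> \<in> {e..t1}" | "\<tau> \<in> {t1<..<t1 + \<delta>}" | "\<bar>\<tau> - t2\<bar> < \<delta>"
      | c where "c \<in> fst ` \<Omega>" "c \<noteq> e" "\<bar>\<tau> - c\<bar> < \<delta>"
    proof cases
      case 2
      then consider "c = e" | "c = t1" | "c = t2" | "c \<in> fst ` \<Omega>" "c \<noteq> e" unfolding C_def by blast
      then show ?thesis using 2 that \<delta> e by cases (fastforce simp: abs_less_iff)+
    qed (use that in fastforce)
    then show ?thesis
    proof cases
      case 1
      then have "\<exists>\<omega>\<in>\<Omega>. \<exists>r. 0 \<le> r \<and> r < \<delta> \<and> \<tau> = fst \<omega> + snd \<omega> * r"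
        by (intro bexI[OF _ \<Omega>(2)] exI[of _ "e - \<tau>"]) auto
      then show ?thesis by blast
    next
      case 2 then show ?thesis using seg_time by blast
    next
      case 3
      then have "\<exists>r. 0 < r \<and> r \<le> \<delta> \<and> \<tau> = t1 + r" by (intro exI[of _ "\<tau> - t1"]) auto
      then show ?thesis by blast
    next
      case 4
      then have "\<exists>r. \<bar>r\<bar> \<le> \<delta> \<and> \<tau> = t2 + r" by (intro exI[of _ "\<tau> - t2"]) auto
      then show ?thesis by blast
    next
      case 5
      then have "(c, 1) \<in> \<Omega>" "(c, -1) \<in> \<Omega>" using \<Omega>I[of c] \<Omega>D by force+
      then have "\<exists>\<omega>\<in>\<Omega>. \<exists>r. 0 \<le> r \<and> r < \<delta> \<and> \<tau> = fst \<omega> + snd \<omega> * r"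
      proof (cases "\<tau> \<ge> c")
        case True
        then show ?thesis using 5 by (intro bexI[OF _ \<open>(c, 1) \<in> \<Omega>\<close>] exI[of _ "\<tau> - c"]) auto
      next
        case False
        then show ?thesis using 5 by (intro bexI[OF _ \<open>(c, -1) \<in> \<Omega>\<close>] exI[of _ "c - \<tau>"]) auto
      qed
      then show ?thesis by blast
    qed
  qed blast
  text \<open>The finger passes above everything if the strand at \<open>t2\<close> is the upper one, and below otherwise.\<close>
  define \<rho> :: real where "\<rho> = (if snd (g t1) < snd (g t2) then 1 else -1)"
  have \<rho>: "\<rho> = 1 \<or> \<rho> = -1" by (simp add: \<rho>_def)
  have z12: "\<rho> * snd (g t1) < \<rho> * snd (g t2)"
  proof -
    have "snd (g t1) \<noteq> snd (g t2)" using s12 c0[OF cr] unfolding shadow_def by (simp add: prod_eq_iff)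
    then show ?thesis by (auto simp: \<rho>_def)
  qed
  obtain M where M: "M \<ge> 0" "\<And>\<tau>. \<tau> \<in> {0..1} \<Longrightarrow> \<bar>snd (g \<tau>)\<bar> \<le> M"
  proof -
    have "compact ((\<lambda>\<tau>. snd (g \<tau>)) ` {0..1})"
      by (intro compact_continuous_image continuous_on_snd contg compact_Icc)
    then obtain M where "\<forall>z\<in>(\<lambda>\<tau>. snd (g \<tau>)) ` {0..1}. norm z \<le> M" using compact_imp_bounded bounded_iff by blast
    then have m: "\<bar>snd (g \<tau>)\<bar> \<le> M" if "\<tau> \<in> {0..1}" for \<tau> using that by auto
    moreover have "M \<ge> 0" using m[of 0] by simp
    ultimately show ?thesis using that by blast
  qed
  have \<rho>M: "- M \<le> \<rho> * snd (g \<tau>) \<and> \<rho> * snd (g \<tau>) \<le> M" if "\<tau> \<in> {0..1}" for \<tau>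
    using M(2)[OF that] \<rho> by auto
  \<comment> \<open>A level between the two strands at the crossing, after the reflection by
    \<open>\<rho>\<close> that puts the strand at \<open>t2\<close> on top. The base of the finger
    is kept above it.\<close>
  define zs where "zs = (\<rho> * snd (g t1) + \<rho> * snd (g t2)) / 2"
  have zs: "\<rho> * snd (g t1) < zs" "zs < \<rho> * snd (g t2)" "- M \<le> zs"
    using z12 \<rho>M[of t1] t1 unfolding zs_def by auto
  \<comment> \<open>All heights lie between \<open>- M\<close> and \<open>M\<close>, and the tip
    gets height \<open>M + 1\<close>. A convex combination exceeds \<open>M\<close> as soon as the
    weight \<open>d\<close> of the tip is above \<open>\<theta>\<close>, since
    \<open>d * (M + 1) - (1 - d) * M > M\<close> means
    \<open>d > 2 * M / (2 * M + 1)\<close>.\<close>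
  define \<theta> where "\<theta> = 2 * M / (2 * M + 1)"
  have \<theta>: "\<theta> < 1" using M by (simp add: \<theta>_def)
  have high: "(1 - d) * zs + d * (M + 1) > M" if "d > \<theta>" "d \<le> 1" for d
  proof -
    have "d * (2 * M + 1) > 2 * M" using that(1) M(1) unfolding \<theta>_def by (simp add: pos_divide_less_eq)
    moreover have "(1 - d) * zs \<ge> (1 - d) * (- M)" using that(2) zs(3) by (intro mult_left_mono) auto
    ultimately show ?thesis by (simp add: algebra_simps)
  qed
  have "isCont g t2" using continuous_on_interior[OF contg, of t2] t2' by simp
  then have tr0: "((\<lambda>\<epsilon>. g (t2 + \<epsilon>)) \<longlongrightarrow> g t2) (at_right 0)" "((\<lambda>\<epsilon>. g (t2 - \<epsilon>)) \<longlongrightarrow> g t2) (at_right 0)"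
    by (auto intro!: isCont_tendsto_compose[of _ g] tendsto_eq_intros)
  have E6: "\<forall>\<^sub>F \<epsilon> in at_right 0. zs < \<rho> * snd (g (t2 + \<epsilon>))" "\<forall>\<^sub>F \<epsilon> in at_right 0. zs < \<rho> * snd (g (t2 - \<epsilon>))"
    by (rule order_tendstoD(1)[OF tendsto_mult_left[OF tendsto_snd[OF tr0(1)]] zs(2)],
        rule order_tendstoD(1)[OF tendsto_mult_left[OF tendsto_snd[OF tr0(2)]] zs(2)])
  have E5: "\<forall>\<^sub>F \<epsilon> in at_right 0. 1 / (1 + \<epsilon>) > \<theta>"
  proof -
    have "((\<lambda>\<epsilon>::real. 1 / (1 + \<epsilon>)) \<longlongrightarrow> 1 / (1 + 0)) (at_right 0)" by (intro tendsto_intros) auto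
    then show ?thesis using \<theta> by (intro order_tendstoD) auto
  qed
  have E2: "\<forall>\<^sub>F \<epsilon> in at_right (0::real). \<epsilon> < min \<delta> D0"
    using \<delta> D0 by (intro order_tendstoD(2)[OF tendsto_ident_at]) auto
  have E3: "\<forall>\<^sub>F \<epsilon> in at_right 0. \<forall>\<omega>\<in>\<Omega>. \<exists>x\<^sub>0 up. 0 < x\<^sub>0 \<and> x\<^sub>0 < \<delta> \<and> 1 + x\<^sub>0 * X (F \<omega>) < 1 + \<epsilon> \<and>
    (\<forall>x\<in>{0<..<\<delta>}. (low_side \<epsilon> (1 + x * X (F \<omega>)) (x * Y (F \<omega>)) \<longleftrightarrow> \<not> up \<and> x = x\<^sub>0) \<and>
       (up_side \<epsilon> (1 + x * X (F \<omega>)) (x * Y (F \<omega>)) \<longleftrightarrow> up \<and> x = x\<^sub>0)) \<and>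
    (up \<longrightarrow> (1 + \<epsilon>) * Y (F \<omega>) + (\<epsilon> - \<epsilon>\<^sup>2 / 2) * X (F \<omega>) \<noteq> 0) \<and>
    (\<not> up \<longrightarrow> (1 + \<epsilon>) * Y (F \<omega>) - (\<epsilon> + \<epsilon>\<^sup>2 / 2) * X (F \<omega>) \<noteq> 0)"
    by (intro eventually_ball_finite \<Omega>(1) ballI ray_meets_side Fdir \<delta>(1))
  have E4: "\<forall>\<^sub>F \<epsilon> in at_right 0. \<forall>\<omega>\<in>\<Omega>. \<forall>x\<ge>0. \<bar>x * Y (F \<omega>)\<bar> \<le> \<epsilon> \<longrightarrow> (1 + x * X (F \<omega>)) / (1 + \<epsilon>) > \<theta>"
    by (intro eventually_ball_finite \<Omega>(1) ballI ray_stays_near Fdir \<theta>)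
  \<comment> \<open>Each of the requirements holds for all sufficiently small
    \<open>\<epsilon>\<close>, so some \<open>\<epsilon>\<close> satisfies all of them.\<close>
  obtain \<epsilon> where \<epsilon>: "0 < \<epsilon>" "\<epsilon> < \<delta>" "\<epsilon> < D0"
    and side: "\<forall>\<omega>\<in>\<Omega>. \<exists>x\<^sub>0 up. 0 < x\<^sub>0 \<and> x\<^sub>0 < \<delta> \<and> 1 + x\<^sub>0 * X (F \<omega>) < 1 + \<epsilon> \<and>
    (\<forall>x\<in>{0<..<\<delta>}. (low_side \<epsilon> (1 + x * X (F \<omega>)) (x * Y (F \<omega>)) \<longleftrightarrow> \<not> up \<and> x = x\<^sub>0) \<and>
       (up_side \<epsilon> (1 + x * X (F \<omega>)) (x * Y (F \<omega>)) \<longleftrightarrow> up \<and> x = x\<^sub>0)) \<and>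
    (up \<longrightarrow> (1 + \<epsilon>) * Y (F \<omega>) + (\<epsilon> - \<epsilon>\<^sup>2 / 2) * X (F \<omega>) \<noteq> 0) \<and>
    (\<not> up \<longrightarrow> (1 + \<epsilon>) * Y (F \<omega>) - (\<epsilon> + \<epsilon>\<^sup>2 / 2) * X (F \<omega>) \<noteq> 0)"
    and near: "\<And>\<omega> x. \<omega> \<in> \<Omega> \<Longrightarrow> x \<ge> 0 \<Longrightarrow> \<bar>x * Y (F \<omega>)\<bar> \<le> \<epsilon> \<Longrightarrow> (1 + x * X (F \<omega>)) / (1 + \<epsilon>) > \<theta>"
    and e5: "1 / (1 + \<epsilon>) > \<theta>" and e6: "zs < \<rho> * snd (g (t2 + \<epsilon>))" "zs < \<rho> * snd (g (t2 - \<epsilon>))"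
  proof -
    have E1: "\<forall>\<^sub>F \<epsilon> in at_right (0::real). 0 < \<epsilon>" by (rule eventually_at_right_less)
    note ev = eventually_happens'[OF trivial_limit_at_right_real
        eventually_conj[OF E1 eventually_conj[OF E2 eventually_conj[OF E3 eventually_conj[OF E4
        eventually_conj[OF E5 eventually_conj[OF E6]]]]]]]
    show ?thesis
    proof (rule exE[OF ev], elim conjE, rule that)
      fix \<epsilon> :: real assume "\<epsilon> < min \<delta> D0"
      then show "\<epsilon> < \<delta>" "\<epsilon> < D0" by simp_all
    next
      fix \<epsilon> \<omega> x
      assume *: "\<forall>\<omega>\<in>\<Omega>. \<forall>x\<ge>0. \<bar>x * Y (F \<omega>)\<bar> \<le> \<epsilon> \<longrightarrow> \<theta> < (1 + x * X (F \<omega>)) / (1 + \<epsilon>)"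
        and "\<omega> \<in> \<Omega>" "0 \<le> x" "\<bar>x * Y (F \<omega>)\<bar> \<le> \<epsilon>"
      then show "\<theta> < (1 + x * X (F \<omega>)) / (1 + \<epsilon>)" by simp
    qed
  qed
  obtain x0 up where x0: "\<And>\<omega>. \<omega> \<in> \<Omega> \<Longrightarrow> 0 < x0 \<omega>" "\<And>\<omega>. \<omega> \<in> \<Omega> \<Longrightarrow> x0 \<omega> < \<delta>"
      "\<And>\<omega>. \<omega> \<in> \<Omega> \<Longrightarrow> 1 + x0 \<omega> * X (F \<omega>) < 1 + \<epsilon>"
    and low: "\<And>\<omega> r. \<omega> \<in> \<Omega> \<Longrightarrow> 0 < r \<Longrightarrow> r < \<delta> \<Longrightarrow>
      low_side \<epsilon> (1 + r * X (F \<omega>)) (r * Y (F \<omega>)) \<longleftrightarrow> \<not> up \<omega> \<and> r = x0 \<omega>"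
    and upp: "\<And>\<omega> r. \<omega> \<in> \<Omega> \<Longrightarrow> 0 < r \<Longrightarrow> r < \<delta> \<Longrightarrow>
      up_side \<epsilon> (1 + r * X (F \<omega>)) (r * Y (F \<omega>)) \<longleftrightarrow> up \<omega> \<and> r = x0 \<omega>"
    and det: "\<And>\<omega>. \<omega> \<in> \<Omega> \<Longrightarrow> up \<omega> \<Longrightarrow> (1 + \<epsilon>) * Y (F \<omega>) + (\<epsilon> - \<epsilon>\<^sup>2 / 2) * X (F \<omega>) \<noteq> 0"
      "\<And>\<omega>. \<omega> \<in> \<Omega> \<Longrightarrow> \<not> up \<omega> \<Longrightarrow> (1 + \<epsilon>) * Y (F \<omega>) - (\<epsilon> + \<epsilon>\<^sup>2 / 2) * X (F \<omega>) \<noteq> 0"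
  proof -
    have "\<forall>\<omega>\<in>\<Omega>. \<exists>q. 0 < fst q \<and> fst q < \<delta> \<and> 1 + fst q * X (F \<omega>) < 1 + \<epsilon> \<and>
    (\<forall>x\<in>{0<..<\<delta>}. (low_side \<epsilon> (1 + x * X (F \<omega>)) (x * Y (F \<omega>)) \<longleftrightarrow> \<not> snd q \<and> x = fst q) \<and>
       (up_side \<epsilon> (1 + x * X (F \<omega>)) (x * Y (F \<omega>)) \<longleftrightarrow> snd q \<and> x = fst q)) \<and>
    (snd q \<longrightarrow> (1 + \<epsilon>) * Y (F \<omega>) + (\<epsilon> - \<epsilon>\<^sup>2 / 2) * X (F \<omega>) \<noteq> 0) \<and>
    (\<not> snd q \<longrightarrow> (1 + \<epsilon>) * Y (F \<omega>) - (\<epsilon> + \<epsilon>\<^sup>2 / 2) * X (F \<omega>) \<noteq> 0)"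
      using side by simp
    from bchoice[OF this] obtain Q where Q: "\<forall>\<omega>\<in>\<Omega>. 0 < fst (Q \<omega>) \<and> fst (Q \<omega>) < \<delta> \<and> 1 + fst (Q \<omega>) * X (F \<omega>) < 1 + \<epsilon> \<and>
    (\<forall>x\<in>{0<..<\<delta>}. (low_side \<epsilon> (1 + x * X (F \<omega>)) (x * Y (F \<omega>)) \<longleftrightarrow> \<not> snd (Q \<omega>) \<and> x = fst (Q \<omega>)) \<and>
       (up_side \<epsilon> (1 + x * X (F \<omega>)) (x * Y (F \<omega>)) \<longleftrightarrow> snd (Q \<omega>) \<and> x = fst (Q \<omega>))) \<and>
    (snd (Q \<omega>) \<longrightarrow> (1 + \<epsilon>) * Y (F \<omega>) + (\<epsilon> - \<epsilon>\<^sup>2 / 2) * X (F \<omega>) \<noteq> 0) \<and>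
    (\<not> snd (Q \<omega>) \<longrightarrow> (1 + \<epsilon>) * Y (F \<omega>) - (\<epsilon> + \<epsilon>\<^sup>2 / 2) * X (F \<omega>) \<noteq> 0)" by blast
    show ?thesis by (rule that[of "\<lambda>\<omega>. fst (Q \<omega>)" "\<lambda>\<omega>. snd (Q \<omega>)"]) (use Q in \<open>simp_all\<close>)
  qed
  have \<epsilon>1: "\<epsilon> \<le> 1" using \<epsilon> Cin[OF inC(1)] by linarith
  define \<mu> where "\<mu> = \<epsilon>\<^sup>2 / 2"
  have \<mu>: "0 < \<mu>" "\<mu> < \<epsilon>" using \<epsilon>(1) \<epsilon>1 by (auto simp: \<mu>_def power2_eq_square)
  define s where "s = t2 - \<epsilon>"
  define t where "t = t2 + \<epsilon>"
  have st: "0 < s" "s < t" "t < 1" and mid: "(s + t) / 2 = t2" and hf: "(t - s) / 2 = \<epsilon>"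
    using \<epsilon> Cin[OF inC(3)] by (auto simp: s_def t_def)
  \<comment> \<open>The tip: its projection is just beyond the end of the segment, its height
    outside the range of the whole knot.\<close>
  define w where "w = (p + ((1 + \<epsilon>) *\<^sub>R u + \<mu> *\<^sub>R b), \<rho> * (M + 1))"
  define h where "h = bend g s t w"
  have shs: "shadow g s = p - \<epsilon> *\<^sub>R b" and sht: "shadow g t = p + \<epsilon> *\<^sub>R b"
    using g2[of "- \<epsilon>"] g2[of \<epsilon>] \<epsilon> by (auto simp: s_def t_def)
  have hl: "shadow h (s + k * \<epsilon>) - p = (k * (1 + \<epsilon>)) *\<^sub>R u + (- \<epsilon> + k * (\<epsilon> + \<mu>)) *\<^sub>R b" if "0 \<le> k" "k \<le> 1" for k
  proof -
    have "s + k * \<epsilon> \<in> {s..t2}" using that \<epsilon> by (auto simp: s_def)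
    then have "shadow h (s + k * \<epsilon>) = linepath (shadow g s) (fst w) k"
      unfolding h_def shadow_bend using bend_left[OF st(2), of "s + k * \<epsilon>" "shadow g" "fst w"] \<epsilon> unfolding mid hf by simp
    then show ?thesis unfolding shs w_def by (simp add: linepath_def algebra_simps)
  qed
  have hr: "shadow h (t - k * \<epsilon>) - p = (k * (1 + \<epsilon>)) *\<^sub>R u + (\<epsilon> - k * (\<epsilon> - \<mu>)) *\<^sub>R b" if "0 \<le> k" "k \<le> 1" for k
  proof -
    have "t - k * \<epsilon> \<in> {t2..t}" using that \<epsilon> by (auto simp: t_def)
    moreover have "(t - k * \<epsilon> - t2) / \<epsilon> = 1 - k" using \<epsilon> by (simp add: t_def field_simps)
    ultimately have "shadow h (t - k * \<epsilon>) = linepath (fst w) (shadow g t) (1 - k)"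
      unfolding h_def shadow_bend using bend_right[OF st(2), of "t - k * \<epsilon>" "shadow g" "fst w"] unfolding mid hf by simp
    then show ?thesis unfolding sht w_def by (simp add: linepath_def algebra_simps)
  qed
  have low_h: "low_side \<epsilon> (X (shadow h (s + k * \<epsilon>) - p)) (Y (shadow h (s + k * \<epsilon>) - p))" if "0 < k" "k \<le> 1" for k
    using that \<epsilon> hl[of k] unfolding low_side_def \<mu>_def[symmetric] by (simp add: lin mult_left_le_one_le mult.commute)
  have up_h: "up_side \<epsilon> (X (shadow h (t - k * \<epsilon>) - p)) (Y (shadow h (t - k * \<epsilon>) - p))" if "0 < k" "k \<le> 1" for k
    using that \<epsilon> hr[of k] unfolding up_side_def \<mu>_def[symmetric] by (simp add: lin mult_left_le_one_le mult.commute)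
  have low_q: "shadow h (s + x \<tau> / (1 + \<epsilon>) * \<epsilon>) = shadow g \<tau>" if "low_side \<epsilon> (x \<tau>) (y \<tau>)" for \<tau>
  proof -
    have l: "0 < x \<tau>" "x \<tau> \<le> 1 + \<epsilon>" "y \<tau> = - \<epsilon> + (\<epsilon> + \<mu>) * x \<tau> / (1 + \<epsilon>)"
      using that unfolding low_side_def \<mu>_def by auto
    have k: "0 \<le> x \<tau> / (1 + \<epsilon>)" "x \<tau> / (1 + \<epsilon>) \<le> 1" "x \<tau> / (1 + \<epsilon>) * (1 + \<epsilon>) = x \<tau>" using l \<epsilon> by auto
    have "y \<tau> = - \<epsilon> + x \<tau> / (1 + \<epsilon>) * (\<epsilon> + \<mu>)" using l(3) by (simp add: mult.commute)
    then have "shadow h (s + x \<tau> / (1 + \<epsilon>) * \<epsilon>) - p = x \<tau> *\<^sub>R u + y \<tau> *\<^sub>R b" using hl[OF k(1,2)] unfolding k(3) by simp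
    then show ?thesis using xy[of \<tau>] by (simp add: algebra_simps)
  qed
  have up_q: "shadow h (t - x \<tau> / (1 + \<epsilon>) * \<epsilon>) = shadow g \<tau>" if "up_side \<epsilon> (x \<tau>) (y \<tau>)" for \<tau>
  proof -
    have l: "0 < x \<tau>" "x \<tau> \<le> 1 + \<epsilon>" "y \<tau> = \<epsilon> - (\<epsilon> - \<mu>) * x \<tau> / (1 + \<epsilon>)"
      using that unfolding up_side_def \<mu>_def by auto
    have k: "0 \<le> x \<tau> / (1 + \<epsilon>)" "x \<tau> / (1 + \<epsilon>) \<le> 1" "x \<tau> / (1 + \<epsilon>) * (1 + \<epsilon>) = x \<tau>" using l \<epsilon> by auto
    have "y \<tau> = \<epsilon> - x \<tau> / (1 + \<epsilon>) * (\<epsilon> - \<mu>)" using l(3) by (simp add: mult.commute)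
    then have "shadow h (t - x \<tau> / (1 + \<epsilon>) * \<epsilon>) - p = x \<tau> *\<^sub>R u + y \<tau> *\<^sub>R b" using hr[OF k(1,2)] unfolding k(3) by simp
    then show ?thesis using xy[of \<tau>] by (simp add: algebra_simps)
  qed
  \<comment> \<open>The fraction of the side at which the branch is met, measured from the
    base.\<close>
  define k where "k = (\<lambda>\<omega>. (1 + x0 \<omega> * X (F \<omega>)) / (1 + \<epsilon>))"
  define T where "T = (\<lambda>\<omega>. fst \<omega> + snd \<omega> * x0 \<omega>)"
  define S where "S = (\<lambda>\<omega>. if up \<omega> then t - k \<omega> * \<epsilon> else s + k \<omega> * \<epsilon>)"
  have xyT: "x (T \<omega>) = 1 + x0 \<omega> * X (F \<omega>)" "y (T \<omega>) = x0 \<omega> * Y (F \<omega>)" if "\<omega> \<in> \<Omega>" for \<omega>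
    using xyF[OF that, of "x0 \<omega>"] x0(1,2)[OF that] unfolding T_def by auto
  have sideT: "(up \<omega> \<longrightarrow> up_side \<epsilon> (x (T \<omega>)) (y (T \<omega>))) \<and> (\<not> up \<omega> \<longrightarrow> low_side \<epsilon> (x (T \<omega>)) (y (T \<omega>)))" if "\<omega> \<in> \<Omega>" for \<omega>
    unfolding xyT[OF that] using low[OF that x0(1,2)[OF that]] upp[OF that x0(1,2)[OF that]] by blast
  have k01: "0 < k \<omega>" "k \<omega> < 1" if \<omega>: "\<omega> \<in> \<Omega>" for \<omega>
  proof -
    have "low_side \<epsilon> (x (T \<omega>)) (y (T \<omega>)) \<or> up_side \<epsilon> (x (T \<omega>)) (y (T \<omega>))" using sideT[OF \<omega>] by blast
    from side_bounds(1)[OF \<epsilon>(1) \<epsilon>1 this] show "0 < k \<omega>" using \<epsilon> unfolding k_def xyT[OF \<omega>] by simp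
    show "k \<omega> < 1" using x0(3)[OF \<omega>] \<epsilon> unfolding k_def by simp
  qed
  have ST: "shadow h (S \<omega>) = shadow g (T \<omega>)" if "\<omega> \<in> \<Omega>" for \<omega>
    using low_q[of "T \<omega>"] up_q[of "T \<omega>"] sideT[OF that] unfolding S_def k_def xyT[OF that] by auto
  have S_in: "S \<omega> \<in> {s<..<t}" "up \<omega> \<Longrightarrow> S \<omega> \<in> {t2<..<t}" "\<not> up \<omega> \<Longrightarrow> S \<omega> \<in> {s<..<t2}" if "\<omega> \<in> \<Omega>" for \<omega>
  proof -
    have "0 < k \<omega> * \<epsilon>" "k \<omega> * \<epsilon> < \<epsilon>" using k01[OF that] \<epsilon> by auto
    then show "S \<omega> \<in> {s<..<t}" "up \<omega> \<Longrightarrow> S \<omega> \<in> {t2<..<t}" "\<not> up \<omega> \<Longrightarrow> S \<omega> \<in> {s<..<t2}"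
      unfolding S_def s_def t_def using k01[OF that] \<epsilon> by auto
  qed
  have fst2: "fst \<omega> \<noteq> t2" if "\<omega> \<in> \<Omega>" for \<omega>
  proof
    assume "fst \<omega> = t2"
    then have "p = p + u" using F[OF that, of 0] \<delta> s12 by (simp add: p_def)
    then have "u = 0" by simp
    then show False using XY(1,3) linear_0 by force
  qed
  have T_in: "T \<omega> \<in> {0<..<1}" "T \<omega> \<notin> crossing_times g" "\<bar>T \<omega> - t2\<bar> > \<epsilon>" if "\<omega> \<in> \<Omega>" for \<omega>
  proof -
    show "T \<omega> \<in> {0<..<1}" "T \<omega> \<notin> crossing_times g"
      unfolding T_def using ray_noC[OF that x0(1,2)[OF that]] by auto
    have "2 * \<delta> \<le> \<bar>fst \<omega> - t2\<bar>" using sep[OF inC(3), of "fst \<omega>"] inC(4)[OF that] CP fst2[OF that] by blast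
    moreover have "snd \<omega> = 1 \<or> snd \<omega> = -1" using \<Omega>D[of "fst \<omega>" "snd \<omega>"] that by auto
    ultimately show "\<bar>T \<omega> - t2\<bar> > \<epsilon>" unfolding T_def using x0(1,2)[OF that] \<epsilon> by auto
  qed
  define N where "N = (\<lambda>\<omega>. (S \<omega>, T \<omega>)) ` \<Omega>"
  have N: "shadow h \<sigma> = shadow g \<tau> \<longleftrightarrow> (\<sigma>, \<tau>) \<in> N" if \<sigma>: "\<sigma> \<in> {s<..<t}" and \<tau>: "\<tau> \<in> {0..<1} - {s<..<t}" for \<sigma> \<tau>
  proof
    assume "(\<sigma>, \<tau>) \<in> N"
    then show "shadow h \<sigma> = shadow g \<tau>" unfolding N_def using ST by auto
  next
    assume eq: "shadow h \<sigma> = shadow g \<tau>"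
    have "\<exists>k. 0 < k \<and> k \<le> 1 \<and> (\<sigma> = s + k * \<epsilon> \<and> low_side \<epsilon> (x \<tau>) (y \<tau>) \<or> \<sigma> = t - k * \<epsilon> \<and> up_side \<epsilon> (x \<tau>) (y \<tau>)) \<and> x \<tau> = k * (1 + \<epsilon>)"
    proof (cases "\<sigma> \<le> t2")
      case True
      define k where "k = (\<sigma> - s) / \<epsilon>"
      have k: "0 < k" "k \<le> 1" "\<sigma> = s + k * \<epsilon>" using True \<sigma> \<epsilon> unfolding k_def s_def by auto
      have "x \<tau> = k * (1 + \<epsilon>)" unfolding x_def eq[symmetric] k(3) using hl[of k] k by (simp add: lin)
      moreover have "low_side \<epsilon> (x \<tau>) (y \<tau>)" using low_h[OF k(1,2)] unfolding x_def y_def eq[symmetric] k(3) .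
      ultimately show ?thesis using k by blast
    next
      case False
      define k where "k = (t - \<sigma>) / \<epsilon>"
      have k: "0 < k" "k \<le> 1" "\<sigma> = t - k * \<epsilon>" using False \<sigma> \<epsilon> unfolding k_def t_def by auto
      have "x \<tau> = k * (1 + \<epsilon>)" unfolding x_def eq[symmetric] k(3) using hr[of k] k by (simp add: lin)
      moreover have "up_side \<epsilon> (x \<tau>) (y \<tau>)" using up_h[OF k(1,2)] unfolding x_def y_def eq[symmetric] k(3) .
      ultimately show ?thesis using k by blast
    qed
    then obtain k' where k': "0 < k'" "k' \<le> 1" "x \<tau> = k' * (1 + \<epsilon>)"
      "\<sigma> = s + k' * \<epsilon> \<and> low_side \<epsilon> (x \<tau>) (y \<tau>) \<or> \<sigma> = t - k' * \<epsilon> \<and> up_side \<epsilon> (x \<tau>) (y \<tau>)" by blast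
    then have sd: "low_side \<epsilon> (x \<tau>) (y \<tau>) \<or> up_side \<epsilon> (x \<tau>) (y \<tau>)" by blast
    note bd = side_bounds[OF \<epsilon>(1) \<epsilon>1 sd]
    \<comment> \<open>Only a branch can meet a side: the far part is too distant, the segment ends
      before the sides reach the axis, and the pieces near \<open>t2\<close> and past
      \<open>t1\<close> have abscissa at most 0.\<close>
    have "\<exists>\<omega>\<in>\<Omega>. \<exists>r. 0 < r \<and> r < \<delta> \<and> \<tau> = fst \<omega> + snd \<omega> * r"
    proof -
      have "\<tau> \<notin> far" using D0(2)[of \<tau>] \<epsilon> bd unfolding D_def by auto
      moreover have "\<not> (\<exists>r. 0 \<le> r \<and> r \<le> 1 \<and> \<tau> = t1 - r * (t1 - e))" using xseg bd(4) by force
      moreover have "\<not> (\<exists>r. 0 < r \<and> r \<le> \<delta> \<and> \<tau> = t1 + r)" using x1 bd(1) by force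
      moreover have "\<not> (\<exists>r. \<bar>r\<bar> \<le> \<delta> \<and> \<tau> = t2 + r)" using xy2 bd(1) by force
      moreover have "\<not> (\<exists>\<omega>\<in>\<Omega>. \<tau> = fst \<omega> + snd \<omega> * 0)" using xyF[of _ 0] \<delta> bd(4) by force
      moreover have "\<tau> \<in> {0..<1}" using \<tau> by blast
      ultimately have "\<exists>\<omega>\<in>\<Omega>. \<exists>r. 0 \<le> r \<and> r < \<delta> \<and> \<tau> = fst \<omega> + snd \<omega> * r" using kinds[of \<tau>] by blast
      then obtain \<omega> r where \<omega>: "\<omega> \<in> \<Omega>" "0 \<le> r" "r < \<delta>" "\<tau> = fst \<omega> + snd \<omega> * r" by blast
      have "r \<noteq> 0" using \<open>\<not> (\<exists>\<omega>\<in>\<Omega>. \<tau> = fst \<omega> + snd \<omega> * 0)\<close> \<omega> by blast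
      then have "0 < r" using \<omega>(2) by simp
      then show ?thesis using \<omega> by blast
    qed
    then obtain \<omega> r where \<omega>: "\<omega> \<in> \<Omega>" "0 < r" "r < \<delta>" "\<tau> = fst \<omega> + snd \<omega> * r" by blast
    have c: "x \<tau> = 1 + r * X (F \<omega>)" "y \<tau> = r * Y (F \<omega>)" using xyF[OF \<omega>(1), of r] \<omega> by auto
    have kk: "k' = x \<tau> / (1 + \<epsilon>)" using k'(3) \<epsilon> by simp
    from k'(4) have "\<sigma> = S \<omega> \<and> r = x0 \<omega>"
    proof
      assume a: "\<sigma> = s + k' * \<epsilon> \<and> low_side \<epsilon> (x \<tau>) (y \<tau>)"
      then have "\<not> up \<omega> \<and> r = x0 \<omega>" using low[OF \<omega>(1-3)] unfolding c by blast
      then show ?thesis using a unfolding S_def k_def kk c by simp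
    next
      assume a: "\<sigma> = t - k' * \<epsilon> \<and> up_side \<epsilon> (x \<tau>) (y \<tau>)"
      then have "up \<omega> \<and> r = x0 \<omega>" using upp[OF \<omega>(1-3)] unfolding c by blast
      then show ?thesis using a unfolding S_def k_def kk c by simp
    qed
    then show "(\<sigma>, \<tau>) \<in> N" unfolding N_def using \<omega> by (auto simp: T_def intro!: image_eqI[OF _ \<omega>(1)])
  qed
  have snc: "s \<notin> crossing_times g" "t \<notin> crossing_times g"
    using \<epsilon> noC[OF inC(3), of s] noC[OF inC(3), of t] by (auto simp: s_def t_def)
  text \<open>In space the knot meets the two triangles only in the base.\<close>
  have hull: "g \<tau> = g (t2 + \<kappa> * \<epsilon>)"
    if \<tau>: "\<tau> \<in> {0..s} \<union> {t..1}" and \<kappa>: "\<kappa> = 1 \<or> \<kappa> = -1"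
      and q: "g \<tau> \<in> convex hull {g (t2 + \<kappa> * \<epsilon>), g t2, w}" for \<tau> \<kappa>
  proof -
    obtain \<tau>' where \<tau>': "\<tau>' \<in> {0..<1}" "\<tau>' \<notin> {s<..<t}" "g \<tau>' = g \<tau>"
    proof (cases "\<tau> = 1")
      case True then show ?thesis using that[of 0] cl st by simp
    next
      case False then show ?thesis using that[of \<tau>] \<tau> st by auto
    qed
    obtain \<alpha> \<beta> d where c: "0 \<le> \<alpha>" "0 \<le> \<beta>" "0 \<le> d" "\<alpha> + \<beta> + d = 1"
      "g \<tau>' = \<alpha> *\<^sub>R g (t2 + \<kappa> * \<epsilon>) + \<beta> *\<^sub>R g t2 + d *\<^sub>R w"
      using q unfolding convex_hull_3 \<tau>'(3) by blast
    have "shadow g \<tau>' = \<alpha> *\<^sub>R shadow g (t2 + \<kappa> * \<epsilon>) + \<beta> *\<^sub>R shadow g t2 + d *\<^sub>R fst w"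
      unfolding shadow_def c(5) by simp
    also have "\<dots> = (\<alpha> + \<beta> + d) *\<^sub>R p + ((d * (1 + \<epsilon>)) *\<^sub>R u + (\<alpha> * (\<kappa> * \<epsilon>) + d * \<mu>) *\<^sub>R b)"
    proof -
      have "\<bar>\<kappa> * \<epsilon>\<bar> \<le> \<delta>" using \<kappa> \<epsilon> by auto
      then have G: "shadow g (t2 + \<kappa> * \<epsilon>) = p + (\<kappa> * \<epsilon>) *\<^sub>R b" by (rule g2)
      have G2: "shadow g t2 = p" by (simp add: p_def s12)
      show ?thesis unfolding G G2 w_def by (simp add: algebra_simps)
    qed
    finally have sq: "shadow g \<tau>' - p = (d * (1 + \<epsilon>)) *\<^sub>R u + (\<alpha> * (\<kappa> * \<epsilon>) + d * \<mu>) *\<^sub>R b" unfolding c(4) by simp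
    have X: "x \<tau>' = d * (1 + \<epsilon>)" and Y: "y \<tau>' = \<alpha> * (\<kappa> * \<epsilon>) + d * \<mu>" unfolding x_def y_def sq by (simp_all add: lin)
    have d1: "d \<le> 1" using c by simp
    have Yb: "\<bar>y \<tau>'\<bar> \<le> \<epsilon>"
    proof -
      have "0 \<le> \<alpha> * \<epsilon>" "0 \<le> d * \<mu>" "d * \<mu> \<le> d * \<epsilon>" "\<alpha> * \<epsilon> + d * \<epsilon> \<le> \<epsilon>"
        using c(1-4) \<mu> \<epsilon>(1) by (auto simp: mult_left_mono mult_left_le_one_le simp flip: distrib_right)
      then show ?thesis unfolding Y using \<kappa> by auto
    qed
    have ht: "\<rho> * snd (g \<tau>') \<ge> (1 - d) * zs + d * (M + 1)"
    proof -
      have "\<rho> * snd (g \<tau>') = \<alpha> * (\<rho> * snd (g (t2 + \<kappa> * \<epsilon>))) + \<beta> * (\<rho> * snd (g t2)) + d * (\<rho> * \<rho> * (M + 1))"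
        unfolding c(5) w_def by (simp add: algebra_simps)
      moreover have "\<rho> * \<rho> = 1" using \<rho> by auto
      moreover have "\<alpha> * zs \<le> \<alpha> * (\<rho> * snd (g (t2 + \<kappa> * \<epsilon>)))" using e6 \<kappa> c(1) by (intro mult_left_mono) auto
      moreover have "\<beta> * zs \<le> \<beta> * (\<rho> * snd (g t2))" using zs c(2) by (intro mult_left_mono) auto
      moreover have "1 - d = \<alpha> + \<beta>" using c(4) by simp
      ultimately show ?thesis by (simp add: distrib_right)
    qed
    have \<tau>01: "\<tau>' \<in> {0..1}" using \<tau>'(1) by simp
    have "\<tau>' \<notin> far"
    proof
      assume "\<tau>' \<in> far"
      then have "D0 \<le> D \<tau>'" by (rule D0(2))
      moreover have "D \<tau>' \<le> \<epsilon>"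
      proof -
        have "0 \<le> d * (1 + \<epsilon>)" "d * (1 + \<epsilon>) \<le> 1 + \<epsilon>" using c(3) d1 \<epsilon> by (auto simp: mult_left_le_one_le)
        then show ?thesis unfolding D_def X using Yb \<epsilon> by (intro max.boundedI; linarith)
      qed
      ultimately show False using \<epsilon> by simp
    qed
    \<comment> \<open>After the reflection, the segment is below the level \<open>zs\<close> at
      \<open>t1\<close> and at most at height \<open>M\<close> at \<open>e\<close>. Over it the
      triangle is bounded below by an affine function of \<open>r\<close> with value
      \<open>zs\<close> at \<open>t1\<close> and above \<open>M\<close> at \<open>e\<close>. So the
      triangle is higher all along.\<close>
    moreover have "\<not> (\<exists>r. 0 \<le> r \<and> r \<le> 1 \<and> \<tau>' = t1 - r * (t1 - e))"
    proof
      assume "\<exists>r. 0 \<le> r \<and> r \<le> 1 \<and> \<tau>' = t1 - r * (t1 - e)"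
      then obtain r where r: "0 \<le> r" "r \<le> 1" "\<tau>' = t1 - r * (t1 - e)" by blast
      have rd: "r = d * (1 + \<epsilon>)" using xseg[OF r(1,2)] X r(3) by simp
      have d: "d = r * (1 / (1 + \<epsilon>))" unfolding rd using \<epsilon> by simp
      obtain v3 where v3: "\<And>x. 0 \<le> x \<Longrightarrow> x \<le> t1 - e \<Longrightarrow> snd (g (t1 - x)) = snd (g t1) - x *\<^sub>R v3"
        by (rule affine_on_left[OF affine_on_snd[OF aff]]) (use e in auto)
      have "snd (g e) = snd (g t1) - (t1 - e) * v3" using v3[of "t1 - e"] e by simp
      then have E: "(t1 - e) * v3 = snd (g t1) - snd (g e)" by linarith
      have "r * (t1 - e) \<le> t1 - e" "0 \<le> r * (t1 - e)" using r(1,2) e by (simp_all add: mult_left_le_one_le)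
      then have "snd (g (t1 - r * (t1 - e))) = snd (g t1) - (r * (t1 - e)) *\<^sub>R v3" by (intro v3)
      then have E2: "snd (g \<tau>') = snd (g t1) - r * ((t1 - e) * v3)" unfolding r(3) real_scaleR_def mult.assoc .
      have "\<rho> * snd (g \<tau>') = (1 - r) * (\<rho> * snd (g t1)) + r * (\<rho> * snd (g e))"
        unfolding E2 E by (simp add: algebra_simps)
      moreover have "(1 - d) * zs + d * (M + 1) = (1 - r) * zs + r * ((1 - 1 / (1 + \<epsilon>)) * zs + 1 / (1 + \<epsilon>) * (M + 1))"
        unfolding d by (simp add: algebra_simps)
      moreover have "(1 - 1 / (1 + \<epsilon>)) * zs + 1 / (1 + \<epsilon>) * (M + 1) > \<rho> * snd (g e)"
      proof -
        have "1 / (1 + \<epsilon>) \<le> 1" using \<epsilon> by simp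
        from high[OF e5 this] show ?thesis using \<rho>M[of e] e t1 by simp
      qed
      ultimately have "(1 - r) * (zs - \<rho> * snd (g t1)) + r * ((1 - 1 / (1 + \<epsilon>)) * zs + 1 / (1 + \<epsilon>) * (M + 1) - \<rho> * snd (g e)) \<le> 0"
        using ht by (simp only: right_diff_distrib; linarith)
      moreover have "(1 - r) * A + r * B > 0" if "A > 0" "B > 0" for A B :: real
        using r(1,2) that by (cases "r = 0") (auto intro!: add_nonneg_pos mult_nonneg_nonneg)
      ultimately show False
        using zs(1) \<open>(1 - 1 / (1 + \<epsilon>)) * zs + 1 / (1 + \<epsilon>) * (M + 1) > \<rho> * snd (g e)\<close> by (metis diff_gt_0_iff_gt not_less)
    qed
    moreover have "\<not> (\<exists>r. 0 < r \<and> r \<le> \<delta> \<and> \<tau>' = t1 + r)"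
    proof
      assume "\<exists>r. 0 < r \<and> r \<le> \<delta> \<and> \<tau>' = t1 + r"
      then have "x \<tau>' < 0" using x1 by blast
      then show False unfolding X using c(3) \<epsilon> by (simp add: mult_less_0_iff)
    qed
    \<comment> \<open>Over the branches the tip has weight above \<open>\<theta>\<close>, so the
      triangle is higher than the whole knot.\<close>
    moreover have "\<not> (\<exists>\<omega>\<in>\<Omega>. \<exists>r. 0 \<le> r \<and> r < \<delta> \<and> \<tau>' = fst \<omega> + snd \<omega> * r)"
    proof
      assume "\<exists>\<omega>\<in>\<Omega>. \<exists>r. 0 \<le> r \<and> r < \<delta> \<and> \<tau>' = fst \<omega> + snd \<omega> * r"
      then obtain \<omega> r where \<omega>: "\<omega> \<in> \<Omega>" "0 \<le> r" "r < \<delta>" "\<tau>' = fst \<omega> + snd \<omega> * r" by blast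
      have xy': "x \<tau>' = 1 + r * X (F \<omega>)" "y \<tau>' = r * Y (F \<omega>)" using xyF[OF \<omega>(1), of r] \<omega> by auto
      have "(1 + r * X (F \<omega>)) / (1 + \<epsilon>) > \<theta>" by (rule near[OF \<omega>(1,2)]) (use Yb xy' in simp)
      moreover have "d = (1 + r * X (F \<omega>)) / (1 + \<epsilon>)" using X \<epsilon> unfolding xy' by simp
      ultimately have "d > \<theta>" by simp
      from high[OF this d1] show False using ht \<rho>M[OF \<tau>01] by linarith
    qed
    ultimately have "\<exists>r. \<bar>r\<bar> \<le> \<delta> \<and> \<tau>' = t2 + r" using kinds[OF \<tau>'(1)] by blast
    then obtain r where r: "\<bar>r\<bar> \<le> \<delta>" "\<tau>' = t2 + r" by blast
    have "d * (1 + \<epsilon>) = 0" using xy2[OF r(1)] X r(2) by simp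
    then have d0: "d = 0" using \<epsilon> by simp
    have "r = \<alpha> * (\<kappa> * \<epsilon>)" using xy2[OF r(1)] Y r(2) d0 by simp
    moreover have "\<bar>r\<bar> \<ge> \<epsilon>" using \<tau>'(2) r(2) by (auto simp: s_def t_def)
    ultimately have "\<alpha> * \<epsilon> \<ge> 1 * \<epsilon>" using \<kappa> c(1) \<epsilon>(1) by (auto simp: abs_mult)
    then have "\<alpha> \<ge> 1" using \<epsilon>(1) by simp
    then have "\<alpha> = 1" "\<beta> = 0" using c d0 by auto
    then show ?thesis using c(5) d0 \<tau>'(3) by simp
  qed
  define K0 where "K0 = g ` {0..s} \<union> g ` {t..1}"
  have poly: "polyhedral K0" unfolding K0_def
    using st by (intro polyhedral_Un polyhedral_piecewise_linear_image[OF pl]) auto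
  have hull_l: "K0 \<inter> convex hull {g s, g t2, w} \<subseteq> {g s}"
    using hull[of _ "-1"] unfolding K0_def by (auto simp: s_def)
  have hull_r: "K0 \<inter> convex hull {g t2, g t, w} \<subseteq> {g t}"
    using hull[of _ 1] unfolding K0_def insert_commute[of "g t2" "g t"] by (auto simp: t_def)
  have nc3: "\<not> collinear {a, b', c}" if "X (a - b') * Y (c - b') - Y (a - b') * X (c - b') \<noteq> 0" for a b' c
  proof
    assume "collinear {a, b', c}"
    then have "collinear {0, a - b', c - b'}" by (subst (asm) collinear_3) (simp_all add: NO_MATCH_def)
    then consider "a - b' = 0" | "c - b' = 0" | k where "c - b' = k *\<^sub>R (a - b')" unfolding collinear_lemma by blast
    then have "X (a - b') * Y (c - b') - Y (a - b') * X (c - b') = 0"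
    proof cases
      case 1 then show ?thesis by (simp only: linear_0[OF XY(1)] linear_0[OF XY(2)]; simp)
    next
      case 2 then show ?thesis by (simp only: linear_0[OF XY(1)] linear_0[OF XY(2)]; simp)
    next
      case 3 show ?thesis unfolding 3 by (simp only: linear_cmul[OF XY(1)] linear_cmul[OF XY(2)]; simp)
    qed
    then show False using that by simp
  qed
  have s2: "shadow g t2 = p" by (simp add: p_def s12)
  have fw: "fst w = p + ((1 + \<epsilon>) *\<^sub>R u + \<mu> *\<^sub>R b)" by (simp add: w_def)
  have nc: "\<not> collinear {shadow g s, fst w, shadow g t}"
  proof (rule nc3)
    have d: "shadow g s - fst w = (- (1 + \<epsilon>)) *\<^sub>R u + (- (\<epsilon> + \<mu>)) *\<^sub>R b" "shadow g t - fst w = (- (1 + \<epsilon>)) *\<^sub>R u + (\<epsilon> - \<mu>) *\<^sub>R b"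
      unfolding shs sht fw by (simp_all add: algebra_simps)
    have "X (shadow g s - fst w) * Y (shadow g t - fst w) - Y (shadow g s - fst w) * X (shadow g t - fst w) = - (2 * \<epsilon> * (1 + \<epsilon>))"
      unfolding d by (simp only: lin) (simp add: algebra_simps)
    then show "X (shadow g s - fst w) * Y (shadow g t - fst w) - Y (shadow g s - fst w) * X (shadow g t - fst w) \<noteq> 0"
      using \<epsilon> by simp
  qed
  have ncl: "\<not> collinear {g s, g t2, w}"
  proof (rule collinear_fst, rule nc3)
    have d: "fst (g s) - fst (g t2) = (- \<epsilon>) *\<^sub>R b" "fst w - fst (g t2) = (1 + \<epsilon>) *\<^sub>R u + \<mu> *\<^sub>R b"
      using shs s2 fw unfolding shadow_def by simp_all
    show "X (fst (g s) - fst (g t2)) * Y (fst w - fst (g t2)) - Y (fst (g s) - fst (g t2)) * X (fst w - fst (g t2)) \<noteq> 0"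
      unfolding d by (simp only: lin) (use \<epsilon> in simp)
  qed
  have ncr: "\<not> collinear {g t2, g t, w}"
  proof (rule collinear_fst, rule nc3)
    have d: "fst (g t2) - fst (g t) = (- \<epsilon>) *\<^sub>R b" "fst w - fst (g t) = (1 + \<epsilon>) *\<^sub>R u + (\<mu> - \<epsilon>) *\<^sub>R b"
      using sht s2 fw unfolding shadow_def by (simp_all add: algebra_simps)
    show "X (fst (g t2) - fst (g t)) * Y (fst w - fst (g t)) - Y (fst (g t2) - fst (g t)) * X (fst w - fst (g t)) \<noteq> 0"
      unfolding d by (simp only: lin) (use \<epsilon> in simp)
  qed
  have co: "fst (\<alpha> *\<^sub>R a + \<beta> *\<^sub>R c + \<gamma> *\<^sub>R d) - p = \<alpha> *\<^sub>R (fst a - p) + \<beta> *\<^sub>R (fst c - p) + \<gamma> *\<^sub>R (fst d - p)"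
    if "\<alpha> + \<beta> + \<gamma> = 1" for \<alpha> \<beta> \<gamma> and a c d :: space3
  proof -
    have "p = (\<alpha> + \<beta> + \<gamma>) *\<^sub>R p" using that by simp
    then show ?thesis by (simp only: fst_add fst_scaleR scaleR_right_diff_distrib) (simp add: algebra_simps)
  qed
  have dl: "fst (g s) - p = (- \<epsilon>) *\<^sub>R b" and dk: "fst (g t2) - p = 0" and dr: "fst (g t) - p = \<epsilon> *\<^sub>R b"
    and dw: "fst w - p = (1 + \<epsilon>) *\<^sub>R u + \<mu> *\<^sub>R b"
    using shs sht s2 fw unfolding shadow_def by simp_all
  have lkr: "closed_segment (g t2) (g t) \<inter> convex hull {g s, g t2, w} \<subseteq> {g t2}"
  proof
    fix q assume "q \<in> closed_segment (g t2) (g t) \<inter> convex hull {g s, g t2, w}"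
    then obtain a \<alpha> \<beta> d where a: "0 \<le> a" "q = (1 - a) *\<^sub>R g t2 + a *\<^sub>R g t"
      and c: "0 \<le> \<alpha>" "0 \<le> \<beta>" "0 \<le> d" "\<alpha> + \<beta> + d = 1" "q = \<alpha> *\<^sub>R g s + \<beta> *\<^sub>R g t2 + d *\<^sub>R w"
      unfolding closed_segment_def convex_hull_3 by blast
    have "fst q - p = (a * \<epsilon>) *\<^sub>R b" using co[of "1 - a" a 0 "g t2" "g t" w] unfolding a(2) dk dr by simp
    moreover have "fst q - p = (d * (1 + \<epsilon>)) *\<^sub>R u + (- (\<alpha> * \<epsilon>) + d * \<mu>) *\<^sub>R b"
      using co[OF c(4), of "g s" "g t2" w] unfolding c(5) dk dl dw by (simp add: algebra_simps)
    ultimately have eq: "(a * \<epsilon>) *\<^sub>R b = (d * (1 + \<epsilon>)) *\<^sub>R u + (- (\<alpha> * \<epsilon>) + d * \<mu>) *\<^sub>R b" by simp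
    have "0 = d * (1 + \<epsilon>)" using arg_cong[OF eq, of X] by (simp only: lin; simp)
    then have "d = 0" using \<epsilon> by simp
    moreover have "a * \<epsilon> = - (\<alpha> * \<epsilon>) + d * \<mu>" using arg_cong[OF eq, of Y] by (simp only: lin; simp)
    ultimately have "(a + \<alpha>) * \<epsilon> = 0" by (simp add: algebra_simps)
    then have "a = 0" using \<epsilon> a(1) c(1) by simp
    then show "q \<in> {g t2}" using a(2) by simp
  qed
  have krl: "closed_segment (g s) w \<inter> convex hull {g t2, g t, w} \<subseteq> {w}"
  proof
    fix q assume "q \<in> closed_segment (g s) w \<inter> convex hull {g t2, g t, w}"
    then obtain a \<alpha> \<beta> d where a: "0 \<le> a" "a \<le> 1" "q = (1 - a) *\<^sub>R g s + a *\<^sub>R w"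
      and c: "0 \<le> \<alpha>" "0 \<le> \<beta>" "0 \<le> d" "\<alpha> + \<beta> + d = 1" "q = \<alpha> *\<^sub>R g t2 + \<beta> *\<^sub>R g t + d *\<^sub>R w"
      unfolding closed_segment_def convex_hull_3 by blast
    have "fst q - p = (a * (1 + \<epsilon>)) *\<^sub>R u + (- ((1 - a) * \<epsilon>) + a * \<mu>) *\<^sub>R b"
      using co[of "1 - a" a 0 "g s" w w] unfolding a(3) dl dw by (simp add: algebra_simps)
    moreover have "fst q - p = (d * (1 + \<epsilon>)) *\<^sub>R u + (\<beta> * \<epsilon> + d * \<mu>) *\<^sub>R b"
      using co[OF c(4), of "g t2" "g t" w] unfolding c(5) dk dr dw by (simp add: algebra_simps)
    ultimately have eq: "(a * (1 + \<epsilon>)) *\<^sub>R u + (- ((1 - a) * \<epsilon>) + a * \<mu>) *\<^sub>R b = (d * (1 + \<epsilon>)) *\<^sub>R u + (\<beta> * \<epsilon> + d * \<mu>) *\<^sub>R b" by simp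
    have "a * (1 + \<epsilon>) = d * (1 + \<epsilon>)" using arg_cong[OF eq, of X] by (simp only: lin; simp)
    then have ad: "d = a" using \<epsilon> by simp
    have "- ((1 - a) * \<epsilon>) + a * \<mu> = \<beta> * \<epsilon> + d * \<mu>" using arg_cong[OF eq, of Y] by (simp only: lin; simp)
    then have "(\<beta> + (1 - a)) * \<epsilon> = 0" unfolding ad by (simp add: algebra_simps)
    then have "\<beta> + (1 - a) = 0" using \<epsilon> by simp
    then have "a = 1" using a(2) c(2) by linarith
    then show "q \<in> {w}" using a(3) by simp
  qed
  have iso: "isotopic3 (path_image g) (path_image h)"
  proof -
    have "{0..1} = {0..s} \<union> {t..1} \<union> ({s..t2} \<union> {t2..t})" using st \<epsilon> by (auto simp: s_def t_def)
    moreover have "g ` {s..t2} = closed_segment (g s) (g t2)"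
      using \<epsilon> by (intro affine_on_image affine_on_subset[OF affL[OF inC(3)]]) (auto simp: s_def)
    moreover have "g ` {t2..t} = closed_segment (g t2) (g t)"
      using \<epsilon> by (intro affine_on_image affine_on_subset[OF affR[OF inC(3)]]) (auto simp: t_def)
    ultimately have "path_image g = K0 \<union> (closed_segment (g s) (g t2) \<union> closed_segment (g t2) (g t))"
      unfolding path_image_def K0_def by (simp only: image_Un)
    moreover have "path_image h = K0 \<union> (closed_segment (g s) w \<union> closed_segment w (g t))"
      unfolding h_def K0_def by (rule bend_image) (use st in auto)
    ultimately show ?thesis using isotopic3_cone[OF poly ncl ncr hull_l hull_r lkr krl] by simp
  qed
  have derivL: "(shadow h has_vector_derivative (1 / \<epsilon>) *\<^sub>R ((1 + \<epsilon>) *\<^sub>R u + (\<epsilon> + \<mu>) *\<^sub>R b)) (at \<sigma>)" if \<sigma>: "\<sigma> \<in> {s<..<t2}" for \<sigma>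
  proof (rule has_vector_derivative_transform_within_open[of "\<lambda>\<tau>. shadow g s + ((\<tau> - s) / \<epsilon>) *\<^sub>R ((1 + \<epsilon>) *\<^sub>R u + (\<epsilon> + \<mu>) *\<^sub>R b)" _ _ "{s<..<t2}"])
    show "((\<lambda>\<tau>. shadow g s + ((\<tau> - s) / \<epsilon>) *\<^sub>R ((1 + \<epsilon>) *\<^sub>R u + (\<epsilon> + \<mu>) *\<^sub>R b)) has_vector_derivative
        (1 / \<epsilon>) *\<^sub>R ((1 + \<epsilon>) *\<^sub>R u + (\<epsilon> + \<mu>) *\<^sub>R b)) (at \<sigma>)"
      using \<epsilon>(1) by (auto intro!: derivative_eq_intros)
    fix \<tau> assume \<tau>: "\<tau> \<in> {s<..<t2}"
    define k where "k = (\<tau> - s) / \<epsilon>"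
    have k: "0 \<le> k" "k \<le> 1" "s + k * \<epsilon> = \<tau>" using \<tau> \<epsilon> by (auto simp: s_def k_def)
    show "shadow g s + ((\<tau> - s) / \<epsilon>) *\<^sub>R ((1 + \<epsilon>) *\<^sub>R u + (\<epsilon> + \<mu>) *\<^sub>R b) = shadow h \<tau>"
      using hl[OF k(1,2)] unfolding k_def[symmetric] shs k(3) by (simp add: algebra_simps)
  qed (use \<sigma> in auto)
  have derivR: "(shadow h has_vector_derivative (1 / \<epsilon>) *\<^sub>R ((- (1 + \<epsilon>)) *\<^sub>R u + (\<epsilon> - \<mu>) *\<^sub>R b)) (at \<sigma>)" if \<sigma>: "\<sigma> \<in> {t2<..<t}" for \<sigma>
  proof (rule has_vector_derivative_transform_within_open[of "\<lambda>\<tau>. shadow g t + ((\<tau> - t) / \<epsilon>) *\<^sub>R ((- (1 + \<epsilon>)) *\<^sub>R u + (\<epsilon> - \<mu>) *\<^sub>R b)" _ _ "{t2<..<t}"])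
    show "((\<lambda>\<tau>. shadow g t + ((\<tau> - t) / \<epsilon>) *\<^sub>R ((- (1 + \<epsilon>)) *\<^sub>R u + (\<epsilon> - \<mu>) *\<^sub>R b)) has_vector_derivative
        (1 / \<epsilon>) *\<^sub>R ((- (1 + \<epsilon>)) *\<^sub>R u + (\<epsilon> - \<mu>) *\<^sub>R b)) (at \<sigma>)"
      using \<epsilon>(1) by (auto intro!: derivative_eq_intros)
    fix \<tau> assume \<tau>: "\<tau> \<in> {t2<..<t}"
    define k where "k = (t - \<tau>) / \<epsilon>"
    have k: "0 \<le> k" "k \<le> 1" "t - k * \<epsilon> = \<tau>" using \<tau> \<epsilon> by (auto simp: t_def k_def)
    have m: "(\<tau> - t) / \<epsilon> = - k" by (simp add: k_def minus_divide_left)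
    show "shadow g t + ((\<tau> - t) / \<epsilon>) *\<^sub>R ((- (1 + \<epsilon>)) *\<^sub>R u + (\<epsilon> - \<mu>) *\<^sub>R b) = shadow h \<tau>"
      using hr[OF k(1,2)] unfolding sht m k(3) by (simp add: algebra_simps)
  qed (use \<sigma> in auto)
  have derivT: "(shadow g has_vector_derivative snd \<omega> *\<^sub>R F \<omega>) (at (T \<omega>))" if \<omega>: "\<omega> \<in> \<Omega>" for \<omega>
  proof (rule has_vector_derivative_transform_within_open[of "\<lambda>\<tau>. p + u + (snd \<omega> * (\<tau> - fst \<omega>)) *\<^sub>R F \<omega>" _ _ "{\<tau>. 0 < snd \<omega> * (\<tau> - fst \<omega>)} \<inter> {\<tau>. snd \<omega> * (\<tau> - fst \<omega>) < \<delta>}"])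
    have sg: "snd \<omega> * snd \<omega> = 1" using \<Omega>D[of "fst \<omega>" "snd \<omega>"] \<omega> by auto
    show "((\<lambda>\<tau>. p + u + (snd \<omega> * (\<tau> - fst \<omega>)) *\<^sub>R F \<omega>) has_vector_derivative snd \<omega> *\<^sub>R F \<omega>) (at (T \<omega>))"
      by (auto intro!: derivative_eq_intros)
    show "open ({\<tau>. 0 < snd \<omega> * (\<tau> - fst \<omega>)} \<inter> {\<tau>. snd \<omega> * (\<tau> - fst \<omega>) < \<delta>})"
      by (intro open_Int open_Collect_less continuous_intros)
    have "snd \<omega> * (T \<omega> - fst \<omega>) = x0 \<omega>" unfolding T_def using sg by (simp flip: mult.assoc)
    then show "T \<omega> \<in> {\<tau>. 0 < snd \<omega> * (\<tau> - fst \<omega>)} \<inter> {\<tau>. snd \<omega> * (\<tau> - fst \<omega>) < \<delta>}" using x0(1,2)[OF \<omega>] by simp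
    fix \<tau> assume \<tau>: "\<tau> \<in> {\<tau>. 0 < snd \<omega> * (\<tau> - fst \<omega>)} \<inter> {\<tau>. snd \<omega> * (\<tau> - fst \<omega>) < \<delta>}"
    have "fst \<omega> + snd \<omega> * (snd \<omega> * (\<tau> - fst \<omega>)) = \<tau>" using sg by (simp flip: mult.assoc)
    then show "p + u + (snd \<omega> * (\<tau> - fst \<omega>)) *\<^sub>R F \<omega> = shadow g \<tau>"
      using F[OF \<omega>, of "snd \<omega> * (\<tau> - fst \<omega>)"] \<tau> by simp
  qed
  \<comment> \<open>Up to nonzero factors, the determinant of the two directions is the one provided
    with the choice of the side.\<close>
  have tr: "\<exists>v x. (shadow h has_vector_derivative v) (at (S \<omega>)) \<and> (shadow g has_vector_derivative x) (at (T \<omega>)) \<and> \<not> collinear {0, v, x}"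
    if \<omega>: "\<omega> \<in> \<Omega>" for \<omega>
  proof -
    have "snd \<omega> = 1 \<or> snd \<omega> = -1" using \<Omega>D[of "fst \<omega>" "snd \<omega>"] \<omega> by simp
    then have sg: "snd \<omega> \<noteq> 0" by (elim disjE) simp_all
    have ncs: "\<not> collinear {0, (1 / \<epsilon>) *\<^sub>R a, snd \<omega> *\<^sub>R F \<omega>}" if "X a * Y (F \<omega>) - Y a * X (F \<omega>) \<noteq> 0" for a
    proof -
      have "\<not> collinear {(1 / \<epsilon>) *\<^sub>R a, 0, snd \<omega> *\<^sub>R F \<omega>}"
      proof (rule nc3)
        have "X ((1 / \<epsilon>) *\<^sub>R a - 0) * Y (snd \<omega> *\<^sub>R F \<omega> - 0) - Y ((1 / \<epsilon>) *\<^sub>R a - 0) * X (snd \<omega> *\<^sub>R F \<omega> - 0) =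
            (snd \<omega> / \<epsilon>) * (X a * Y (F \<omega>) - Y a * X (F \<omega>))"
        proof -
          have l: "X ((1 / \<epsilon>) *\<^sub>R a) = (1 / \<epsilon>) * X a" "Y ((1 / \<epsilon>) *\<^sub>R a) = (1 / \<epsilon>) * Y a"
            "X (snd \<omega> *\<^sub>R F \<omega>) = snd \<omega> * X (F \<omega>)" "Y (snd \<omega> *\<^sub>R F \<omega>) = snd \<omega> * Y (F \<omega>)"
            by (simp_all only: linear_cmul[OF XY(1)] linear_cmul[OF XY(2)] real_scaleR_def)
          have "(i * A) * (k * B) - (i * A') * (k * B') = (k * i) * (A * B - A' * B')" for i k A A' B B' :: real
            by (simp add: algebra_simps)
          from this[of "1 / \<epsilon>" "X a" "snd \<omega>" "Y (F \<omega>)" "Y a" "X (F \<omega>)"]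
          show ?thesis unfolding diff_zero l by (simp only: times_divide_eq_right mult_1_right)
        qed
        then show "X ((1 / \<epsilon>) *\<^sub>R a - 0) * Y (snd \<omega> *\<^sub>R F \<omega> - 0) - Y ((1 / \<epsilon>) *\<^sub>R a - 0) * X (snd \<omega> *\<^sub>R F \<omega> - 0) \<noteq> 0"
          using that sg \<epsilon> by simp
      qed
      then show ?thesis by (simp add: insert_commute)
    qed
    show ?thesis
    proof (cases "up \<omega>")
      case True
      have "X ((- (1 + \<epsilon>)) *\<^sub>R u + (\<epsilon> - \<mu>) *\<^sub>R b) * Y (F \<omega>) - Y ((- (1 + \<epsilon>)) *\<^sub>R u + (\<epsilon> - \<mu>) *\<^sub>R b) * X (F \<omega>) \<noteq> 0"
        using det(1)[OF \<omega> True] unfolding \<mu>_def[symmetric]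
        by (simp only: lin) (simp add: algebra_simps)
      then show ?thesis using derivR[OF S_in(2)[OF \<omega> True]] derivT[OF \<omega>] ncs by blast
    next
      case False
      have "X ((1 + \<epsilon>) *\<^sub>R u + (\<epsilon> + \<mu>) *\<^sub>R b) * Y (F \<omega>) - Y ((1 + \<epsilon>) *\<^sub>R u + (\<epsilon> + \<mu>) *\<^sub>R b) * X (F \<omega>) \<noteq> 0"
        using det(2)[OF \<omega> False] unfolding \<mu>_def[symmetric] by (simp only: lin) (simp add: algebra_simps)
      then show ?thesis using derivL[OF S_in(3)[OF \<omega> False]] derivT[OF \<omega>] ncs by blast
    qed
  qed
  have Nsub: "N \<subseteq> {s<..<t} \<times> ({0<..<1} - {s..t})"
  proof
    fix z assume "z \<in> N"
    then obtain \<omega> where \<omega>: "\<omega> \<in> \<Omega>" "z = (S \<omega>, T \<omega>)" unfolding N_def by blast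
    have "T \<omega> \<notin> {s..t}" using T_in(3)[OF \<omega>(1)] unfolding s_def t_def by auto
    then show "z \<in> {s<..<t} \<times> ({0<..<1} - {s..t})" unfolding \<omega>(2) using S_in(1)[OF \<omega>(1)] T_in(1)[OF \<omega>(1)] by blast
  qed
  have Nx: "\<tau> \<notin> crossing_times g" "\<tau> \<in> {0..<1}" "shadow h \<sigma> = shadow g \<tau>" "\<sigma> \<in> {s<..<t}" "\<tau> \<notin> {s..t}" if n: "(\<sigma>, \<tau>) \<in> N" for \<sigma> \<tau>
  proof -
    obtain \<omega> where \<omega>: "\<omega> \<in> \<Omega>" "\<sigma> = S \<omega>" "\<tau> = T \<omega>" using n unfolding N_def by blast
    show "\<tau> \<notin> crossing_times g" "shadow h \<sigma> = shadow g \<tau>" unfolding \<omega>(2,3) by (rule T_in(2)[OF \<omega>(1)], rule ST[OF \<omega>(1)])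
    show "\<tau> \<in> {0..<1}" using T_in(1)[OF \<omega>(1)] unfolding \<omega>(3) by simp
    show "\<sigma> \<in> {s<..<t}" "\<tau> \<notin> {s..t}" using Nsub n by blast+
  qed
  \<comment> \<open>A time \<open>T \<omega>\<close> is no crossing time of \<open>g\<close>, so two
    different ones never share a projection.\<close>
  have sv1: "single_valued N"
  proof (rule single_valuedI, rule ccontr)
    fix \<sigma> \<tau> \<tau>' assume n: "(\<sigma>, \<tau>) \<in> N" "(\<sigma>, \<tau>') \<in> N" "\<tau> \<noteq> \<tau>'"
    then have "(\<tau>, \<tau>') \<in> coinc g" using Nx[OF n(1)] Nx[OF n(2)] by (intro coincI) auto
    then show False using Nx(1)[OF n(1)] unfolding crossing_times_eq by blast
  qed
  have sv2: "single_valued (N\<inverse>)"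
  proof (rule single_valuedI)
    fix \<tau> \<sigma> \<sigma>' assume "(\<tau>, \<sigma>) \<in> N\<inverse>" "(\<tau>, \<sigma>') \<in> N\<inverse>"
    then have n: "(\<sigma>, \<tau>) \<in> N" "(\<sigma>', \<tau>) \<in> N" by auto
    have "shadow h \<sigma> = shadow h \<sigma>'" using Nx(3)[OF n(1)] Nx(3)[OF n(2)] by simp
    then show "\<sigma> = \<sigma>'" unfolding h_def shadow_bend using Nx(4)[OF n(1)] Nx(4)[OF n(2)]
      by (intro bend_inj[OF st(2) nc]) auto
  qed
  \<comment> \<open>The new edges are sides of the two triangles, which the unchanged part of the
    knot meets only in \<open>g s\<close> and \<open>g t\<close>.\<close>
  have ne: "h \<sigma> \<noteq> g \<tau>" if n: "(\<sigma>, \<tau>) \<in> N" for \<sigma> \<tau>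
  proof
    assume eq: "h \<sigma> = g \<tau>"
    have "\<tau> \<in> {0..s} \<union> {t..1}" using Nx(2,5)[OF n] by auto
    then have \<tau>: "g \<tau> \<in> K0" unfolding K0_def by blast
    have nst: "g \<tau> \<noteq> g r" if "r \<in> {s, t}" for r
    proof
      assume "g \<tau> = g r"
      moreover have "r \<in> {0..<1}" "\<tau> \<noteq> r" using \<open>r \<in> {s, t}\<close> st Nx(5)[OF n] by auto
      ultimately have "(\<tau>, r) \<in> coinc g" using Nx(2)[OF n] by (intro coincI) (simp_all add: shadow_def)
      then show False using Nx(1)[OF n] unfolding crossing_times_eq by blast
    qed
    have "\<sigma> \<in> {s..t2} \<or> \<sigma> \<in> {t2..t}" using Nx(4)[OF n] by auto
    then consider "\<sigma> \<in> {s..t2}" | "\<sigma> \<in> {t2..t}" by blast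
    then show False
    proof cases
      case 1
      have BL: "h ` {s..t2} = closed_segment (g s) w" using bend_image_left[OF st(2), of g w] unfolding mid h_def .
      have "g \<tau> \<in> closed_segment (g s) w" using imageI[OF 1, of h] unfolding BL eq .
      moreover have "closed_segment (g s) w \<subseteq> convex hull {g s, g t2, w}"
        unfolding segment_convex_hull by (rule hull_mono) blast
      ultimately have "g \<tau> = g s" using hull_l \<tau> by blast
      then show False using nst[of s] by simp
    next
      case 2
      have BR: "h ` {t2..t} = closed_segment w (g t)" using bend_image_right[OF st(2), of g w] unfolding mid h_def .
      have "g \<tau> \<in> closed_segment w (g t)" using imageI[OF 2, of h] unfolding BR eq .
      moreover have "closed_segment w (g t) \<subseteq> convex hull {g t2, g t, w}"
        unfolding segment_convex_hull by (rule hull_mono) blast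
      ultimately have "g \<tau> = g t" using hull_r \<tau> by blast
      then show False using nst[of t] by simp
    qed
  qed
  have bd: "coinc (bend g s t w) = coinc g \<inter> (- {s<..<t}) \<times> (- {s<..<t}) \<union> N \<union> N\<inverse>" "knot_diagram (bend g s t w)"
  proof -
    have f1: "shadow (bend g s t w) \<sigma> = shadow g \<tau> \<longleftrightarrow> (\<sigma>, \<tau>) \<in> N"
      if "\<sigma> \<in> {s<..<t}" "\<tau> \<in> {0..<1} - {s<..<t}" for \<sigma> \<tau> using N[OF that] unfolding h_def .
    have f2: "finite N" unfolding N_def using \<Omega>(1) by simp
    have f3: "r \<in> {s<..<t}" if "(\<sigma>, \<tau>) \<in> N" "(\<tau>, r) \<in> coinc g" for \<sigma> \<tau> r
      using Nx(1)[OF that(1)] that(2) unfolding crossing_times_eq by blast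
    have f4: "bend g s t w \<sigma> \<noteq> g \<tau>" if "(\<sigma>, \<tau>) \<in> N" for \<sigma> \<tau> using ne[OF that] unfolding h_def .
    have f5: "\<exists>v x. (bend (shadow g) s t (fst w) has_vector_derivative v) (at \<sigma>) \<and>
        (shadow g has_vector_derivative x) (at \<tau>) \<and> \<not> collinear {0, v, x}" if "(\<sigma>, \<tau>) \<in> N" for \<sigma> \<tau>
    proof -
      obtain \<omega> where "\<omega> \<in> \<Omega>" "\<sigma> = S \<omega>" "\<tau> = T \<omega>" using \<open>(\<sigma>, \<tau>) \<in> N\<close> unfolding N_def by blast
      then show ?thesis using tr[of \<omega>] unfolding h_def shadow_bend_fun by simp
    qed
    show "coinc (bend g s t w) = coinc g \<inter> (- {s<..<t}) \<times> (- {s<..<t}) \<union> N \<union> N\<inverse>"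
      by (rule bend_diagram(1)[OF kd st snc nc f1 Nsub f2 sv1 sv2 f3 f4 f5])
    show "knot_diagram (bend g s t w)"
      by (rule bend_diagram(2)[OF kd st snc nc f1 Nsub f2 sv1 sv2 f3 f4 f5])
  qed
  \<comment> \<open>Within the bent piece \<open>t2\<close> is the only crossing time, so only the
    crossing of \<open>t1\<close> and \<open>t2\<close> is lost.\<close>
  have old: "coinc g \<inter> (- {s<..<t}) \<times> (- {s<..<t}) = coinc g - {(t1, t2), (t2, t1)}"
  proof -
    have only: "a = t2" if "(a, c) \<in> coinc g" "a \<in> {s<..<t}" for a c
      using noC[OF inC(3), of a] that \<epsilon> unfolding crossing_times_eq by (force simp: s_def t_def)
    have 1: "(a, c) = (t2, t1) \<or> (a, c) = (t1, t2)" if "(a, c) \<in> coinc g" "a \<in> {s<..<t} \<or> c \<in> {s<..<t}" for a c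
    proof -
      have c': "(c, a) \<in> coinc g" using that(1) coinc_sym by blast
      from that(2) show ?thesis
      proof
        assume "a \<in> {s<..<t}"
        then have "a = t2" by (rule only[OF that(1)])
        then show ?thesis using sv[OF _ cr', of c] that(1) by simp
      next
        assume "c \<in> {s<..<t}"
        then have "c = t2" by (rule only[OF c'])
        then show ?thesis using sv[OF _ cr', of a] c' by simp
      qed
    qed
    have "t2 \<in> {s<..<t}" using \<epsilon> by (simp add: s_def t_def)
    show ?thesis
    proof (rule set_eqI)
      fix z :: "real \<times> real"
      obtain a c where z: "z = (a, c)" by (cases z)
      show "z \<in> coinc g \<inter> (- {s<..<t}) \<times> (- {s<..<t}) \<longleftrightarrow> z \<in> coinc g - {(t1, t2), (t2, t1)}"
        unfolding z using 1[of a c] \<open>t2 \<in> {s<..<t}\<close> by auto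
    qed
  qed
  show ?thesis
  proof (intro exI conjI allI impI ballI)
    show "knot_diagram h" unfolding h_def by (rule bd(2))
    show "isotopic3 (path_image g) (path_image h)" by (rule iso)
    show "h \<tau> = g \<tau>" if "\<eta> \<le> \<bar>\<tau> - t2\<bar>" for \<tau>
      unfolding h_def by (rule bend_outside[OF st(2)]) (use that \<delta> \<epsilon> in \<open>auto simp: s_def t_def\<close>)
    show "coinc h = coinc g - {(t1, t2), (t2, t1)} \<union> (\<lambda>\<omega>. (S \<omega>, T \<omega>)) ` \<Omega> \<union> (\<lambda>\<omega>. (T \<omega>, S \<omega>)) ` \<Omega>"
    proof -
      have "N\<inverse> = (\<lambda>\<omega>. (T \<omega>, S \<omega>)) ` \<Omega>" unfolding N_def by force
      then show ?thesis using bd(1) unfolding old h_def N_def by simp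
    qed
    fix \<omega> assume \<omega>: "\<omega> \<in> \<Omega>"
    show "\<bar>S \<omega> - t2\<bar> < \<eta>" using S_in(1)[OF \<omega>] \<epsilon> \<delta> by (auto simp: s_def t_def)
    show "0 < x0 \<omega>" "x0 \<omega> < \<eta>" using x0(1,2)[OF \<omega>] \<delta> by auto
    show "T \<omega> = fst \<omega> + snd \<omega> * x0 \<omega>" by (simp add: T_def)
  qed
qed

section \<open>Untangling an arc\<close>

declare split_paired_All [simp del] split_paired_Ex [simp del]

text \<open>Kinks are taken in space and not only in the projection, because the comparison of
  heights in the finger move uses a segment that is straight in space.\<close>

definition kinks :: "(real \<Rightarrow> space3) \<Rightarrow> real set" where
  "kinks g = {u \<in> {0<..<1}. \<not> (\<exists>v. \<forall>\<^sub>F s in at u. g s = g u + (s - u) *\<^sub>R v)}"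

lemma finite_kinks: "piecewise_linear_path g \<Longrightarrow> finite (kinks g)"
  unfolding piecewise_linear_path_def kinks_def by (elim conjE exE) (erule rev_finite_subset, blast)

lemma affine_on_no_kinks:
  assumes "piecewise_linear_path g" "0 \<le> s" "s < t" "t \<le> 1" "{s<..<t} \<inter> kinks g = {}"
  shows "affine_on g {s..t}"
proof (rule affine_on_of_locally_affine)
  have "continuous_on {0..1} g" using assms(1) unfolding piecewise_linear_path_def path_def by blast
  then show "continuous_on {s..t} g" by (rule continuous_on_subset) (use assms in auto)
  show "s < t" by fact
  fix u assume "u \<in> {s<..<t}"
  then have "u \<in> {0<..<1}" "u \<notin> kinks g" using assms by auto
  then show "\<exists>v. \<forall>\<^sub>F x in at u. g x = g u + (x - u) *\<^sub>R v" unfolding kinks_def by blast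
qed

lemma kinks_cong:
  assumes "open U" "\<And>x. x \<in> U \<Longrightarrow> g x = h x" "u \<in> U"
  shows "u \<in> kinks g \<longleftrightarrow> u \<in> kinks h"
proof -
  have U: "\<forall>\<^sub>F x in at u. x \<in> U" using assms(1,3) eventually_at_topological by blast
  have "(\<forall>\<^sub>F s in at u. g s = g u + (s - u) *\<^sub>R v) \<longleftrightarrow> (\<forall>\<^sub>F s in at u. h s = h u + (s - u) *\<^sub>R v)" for v
    by (rule eventually_cong[OF U]) (simp add: assms(2,3))
  then show ?thesis unfolding kinks_def mem_Collect_eq by (simp only:)
qed

text \<open>The times \<open>{p<..<q}\<close> form one of the two arcs; the complementary arc is simple in the projection.
  Each crossing between the arcs is counted once by \<open>mixed\<close>, each self-crossing twice by \<open>internal\<close>.\<close>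

definition mixed :: "(real \<times> real) set \<Rightarrow> real set \<Rightarrow> (real \<times> real) set" where
  "mixed C I = {(a, b). (a, b) \<in> C \<and> a \<in> I \<and> b \<notin> I}"

definition internal :: "(real \<times> real) set \<Rightarrow> real set \<Rightarrow> (real \<times> real) set" where
  "internal C I = {(a, b). (a, b) \<in> C \<and> a \<in> I \<and> b \<in> I}"

definition split_diagram :: "(real \<Rightarrow> space3) \<Rightarrow> real \<Rightarrow> real \<Rightarrow> bool" where
  "split_diagram g p q \<longleftrightarrow> knot_diagram g \<and> 0 \<le> p \<and> p < q \<and> q \<le> 1 \<and>
     p \<notin> crossing_times g \<and> q \<notin> crossing_times g \<and>
     (\<forall>a b. (a, b) \<in> coinc g \<longrightarrow> a \<in> {p<..<q} \<or> b \<in> {p<..<q})"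

lemma knot_diagramD:
  assumes "knot_diagram g"
  shows "piecewise_linear_path g" "g 1 = g 0" "finite (coinc g)" "finite (crossing_times g)"
    "\<And>x y y'. (x, y) \<in> coinc g \<Longrightarrow> (x, y') \<in> coinc g \<Longrightarrow> y = y'"
    "\<And>x y y'. (y, x) \<in> coinc g \<Longrightarrow> (y', x) \<in> coinc g \<Longrightarrow> y = y'"
    "\<And>s t. (s, t) \<in> coinc g \<Longrightarrow> s \<in> {0<..<1} \<and> t \<in> {0<..<1}"
    "\<And>s t. (s, t) \<in> coinc g \<Longrightarrow> g s \<noteq> g t \<and> transverse g s t"
proof -
  note kd = assms[unfolded knot_diagram_iff]
  show pl: "piecewise_linear_path g" "g 1 = g 0" and fin: "finite (coinc g)" using kd by blast+
  show "finite (crossing_times g)" unfolding crossing_times_eq Domain_fst using fin by simp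
  show sv: "\<And>x y y'. (x, y) \<in> coinc g \<Longrightarrow> (x, y') \<in> coinc g \<Longrightarrow> y = y'"
    using kd unfolding single_valued_def by blast
  then show "\<And>x y y'. (y, x) \<in> coinc g \<Longrightarrow> (y', x) \<in> coinc g \<Longrightarrow> y = y'" using coinc_sym by metis
  have c: "s \<noteq> 0 \<and> g s \<noteq> g t \<and> transverse g s t" if "(s, t) \<in> coinc g" for s t using kd that by blast
  show "s \<in> {0<..<1} \<and> t \<in> {0<..<1}" if "(s, t) \<in> coinc g" for s t
  proof -
    have "(t, s) \<in> coinc g" using that coinc_sym by blast
    then show ?thesis using c[OF that] c[of t s] coincD(1,2)[OF that] by auto
  qed
  show "\<And>s t. (s, t) \<in> coinc g \<Longrightarrow> g s \<noteq> g t \<and> transverse g s t" using c by blast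
qed

lemma finite_mixed: "finite C \<Longrightarrow> finite (mixed C I)" and finite_internal: "finite C \<Longrightarrow> finite (internal C I)"
  unfolding mixed_def internal_def by (erule rev_finite_subset, blast)+

definition first_internal :: "(real \<Rightarrow> space3) \<Rightarrow> real \<Rightarrow> real \<Rightarrow> real \<Rightarrow> bool" where
  "first_internal g p q t1 \<longleftrightarrow> (\<exists>t2. (t1, t2) \<in> internal (coinc g) {p<..<q}) \<and>
     (\<forall>a b. (a, b) \<in> internal (coinc g) {p<..<q} \<longrightarrow> t1 \<le> a)"

definition before :: "(real \<times> real) set \<Rightarrow> real \<Rightarrow> (real \<times> real) set" where
  "before C t = {(a, b). (a, b) \<in> C \<and> a < t}"

text \<open>The arc is shortened past its first self-crossing, which thereby becomes a mixed one.\<close>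

lemma shorten:
  assumes sd: "split_diagram g p q" and fi: "first_internal g p q t1"
    and none: "before (mixed (coinc g) {p<..<q}) t1 = {}"
  shows "\<exists>p'. split_diagram g p' q \<and>
    card (internal (coinc g) {p'<..<q}) + 2 = card (internal (coinc g) {p<..<q}) \<and>
    card (mixed (coinc g) {p'<..<q}) = card (mixed (coinc g) {p<..<q}) + 1"
proof -
  note kd = sd[unfolded split_diagram_def]
  have kdg: "knot_diagram g" and pq: "0 \<le> p" "p < q" "q \<le> 1" and npq: "p \<notin> crossing_times g" "q \<notin> crossing_times g"
    and AA: "\<And>a b. (a, b) \<in> coinc g \<Longrightarrow> a \<in> {p<..<q} \<or> b \<in> {p<..<q}" using kd by blast+
  note kD = knot_diagramD[OF kdg]
  obtain t2 where t12: "(t1, t2) \<in> coinc g" "t1 \<in> {p<..<q}" "t2 \<in> {p<..<q}"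
    using fi unfolding first_internal_def internal_def by blast
  have t21: "(t2, t1) \<in> coinc g" using t12(1) coinc_sym by blast
  have least: "t1 \<le> a" if "(a, b) \<in> coinc g" "a \<in> {p<..<q}" "b \<in> {p<..<q}" for a b
    using fi that unfolding first_internal_def internal_def by blast
  have "t1 \<le> t2" using least[OF t21 t12(3,2)] .
  then have lt: "t1 < t2" using coincD(3)[OF t12(1)] by simp
  obtain \<delta> where \<delta>: "\<delta> > 0" and sep: "\<And>x. x \<in> crossing_times g \<Longrightarrow> x \<noteq> t1 \<Longrightarrow> 2 * \<delta> \<le> \<bar>x - t1\<bar>"
    using finite_separation[OF kD(4), of "{t1}" 1] by (metis finite.emptyI finite.insertI insertI1 zero_less_one)
  \<comment> \<open>Just past \<open>t1\<close> and before the next crossing time, so that only the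
    passage at \<open>t1\<close> changes over to the other arc.\<close>
  define p' where "p' = t1 + \<delta>"
  have ct: "t1 \<in> crossing_times g" "t2 \<in> crossing_times g" unfolding crossing_times_eq using t12(1) t21 by blast+
  have p't2: "p' < t2" using sep[OF ct(2)] lt \<delta> unfolding p'_def by auto
  have p'c: "a = t1 \<or> a > p'" if "a \<in> crossing_times g" "a \<ge> t1" for a
    using sep[OF that(1)] that(2) \<delta> unfolding p'_def by force
  have early: "a \<ge> t1" if "(a, b) \<in> coinc g" "a \<in> {p<..<q}" for a b
  proof (rule ccontr)
    assume "\<not> a \<ge> t1"
    then have "b \<notin> {p<..<q}" using least[OF that] by blast
    then have "(a, b) \<in> before (mixed (coinc g) {p<..<q}) t1"
      using that \<open>\<not> a \<ge> t1\<close> unfolding before_def mixed_def by simp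
    then show False using none by blast
  qed
  have I': "a \<in> {p'<..<q} \<longleftrightarrow> a \<in> {p<..<q} \<and> a \<noteq> t1" if "(a, b) \<in> coinc g" for a b
  proof -
    have "a \<in> crossing_times g" unfolding crossing_times_eq using that by blast
    then show ?thesis using p'c[of a] early[OF that] t12(2) \<delta> unfolding p'_def by auto
  qed
  have I'2: "b \<in> {p'<..<q} \<longleftrightarrow> b \<in> {p<..<q} \<and> b \<noteq> t1" if "(a, b) \<in> coinc g" for a b
    using I'[of b a] that coinc_sym by blast
  have part: "a = t1 \<longleftrightarrow> b = t2" if "(a, b) \<in> coinc g" for a b using kD(5,6) t12(1) that by blast
  have part': "a = t2 \<longleftrightarrow> b = t1" if "(a, b) \<in> coinc g" for a b using kD(5,6) t21 that by blast
  \<comment> \<open>Both ordered pairs of the crossing leave \<open>internal\<close>; one of them,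
    \<open>(t2, t1)\<close>, is counted by \<open>mixed\<close> from now on.\<close>
  have in_eq: "internal (coinc g) {p<..<q} = insert (t1, t2) (insert (t2, t1) (internal (coinc g) {p'<..<q}))"
    (is "?l = ?r")
  proof (rule set_eqI)
    fix z :: "real \<times> real" obtain a b where z: "z = (a, b)" by (cases z)
    show "z \<in> ?l \<longleftrightarrow> z \<in> ?r"
    proof (cases "(a, b) \<in> coinc g")
      case True
      have "(a, b) = (t1, t2) \<longleftrightarrow> a = t1" "(a, b) = (t2, t1) \<longleftrightarrow> b = t1" using part[OF True] part'[OF True] by blast+
      then show ?thesis unfolding z internal_def using I'[OF True] I'2[OF True] True t12 t21 part[OF True] part'[OF True] by blast
    next
      case False
      then show ?thesis unfolding z internal_def using t12 t21 by blast
    qed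
  qed
  have nin: "(t1, t2) \<notin> insert (t2, t1) (internal (coinc g) {p'<..<q})" "(t2, t1) \<notin> internal (coinc g) {p'<..<q}"
    using lt I'[OF t12(1)] I'2[OF t21] unfolding internal_def by auto
  have fin: "finite (internal (coinc g) {p'<..<q})" by (rule finite_internal[OF kD(3)])
  have c1: "card (internal (coinc g) {p'<..<q}) + 2 = card (internal (coinc g) {p<..<q})"
    unfolding in_eq using nin fin by simp
  have mx_eq: "mixed (coinc g) {p'<..<q} = insert (t2, t1) (mixed (coinc g) {p<..<q})" (is "?l = ?r")
  proof (rule set_eqI)
    fix z :: "real \<times> real" obtain a b where z: "z = (a, b)" by (cases z)
    show "z \<in> ?l \<longleftrightarrow> z \<in> ?r"
    proof (cases "(a, b) \<in> coinc g")
      case True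
      have "(a, b) = (t2, t1) \<longleftrightarrow> b = t1" using part'[OF True] by blast
      then show ?thesis unfolding z mixed_def using I'[OF True] I'2[OF True] True t12 lt part[OF True] part'[OF True] by blast
    next
      case False
      then show ?thesis unfolding z mixed_def using t21 by blast
    qed
  qed
  have "(t2, t1) \<notin> mixed (coinc g) {p<..<q}" unfolding mixed_def using t12(2) by blast
  then have c2: "card (mixed (coinc g) {p'<..<q}) = card (mixed (coinc g) {p<..<q}) + 1"
    unfolding mx_eq using finite_mixed[OF kD(3)] by simp
  have "p' \<notin> crossing_times g" using p'c[of p'] \<delta> unfolding p'_def by auto
  moreover have "a \<in> {p'<..<q} \<or> b \<in> {p'<..<q}" if "(a, b) \<in> coinc g" for a b
  proof -
    have "a \<noteq> t1 \<or> b \<noteq> t1" using part[OF that] lt by auto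
    then show ?thesis using AA[OF that] I'[OF that] I'2[OF that] part[OF that] part'[OF that] t12(2,3) by blast
  qed
  moreover have "0 \<le> p'" "p' < q" using pq t12 \<delta> p't2 unfolding p'_def by auto
  ultimately have "split_diagram g p' q" unfolding split_diagram_def using kdg pq npq by blast
  then show ?thesis using c1 c2 by blast
qed

text \<open>The obstacles for a finger pushed back along the arc. Kinks are included because the
  finger needs a straight segment; as passing a kink changes no count of crossings, the number of
  events is what makes the passing terminate.\<close>

definition events :: "(real \<Rightarrow> space3) \<Rightarrow> real \<Rightarrow> real \<Rightarrow> real set" where
  "events g p t = {u. p < u \<and> u < t \<and> (u \<in> crossing_times g \<or> u \<in> kinks g)}"

lemma finite_events: "knot_diagram g \<Longrightarrow> finite (events g p t)"
  using knot_diagramD(4)[of g] finite_kinks[OF knot_diagramD(1)[of g]]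
  by (rule_tac finite_subset[of _ "crossing_times g \<union> kinks g"]) (auto simp: events_def)

text \<open>The crossing strand is pushed by a finger along the arc past the last kink or mixed crossing before
  the first self-crossing of the arc.\<close>

lemma pass_event:
  assumes sd: "split_diagram g p q" and fi: "first_internal g p q t1"
    and some: "before (mixed (coinc g) {p<..<q}) t1 \<noteq> {}"
  shows "\<exists>g' t1'. isotopic3 (path_image g) (path_image g') \<and> split_diagram g' p q \<and> first_internal g' p q t1' \<and>
    card (internal (coinc g') {p<..<q}) = card (internal (coinc g) {p<..<q}) \<and>
    card (events g' p t1') < card (events g p t1) \<and>
    card (mixed (coinc g') {p<..<q}) + 2 * card (before (mixed (coinc g') {p<..<q}) t1') =
    card (mixed (coinc g) {p<..<q}) + 2 * card (before (mixed (coinc g) {p<..<q}) t1)"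
proof -
  note kd = sd[unfolded split_diagram_def]
  have kdg: "knot_diagram g" and pq: "0 \<le> p" "p < q" "q \<le> 1" and npq: "p \<notin> crossing_times g" "q \<notin> crossing_times g"
    and AA: "\<And>a b. (a, b) \<in> coinc g \<Longrightarrow> a \<in> {p<..<q} \<or> b \<in> {p<..<q}" using kd by blast+
  note kD = knot_diagramD[OF kdg]
  obtain t2 where t12: "(t1, t2) \<in> coinc g" "t1 \<in> {p<..<q}" "t2 \<in> {p<..<q}"
    using fi unfolding first_internal_def internal_def by blast
  have t21: "(t2, t1) \<in> coinc g" using t12(1) coinc_sym by blast
  have least: "t1 \<le> a" if "(a, b) \<in> coinc g" "a \<in> {p<..<q}" "b \<in> {p<..<q}" for a b
    using fi that unfolding first_internal_def internal_def by blast
  have "t1 \<le> t2" using least[OF t21 t12(3,2)] .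
  then have lt: "t1 < t2" using coincD(3)[OF t12(1)] by simp
  have ctI: "a \<in> crossing_times g" if "(a, b) \<in> coinc g" for a b unfolding crossing_times_eq using that by blast
  have ctI': "b \<in> crossing_times g" if "(a, b) \<in> coinc g" for a b using that coinc_sym ctI by blast
  have finE: "finite (events g p t1)" by (rule finite_events[OF kdg])
  have neE: "events g p t1 \<noteq> {}"
  proof -
    obtain a b where "(a, b) \<in> coinc g" "a \<in> {p<..<q}" "a < t1"
      using some unfolding before_def mixed_def by blast
    then have "a \<in> events g p t1" unfolding events_def using ctI by auto
    then show ?thesis by blast
  qed
  \<comment> \<open>The last event before \<open>t1\<close>; between the two the arc is straight and
    free of crossings.\<close>
  define e where "e = Max (events g p t1)"
  have e: "e \<in> events g p t1" unfolding e_def by (rule Max_in[OF finE neE])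
  have emax: "u \<le> e" if "u \<in> events g p t1" for u unfolding e_def using finE that by (rule Max_ge)
  have ep: "p < e" "e < t1" using e unfolding events_def by auto
  have clear: "u \<notin> crossing_times g" "u \<notin> kinks g" if "u \<in> {e<..<t1}" for u
    using emax[of u] that ep unfolding events_def by force+
  have t1q: "t1 < q" "p < t1" "t2 < q" using t12 by auto
  have aff: "affine_on g {e..t1}"
    by (rule affine_on_no_kinks[OF kD(1)]) (use ep pq t1q clear(2) in auto)
  \<comment> \<open>Empty if \<open>e\<close> is only a kink, otherwise the one partner of
    \<open>e\<close>. The partner lies on the other arc, because \<open>t1\<close> is the first
    passage through a self-crossing.\<close>
  define D where "D = {d. (e, d) \<in> coinc g}"
  have D1: "d = d'" if "d \<in> D" "d' \<in> D" for d d' using that kD(5) unfolding D_def by blast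
  have finD: "finite D" by (rule finite_subset[OF _ kD(4)]) (use ctI' D_def in blast)
  have e01: "e \<in> {0<..<1}" using ep pq t1q by auto
  have DI: "d \<notin> {p<..<q}" "d \<in> crossing_times g" "d \<noteq> e" "d \<in> {0<..<1}" if "d \<in> D" for d
  proof -
    have de: "(e, d) \<in> coinc g" using that unfolding D_def by simp
    show "d \<notin> {p<..<q}" using least[OF de] ep t1q by auto
    show "d \<in> crossing_times g" by (rule ctI'[OF de])
    show "d \<noteq> e" using coincD(3)[OF de] by simp
    show "d \<in> {0<..<1}" using kD(7)[OF de] by simp
  qed
  define \<Omega> where "\<Omega> = insert (e, -1) (D \<times> {1, -1 :: real})"
  \<comment> \<open>The ends \<open>p\<close> and \<open>q\<close> and the time \<open>t1\<close>
    are kept at a distance too, so that the new crossing times lie on the same arcs as the times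
    next to them.\<close>
  obtain \<delta> where \<delta>: "\<delta> > 0" and sep: "\<And>c x. c \<in> {e, t2} \<union> D \<Longrightarrow> x \<in> crossing_times g \<union> {p, q, t1} \<Longrightarrow> x \<noteq> c \<Longrightarrow> 2 * \<delta> \<le> \<bar>x - c\<bar>"
  proof (rule finite_separation[of "crossing_times g \<union> {p, q, t1}" "{e, t2} \<union> D" 1])
    show "finite (crossing_times g \<union> {p, q, t1})" using kD(4) by simp
    show "finite ({e, t2} \<union> D)" using finD by simp
  qed (use that in auto)
  have "\<exists>g' S T. knot_diagram g' \<and> isotopic3 (path_image g) (path_image g') \<and>
    (\<forall>\<tau>. \<bar>\<tau> - t2\<bar> \<ge> \<delta> \<longrightarrow> g' \<tau> = g \<tau>) \<and>
    coinc g' = coinc g - {(t1, t2), (t2, t1)} \<union> (\<lambda>\<omega>. (S \<omega>, T \<omega>)) ` \<Omega> \<union> (\<lambda>\<omega>. (T \<omega>, S \<omega>)) ` \<Omega> \<and>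
    (\<forall>\<omega>\<in>\<Omega>. \<bar>S \<omega> - t2\<bar> < \<delta> \<and> (\<exists>x. 0 < x \<and> x < \<delta> \<and> T \<omega> = fst \<omega> + snd \<omega> * x))"
  proof (rule finger_move[OF kdg t12(1) _ ep(2) aff _ _ _ _ _ _ \<delta>])
    show "0 < e" using e01 by simp
    show "t2 \<notin> {e..t1}" using lt by simp
    show "\<tau> \<notin> crossing_times g" if "\<tau> \<in> {e<..<t1}" for \<tau> by (rule clear(1)[OF that])
    show "finite \<Omega>" unfolding \<Omega>_def using finD by simp
    show "(e, -1) \<in> \<Omega>" unfolding \<Omega>_def by simp
    show "(\<sigma> = 1 \<or> \<sigma> = -1) \<and> shadow g \<tau> = shadow g e \<and> \<tau> \<in> {0<..<1} \<and> (\<tau> = e \<longrightarrow> \<sigma> = -1)" if "(\<tau>, \<sigma>) \<in> \<Omega>" for \<tau> \<sigma>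
    proof -
      have "\<tau> = e \<and> \<sigma> = -1 \<or> \<tau> \<in> D \<and> (\<sigma> = 1 \<or> \<sigma> = -1)" using that unfolding \<Omega>_def by auto
      then show ?thesis
      proof
        assume *: "\<tau> \<in> D \<and> (\<sigma> = 1 \<or> \<sigma> = -1)"
        then have "shadow g e = shadow g \<tau>" using coincD(4) unfolding D_def by blast
        then show ?thesis using * DI[of \<tau>] by simp
      qed (use e01 in simp)
    qed
    show "(\<tau>, 1) \<in> \<Omega> \<and> (\<tau>, -1) \<in> \<Omega>" if "\<tau> \<in> {0..<1}" "shadow g \<tau> = shadow g e" "\<tau> \<noteq> e" for \<tau>
    proof -
      have "(e, \<tau>) \<in> coinc g" using that e01 by (intro coincI) auto
      then show ?thesis unfolding \<Omega>_def D_def by simp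
    qed
  qed
  then obtain g' S T where G: "knot_diagram g' \<and> isotopic3 (path_image g) (path_image g') \<and>
    (\<forall>\<tau>. \<bar>\<tau> - t2\<bar> \<ge> \<delta> \<longrightarrow> g' \<tau> = g \<tau>) \<and>
    coinc g' = coinc g - {(t1, t2), (t2, t1)} \<union> (\<lambda>\<omega>. (S \<omega>, T \<omega>)) ` \<Omega> \<union> (\<lambda>\<omega>. (T \<omega>, S \<omega>)) ` \<Omega> \<and>
    (\<forall>\<omega>\<in>\<Omega>. \<bar>S \<omega> - t2\<bar> < \<delta> \<and> (\<exists>x. 0 < x \<and> x < \<delta> \<and> T \<omega> = fst \<omega> + snd \<omega> * x))"
    by (elim exE) (erule that)
  note kdg' = conjunct1[OF G] and G2 = conjunct2[OF G]
  note iso = conjunct1[OF G2] and G3 = conjunct2[OF G2]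
  note same = conjunct1[OF G3, rule_format] and G4 = conjunct2[OF G3]
  note C' = conjunct1[OF G4]
  have ST: "\<bar>S \<omega> - t2\<bar> < \<delta>" "\<exists>x. 0 < x \<and> x < \<delta> \<and> T \<omega> = fst \<omega> + snd \<omega> * x" if "\<omega> \<in> \<Omega>" for \<omega>
    using bspec[OF conjunct2[OF G4] that] by (rule conjunct1, rule conjunct2)
  have sp1: "2 * \<delta> \<le> t2 - t1" "2 * \<delta> \<le> q - t2" "2 * \<delta> \<le> e - p"
    using sep[of t2 t1] sep[of t2 q] sep[of e p] lt t1q ep by auto
  have S: "t1 < S \<omega>" "S \<omega> < q" if "\<omega> \<in> \<Omega>" for \<omega>
    using ST(1)[OF that] sp1 \<delta> by linarith+
  \<comment> \<open>At \<open>\<omega>0\<close> the finger meets the arc itself, on the branch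
    before \<open>e\<close>; this crossing replaces the one at \<open>t1\<close> as the first
    self-crossing. The branches in \<open>W\<close> belong to the other arc and give the new mixed
    crossings.\<close>
  define \<omega>0 where "\<omega>0 = (e, -1 :: real)"
  define W where "W = D \<times> {1, -1 :: real}"
  have \<Omega>W: "\<Omega> = insert \<omega>0 W" unfolding \<Omega>_def \<omega>0_def W_def ..
  have \<omega>0: "\<omega>0 \<in> \<Omega>" and WO: "\<omega> \<in> W \<Longrightarrow> \<omega> \<in> \<Omega>" for \<omega> unfolding \<Omega>W by auto
  define e' where "e' = T \<omega>0"
  define S0 where "S0 = S \<omega>0"
  have e': "p < e'" "e' < e" "e - e' < \<delta>" using ST(2)[OF \<omega>0] sp1 \<delta> unfolding e'_def \<omega>0_def by auto
  have S0: "t1 < S0" "S0 < q" unfolding S0_def by (rule S[OF \<omega>0])+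
  have Wfst: "fst \<omega> \<in> D" "snd \<omega> = 1 \<or> snd \<omega> = -1" if "\<omega> \<in> W" for \<omega> using that unfolding W_def by auto
  have TW: "\<bar>T \<omega> - fst \<omega>\<bar> < \<delta>" "T \<omega> \<noteq> fst \<omega>" "snd \<omega> = 1 \<Longrightarrow> T \<omega> > fst \<omega>" "snd \<omega> = -1 \<Longrightarrow> T \<omega> < fst \<omega>" if "\<omega> \<in> W" for \<omega>
    using ST(2)[OF WO[OF that]] Wfst(2)[OF that] by auto
  have dpq: "2 * \<delta> \<le> \<bar>p - fst \<omega>\<bar>" "2 * \<delta> \<le> \<bar>q - fst \<omega>\<bar>" "fst \<omega> \<notin> {p<..<q}" if "\<omega> \<in> W" for \<omega>
  proof -
    have "p \<noteq> fst \<omega>" "q \<noteq> fst \<omega>" using DI(2)[OF Wfst(1)[OF that]] npq by blast+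
    then show "2 * \<delta> \<le> \<bar>p - fst \<omega>\<bar>" "2 * \<delta> \<le> \<bar>q - fst \<omega>\<bar>" using sep Wfst(1)[OF that] by blast+
    show "fst \<omega> \<notin> {p<..<q}" by (rule DI(1)[OF Wfst(1)[OF that]])
  qed
  have TI: "T \<omega> \<notin> {p..q}" if "\<omega> \<in> W" for \<omega>
    using TW(1)[OF that] dpq[OF that] \<delta> by auto
  have Tnc: "T \<omega> \<notin> crossing_times g" if "\<omega> \<in> W" for \<omega>
    using sep[of "fst \<omega>" "T \<omega>"] Wfst(1)[OF that] TW(1,2)[OF that] \<delta> by auto
  have e'nc: "u \<notin> crossing_times g" if "e' \<le> u" "u < t1" "u \<noteq> e" for u
  proof
    assume u: "u \<in> crossing_times g"
    then have "u < e" using clear(1)[of u] that by force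
    then have "2 * \<delta> \<le> e - u" using sep[of e u] u by auto
    then show False using e' that \<delta> by linarith
  qed
  have C'cases: "(a, b) \<in> coinc g \<and> (a, b) \<noteq> (t1, t2) \<and> (a, b) \<noteq> (t2, t1) \<or> (a, b) = (S0, e') \<or> (a, b) = (e', S0) \<or>
      (\<exists>\<omega>\<in>W. (a, b) = (S \<omega>, T \<omega>) \<or> (a, b) = (T \<omega>, S \<omega>))" if "(a, b) \<in> coinc g'" for a b
    using that unfolding C' \<Omega>W S0_def e'_def by blast
  have C'new: "(S0, e') \<in> coinc g'" "(e', S0) \<in> coinc g'" "\<And>\<omega>. \<omega> \<in> W \<Longrightarrow> (S \<omega>, T \<omega>) \<in> coinc g'"
    unfolding C' \<Omega>W S0_def e'_def by blast+
  have C'old: "(a, b) \<in> coinc g'" if "(a, b) \<in> coinc g" "(a, b) \<noteq> (t1, t2)" "(a, b) \<noteq> (t2, t1)" for a b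
    unfolding C' using that by blast
  have SI: "S \<omega> \<in> {p<..<q}" if "\<omega> \<in> \<Omega>" for \<omega> using S[OF that] t1q by simp
  have e'I: "e' \<in> {p<..<q}" and S0I: "S0 \<in> {p<..<q}" using e' ep t1q S0 by auto
  have TI': "T \<omega> \<notin> {p<..<q}" if "\<omega> \<in> W" for \<omega> using TI[OF that] by auto
  have e'ct: "e' \<notin> crossing_times g" using e'nc[of e'] e' ep by auto
  have ct': "p \<notin> crossing_times g'" "q \<notin> crossing_times g'"
  proof -
    have "r \<notin> crossing_times g'" if r: "r = p \<or> r = q" for r
    proof
      assume "r \<in> crossing_times g'"
      then obtain b where "(r, b) \<in> coinc g'" unfolding crossing_times_eq by blast
      from C'cases[OF this] show False
      proof (elim disjE conjE bexE)
        assume "(r, b) \<in> coinc g" then show False using ctI r npq by blast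
      next
        assume "(r, b) = (S0, e')" then show False using S0I r by auto
      next
        assume "(r, b) = (e', S0)" then show False using e'I r by auto
      next
        fix \<omega> assume w: "\<omega> \<in> W" "(r, b) = (S \<omega>, T \<omega>)"
        have "r \<in> {p<..<q}" using SI[OF WO[OF w(1)]] w(2) by simp
        then show False using r by auto
      next
        fix \<omega> assume w: "\<omega> \<in> W" "(r, b) = (T \<omega>, S \<omega>)"
        have "r \<notin> {p..q}" using TI[OF w(1)] w(2) by simp
        then show False using r pq by auto
      qed
    qed
    then show "p \<notin> crossing_times g'" "q \<notin> crossing_times g'" by blast+
  qed
  have AA': "a \<in> {p<..<q} \<or> b \<in> {p<..<q}" if "(a, b) \<in> coinc g'" for a b
    using C'cases[OF that] AA e'I SI WO by blast
  have sd': "split_diagram g' p q" unfolding split_diagram_def using kdg' pq ct' AA' by blast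
  define R where "R = internal (coinc g) {p<..<q} - {(t1, t2), (t2, t1)}"
  have in': "internal (coinc g') {p<..<q} = insert (S0, e') (insert (e', S0) R)" (is "?l = ?r")
  proof (rule set_eqI)
    fix z :: "real \<times> real" obtain a b where z: "z = (a, b)" by (cases z)
    show "z \<in> ?l \<longleftrightarrow> z \<in> ?r"
    proof
      assume "z \<in> ?l"
      then have *: "(a, b) \<in> coinc g'" "a \<in> {p<..<q}" "b \<in> {p<..<q}" unfolding z internal_def by auto
      from C'cases[OF *(1)] show "z \<in> ?r" unfolding z R_def internal_def using *(2,3) TI' by blast
    next
      assume "z \<in> ?r"
      then show "z \<in> ?l" unfolding z R_def internal_def using C'new C'old e'I S0I by blast
    qed
  qed
  have in0: "internal (coinc g) {p<..<q} = insert (t1, t2) (insert (t2, t1) R)"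
    unfolding R_def internal_def using t12 t21 by blast
  have finR: "finite R" unfolding R_def using finite_internal[OF kD(3)] by simp
  have nR: "(S0, e') \<notin> R" "(e', S0) \<notin> R" using e'ct ctI ctI' unfolding R_def internal_def by blast+
  have nR2: "(t1, t2) \<notin> R" "(t2, t1) \<notin> R" unfolding R_def by blast+
  have ne: "S0 \<noteq> e'" "t1 \<noteq> t2" using S0 e' ep lt by auto
  have card_in: "card (internal (coinc g') {p<..<q}) = card (internal (coinc g) {p<..<q})"
    unfolding in' in0 using finR nR nR2 ne by simp
  have mx': "mixed (coinc g') {p<..<q} = mixed (coinc g) {p<..<q} \<union> (\<lambda>\<omega>. (S \<omega>, T \<omega>)) ` W" (is "?l = ?r")
  proof (rule set_eqI)
    fix z :: "real \<times> real" obtain a b where z: "z = (a, b)" by (cases z)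
    show "z \<in> ?l \<longleftrightarrow> z \<in> ?r"
    proof
      assume "z \<in> ?l"
      then have *: "(a, b) \<in> coinc g'" "a \<in> {p<..<q}" "b \<notin> {p<..<q}" unfolding z mixed_def by auto
      from C'cases[OF *(1)] show "z \<in> ?r" unfolding z mixed_def using *(2,3) TI' e'I S0I by blast
    next
      assume "z \<in> ?r"
      then show "z \<in> ?l" unfolding z mixed_def using C'new(3) C'old TI' SI WO t12 by blast
    qed
  qed
  have injW: "inj_on (\<lambda>\<omega>. (S \<omega>, T \<omega>)) W"
  proof (rule inj_onI)
    fix \<omega> \<omega>' assume w: "\<omega> \<in> W" "\<omega>' \<in> W" "(S \<omega>, T \<omega>) = (S \<omega>', T \<omega>')"
    have f: "fst \<omega> = fst \<omega>'" by (rule D1[OF Wfst(1)[OF w(1)] Wfst(1)[OF w(2)]])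
    moreover have "snd \<omega> = snd \<omega>'"
      using Wfst(2)[OF w(1)] Wfst(2)[OF w(2)] TW(3,4)[OF w(1)] TW(3,4)[OF w(2)] w(3) f by auto
    ultimately show "\<omega> = \<omega>'" by (rule prod_eqI)
  qed
  have finW: "finite W" unfolding W_def using finD by simp
  have cardW: "card W = 2 * card D" unfolding W_def by (simp add: card_cartesian_product)
  \<comment> \<open>Two mixed crossings are gained if \<open>e\<close> is a crossing time and none
    if it is only a kink. Correspondingly, one crossing or none drops out of those ahead, which
    keeps \<open>mixed\<close> plus twice \<open>before\<close> constant.\<close>
  have "mixed (coinc g) {p<..<q} \<inter> (\<lambda>\<omega>. (S \<omega>, T \<omega>)) ` W = {}"
    using Tnc ctI' unfolding mixed_def by blast
  then have card_mx: "card (mixed (coinc g') {p<..<q}) = card (mixed (coinc g) {p<..<q}) + 2 * card D"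
    unfolding mx' using card_Un_disjoint[OF finite_mixed[OF kD(3)] finite_imageI[OF finW]] card_image[OF injW] cardW by simp
  have bf': "before (mixed (coinc g') {p<..<q}) e' = before (mixed (coinc g) {p<..<q}) e'"
  proof -
    have "\<not> S \<omega> < e'" if "\<omega> \<in> W" for \<omega> using S(1)[OF WO[OF that]] e' ep by simp
    then show ?thesis unfolding mx' before_def by blast
  qed
  have bf: "before (mixed (coinc g) {p<..<q}) t1 = before (mixed (coinc g) {p<..<q}) e' \<union> {e} \<times> D" (is "?l = ?r")
  proof (rule set_eqI)
    fix z :: "real \<times> real" obtain a b where z: "z = (a, b)" by (cases z)
    show "z \<in> ?l \<longleftrightarrow> z \<in> ?r"
    proof
      assume "z \<in> ?l"
      then have *: "(a, b) \<in> coinc g" "a \<in> {p<..<q}" "b \<notin> {p<..<q}" "a < t1" unfolding z mixed_def before_def by auto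
      show "z \<in> ?r"
      proof (cases "a < e'")
        case True then show ?thesis using * unfolding z mixed_def before_def by blast
      next
        case False
        then have "a = e" using e'nc[of a] *(4) ctI[OF *(1)] by linarith
        then show ?thesis using * unfolding z D_def by blast
      qed
    next
      assume "z \<in> ?r"
      then show "z \<in> ?l"
      proof
        assume "z \<in> before (mixed (coinc g) {p<..<q}) e'"
        then show ?thesis unfolding z before_def using e' ep by auto
      next
        assume "z \<in> {e} \<times> D"
        then have ab: "a = e" "b \<in> D" unfolding z by auto
        then show ?thesis unfolding z mixed_def before_def using DI(1)[OF ab(2)] ep t1q D_def by auto
      qed
    qed
  qed
  have finb: "finite (before (mixed (coinc g) {p<..<q}) e')"
    by (rule finite_subset[OF _ finite_mixed[OF kD(3)]]) (auto simp: before_def)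
  have "before (mixed (coinc g) {p<..<q}) e' \<inter> {e} \<times> D = {}" unfolding before_def using e' by auto
  then have card_bf: "card (before (mixed (coinc g) {p<..<q}) t1) = card (before (mixed (coinc g) {p<..<q}) e') + card D"
    unfolding bf using card_Un_disjoint[OF finb, of "{e} \<times> D"] finD by (simp add: card_cartesian_product)
  have fi': "first_internal g' p q e'"
    unfolding first_internal_def
  proof (intro conjI allI impI exI)
    show "(e', S0) \<in> internal (coinc g') {p<..<q}" unfolding in' by simp
    fix a b assume "(a, b) \<in> internal (coinc g') {p<..<q}"
    then have "a = S0 \<or> a = e' \<or> (a, b) \<in> internal (coinc g) {p<..<q}" unfolding in' R_def by blast
    then show "e' \<le> a" using S0 e' ep least unfolding internal_def by force
  qed
  \<comment> \<open>The path has changed only near \<open>t2\<close>, beyond \<open>t1\<close>, and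
    the new crossings before \<open>t1\<close> on the arc are not before \<open>e'\<close>. So no
    event has been added, and \<open>e\<close> is gone.\<close>
  have "events g' p e' \<subseteq> events g p t1 - {e}"
  proof
    fix u assume u: "u \<in> events g' p e'"
    then have up: "p < u" "u < e'" unfolding events_def by auto
    have "u \<in> crossing_times g \<or> u \<in> kinks g"
    proof (cases "u \<in> crossing_times g'")
      case True
      then obtain b where "(u, b) \<in> coinc g'" unfolding crossing_times_eq by blast
      from C'cases[OF this] show ?thesis
      proof (elim disjE conjE bexE)
        assume "(u, b) \<in> coinc g" then show ?thesis using ctI by blast
      next
        assume "(u, b) = (S0, e')" then show ?thesis using S0 up e' ep by auto
      next
        assume "(u, b) = (e', S0)" then show ?thesis using up by auto
      next
        fix \<omega> assume w: "\<omega> \<in> W" "(u, b) = (S \<omega>, T \<omega>)"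
        have "t1 < u" using S(1)[OF WO[OF w(1)]] w(2) by simp
        then show ?thesis using up e' ep by simp
      next
        fix \<omega> assume w: "\<omega> \<in> W" "(u, b) = (T \<omega>, S \<omega>)"
        have "u \<notin> {p..q}" using TI[OF w(1)] w(2) by simp
        then show ?thesis using up e' ep t1q by auto
      qed
    next
      case False
      then have "u \<in> kinks g'" using u unfolding events_def by simp
      moreover have "g' x = g x" if "x \<in> {..<t1}" for x using that sp1 \<delta> by (intro same) auto
      ultimately have "u \<in> kinks g" using kinks_cong[of "{..<t1}" g' g u] up e' ep by auto
      then show ?thesis by simp
    qed
    then show "u \<in> events g p t1 - {e}" using up e' ep unfolding events_def by auto
  qed
  then have "events g' p e' \<subset> events g p t1" using e by blast
  then have "card (events g' p e') < card (events g p t1)" using finE by (rule psubset_card_mono[rotated])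
  then show ?thesis using iso sd' fi' card_in card_mx card_bf bf' by (intro exI[of _ g'] exI[of _ e']) simp
qed

text \<open>Induction on the number of events. Passing an event preserves \<open>mixed\<close> plus
  twice \<open>before\<close>, at the end \<open>before\<close> is empty, and the final shortening
  of the arc contributes the 1.\<close>

lemma straighten_first:
  assumes "split_diagram g p q" "first_internal g p q t1"
  shows "\<exists>g' p'. isotopic3 (path_image g) (path_image g') \<and> split_diagram g' p' q \<and>
    card (internal (coinc g') {p'<..<q}) + 2 = card (internal (coinc g) {p<..<q}) \<and>
    card (mixed (coinc g') {p'<..<q}) =
      card (mixed (coinc g) {p<..<q}) + 2 * card (before (mixed (coinc g) {p<..<q}) t1) + 1"
  using assms
proof (induction "card (events g p t1)" arbitrary: g t1 rule: less_induct)
  case less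
  show ?case
  proof (cases "before (mixed (coinc g) {p<..<q}) t1 = {}")
    case True
    from shorten[OF less.prems True] obtain p' where "split_diagram g p' q"
      "card (internal (coinc g) {p'<..<q}) + 2 = card (internal (coinc g) {p<..<q})"
      "card (mixed (coinc g) {p'<..<q}) = card (mixed (coinc g) {p<..<q}) + 1" by blast
    then show ?thesis using isotopic3_refl True by (intro exI[of _ g] exI[of _ p']) simp
  next
    case False
    from pass_event[OF less.prems False] obtain g1 t1' where 1: "isotopic3 (path_image g) (path_image g1)"
      "split_diagram g1 p q" "first_internal g1 p q t1'"
      "card (internal (coinc g1) {p<..<q}) = card (internal (coinc g) {p<..<q})"
      "card (events g1 p t1') < card (events g p t1)"
      "card (mixed (coinc g1) {p<..<q}) + 2 * card (before (mixed (coinc g1) {p<..<q}) t1') =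
       card (mixed (coinc g) {p<..<q}) + 2 * card (before (mixed (coinc g) {p<..<q}) t1)" by blast
    from less.hyps[OF 1(5,2,3)] obtain g' p' where 2: "isotopic3 (path_image g1) (path_image g')" "split_diagram g' p' q"
      "card (internal (coinc g') {p'<..<q}) + 2 = card (internal (coinc g1) {p<..<q})"
      "card (mixed (coinc g') {p'<..<q}) = card (mixed (coinc g1) {p<..<q}) + 2 * card (before (mixed (coinc g1) {p<..<q}) t1') + 1"
      by blast
    show ?thesis using isotopic3_trans[OF 1(1) 2(1)] 2 1 by (intro exI[of _ g'] exI[of _ p']) simp
  qed
qed

section \<open>Reversal, and the better end of the arc\<close>

lemma shadow_reversepath: "shadow (reversepath g) t = shadow g (1 - t)"
  by (simp add: shadow_def reversepath_def)

text \<open>Reflection exchanges the two half-open ranges of times. They differ in the base point,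
  which is not a crossing.\<close>

lemma coinc_reversepath:
  assumes kd: "knot_diagram g"
  shows "(a, b) \<in> coinc (reversepath g) \<longleftrightarrow> (1 - a, 1 - b) \<in> coinc g"
proof
  note kD = knot_diagramD[OF kd]
  assume h: "(a, b) \<in> coinc (reversepath g)"
  have ab: "a \<in> {0..<1}" "b \<in> {0..<1}" "a \<noteq> b" "shadow g (1 - a) = shadow g (1 - b)"
    using coincD[OF h] unfolding shadow_reversepath by auto
  have s10: "shadow g 1 = shadow g 0" using kD(2) by (simp add: shadow_def)
  have nz: "b' = 0" if "b' \<in> {0..<1}" "shadow g 1 = shadow g (1 - b')" for b'
  proof (rule ccontr)
    assume "b' \<noteq> 0"
    then have "(0, 1 - b') \<in> coinc g" using that s10 by (intro coincI) auto
    then show False using kD(7) by force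
  qed
  have "a \<noteq> 0" using nz[of b] ab by auto
  moreover have "b \<noteq> 0" using nz[of a] ab by auto
  ultimately show "(1 - a, 1 - b) \<in> coinc g" using ab by (intro coincI) auto
next
  assume h: "(1 - a, 1 - b) \<in> coinc g"
  then have "1 - a \<in> {0<..<1}" "1 - b \<in> {0<..<1}" using knot_diagramD(7)[OF kd h] by auto
  then show "(a, b) \<in> coinc (reversepath g)" using coincD[OF h] by (intro coincI) (auto simp: shadow_reversepath)
qed

lemma piecewise_linear_path_reversepath:
  assumes "piecewise_linear_path g"
  shows "piecewise_linear_path (reversepath g)"
proof -
  obtain B where B: "finite B" "\<forall>t\<in>{0<..<1} - B. \<exists>v. \<forall>\<^sub>F s in at t. g s = g t + (s - t) *\<^sub>R v" and pg: "path g"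
    using assms unfolding piecewise_linear_path_def by blast
  have "\<exists>v. \<forall>\<^sub>F s in at t. reversepath g s = reversepath g t + (s - t) *\<^sub>R v"
    if t: "t \<in> {0<..<1} - (\<lambda>u. 1 - u) ` B" for t
  proof -
    have "1 - t \<in> {0<..<1} - B" using t by (auto simp: image_iff)
    then obtain v where "\<forall>\<^sub>F s in at (1 - t). g s = g (1 - t) + (s - (1 - t)) *\<^sub>R v" using B(2) by blast
    then obtain d where d: "d > 0" "\<And>s. s \<noteq> 1 - t \<Longrightarrow> dist s (1 - t) < d \<Longrightarrow> g s = g (1 - t) + (s - (1 - t)) *\<^sub>R v"
      unfolding eventually_at by auto
    have "reversepath g s = reversepath g t + (s - t) *\<^sub>R (- v)" if "s \<noteq> t" "dist s t < d" for s
    proof -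
      have "g (1 - s) = g (1 - t) + ((1 - s) - (1 - t)) *\<^sub>R v"
        by (rule d(2)) (use that in \<open>auto simp: dist_real_def\<close>)
      then show ?thesis by (simp add: reversepath_def algebra_simps)
    qed
    then have "\<forall>\<^sub>F s in at t. reversepath g s = reversepath g t + (s - t) *\<^sub>R (- v)"
      unfolding eventually_at using d(1) by auto
    then show ?thesis by blast
  qed
  moreover have "finite ((\<lambda>u. 1 - u) ` B)" using B(1) by simp
  ultimately show ?thesis unfolding piecewise_linear_path_def using pg path_reversepath by blast
qed

lemma knot_diagram_reversepath:
  assumes kd: "knot_diagram g"
  shows "knot_diagram (reversepath g)"
  unfolding knot_diagram_iff
proof (intro conjI allI impI)
  note kD = knot_diagramD[OF kd]
  show "piecewise_linear_path (reversepath g)" by (rule piecewise_linear_path_reversepath[OF kD(1)])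
  show "reversepath g 1 = reversepath g 0" using kD(2) by (simp add: reversepath_def)
  have "coinc (reversepath g) = (\<lambda>z. (1 - fst z, 1 - snd z)) ` coinc g"
  proof (rule set_eqI)
    fix z :: "real \<times> real" obtain a b where z: "z = (a, b)" by (cases z)
    show "z \<in> coinc (reversepath g) \<longleftrightarrow> z \<in> (\<lambda>z. (1 - fst z, 1 - snd z)) ` coinc g"
      unfolding z coinc_reversepath[OF kd] by (force simp: image_iff)
  qed
  then show "finite (coinc (reversepath g))" using kD(3) by simp
  show "single_valued (coinc (reversepath g))"
  proof (rule single_valuedI)
    fix x y y' assume "(x, y) \<in> coinc (reversepath g)" "(x, y') \<in> coinc (reversepath g)"
    then have "1 - y = 1 - y'" unfolding coinc_reversepath[OF kd] using kD(5) by blast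
    then show "y = y'" by simp
  qed
  fix s t assume st: "(s, t) \<in> coinc (reversepath g)"
  then have st': "(1 - s, 1 - t) \<in> coinc g" unfolding coinc_reversepath[OF kd] .
  show "s \<noteq> 0" using kD(7)[OF st'] by auto
  show "reversepath g s \<noteq> reversepath g t" using kD(8)[OF st'] by (simp add: reversepath_def)
  obtain v w where vw: "(shadow g has_vector_derivative v) (at (1 - s))" "(shadow g has_vector_derivative w) (at (1 - t))"
    "\<not> collinear {0, v, w}" using kD(8)[OF st'] unfolding transverse_def by blast
  have d: "(shadow (reversepath g) has_vector_derivative - v) (at s)" if "(shadow g has_vector_derivative v) (at (1 - s))" for v s
  proof -
    have "((\<lambda>u. 1 - u) has_real_derivative (0 - 1)) (at s)" by (rule DERIV_diff) (auto intro: DERIV_ident)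
    then have "((\<lambda>u. 1 - u) has_vector_derivative - 1) (at s)" by (simp add: has_real_derivative_iff_has_vector_derivative)
    from vector_diff_chain_at[OF this that] have "((shadow g \<circ> (\<lambda>u. 1 - u)) has_vector_derivative (- 1) *\<^sub>R v) (at s)" .
    moreover have "shadow g \<circ> (\<lambda>u. 1 - u) = shadow (reversepath g)" by (auto simp: shadow_reversepath)
    ultimately show ?thesis by simp
  qed
  have "\<not> collinear {0, - v, - w}"
  proof
    assume "collinear {0, - v, - w}"
    then consider "- v = 0" | "- w = 0" | c where "- w = c *\<^sub>R (- v)" unfolding collinear_lemma by blast
    then have "v = 0 \<or> w = 0 \<or> (\<exists>c. w = c *\<^sub>R v)"
    proof cases
      case 3 then have "w = c *\<^sub>R v" by simp
      then show ?thesis by blast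
    qed simp_all
    then show False using vw(3) unfolding collinear_lemma by blast
  qed
  then show "transverse (reversepath g) s t" unfolding transverse_def using d[OF vw(1)] d[OF vw(2)] by blast
qed

text \<open>The mixed crossings before the first passage through a self-crossing and those after the
  last such passage form disjoint sets, so one of the sets has at most half of all mixed crossings.
  The far end is treated by reversing the diagram.\<close>

lemma halve:
  assumes sd: "split_diagram g p q" and ne: "internal (coinc g) {p<..<q} \<noteq> {}"
  shows "\<exists>g' p' q'. isotopic3 (path_image g) (path_image g') \<and> split_diagram g' p' q' \<and>
    card (internal (coinc g') {p'<..<q'}) + 2 = card (internal (coinc g) {p<..<q}) \<and>
    card (mixed (coinc g') {p'<..<q'}) \<le> 2 * card (mixed (coinc g) {p<..<q}) + 1"
proof -
  note kd = sd[unfolded split_diagram_def]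
  have kdg: "knot_diagram g" and pq: "0 \<le> p" "p < q" "q \<le> 1" and npq: "p \<notin> crossing_times g" "q \<notin> crossing_times g"
    and AA: "\<And>a b. (a, b) \<in> coinc g \<Longrightarrow> a \<in> {p<..<q} \<or> b \<in> {p<..<q}" using kd by blast+
  note kD = knot_diagramD[OF kdg]
  let ?I = "internal (coinc g) {p<..<q}" and ?X = "mixed (coinc g) {p<..<q}"
  let ?r = "reversepath g" and ?J = "{1 - q<..<1 - p}"
  have finI: "finite (fst ` ?I)" using finite_internal[OF kD(3)] by simp
  have neI: "fst ` ?I \<noteq> {}" using ne by simp
  define t1 where "t1 = Min (fst ` ?I)"
  define tl where "tl = Max (fst ` ?I)"
  have t1: "t1 \<in> fst ` ?I" "\<And>a b. (a, b) \<in> ?I \<Longrightarrow> t1 \<le> a"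
    unfolding t1_def using Min_in[OF finI neI] Min_le[OF finI] by force+
  have tl: "tl \<in> fst ` ?I" "\<And>a b. (a, b) \<in> ?I \<Longrightarrow> a \<le> tl"
    unfolding tl_def using Max_in[OF finI neI] Max_ge[OF finI] by force+
  obtain t2 where t2: "(t1, t2) \<in> ?I" using t1(1) by force
  obtain t2' where t2': "(tl, t2') \<in> ?I" using tl(1) by force
  have t1l: "t1 \<le> tl" by (rule tl(2)[OF t2])
  have fi: "first_internal g p q t1" unfolding first_internal_def using t1(2) t2 by blast
  have neg: "1 - a \<in> {p<..<q} \<longleftrightarrow> a \<in> ?J" for a by auto
  have inr: "(a, b) \<in> internal (coinc ?r) ?J \<longleftrightarrow> (1 - a, 1 - b) \<in> ?I" for a b
    unfolding internal_def by (simp add: coinc_reversepath[OF kdg]) auto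
  have mxr: "(a, b) \<in> mixed (coinc ?r) ?J \<longleftrightarrow> (1 - a, 1 - b) \<in> ?X" for a b
    unfolding mixed_def by (simp add: coinc_reversepath[OF kdg]) auto
  let ?\<phi> = "\<lambda>z::real \<times> real. (1 - fst z, 1 - snd z)"
  have inj: "inj_on ?\<phi> A" for A by (rule inj_onI) (simp add: prod_eq_iff)
  have phi: "A = ?\<phi> ` B" if "\<And>a b. (a, b) \<in> A \<longleftrightarrow> (1 - a, 1 - b) \<in> B" for A B
  proof (rule set_eqI)
    fix z :: "real \<times> real" obtain a b where z: "z = (a, b)" by (cases z)
    show "z \<in> A \<longleftrightarrow> z \<in> ?\<phi> ` B" unfolding z that by (force simp: image_iff)
  qed
  have cI: "card (internal (coinc ?r) ?J) = card ?I" and cX: "card (mixed (coinc ?r) ?J) = card ?X"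
    using phi[OF inr] phi[OF mxr] card_image[OF inj] by simp_all
  have bfr: "(a, b) \<in> before (mixed (coinc ?r) ?J) (1 - tl) \<longleftrightarrow> (1 - a, 1 - b) \<in> {(a, b). (a, b) \<in> ?X \<and> tl < a}" for a b
    unfolding before_def using mxr by auto
  have cB: "card (before (mixed (coinc ?r) ?J) (1 - tl)) = card {(a, b). (a, b) \<in> ?X \<and> tl < a}"
    using phi[OF bfr] card_image[OF inj] by simp
  have ctr: "a \<in> crossing_times ?r \<longleftrightarrow> 1 - a \<in> crossing_times g" for a
  proof -
    have "(\<exists>b. (a, b) \<in> coinc ?r) \<longleftrightarrow> (\<exists>b. (1 - a, b) \<in> coinc g)"
      unfolding coinc_reversepath[OF kdg] by (metis diff_diff_eq2 add_diff_cancel_left')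
    then show ?thesis unfolding crossing_times_eq Domain_iff .
  qed
  have sdr: "split_diagram ?r (1 - q) (1 - p)"
    unfolding split_diagram_def ctr
  proof (intro conjI allI impI)
    show "knot_diagram ?r" by (rule knot_diagram_reversepath[OF kdg])
    show "1 - (1 - q) \<notin> crossing_times g" "1 - (1 - p) \<notin> crossing_times g" using npq by simp_all
    fix a b assume "(a, b) \<in> coinc ?r"
    then show "a \<in> ?J \<or> b \<in> ?J" using AA[of "1 - a" "1 - b"] unfolding coinc_reversepath[OF kdg] neg by simp
  qed (use pq in auto)
  have fir: "first_internal ?r (1 - q) (1 - p) (1 - tl)"
    unfolding first_internal_def inr
  proof (intro conjI allI impI exI)
    show "(1 - (1 - tl), 1 - (1 - t2')) \<in> ?I" using t2' by simp
    fix a b assume "(1 - a, 1 - b) \<in> ?I"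
    then show "1 - tl \<le> a" using tl(2) by fastforce
  qed
  have finX: "finite ?X" by (rule finite_mixed[OF kD(3)])
  have "card (before ?X t1) + card {(a, b). (a, b) \<in> ?X \<and> tl < a} = card (before ?X t1 \<union> {(a, b). (a, b) \<in> ?X \<and> tl < a})"
  proof (rule card_Un_disjoint[symmetric])
    show "finite (before ?X t1)" by (rule finite_subset[OF _ finX]) (auto simp: before_def)
    show "finite {(a, b). (a, b) \<in> ?X \<and> tl < a}" by (rule finite_subset[OF _ finX]) auto
    show "before ?X t1 \<inter> {(a, b). (a, b) \<in> ?X \<and> tl < a} = {}" unfolding before_def using t1l by auto
  qed
  also have "\<dots> \<le> card ?X" by (rule card_mono[OF finX]) (auto simp: before_def)
  finally have le: "card (before ?X t1) + card {(a, b). (a, b) \<in> ?X \<and> tl < a} \<le> card ?X" .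
  show ?thesis
  proof (cases "2 * card (before ?X t1) \<le> card ?X")
    case True
    obtain g' p' where "isotopic3 (path_image g) (path_image g')" "split_diagram g' p' q"
      "card (internal (coinc g') {p'<..<q}) + 2 = card ?I"
      "card (mixed (coinc g') {p'<..<q}) = card ?X + 2 * card (before ?X t1) + 1"
      using straighten_first[OF sd fi] by blast
    then show ?thesis using True by (intro exI[of _ g'] exI[of _ p'] exI[of _ q]) simp
  next
    case False
    obtain g' p' where "isotopic3 (path_image ?r) (path_image g')" "split_diagram g' p' (1 - p)"
      "card (internal (coinc g') {p'<..<1 - p}) + 2 = card (internal (coinc ?r) ?J)"
      "card (mixed (coinc g') {p'<..<1 - p}) = card (mixed (coinc ?r) ?J) + 2 * card (before (mixed (coinc ?r) ?J) (1 - tl)) + 1"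
      using straighten_first[OF sdr fir] by blast
    then show ?thesis using False le unfolding path_image_reversepath cI cX cB
      by (intro exI[of _ g'] exI[of _ p'] exI[of _ "1 - p"]) simp
  qed
qed

text \<open>Replacing m by at most 2m + 1 at most doubles m + 1. Each round removes one
  self-crossing, that is two ordered pairs of \<open>internal\<close>, which explains the
  exponent.\<close>

lemma untangle:
  assumes "split_diagram g p q"
  shows "\<exists>g' p' q'. isotopic3 (path_image g) (path_image g') \<and> split_diagram g' p' q' \<and>
    internal (coinc g') {p'<..<q'} = {} \<and>
    card (mixed (coinc g') {p'<..<q'}) + 1 \<le> 2 ^ (card (internal (coinc g) {p<..<q}) div 2) * (card (mixed (coinc g) {p<..<q}) + 1)"
  using assms
proof (induction "card (internal (coinc g) {p<..<q})" arbitrary: g p q rule: less_induct)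
  case less
  show ?case
  proof (cases "internal (coinc g) {p<..<q} = {}")
    case True
    then show ?thesis using less.prems isotopic3_refl by (intro exI[of _ g] exI[of _ p] exI[of _ q]) simp
  next
    case False
    obtain g1 p1 q1 where 1: "isotopic3 (path_image g) (path_image g1)" "split_diagram g1 p1 q1"
      "card (internal (coinc g1) {p1<..<q1}) + 2 = card (internal (coinc g) {p<..<q})"
      "card (mixed (coinc g1) {p1<..<q1}) \<le> 2 * card (mixed (coinc g) {p<..<q}) + 1"
      using halve[OF less.prems False] by blast
    obtain g' p' q' where 2: "isotopic3 (path_image g1) (path_image g')" "split_diagram g' p' q'"
      "internal (coinc g') {p'<..<q'} = {}"
      "card (mixed (coinc g') {p'<..<q'}) + 1 \<le> 2 ^ (card (internal (coinc g1) {p1<..<q1}) div 2) * (card (mixed (coinc g1) {p1<..<q1}) + 1)"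
      using less.hyps[OF _ 1(2)] 1(3) by auto
    have d: "card (internal (coinc g) {p<..<q}) div 2 = Suc (card (internal (coinc g1) {p1<..<q1}) div 2)" using 1(3) by simp
    note 2(4)
    also have "2 ^ (card (internal (coinc g1) {p1<..<q1}) div 2) * (card (mixed (coinc g1) {p1<..<q1}) + 1) \<le>
        2 ^ (card (internal (coinc g1) {p1<..<q1}) div 2) * (2 * (card (mixed (coinc g) {p<..<q}) + 1))"
      using 1(4) by (intro mult_left_mono) auto
    also have "\<dots> = 2 ^ (card (internal (coinc g) {p<..<q}) div 2) * (card (mixed (coinc g) {p<..<q}) + 1)"
      unfolding d by simp
    finally show ?thesis using 2 isotopic3_trans[OF 1(1) 2(1)] by blast
  qed
qed

section \<open>Rotation and straight words\<close>

text \<open>The first half meets every crossing for the first time, which gives the labels 1 to n in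
  order; the second half meets the same crossings once more, in an order that defines the
  permutation.\<close>

lemma straight_word_labels:
  assumes d1: "distinct P1" and d2: "distinct P2" and s: "set P2 = set P1" and n: "length P1 = n"
  shows "straight_word n (map (label_of (P1 @ P2)) (P1 @ P2))"
proof -
  let ?lab = "label_of (P1 @ P2)"
  have lab: "?lab (P1 ! i) = Suc i" if i: "i < n" for i
  proof -
    have "takeWhile (\<lambda>q. q \<noteq> P1 ! i) (P1 @ P2) = takeWhile (\<lambda>q. q \<noteq> P1 ! i) P1"
      by (rule takeWhile_append1[of "P1 ! i"]) (use i n in auto)
    also have "\<dots> = take i P1"
      by (rule takeWhile_eq_take_P_nth) (use i n d1 in \<open>auto simp: nth_eq_iff_index_eq\<close>)
    finally show ?thesis unfolding label_of_def using d1 i n by (simp add: distinct_card)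
  qed
  have n2: "length P2 = n" using d1 d2 s n distinct_card by metis
  have ix: "\<exists>i<n. x = P1 ! i" if "x \<in> set P1" for x using that n by (auto simp: in_set_conv_nth)
  have lab1: "map ?lab P1 = [1..<Suc n]" by (rule nth_equalityI) (use n lab in \<open>auto simp del: upt_Suc\<close>)
  have lab_inj: "x = y" if xy: "x \<in> set P1" "y \<in> set P1" "?lab x = ?lab y" for x y
  proof -
    obtain i j where "i < n" "x = P1 ! i" "j < n" "y = P1 ! j" using ix[OF xy(1)] ix[OF xy(2)] by blast
    then show ?thesis using xy(3) lab by simp
  qed
  have lab_range: "?lab x \<in> {1..n}" if "x \<in> set P1" for x using ix[OF that] lab by auto
  \<comment> \<open>The shift by 1 translates labels, which start from 1, into list positions;
    outside the labels a permutation has to be the identity.\<close>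
  define \<sigma> where "\<sigma> = (\<lambda>j. if j \<in> {1..n} then ?lab (P2 ! (j - 1)) else j)"
  have P2in: "P2 ! (j - 1) \<in> set P1" if "j \<in> {1..n}" for j
  proof -
    have "j - 1 < length P2" using that n2 by auto
    from nth_mem[OF this] show ?thesis unfolding s .
  qed
  have "inj_on \<sigma> {1..n}"
  proof (rule inj_onI)
    fix i j assume ij: "i \<in> {1..n}" "j \<in> {1..n}" "\<sigma> i = \<sigma> j"
    then have "P2 ! (i - 1) = P2 ! (j - 1)" using lab_inj[OF P2in[OF ij(1)] P2in[OF ij(2)]] by (simp add: \<sigma>_def)
    then have "i - 1 = j - 1" using d2 n2 ij(1,2) by (subst (asm) nth_eq_iff_index_eq) auto
    then show "i = j" using ij(1,2) by auto
  qed
  moreover have "\<sigma> ` {1..n} \<subseteq> {1..n}" using lab_range[OF P2in] by (auto simp: \<sigma>_def)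
  ultimately have "bij_betw \<sigma> {1..n} {1..n}" unfolding bij_betw_def using endo_inj_surj by blast
  then have perm: "\<sigma> permutes {1..n}" by (rule bij_imp_permutes) (simp only: \<sigma>_def if_False)
  have "map ?lab P2 = map \<sigma> [1..<Suc n]" by (rule nth_equalityI) (use n2 in \<open>auto simp: \<sigma>_def simp del: upt_Suc\<close>)
  then show ?thesis unfolding straight_word_def using perm lab1 by auto
qed

section \<open>Change of the starting point\<close>

text \<open>The time of the original loop that \<open>shiftpath c\<close> visits at time
  \<open>b\<close>, reduced to the half-open range. \<open>shiftpath\<close> itself takes time 1 and
  not 0 at the seam, which makes no difference on a closed path.\<close>

definition unrot :: "real \<Rightarrow> real \<Rightarrow> real" where
  "unrot c b = (if c + b < 1 then c + b else c + b - 1)"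

lemma unrot_range: "c \<in> {0..<1} \<Longrightarrow> b \<in> {0..<1} \<Longrightarrow> unrot c b \<in> {0..<1}"
  by (auto simp: unrot_def)

lemma unrot_inj: "c \<in> {0..<1} \<Longrightarrow> a \<in> {0..<1} \<Longrightarrow> b \<in> {0..<1} \<Longrightarrow> unrot c a = unrot c b \<Longrightarrow> a = b"
  by (auto simp: unrot_def split: if_splits)

lemma unrot_surj:
  assumes "c \<in> {0..<1}" "a \<in> {0..<1}"
  shows "\<exists>b\<in>{0..<1}. unrot c b = a"
proof (cases "c \<le> a")
  case True then show ?thesis using assms by (intro bexI[of _ "a - c"]) (auto simp: unrot_def)
next
  case False then show ?thesis using assms by (intro bexI[of _ "a - c + 1"]) (auto simp: unrot_def)
qed

lemma shiftpath_unrot: "g 1 = g 0 \<Longrightarrow> shiftpath c g b = g (unrot c b)"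
  by (cases "c + b = 1") (auto simp: unrot_def shiftpath_def)

lemma coinc_shiftpath:
  assumes "g 1 = g 0" "c \<in> {0..<1}"
  shows "(a, b) \<in> coinc (shiftpath c g) \<longleftrightarrow> a \<in> {0..<1} \<and> b \<in> {0..<1} \<and> (unrot c a, unrot c b) \<in> coinc g"
  unfolding coinc_def shadow_def shiftpath_unrot[of g, OF assms(1)]
  using unrot_range[OF assms(2)] unrot_inj[OF assms(2)] by auto

lemma coinc_shiftpath_inj:
  assumes "g 1 = g 0" "c \<in> {0..<1}"
  defines "f \<equiv> \<lambda>z. (unrot c (fst z), unrot c (snd z))"
  shows "f ` coinc (shiftpath c g) \<subseteq> coinc g" "inj_on f (coinc (shiftpath c g))"
proof -
  note co = coinc_shiftpath[of g, OF assms(1,2)]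
  show "f ` coinc (shiftpath c g) \<subseteq> coinc g"
  proof
    fix y assume "y \<in> f ` coinc (shiftpath c g)"
    then obtain z where z: "z \<in> coinc (shiftpath c g)" "y = f z" by blast
    then show "y \<in> coinc g" using co[of "fst z" "snd z"] unfolding f_def by simp
  qed
  show "inj_on f (coinc (shiftpath c g))"
  proof (rule inj_onI)
    fix y z assume yz: "y \<in> coinc (shiftpath c g)" "z \<in> coinc (shiftpath c g)" "f y = f z"
    have "fst y \<in> {0..<1} \<and> snd y \<in> {0..<1}" "fst z \<in> {0..<1} \<and> snd z \<in> {0..<1}"
      using co[of "fst y" "snd y"] co[of "fst z" "snd z"] yz by simp_all
    then show "y = z"
      using unrot_inj[OF assms(2), of "fst y" "fst z"] unrot_inj[OF assms(2), of "snd y" "snd z"] yz(3)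
      unfolding f_def by (simp add: prod_eq_iff)
  qed
qed

lemma eventually_at_shift:
  fixes t d :: real
  assumes "\<forall>\<^sub>F s in at (t + d). P s"
  shows "\<forall>\<^sub>F s in at t. P (s + d)"
proof -
  obtain e where e: "e > 0" "\<And>s. s \<noteq> t + d \<Longrightarrow> dist s (t + d) < e \<Longrightarrow> P s"
    using assms unfolding eventually_at by auto
  have "P (s + d)" if "s \<noteq> t" "dist s t < e" for s
    by (rule e(2)) (use that in \<open>auto simp: dist_real_def\<close>)
  then show ?thesis unfolding eventually_at using e(1) by auto
qed

lemma shiftpath_local:
  assumes c: "c \<in> {0..<1}" and b: "b \<in> {0<..<1}" "b \<noteq> 1 - c"
  shows "\<exists>U d. open U \<and> b \<in> U \<and> (\<forall>x\<in>U. shiftpath c g x = g (x + d)) \<and> unrot c b = b + d"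
proof (cases "b < 1 - c")
  case True
  show ?thesis by (intro exI[of _ "{..<1 - c}"] exI[of _ c]) (use True in \<open>auto simp: shiftpath_def unrot_def add.commute\<close>)
next
  case False
  show ?thesis by (intro exI[of _ "{1 - c<..}"] exI[of _ "c - 1"]) (use False b in \<open>auto simp: shiftpath_def unrot_def algebra_simps\<close>)
qed

lemma knot_diagram_shiftpath:
  assumes kd: "knot_diagram g" and c: "c \<in> {0..<1}" and nc: "c \<notin> crossing_times g"
  shows "knot_diagram (shiftpath c g)"
  unfolding knot_diagram_iff
proof (intro conjI allI impI)
  note kD = knot_diagramD[OF kd]
  note co = coinc_shiftpath[of g, OF kD(2) c]
  let ?h = "shiftpath c g"
  obtain B where B: "finite B" "\<And>t. t \<in> {0<..<1} - B \<Longrightarrow> \<exists>v. \<forall>\<^sub>F s in at t. g s = g t + (s - t) *\<^sub>R v" and pg: "path g"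
    using kD(1) unfolding piecewise_linear_path_def by blast
  have ph: "path ?h" by (rule path_shiftpath[OF pg]) (use kD(2) c in \<open>auto simp: pathfinish_def pathstart_def\<close>)
  \<comment> \<open>The old base point may be a corner of the loop, and it becomes an inner time
    \<open>1 - c\<close> of the shifted path. The other exceptions are the old breaks, shifted by
    \<open>- c\<close> or by \<open>1 - c\<close>.\<close>
  have loc: "\<exists>v. \<forall>\<^sub>F s in at t. ?h s = ?h t + (s - t) *\<^sub>R v"
    if t: "t \<in> {0<..<1} - ({1 - c} \<union> (\<lambda>x. x - c) ` insert 0 B \<union> (\<lambda>x. x - c + 1) ` insert 0 B)" for t
  proof -
    have t01: "t \<in> {0<..<1}" "t \<noteq> 1 - c" using t by auto
    obtain U d where U: "open U" "t \<in> U" "\<forall>x\<in>U. ?h x = g (x + d)" and d: "unrot c t = t + d"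
      using shiftpath_local[OF c t01, of g] by blast
    have "unrot c t \<noteq> x" if "x \<in> insert 0 B" for x
    proof
      assume "unrot c t = x"
      then have "t = x - c \<or> t = x - c + 1" unfolding unrot_def by (auto split: if_splits)
      then show False using t that by blast
    qed
    moreover have "unrot c t \<in> {0..<1}" by (rule unrot_range[OF c]) (use t01 in auto)
    ultimately have "unrot c t \<in> {0<..<1} - B" by force
    then obtain v where "\<forall>\<^sub>F s in at (t + d). g s = g (t + d) + (s - (t + d)) *\<^sub>R v" using B(2) d by metis
    from eventually_at_shift[OF this] have "\<forall>\<^sub>F s in at t. g (s + d) = g (t + d) + (s - t) *\<^sub>R v" by simp
    moreover have "\<forall>\<^sub>F s in at t. s \<in> U" using U(1,2) eventually_at_topological by blast
    ultimately have "\<forall>\<^sub>F s in at t. ?h s = ?h t + (s - t) *\<^sub>R v"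
      by eventually_elim (simp add: U(2,3))
    then show ?thesis by blast
  qed
  have fin: "finite ({1 - c} \<union> (\<lambda>x. x - c) ` insert 0 B \<union> (\<lambda>x. x - c + 1) ` insert 0 B)" using B(1) by simp
  show "piecewise_linear_path ?h" unfolding piecewise_linear_path_def
    by (intro conjI ph exI[of _ "{1 - c} \<union> (\<lambda>x. x - c) ` insert 0 B \<union> (\<lambda>x. x - c + 1) ` insert 0 B"] ballI fin loc)
  show "?h 1 = ?h 0" using kD(2) c by (auto simp: shiftpath_def)
  show "finite (coinc ?h)"
    by (rule finite_imageD[OF finite_subset[OF coinc_shiftpath_inj(1)[OF kD(2) c] kD(3)] coinc_shiftpath_inj(2)[OF kD(2) c]])
  show "single_valued (coinc ?h)"
  proof (rule single_valuedI)
    fix x y y' assume "(x, y) \<in> coinc ?h" "(x, y') \<in> coinc ?h"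
    then have "y \<in> {0..<1}" "y' \<in> {0..<1}" "(unrot c x, unrot c y) \<in> coinc g" "(unrot c x, unrot c y') \<in> coinc g"
      unfolding co by blast+
    then show "y = y'" using kD(5) unrot_inj[OF c] by blast
  qed
  have nz: "a \<in> {0<..<1} \<and> a \<noteq> 1 - c" if "(a, b) \<in> coinc ?h" for a b
  proof -
    have h: "a \<in> {0..<1}" "(unrot c a, unrot c b) \<in> coinc g" using that unfolding co by blast+
    have "unrot c a \<in> crossing_times g" unfolding crossing_times_eq using h(2) by (rule DomainI)
    then have "unrot c a \<noteq> c" using nc by metis
    moreover have "unrot c a \<noteq> 0" using kD(7)[OF h(2)] by force
    ultimately show ?thesis using h(1) c unfolding unrot_def by (auto split: if_splits)
  qed
  fix a b assume ab: "(a, b) \<in> coinc ?h"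
  have ba: "(b, a) \<in> coinc ?h" using ab coinc_sym by blast
  have g: "(unrot c a, unrot c b) \<in> coinc g" using ab unfolding co by blast
  show "a \<noteq> 0" using nz[OF ab] by auto
  show "?h a \<noteq> ?h b" using kD(8)[OF g] unfolding shiftpath_unrot[of g, OF kD(2)] by blast
  have d: "(shadow ?h has_vector_derivative v) (at a)"
    if a: "a \<in> {0<..<1} \<and> a \<noteq> 1 - c" and v: "(shadow g has_vector_derivative v) (at (unrot c a))" for a v
  proof -
    obtain U d where U: "open U" "a \<in> U" "\<forall>x\<in>U. ?h x = g (x + d)" and d: "unrot c a = a + d"
      using shiftpath_local[OF c conjunct1[OF a] conjunct2[OF a], of g] by blast
    have "((\<lambda>x. x + d) has_real_derivative (1 + 0)) (at a)" by (rule DERIV_add) (auto intro: DERIV_ident)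
    then have "((\<lambda>x. x + d) has_vector_derivative 1) (at a)" by (simp add: has_real_derivative_iff_has_vector_derivative)
    from vector_diff_chain_at[OF this] v[unfolded d] have "((shadow g \<circ> (\<lambda>x. x + d)) has_vector_derivative 1 *\<^sub>R v) (at a)" by blast
    then have 1: "((shadow g \<circ> (\<lambda>x. x + d)) has_vector_derivative v) (at a)" by simp
    show ?thesis by (rule has_vector_derivative_transform_within_open[OF 1 U(1,2)]) (simp add: shadow_def U(3))
  qed
  show "transverse ?h a b" using kD(8)[OF g] d[OF nz[OF ab]] d[OF nz[OF ba]] unfolding transverse_def by blast
qed

text \<open>Started at \<open>p\<close>, the diagram is traversed along the arc from
  \<open>p\<close> to \<open>q\<close> and then along the complementary arc. Neither arc has
  self-crossings, so each crossing is met once on each of them, and the word is straight.\<close>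

lemma straight_of_split:
  assumes sd: "split_diagram g p q" and ni: "internal (coinc g) {p<..<q} = {}"
  shows "straight_diagram g" "num_crossings g = card (mixed (coinc g) {p<..<q})"
proof -
  note kd = sd[unfolded split_diagram_def]
  have kdg: "knot_diagram g" and pq: "0 \<le> p" "p < q" "q \<le> 1" and npq: "p \<notin> crossing_times g" "q \<notin> crossing_times g"
    and AA: "\<And>a b. (a, b) \<in> coinc g \<Longrightarrow> a \<in> {p<..<q} \<or> b \<in> {p<..<q}" using kd by blast+
  note kD = knot_diagramD[OF kdg]
  let ?X = "mixed (coinc g) {p<..<q}"
  have one: "a \<in> {p<..<q} \<longleftrightarrow> b \<notin> {p<..<q}" if "(a, b) \<in> coinc g" for a b
    using AA[OF that] ni that unfolding internal_def by blast
  have coX: "coinc g = ?X \<union> ?X\<inverse>"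
  proof (rule set_eqI)
    fix z :: "real \<times> real" obtain a b where z: "z = (a, b)" by (cases z)
    show "z \<in> coinc g \<longleftrightarrow> z \<in> ?X \<union> ?X\<inverse>"
      unfolding z mixed_def using one[of a b] coinc_sym[of a b g] by blast
  qed
  have finX: "finite ?X" by (rule finite_mixed[OF kD(3)])
  have "?X \<inter> ?X\<inverse> = {}" unfolding mixed_def by blast
  then have "card (coinc g) = card ?X + card (?X\<inverse>)"
    using card_Un_disjoint[OF finX] finX coX by (metis finite_converse)
  then have "card (coinc g) = 2 * card ?X" by simp
  then show num: "num_crossings g = card ?X" using card_coinc[OF kdg] by simp
  have p01: "p \<in> {0..<1}" using pq by auto
  let ?h = "shiftpath p g"
  have kdh: "knot_diagram ?h" by (rule knot_diagram_shiftpath[OF kdg p01 npq(1)])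
  note kH = knot_diagramD[OF kdh]
  note co = coinc_shiftpath[of g, OF kD(2) p01]
  define r where "r = q - p"
  let ?C = "crossing_times ?h"
  have C: "b \<in> ?C \<Longrightarrow> b \<in> {0..<1} \<and> unrot p b \<in> crossing_times g" for b
    unfolding crossing_times_eq using co by blast
  \<comment> \<open>The rotated times below \<open>r\<close> are those on the arc. The seam and the
    end \<open>q\<close> are not crossing times, so no boundary case occurs.\<close>
  have CI: "b < r \<longleftrightarrow> unrot p b \<in> {p<..<q}" and Cr: "b \<noteq> r" if b: "b \<in> ?C" for b
  proof -
    have b01: "b \<in> {0<..<1}" using b kH(7) unfolding crossing_times_eq by blast
    have c: "unrot p b \<in> crossing_times g" using C[OF b] by blast
    have "unrot p b \<noteq> 0" using c kD(7) unfolding crossing_times_eq by force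
    moreover have "unrot p b \<noteq> q" using c npq by blast
    ultimately show "b \<noteq> r" using b01 pq unfolding unrot_def r_def by (auto split: if_splits)
    then show "b < r \<longleftrightarrow> unrot p b \<in> {p<..<q}" using b01 pq unfolding unrot_def r_def by (auto split: if_splits)
  qed
  have oneh: "a < r \<longleftrightarrow> \<not> b < r" if ab: "(a, b) \<in> coinc ?h" for a b
  proof -
    have "(b, a) \<in> coinc ?h" using ab coinc_sym by blast
    then have "a \<in> ?C" "b \<in> ?C" using ab unfolding crossing_times_eq by blast+
    moreover have "(unrot p a, unrot p b) \<in> coinc g" using ab unfolding co by blast
    ultimately show ?thesis using CI one by blast
  qed
  define C1 where "C1 = {b \<in> ?C. b < r}"
  define C2 where "C2 = {b \<in> ?C. \<not> b < r}"
  have fin12: "finite C1" "finite C2" and C12: "?C = C1 \<union> C2" using kH(4) unfolding C1_def C2_def by auto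
  define L1 where "L1 = sorted_list_of_set C1"
  define L2 where "L2 = sorted_list_of_set C2"
  have sets: "set L1 = C1" "set L2 = C2" unfolding L1_def L2_def using fin12 by simp_all
  have L: "sorted_list_of_set ?C = L1 @ L2"
  proof (rule sorted_distinct_set_unique)
    have "sorted L1" "sorted L2" unfolding L1_def L2_def by simp_all
    then show "sorted (L1 @ L2)" unfolding sorted_append sets C1_def C2_def by auto
    have "distinct L1" "distinct L2" unfolding L1_def L2_def by simp_all
    then show "distinct (L1 @ L2)" unfolding distinct_append sets C1_def C2_def by auto
    show "set (sorted_list_of_set ?C) = set (L1 @ L2)" using kH(4) C12 sets by simp
  qed simp_all
  let ?s = "shadow ?h"
  have C01: "C1 \<subseteq> {0..<1}" "C2 \<subseteq> {0..<1}" using C unfolding C1_def C2_def by blast+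
  have inj1: "inj_on ?s C1"
  proof (rule inj_onI, rule ccontr)
    fix a b assume ab: "a \<in> C1" "b \<in> C1" "?s a = ?s b" "a \<noteq> b"
    have "(a, b) \<in> coinc ?h" by (rule coincI) (use ab C01 in blast)+
    then show False using oneh ab unfolding C1_def by blast
  qed
  have inj2: "inj_on ?s C2"
  proof (rule inj_onI, rule ccontr)
    fix a b assume ab: "a \<in> C2" "b \<in> C2" "?s a = ?s b" "a \<noteq> b"
    have "(a, b) \<in> coinc ?h" by (rule coincI) (use ab C01 in blast)+
    then show False using oneh ab unfolding C2_def by blast
  qed
  have img: "?s ` C2 = ?s ` C1"
  proof
    show "?s ` C2 \<subseteq> ?s ` C1"
    proof
      fix z assume "z \<in> ?s ` C2"
      then obtain b where b: "b \<in> C2" "z = ?s b" by blast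
      then obtain a where ab: "(b, a) \<in> coinc ?h" unfolding C2_def crossing_times_eq by blast
      then have "a < r" using oneh[OF ab] b unfolding C2_def by blast
      moreover have "a \<in> ?C" unfolding crossing_times_eq using ab coinc_sym by blast
      ultimately show "z \<in> ?s ` C1" unfolding C1_def b(2) coincD(4)[OF ab] by blast
    qed
    show "?s ` C1 \<subseteq> ?s ` C2"
    proof
      fix z assume "z \<in> ?s ` C1"
      then obtain b where b: "b \<in> C1" "z = ?s b" by blast
      then obtain a where ab: "(b, a) \<in> coinc ?h" unfolding C1_def crossing_times_eq by blast
      then have "\<not> a < r" using oneh[OF ab] b unfolding C1_def by blast
      moreover have "a \<in> ?C" unfolding crossing_times_eq using ab coinc_sym by blast
      ultimately show "z \<in> ?s ` C2" unfolding C2_def b(2) coincD(4)[OF ab] by blast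
    qed
  qed
  have "bij_betw (unrot p) C1 (fst ` ?X)"
  proof -
    have "inj_on (unrot p) C1" by (rule inj_onI) (use unrot_inj[OF p01] C01 in blast)
    moreover have "unrot p ` C1 = fst ` ?X"
    proof (rule set_eqI)
      fix a
      have "a \<in> fst ` ?X \<longleftrightarrow> a \<in> {p<..<q} \<and> a \<in> crossing_times g"
        unfolding mixed_def crossing_times_eq using one by force
      also have "\<dots> \<longleftrightarrow> a \<in> unrot p ` C1"
      proof
        assume a: "a \<in> {p<..<q} \<and> a \<in> crossing_times g"
        then obtain a' where aa: "(a, a') \<in> coinc g" unfolding crossing_times_eq by blast
        obtain b where b: "b \<in> {0..<1}" "unrot p b = a" using unrot_surj[OF p01 coincD(1)[OF aa]] by blast
        obtain b' where b': "b' \<in> {0..<1}" "unrot p b' = a'" using unrot_surj[OF p01 coincD(2)[OF aa]] by blast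
        have "(b, b') \<in> coinc ?h" unfolding co using aa b b' by simp
        then have bC: "b \<in> ?C" unfolding crossing_times_eq by blast
        then show "a \<in> unrot p ` C1" using CI[OF bC] a b(2) unfolding C1_def by blast
      next
        assume "a \<in> unrot p ` C1"
        then show "a \<in> {p<..<q} \<and> a \<in> crossing_times g" using CI C unfolding C1_def by blast
      qed
      finally show "a \<in> unrot p ` C1 \<longleftrightarrow> a \<in> fst ` ?X" by blast
    qed
    ultimately show ?thesis unfolding bij_betw_def by blast
  qed
  then have "card C1 = card (fst ` ?X)" by (rule bij_betw_same_card)
  also have "\<dots> = card ?X"
  proof (rule card_image, rule inj_onI)
    fix y z :: "real \<times> real" assume yz: "y \<in> ?X" "z \<in> ?X" "fst y = fst z"
    then have "(fst y, snd y) \<in> coinc g" "(fst y, snd z) \<in> coinc g" unfolding mixed_def by auto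
    then show "y = z" using kD(5) yz(3) by (intro prod_eqI) auto
  qed
  finally have cC: "card C1 = card ?X" .
  have "straight_word (card ?X) (map (label_of (map ?s L1 @ map ?s L2)) (map ?s L1 @ map ?s L2))"
  proof (rule straight_word_labels)
    show "distinct (map ?s L1)" "distinct (map ?s L2)"
      unfolding distinct_map sets using inj1 inj2 by (simp_all add: L1_def L2_def)
    show "set (map ?s L2) = set (map ?s L1)" unfolding set_map sets by (rule img)
    show "length (map ?s L1) = card ?X" unfolding cC[symmetric] by (simp add: L1_def)
  qed
  then have sw: "straight_word (num_crossings g) (knot_word ?h)"
    unfolding knot_word_def crossing_sequence_def L num by simp
  show "straight_diagram g" unfolding straight_diagram_def
    by (intro conjI kdg bexI[of _ p] bexI[of _ ?h] sw) (use p01 npq in auto)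
qed

section \<open>Over-arcs and loops\<close>

text \<open>The triangle stands in the vertical wall over the segment from \<open>a\<close> to
  \<open>b\<close>, with one vertex above \<open>a\<close> and two above \<open>b\<close>. So below
  each of its points there is a point of the segment, and nothing that passes under the segment can
  meet the triangle. The remaining conclusions locate the points over the two ends.\<close>

lemma wall_hull:
  fixes a b :: space3
  assumes x: "x \<in> convex hull {a1, b1, b2}" and ab: "fst a \<noteq> fst b"
    and f: "fst a1 = fst a" "fst b1 = fst b" "fst b2 = fst b"
    and s: "snd a \<le> snd a1" "snd b \<le> snd b1" "snd b \<le> snd b2"
  shows "\<exists>p\<in>closed_segment a b. fst p = fst x \<and> snd p \<le> snd x"
    and "fst x = fst a \<Longrightarrow> x = a1"
    and "fst x = fst b \<Longrightarrow> x \<in> closed_segment b1 b2"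
proof -
  obtain \<alpha> \<beta> \<gamma> where h: "x = \<alpha> *\<^sub>R a1 + \<beta> *\<^sub>R b1 + \<gamma> *\<^sub>R b2" "0 \<le> \<alpha>" "0 \<le> \<beta>" "0 \<le> \<gamma>" "\<alpha> + \<beta> + \<gamma> = 1"
    using x unfolding convex_hull_3 by (simp only: mem_Collect_eq) (elim exE conjE, erule that)
  have al: "1 - \<alpha> = \<beta> + \<gamma>" using h(5) by simp
  have fx: "fst x = (1 - \<alpha>) *\<^sub>R fst b + \<alpha> *\<^sub>R fst a"
    unfolding al by (simp add: h(1) f algebra_simps)
  show "\<exists>p\<in>closed_segment a b. fst p = fst x \<and> snd p \<le> snd x"
  proof (rule bexI[of _ "(1 - \<alpha>) *\<^sub>R b + \<alpha> *\<^sub>R a"], intro conjI)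
    show "fst ((1 - \<alpha>) *\<^sub>R b + \<alpha> *\<^sub>R a) = fst x" by (simp add: fx)
    have "snd ((1 - \<alpha>) *\<^sub>R b + \<alpha> *\<^sub>R a) = \<alpha> * snd a + \<beta> * snd b + \<gamma> * snd b"
      unfolding al by (simp add: algebra_simps)
    also have "\<dots> \<le> \<alpha> * snd a1 + \<beta> * snd b1 + \<gamma> * snd b2"
      by (intro add_mono mult_left_mono s h(2-4))
    finally show "snd ((1 - \<alpha>) *\<^sub>R b + \<alpha> *\<^sub>R a) \<le> snd x" by (simp add: h(1))
    have "(1 - \<alpha>) *\<^sub>R b + \<alpha> *\<^sub>R a \<in> closed_segment b a" unfolding in_segment using h by (intro exI[of _ \<alpha>]) auto
    then show "(1 - \<alpha>) *\<^sub>R b + \<alpha> *\<^sub>R a \<in> closed_segment a b" by (simp add: closed_segment_commute)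
  qed
  show "x = a1" if e: "fst x = fst a"
  proof -
    have "(1 - \<alpha>) *\<^sub>R (fst a - fst b) = 0" using fx e by (simp add: algebra_simps)
    then have "\<alpha> = 1" using ab by simp
    moreover from this have "\<beta> = 0" "\<gamma> = 0" using h by auto
    ultimately show ?thesis using h(1) by simp
  qed
  show "x \<in> closed_segment b1 b2" if e: "fst x = fst b"
  proof -
    have "\<alpha> *\<^sub>R (fst a - fst b) = 0" using fx e by (auto simp: algebra_simps)
    then have "\<alpha> = 0" using ab by auto
    then have "\<beta> = 1 - \<gamma>" using h by auto
    then show ?thesis unfolding in_segment using h \<open>\<alpha> = 0\<close> by (intro exI[of _ \<gamma>]) auto
  qed
qed

lemma wall_noncollinear:
  fixes a b c :: space3
  assumes "fst a \<noteq> fst b" "fst c = fst b" "snd c \<noteq> snd b"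
  shows "\<not> collinear {a, b, c}"
proof
  assume "collinear {a, b, c}"
  then have "collinear {0, a - b, c - b}"
    by (subst (asm) insert_commute, subst (asm) collinear_3) auto
  then consider "a - b = 0" | "c - b = 0" | k where "c - b = k *\<^sub>R (a - b)"
    unfolding collinear_lemma by blast
  then show False
  proof cases
    case 3
    then have "k *\<^sub>R (fst a - fst b) = 0" "snd c - snd b = k * (snd a - snd b)"
      using assms(2) by (metis fst_diff fst_scaleR right_minus_eq, metis snd_diff snd_scaleR real_scaleR_def)
    then show ?thesis using assms by auto
  qed (use assms in auto)
qed

section \<open>Broken lines with simple projection\<close>

fun chain :: "space3 list \<Rightarrow> space3 set" where
  "chain (a # b # L) = closed_segment a b \<union> chain (b # L)"
| "chain [a] = {a}"
| "chain [] = {}"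

text \<open>Injectivity of the projection in a form suited to induction: no edge is vertical, and
  each edge meets the rest of the broken line in the projection only at the common vertex.\<close>

fun simple_chain :: "space3 list \<Rightarrow> bool" where
  "simple_chain (a # b # L) \<longleftrightarrow> fst a \<noteq> fst b \<and> fst ` closed_segment a b \<inter> fst ` chain (b # L) \<subseteq> {fst b} \<and>
     simple_chain (b # L)"
| "simple_chain _ \<longleftrightarrow> True"

lemma chain_hd_last: "a \<in> chain (a # L)" "last (a # L) \<in> chain (a # L)"
  by (induction L arbitrary: a) auto

lemma polyhedral_chain: "polyhedral (chain L)"
proof (induction L rule: chain.induct)
  case (2 a)
  have "chain [a] = closed_segment a a" by simp
  then show ?case by (metis polyhedral_segment)
qed auto

lemma simple_chainD:
  assumes "simple_chain (a # b # L)" "x \<in> closed_segment a b" "y \<in> chain (b # L)" "fst x = fst y"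
  shows "fst x = fst b"
proof -
  have "fst x \<in> fst ` closed_segment a b" "fst x \<in> fst ` chain (b # L)"
    using assms(2) imageI[OF assms(3), of fst] assms(4) by auto
  then show ?thesis using assms(1) by auto
qed

lemma simple_chain_last:
  assumes "simple_chain (a # b # L)"
  shows "fst (last (a # b # L)) \<noteq> fst a"
proof
  assume e: "fst (last (a # b # L)) = fst a"
  have "fst a = fst b"
    by (rule simple_chainD[OF assms, of _ "last (b # L)"]) (use chain_hd_last e in auto)
  then show False using assms by simp
qed

definition at_height :: "real \<Rightarrow> space3 \<Rightarrow> space3" where "at_height h p = (fst p, h)"

lemma at_height_simps [simp]: "fst (at_height h p) = fst p" "snd (at_height h p) = h"
  by (simp_all add: at_height_def)

lemma at_height_segment: "at_height h ` closed_segment a b = closed_segment (at_height h a) (at_height h b)"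
proof -
  have "closed_segment (at_height h a) (at_height h b) = (\<lambda>p. (0, h) + p) ` closed_segment (fst a, 0) (fst b, 0)"
    unfolding closed_segment_translation[symmetric] by (simp add: at_height_def)
  also have "closed_segment (fst a, 0::real) (fst b, 0) = (\<lambda>p. (fst p, 0)) ` closed_segment a b"
    by (subst closed_segment_linear_image[of "\<lambda>p. (fst p, 0)"]) (auto simp: linear_iff)
  finally show ?thesis by (simp add: image_image at_height_def)
qed

lemma chain_at_height: "chain (map (at_height h) L) = at_height h ` chain L"
  by (induction L rule: chain.induct) (simp_all add: at_height_segment image_Un)

lemma segment_vertical:
  fixes a b :: space3
  assumes "fst a = fst b" "x \<in> closed_segment a b"
  shows "fst x = fst b"
  using assms(2) unfolding in_segment by (elim exE conjE) (simp add: assms(1) scaleR_left_diff_distrib)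

text \<open>The arc is raised edge by edge; it arrives at height \<open>h\<close> together with vertical segments at its ends.\<close>

lemma walls:
  fixes X :: "space3 set"
  assumes "polyhedral X" "simple_chain (a # b # L)" "\<And>p. p \<in> chain (a # b # L) \<Longrightarrow> snd p < h"
    and "\<And>x p. x \<in> X \<Longrightarrow> p \<in> chain (a # b # L) \<Longrightarrow> fst x = fst p \<Longrightarrow>
      snd x < snd p \<or> fst x = fst a \<or> x = last (b # L)"
  shows "isotopic3 (X \<union> (closed_segment (at_height h a) b \<union> chain (b # L)))
    (X \<union> chain (map (at_height h) (a # b # L)) \<union> closed_segment (at_height h (last (b # L))) (last (b # L)))"
  using assms
proof (induction L arbitrary: X a b)
  case Nil
  let ?a = "at_height h a" and ?b = "at_height h b"
  have ab: "fst a \<noteq> fst b" using Nil(2) by simp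
  have hh: "snd a < h" "snd b < h" using Nil(3)[of a] Nil(3)[of b] by auto
  have "isotopic3 (X \<union> closed_segment ?a b) (X \<union> closed_segment ?a ?b \<union> closed_segment ?b b)"
  proof (rule isotopic3_triangle[OF Nil(1)])
    show "\<not> collinear {?a, b, ?b}" by (rule wall_noncollinear) (use ab hh in auto)
    show "X \<inter> convex hull {?a, b, ?b} \<subseteq> {?a, b}"
    proof
      fix x assume x: "x \<in> X \<inter> convex hull {?a, b, ?b}"
      note w = wall_hull[OF IntD2[OF x] ab at_height_simps(1) refl at_height_simps(1)]
      obtain p where p: "p \<in> closed_segment a b" "fst p = fst x" "snd p \<le> snd x"
        using w(1) hh by auto
      have "fst x = fst a \<or> x = b" using Nil(4)[of x p] x p by auto
      then show "x \<in> {?a, b}" using w(2) hh by auto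
    qed
  qed
  moreover have "X \<union> (closed_segment ?a b \<union> chain [b]) = X \<union> closed_segment ?a b"
    by auto
  moreover have "X \<union> chain (map (at_height h) [a, b]) \<union> closed_segment ?b b = X \<union> closed_segment ?a ?b \<union> closed_segment ?b b"
    by auto
  ultimately show ?case by simp
next
  case (Cons c L)
  let ?a = "at_height h a" and ?b = "at_height h b" and ?l = "last (b # c # L)"
  have ab: "fst a \<noteq> fst b" and sc: "simple_chain (b # c # L)" and bc: "fst c \<noteq> fst b" using Cons(3) by auto
  have lc: "?l \<in> chain (c # L)" using chain_hd_last(2)[of c L] by simp
  have lb: "fst ?l \<noteq> fst b" using simple_chain_last[OF sc] by simp
  have hh: "snd a < h" "snd b < h" "snd c < h" using Cons(4)[of a] Cons(4)[of b] Cons(4)[of c] chain_hd_last(1)[of c L] by auto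
  \<comment> \<open>Two triangle moves per edge: the slanted edge to \<open>b\<close> becomes a
    horizontal and a vertical edge, and the vertical edge together with the next edge of the arc
    becomes the slanted edge to \<open>c\<close>. The horizontal edge is then counted to the fixed
    part \<open>?X\<close>.\<close>
  let ?X = "X \<union> closed_segment ?a ?b"
  have "isotopic3 ((X \<union> chain (b # c # L)) \<union> closed_segment ?a b)
      ((X \<union> chain (b # c # L)) \<union> closed_segment ?a ?b \<union> closed_segment ?b b)"
  proof (rule isotopic3_triangle)
    show "polyhedral (X \<union> chain (b # c # L))" using Cons(2) polyhedral_chain by simp
    show "\<not> collinear {?a, b, ?b}" by (rule wall_noncollinear) (use ab hh in auto)
    show "(X \<union> chain (b # c # L)) \<inter> convex hull {?a, b, ?b} \<subseteq> {?a, b}"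
    proof
      fix x assume x: "x \<in> (X \<union> chain (b # c # L)) \<inter> convex hull {?a, b, ?b}"
      note w = wall_hull[OF IntD2[OF x] ab at_height_simps(1) refl at_height_simps(1)]
      obtain p where p: "p \<in> closed_segment a b" "fst p = fst x" "snd p \<le> snd x"
        using w(1) hh by auto
      show "x \<in> {?a, b}"
      proof (cases "x \<in> X")
        case True
        have "fst x = fst a \<or> x = ?l" using Cons(5)[OF True, of p] p by auto
        moreover have "x \<noteq> ?l"
        proof
          assume e: "x = ?l"
          have "fst p = fst b" by (rule simple_chainD[OF Cons(3) p(1), of ?l]) (use lc p(2) e in auto)
          then show False using lb e p(2) by simp
        qed
        ultimately show ?thesis using w(2) hh by auto
      next
        case False
        then have xc: "x \<in> chain (b # c # L)" using x by blast
        have "fst p = fst b" by (rule simple_chainD[OF Cons(3) p(1) xc p(2)])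
        then have xb: "fst x = fst b" using p(2) by simp
        have "x = b"
        proof (cases "x \<in> closed_segment b c")
          case True
          then obtain u where u: "x = (1 - u) *\<^sub>R b + u *\<^sub>R c" unfolding in_segment by blast
          then have "(1 - u) *\<^sub>R fst b + u *\<^sub>R fst c = fst b" using xb by simp
          then have "u *\<^sub>R (fst c - fst b) = 0" by (simp add: algebra_simps)
          then have "u = 0" using bc by simp
          then show ?thesis using u by simp
        next
          case False
          then have "x \<in> chain (c # L)" using xc by simp
          then have "fst b = fst c" by (intro simple_chainD[OF sc, of b x]) (use xb in auto)
          then show ?thesis using bc by simp
        qed
        then show ?thesis by simp
      qed
    qed
  qed
  also have "X \<union> chain (b # c # L) \<union> closed_segment ?a b = X \<union> (closed_segment ?a b \<union> chain (b # c # L))" by blast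
  also have "X \<union> chain (b # c # L) \<union> closed_segment ?a ?b \<union> closed_segment ?b b
      = (?X \<union> chain (c # L)) \<union> closed_segment ?b b \<union> closed_segment b c" by auto
  also have "isotopic3 \<dots> ((?X \<union> chain (c # L)) \<union> closed_segment ?b c)"
  proof (rule isotopic3_sym, rule isotopic3_triangle)
    show "polyhedral (?X \<union> chain (c # L))" using Cons(2) polyhedral_chain by simp
    have eq: "{?b, c, b} = {c, b, ?b}" by blast
    show "\<not> collinear {?b, c, b}" unfolding eq by (rule wall_noncollinear) (use bc hh in auto)
    show "(?X \<union> chain (c # L)) \<inter> convex hull {?b, c, b} \<subseteq> {?b, c}"
    proof
      fix x assume x: "x \<in> (?X \<union> chain (c # L)) \<inter> convex hull {?b, c, b}"
      then have xh: "x \<in> convex hull {c, b, ?b}" unfolding eq by blast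
      note w = wall_hull[OF xh bc refl refl at_height_simps(1)]
      obtain p where p: "p \<in> closed_segment b c" "fst p = fst x" "snd p \<le> snd x"
        using w(1) hh closed_segment_commute[of b c] by auto
      have pc: "p \<in> chain (b # c # L)" using p(1) by simp
      consider (X) "x \<in> X" | (ab) "x \<in> closed_segment ?a ?b" | (ch) "x \<in> chain (c # L)" using x by blast
      then show "x \<in> {?b, c}"
      proof cases
        case X
        have "fst x = fst a \<or> x = ?l" using Cons(5)[OF X, of p] p pc by auto
        moreover have "fst x \<noteq> fst a"
        proof
          assume e: "fst x = fst a"
          have "fst a = fst b" by (rule simple_chainD[OF Cons(3) _ pc]) (use e p(2) in auto)
          then show False using ab by simp
        qed
        ultimately have xl: "x = ?l" by auto
        have "fst p = fst c" by (rule simple_chainD[OF sc p(1) lc]) (use xl p(2) in simp)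
        then show ?thesis using w(2) hh p(2) by auto
      next
        case ab
        then obtain y where y: "y \<in> closed_segment a b" "x = at_height h y" unfolding at_height_segment[symmetric] by blast
        have "fst y = fst b" by (rule simple_chainD[OF Cons(3) y(1) pc]) (use y p(2) in simp)
        then show ?thesis using y(2) by (simp add: at_height_def)
      next
        case ch
        have "fst p = fst c" by (rule simple_chainD[OF sc p(1) ch p(2)])
        then show ?thesis using w(2) hh p(2) by auto
      qed
    qed
  qed
  also have "(?X \<union> chain (c # L)) \<union> closed_segment ?b c = ?X \<union> (closed_segment ?b c \<union> chain (c # L))" by blast
  also have "isotopic3 \<dots> (?X \<union> chain (map (at_height h) (b # c # L)) \<union>
      closed_segment (at_height h (last (c # L))) (last (c # L)))"
  proof (rule Cons.IH)
    show "polyhedral ?X" using Cons(2) by simp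
    show "simple_chain (b # c # L)" by (rule sc)
    show "snd p < h" if "p \<in> chain (b # c # L)" for p using Cons(4)[of p] that by simp
    fix x p assume xp: "x \<in> ?X" "p \<in> chain (b # c # L)" "fst x = fst p"
    \<comment> \<open>The exception for the vertical line through \<open>a\<close> is void on the
      remaining arc, whose projection does not return to that point. The vertical line through
      \<open>b\<close> takes over its role, on account of the new horizontal edge.\<close>
    have na: "fst x \<noteq> fst a"
    proof
      assume e: "fst x = fst a"
      have "fst a = fst b" by (rule simple_chainD[OF Cons(3) _ xp(2)]) (use e xp(3) in auto)
      then show False using ab by simp
    qed
    show "snd x < snd p \<or> fst x = fst b \<or> x = last (c # L)"
    proof (cases "x \<in> X")
      case True
      then show ?thesis using Cons(5)[OF True, of p] xp(2,3) na by auto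
    next
      case False
      then obtain y where y: "y \<in> closed_segment a b" "x = at_height h y" using xp(1) unfolding at_height_segment[symmetric] by blast
      have "fst y = fst b" by (rule simple_chainD[OF Cons(3) y(1) xp(2)]) (use y xp(3) in simp)
      then show ?thesis using y(2) by simp
    qed
  qed
  also have "?X \<union> chain (map (at_height h) (b # c # L)) = X \<union> chain (map (at_height h) (a # b # c # L))" by auto
  finally show ?case by simp
qed

section \<open>Cones over a planar arc\<close>

text \<open>Each point of the triangle is on a segment from the tip \<open>w\<close> to a point of
  the base, and its height determines its position on that segment.\<close>

lemma cone_point:
  assumes x: "x \<in> convex hull {w, a, b}" and s: "snd a = h" "snd b = h" "h < snd w"
  obtains p u where "p \<in> closed_segment a b" "0 \<le> u" "u \<le> 1" "x = (1 - u) *\<^sub>R w + u *\<^sub>R p" "snd x = (1 - u) * snd w + u * h"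
proof -
  obtain \<alpha> \<beta> \<gamma> where h: "x = \<alpha> *\<^sub>R w + \<beta> *\<^sub>R a + \<gamma> *\<^sub>R b" "0 \<le> \<alpha>" "0 \<le> \<beta>" "0 \<le> \<gamma>" "\<alpha> + \<beta> + \<gamma> = 1"
    using x unfolding convex_hull_3 by (simp only: mem_Collect_eq) (elim exE conjE, erule that)
  have u: "1 - (\<beta> + \<gamma>) = \<alpha>" using h(5) by simp
  have sx: "snd x = (1 - (\<beta> + \<gamma>)) * snd w + (\<beta> + \<gamma>) * h" unfolding u by (simp add: h(1) s algebra_simps)
  show ?thesis
  proof (cases "\<beta> + \<gamma> = 0")
    case True
    then have "\<beta> = 0" "\<gamma> = 0" using h by auto
    then show ?thesis by (intro that[of a 0]) (use h sx in auto)
  next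
    case False
    let ?p = "(1 - \<gamma> / (\<beta> + \<gamma>)) *\<^sub>R a + (\<gamma> / (\<beta> + \<gamma>)) *\<^sub>R b"
    have pos: "0 < \<beta> + \<gamma>" using False h by auto
    show ?thesis
    proof (rule that[of ?p "\<beta> + \<gamma>"])
      show "?p \<in> closed_segment a b" unfolding in_segment using h pos by (intro exI[of _ "\<gamma> / (\<beta> + \<gamma>)"]) auto
      have "(\<beta> + \<gamma>) * (1 - \<gamma> / (\<beta> + \<gamma>)) = \<beta>" "(\<beta> + \<gamma>) * (\<gamma> / (\<beta> + \<gamma>)) = \<gamma>" using pos by (auto simp: field_simps)
      then have "(\<beta> + \<gamma>) *\<^sub>R ?p = \<beta> *\<^sub>R a + \<gamma> *\<^sub>R b" unfolding scaleR_add_right scaleR_scaleR by simp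
      then show "x = (1 - (\<beta> + \<gamma>)) *\<^sub>R w + (\<beta> + \<gamma>) *\<^sub>R ?p" unfolding u by (simp add: h(1))
    qed (use h pos sx in auto)
  qed
qed

text \<open>At height \<open>h\<close> the arc is planar and lies above everything else, so coning it from a higher
  point \<open>w\<close> replaces it by two segments that depend only on its end points.\<close>

lemma cone_step:
  fixes a b w :: space3
  assumes X: "polyhedral X" and sc: "simple_chain (a # b # L)" and ht: "\<And>p. p \<in> chain (a # b # L) \<Longrightarrow> snd p = h"
    and w: "h < snd w"
    and Xh: "\<And>x. x \<in> X \<Longrightarrow> x \<in> convex hull {w, a, b} \<Longrightarrow> x = w \<or> x = last (b # L)"
  shows "isotopic3 (X \<union> (closed_segment w a \<union> chain (a # b # L))) (X \<union> (closed_segment w b \<union> chain (b # L)))"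
proof -
  have ab: "fst a \<noteq> fst b" using sc by simp
  have h: "snd a = h" "snd b = h" using ht[of a] ht[of b] chain_hd_last(1)[of b L] by auto
  have "isotopic3 ((X \<union> chain (b # L)) \<union> closed_segment w b)
      ((X \<union> chain (b # L)) \<union> closed_segment w a \<union> closed_segment a b)"
  proof (rule isotopic3_triangle)
    show "polyhedral (X \<union> chain (b # L))" using X polyhedral_chain by simp
    show "\<not> collinear {w, b, a}"
    proof
      assume "collinear {w, b, a}"
      then have "collinear {a, b, w}" by (simp add: insert_commute)
      then have "collinear {0, a - b, w - b}" by (subst (asm) collinear_3) auto
      moreover have "a - b \<noteq> 0" "w - b \<noteq> 0" using ab w h by auto
      ultimately obtain k where "w - b = k *\<^sub>R (a - b)" unfolding collinear_lemma by blast
      then have "snd (w - b) = snd (k *\<^sub>R (a - b))" by (rule arg_cong)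
      then show False using w h by simp
    qed
    show "(X \<union> chain (b # L)) \<inter> convex hull {w, b, a} \<subseteq> {w, b}"
    proof
      fix x assume x: "x \<in> (X \<union> chain (b # L)) \<inter> convex hull {w, b, a}"
      then have xh: "x \<in> convex hull {w, a, b}" by (simp add: insert_commute)
      \<comment> \<open>The arc lies in the level of the base, where the triangle consists of its
        base edge only.\<close>
      have key: "x = b" if xc: "x \<in> chain (b # L)"
      proof -
        obtain p u where pu: "p \<in> closed_segment a b" "0 \<le> u" "u \<le> 1" "x = (1 - u) *\<^sub>R w + u *\<^sub>R p" "snd x = (1 - u) * snd w + u * h"
          by (rule cone_point[OF xh h w]) (erule that, assumption+)
        have "snd x = h" using ht[of x] xc by simp
        then have "(1 - u) * (snd w - h) = 0" using pu(5) by (simp add: algebra_simps)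
        then have "u = 1" using w by simp
        then have xp: "x \<in> closed_segment a b" using pu by simp
        have "fst x = fst b" by (rule simple_chainD[OF sc xp xc refl])
        then show ?thesis using \<open>snd x = h\<close> h by (simp add: prod_eq_iff)
      qed
      show "x \<in> {w, b}"
      proof (cases "x \<in> X")
        case True
        then have "x = w \<or> x = last (b # L)" using Xh xh by blast
        then show ?thesis using key chain_hd_last(2)[of b L] by auto
      qed (use key x in auto)
    qed
  qed
  then have "isotopic3 ((X \<union> chain (b # L)) \<union> closed_segment w a \<union> closed_segment a b)
    ((X \<union> chain (b # L)) \<union> closed_segment w b)" by (rule isotopic3_sym)
  moreover have "(X \<union> chain (b # L)) \<union> closed_segment w a \<union> closed_segment a b =
      X \<union> (closed_segment w a \<union> chain (a # b # L))" by auto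
  moreover have "(X \<union> chain (b # L)) \<union> closed_segment w b = X \<union> (closed_segment w b \<union> chain (b # L))" by blast
  ultimately show ?thesis by simp
qed

text \<open>The tip stays joined to \<open>q\<close>, the first vertex of the arc, while its other
  edge moves along the arc from vertex to vertex. The triangles swept meet the edge from
  \<open>q\<close> to \<open>w\<close> only in \<open>w\<close>: a common point further down would
  force \<open>q\<close> to be a point of the remaining arc, as the height fixes the parameter on
  both segments.\<close>

lemma cone_rest:
  assumes X: "polyhedral X" and w: "h < snd w" and q: "snd q = h"
    and Xh: "\<And>x. x \<in> X \<Longrightarrow> h \<le> snd x \<Longrightarrow> x = q \<or> x = last (a # L)"
    and sc: "simple_chain (a # L)" and ht: "\<And>p. p \<in> chain (a # L) \<Longrightarrow> snd p = h" and qL: "q \<notin> chain (a # L)"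
  shows "isotopic3 (X \<union> closed_segment q w \<union> (closed_segment w a \<union> chain (a # L)))
    (X \<union> closed_segment q w \<union> closed_segment w (last (a # L)))"
  using Xh sc ht qL
proof (induction L arbitrary: a)
  case Nil
  have "closed_segment w a \<union> chain [a] = closed_segment w a" by auto
  then show ?case by (simp add: isotopic3_refl)
next
  case (Cons b L)
  have h: "snd a = h" "snd b = h" using Cons(4)[of a] Cons(4)[of b] chain_hd_last(1)[of b L] by auto
  have "isotopic3 (X \<union> closed_segment q w \<union> (closed_segment w a \<union> chain (a # b # L)))
      (X \<union> closed_segment q w \<union> (closed_segment w b \<union> chain (b # L)))"
  proof (rule cone_step[OF _ Cons(3) _ w])
    show "polyhedral (X \<union> closed_segment q w)" using X by simp
    show "snd p = h" if "p \<in> chain (a # b # L)" for p by (rule Cons(4)[OF that])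
    fix x assume x: "x \<in> X \<union> closed_segment q w" "x \<in> convex hull {w, a, b}"
    obtain p u where pu: "p \<in> closed_segment a b" "0 \<le> u" "u \<le> 1" "x = (1 - u) *\<^sub>R w + u *\<^sub>R p" "snd x = (1 - u) * snd w + u * h"
      by (rule cone_point[OF x(2) h w]) (erule that, assumption+)
    have pq: "p \<noteq> q" using pu(1) Cons(5) by auto
    have "snd x - h = (1 - u) * (snd w - h)" using pu(5) by (simp add: algebra_simps)
    moreover have "0 \<le> (1 - u) * (snd w - h)" using pu(3) w by simp
    ultimately have xh: "h \<le> snd x" by simp
    consider "x \<in> X" | "x \<in> closed_segment q w" using x(1) by blast
    then show "x = w \<or> x = last (b # L)"
    proof cases
      case 1
      have "x \<noteq> q"
      proof
        assume e: "x = q"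
        then have "(1 - u) * (snd w - h) = 0" using q pu(5) by (simp add: algebra_simps)
        then have "u = 1" using w by simp
        then show False using e pu(4) pq by simp
      qed
      then show ?thesis using Cons(2)[OF 1 xh] by simp
    next
      case 2
      then obtain s where s: "x = (1 - s) *\<^sub>R q + s *\<^sub>R w" unfolding in_segment by blast
      have "snd x = (1 - s) * h + s * snd w" using s q by simp
      then have "(1 - s - u) * (snd w - h) = 0" using pu(5) by (simp add: algebra_simps)
      then have su: "s = 1 - u" using w by simp
      have "u *\<^sub>R (p - q) = 0" using pu(4) unfolding s su by (auto simp: algebra_simps)
      then have "u = 0" using pq by simp
      then show ?thesis using pu(4) by simp
    qed
  qed
  also have "isotopic3 \<dots> (X \<union> closed_segment q w \<union> closed_segment w (last (b # L)))"
    by (rule Cons.IH) (use Cons(2-5) in auto)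
  finally show ?case by simp
qed

text \<open>The first edge opens the cone, being replaced by the path over \<open>w\<close>. From
  then on the second edge at \<open>w\<close> is moved along the arc.\<close>

lemma cone_chain:
  assumes X: "polyhedral X" and w: "h < snd w"
    and sc: "simple_chain (a # b # L)" and ht: "\<And>p. p \<in> chain (a # b # L) \<Longrightarrow> snd p = h"
    and Xh: "\<And>x. x \<in> X \<Longrightarrow> h \<le> snd x \<Longrightarrow> x = a \<or> x = last (b # L)"
  shows "isotopic3 (X \<union> chain (a # b # L)) (X \<union> closed_segment a w \<union> closed_segment w (last (b # L)))"
proof -
  have sa: "snd a = h" using ht[of a] by simp
  have sb: "snd b = h" using ht[of b] chain_hd_last(1)[of b L] by simp
  have anb: "a \<notin> chain (b # L)"
  proof
    assume "a \<in> chain (b # L)"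
    then have "fst a = fst b" by (intro simple_chainD[OF sc, of a a]) auto
    then show False using sc by simp
  qed
  have "isotopic3 ((X \<union> chain (b # L)) \<union> closed_segment a b)
      ((X \<union> chain (b # L)) \<union> closed_segment a w \<union> closed_segment w b)"
  proof (rule isotopic3_triangle)
    show "polyhedral (X \<union> chain (b # L))" using X polyhedral_chain by simp
    show "\<not> collinear {a, b, w}"
    proof
      assume "collinear {a, b, w}"
      then have "collinear {0, a - b, w - b}" by (subst (asm) collinear_3) auto
      moreover have "a - b \<noteq> 0" "w - b \<noteq> 0" using sc w sb by auto
      ultimately obtain k where "w - b = k *\<^sub>R (a - b)" unfolding collinear_lemma by blast
      then have "snd (w - b) = snd (k *\<^sub>R (a - b))" by (rule arg_cong)
      then show False using w sa sb by simp
    qed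
    show "(X \<union> chain (b # L)) \<inter> convex hull {a, b, w} \<subseteq> {a, b}"
    proof
      fix x assume x: "x \<in> (X \<union> chain (b # L)) \<inter> convex hull {a, b, w}"
      have "{a, b, w} = {w, a, b}" by blast
      then have xh: "x \<in> convex hull {w, a, b}" using x by simp
      obtain p u where pu: "p \<in> closed_segment a b" "0 \<le> u" "u \<le> 1" "x = (1 - u) *\<^sub>R w + u *\<^sub>R p" "snd x = (1 - u) * snd w + u * h"
        by (rule cone_point[OF xh sa sb w]) (erule that, assumption+)
      have "snd x - h = (1 - u) * (snd w - h)" using pu(5) by (simp add: algebra_simps)
      moreover have "0 \<le> (1 - u) * (snd w - h)" using pu(3) w by simp
      ultimately have xge: "h \<le> snd x" by simp
      have key: "x = b" if xc: "x \<in> chain (b # L)"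
      proof -
        have "snd x = h" using ht[of x] xc by simp
        then have "(1 - u) * (snd w - h) = 0" using pu(5) by (simp add: algebra_simps)
        then have "u = 1" using w by simp
        then have xp: "x \<in> closed_segment a b" using pu by simp
        have "fst x = fst b" by (rule simple_chainD[OF sc xp xc refl])
        then show ?thesis using \<open>snd x = h\<close> sb by (simp add: prod_eq_iff)
      qed
      show "x \<in> {a, b}"
      proof (cases "x \<in> X")
        case True
        then have "x = a \<or> x = last (b # L)" using Xh xge by blast
        then show ?thesis using key chain_hd_last(2)[of b L] by auto
      qed (use key x in auto)
    qed
  qed
  also have "(X \<union> chain (b # L)) \<union> closed_segment a w \<union> closed_segment w b =
      X \<union> closed_segment a w \<union> (closed_segment w b \<union> chain (b # L))" by blast
  also have "isotopic3 \<dots> (X \<union> closed_segment a w \<union> closed_segment w (last (b # L)))"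
    by (rule cone_rest[OF X w sa Xh]) (use sc ht anb in auto)
  also have "(X \<union> chain (b # L)) \<union> closed_segment a b = X \<union> chain (a # b # L)" by auto
  finally show ?thesis .
qed

lemma simple_chain_at_height: "simple_chain L \<Longrightarrow> simple_chain (map (at_height h) L)"
proof (induction L rule: simple_chain.induct)
  case (1 a b L)
  have "fst ` at_height h ` S = fst ` S" for S by (simp add: image_image)
  then have "fst ` closed_segment (at_height h a) (at_height h b) = fst ` closed_segment a b"
    "fst ` chain (map (at_height h) (b # L)) = fst ` chain (b # L)"
    unfolding at_height_segment[symmetric] chain_at_height by blast+
  then show ?case using 1 by simp
qed auto

text \<open>The result depends on the arc only through its two end points, so for fixed
  \<open>h\<close> and \<open>w\<close> it is a normal form. The arc is lifted at its first vertex,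
  raised edge by edge to the level \<open>h\<close>, and then coned from \<open>w\<close>.\<close>

lemma over_arc_canonical:
  assumes X: "polyhedral X" and sc: "simple_chain (a # b # L)"
    and below: "\<And>x. x \<in> X \<union> chain (a # b # L) \<Longrightarrow> snd x < h" and w: "h < snd w"
    and over: "\<And>x p. x \<in> X \<Longrightarrow> p \<in> chain (a # b # L) \<Longrightarrow> fst x = fst p \<Longrightarrow>
      snd x < snd p \<or> x = a \<or> x = last (b # L)"
  shows "isotopic3 (X \<union> chain (a # b # L))
    (X \<union> closed_segment a (at_height h a) \<union> closed_segment (at_height h (last (b # L))) (last (b # L)) \<union>
     closed_segment (at_height h a) w \<union> closed_segment w (at_height h (last (b # L))))"
proof -
  let ?a = "at_height h a" and ?l = "last (b # L)"
  let ?ll = "at_height h ?l"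
  have ab: "fst a \<noteq> fst b" using sc by simp
  have la: "fst ?l \<noteq> fst a" using simple_chain_last[OF sc] by simp
  have lc: "?l \<in> chain (b # L)" by (rule chain_hd_last)
  have h: "snd a < h" "snd b < h" "snd ?l < h" using below[of a] below[of b] below[of ?l] chain_hd_last[of b L] by auto
  have last_eq: "last (at_height h b # map (at_height h) L) = ?ll" using last_map[of "b # L" "at_height h"] by simp
  let ?X = "X \<union> closed_segment a ?a"
  \<comment> \<open>The first vertex is lifted vertically. This produces the slanted edge with which
    the raising of the arc begins.\<close>
  have "isotopic3 ((X \<union> chain (b # L)) \<union> closed_segment a b)
      ((X \<union> chain (b # L)) \<union> closed_segment a ?a \<union> closed_segment ?a b)"
  proof (rule isotopic3_triangle)
    show "polyhedral (X \<union> chain (b # L))" using X polyhedral_chain by simp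
    have eq: "{a, b, ?a} = {b, a, ?a}" by blast
    show "\<not> collinear {a, b, ?a}" unfolding eq by (rule wall_noncollinear) (use ab h in auto)
    show "(X \<union> chain (b # L)) \<inter> convex hull {a, b, ?a} \<subseteq> {a, b}"
    proof
      fix x assume x: "x \<in> (X \<union> chain (b # L)) \<inter> convex hull {a, b, ?a}"
      then have xh: "x \<in> convex hull {b, a, ?a}" unfolding eq by blast
      note w = wall_hull[OF xh ab[symmetric] refl refl at_height_simps(1)]
      obtain p where p: "p \<in> closed_segment a b" "fst p = fst x" "snd p \<le> snd x"
        using w(1) h closed_segment_commute[of a b] by auto
      have key: "x = b" if xc: "x \<in> chain (b # L)"
      proof -
        have "fst p = fst b" by (rule simple_chainD[OF sc p(1) xc p(2)])
        then show ?thesis using w(2) h p(2) by auto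
      qed
      show "x \<in> {a, b}"
      proof (cases "x \<in> X")
        case True
        then have "x = a \<or> x = ?l" using over[OF True, of p] p by auto
        then show ?thesis using key lc by auto
      qed (use key x in auto)
    qed
  qed
  also have "(X \<union> chain (b # L)) \<union> closed_segment a b = X \<union> chain (a # b # L)" by auto
  also have "(X \<union> chain (b # L)) \<union> closed_segment a ?a \<union> closed_segment ?a b =
    ?X \<union> (closed_segment ?a b \<union> chain (b # L))" by blast
  also have "isotopic3 \<dots> (?X \<union> chain (map (at_height h) (a # b # L)) \<union> closed_segment ?ll ?l)"
  proof (rule walls[OF _ sc])
    show "polyhedral ?X" using X by simp
    show "snd p < h" if "p \<in> chain (a # b # L)" for p using below that by blast
    fix x p assume xp: "x \<in> ?X" "p \<in> chain (a # b # L)" "fst x = fst p"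
    show "snd x < snd p \<or> fst x = fst a \<or> x = ?l"
    proof (cases "x \<in> X")
      case True
      then show ?thesis using over[OF _ xp(2,3)] by auto
    next
      case False
      then have "x \<in> closed_segment a ?a" using xp(1) by blast
      then show ?thesis using segment_vertical[of a ?a x] by simp
    qed
  qed
  also have "?X \<union> chain (map (at_height h) (a # b # L)) \<union> closed_segment ?ll ?l =
      (?X \<union> closed_segment ?ll ?l) \<union> chain (?a # at_height h b # map (at_height h) L)" by auto
  also have "isotopic3 \<dots> (?X \<union> closed_segment ?ll ?l \<union> closed_segment ?a w \<union>
      closed_segment w (last (at_height h b # map (at_height h) L)))"
  proof (rule cone_chain[OF _ w])
    show "polyhedral (?X \<union> closed_segment ?ll ?l)" using X by simp
    show "simple_chain (?a # at_height h b # map (at_height h) L)" using simple_chain_at_height[OF sc] by simp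
    show "snd p = h" if "p \<in> chain (?a # at_height h b # map (at_height h) L)" for p
    proof -
      have "p \<in> at_height h ` chain (a # b # L)" using that chain_at_height[of h "a # b # L"] by (simp only: list.map)
      then show ?thesis by auto
    qed
    fix x assume x: "x \<in> ?X \<union> closed_segment ?ll ?l" "h \<le> snd x"
    \<comment> \<open>The vertical segments at the ends reach the level \<open>h\<close> only in
      their upper end points.\<close>
    have top: "x = at_height h c" if xc: "x \<in> closed_segment c (at_height h c)" and c: "snd c < h" for c
    proof -
      obtain u where u: "0 \<le> u" "u \<le> 1" "x = (1 - u) *\<^sub>R c + u *\<^sub>R at_height h c" using xc unfolding in_segment by blast
      have "snd x = (1 - u) * snd c + u * h" using u(3) by simp
      then have "h \<le> (1 - u) * snd c + u * h" using x(2) by simp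
      then have "(1 - u) * (h - snd c) \<le> 0" by (simp add: algebra_simps)
      then have "1 - u \<le> 0" using c by (simp add: mult_le_0_iff)
      then have "u = 1" using u(2) by simp
      then show ?thesis using u(3) by simp
    qed
    consider "x \<in> X" | "x \<in> closed_segment a ?a" | "x \<in> closed_segment ?l ?ll"
      using x(1) closed_segment_commute[of ?l ?ll] by blast
    then have "x = ?a \<or> x = ?ll"
    proof cases
      case 1
      then show ?thesis using below[of x] x(2) by auto
    next
      case 2
      then show ?thesis using top[OF 2] h by blast
    next
      case 3
      then show ?thesis using top[OF 3] h by blast
    qed
    then show "x = ?a \<or> x = last (at_height h b # map (at_height h) L)" unfolding last_eq .
  qed
  also have "last (at_height h b # map (at_height h) L) = ?ll" by (rule last_eq)
  finally show ?thesis by (simp add: Un_ac)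
qed

lemma compact_chain: "compact (chain L)"
  by (induction L rule: chain.induct) (auto intro: compact_Un)

lemma compact_polyhedral: "polyhedral X \<Longrightarrow> compact X"
  for X :: "'a::euclidean_space set"
  unfolding polyhedral_def by (elim exE conjE) (auto intro!: compact_Union)

text \<open>Both arcs have the same normal form once the same level and the same tip are used; a
  common bound \<open>B\<close> on all heights provides these.\<close>

lemma over_arcs_isotopic:
  assumes X: "polyhedral X" and sc: "simple_chain (a # b # L)" "simple_chain (a # b' # L')"
    and l: "last (b # L) = last (b' # L')"
    and over: "\<And>x p. x \<in> X \<Longrightarrow> p \<in> chain (a # b # L) \<Longrightarrow> fst x = fst p \<Longrightarrow> snd x < snd p \<or> x = a \<or> x = last (b # L)"
      "\<And>x p. x \<in> X \<Longrightarrow> p \<in> chain (a # b' # L') \<Longrightarrow> fst x = fst p \<Longrightarrow> snd x < snd p \<or> x = a \<or> x = last (b # L)"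
  shows "isotopic3 (X \<union> chain (a # b # L)) (X \<union> chain (a # b' # L'))"
proof -
  have "compact (X \<union> chain (a # b # L) \<union> chain (a # b' # L'))"
    by (intro compact_Un compact_chain compact_polyhedral X)
  then have "bounded (snd ` (X \<union> chain (a # b # L) \<union> chain (a # b' # L')))"
    by (intro bounded_snd compact_imp_bounded)
  then obtain B where B: "\<forall>y\<in>snd ` (X \<union> chain (a # b # L) \<union> chain (a # b' # L')). norm y \<le> B"
    unfolding bounded_iff by (elim exE) (erule that)
  have h: "snd x < B + 1" if "x \<in> X \<union> chain (a # b # L) \<union> chain (a # b' # L')" for x
    using bspec[OF B imageI[OF that]] by simp
  let ?w = "(0, B + 2) :: space3"
  note 1 = over_arc_canonical[OF X sc(1) _ _ over(1), of "B + 1" ?w]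
  note 2 = over_arc_canonical[OF X sc(2) _ _ over(2)[unfolded l], of "B + 1" ?w]
  show ?thesis
    by (rule isotopic3_trans[OF 1 isotopic3_sym[OF 2[folded l]]]) (use h in auto)
qed

section \<open>The picture near a crossing\<close>

text \<open>Near a crossing the projection consists of two straight strands with independent
  directions. The radius \<open>\<delta>\<close> also separates the two times from the base point
  and from the other crossing times.\<close>

lemma crossing_local:
  assumes kd: "knot_diagram g" and cr: "(t, t') \<in> coinc g" and \<eta>: "\<eta> > 0"
  shows "\<exists>\<delta> d d'. 0 < \<delta> \<and> \<delta> \<le> \<eta> \<and> \<not> collinear {0, d, d'} \<and>
    (\<forall>r. \<bar>r\<bar> \<le> \<delta> \<longrightarrow> shadow g (t + r) = shadow g t + r *\<^sub>R d \<and> shadow g (t' + r) = shadow g t + r *\<^sub>R d') \<and>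
    (\<forall>x\<in>{0, 1} \<union> crossing_times g. (x \<noteq> t \<longrightarrow> \<delta> < \<bar>x - t\<bar>) \<and> (x \<noteq> t' \<longrightarrow> \<delta> < \<bar>x - t'\<bar>))"
proof -
  note kD = knot_diagramD[OF kd]
  obtain d d' where d: "(shadow g has_vector_derivative d) (at t)" and d': "(shadow g has_vector_derivative d') (at t')"
    and nc: "\<not> collinear {0, d, d'}" using kD(8)[OF cr] unfolding transverse_def by (elim exE conjE) (erule that)
  obtain B where B: "finite B" "\<And>s t. 0 \<le> s \<Longrightarrow> s < t \<Longrightarrow> t \<le> 1 \<Longrightarrow> {s<..<t} \<inter> B = {} \<Longrightarrow> affine_on g {s..t}"
    using piecewise_linear_path_breaks[OF kD(1)] by blast
  define P where "P = B \<union> crossing_times g \<union> {0, 1}"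
  have fin: "finite P" "finite {t, t'}" unfolding P_def using B(1) kD(4) by auto
  obtain \<delta> where \<delta>: "\<delta> > 0" "\<delta> \<le> \<eta>" and sep: "\<And>c q. c \<in> {t, t'} \<Longrightarrow> q \<in> P \<Longrightarrow> q \<noteq> c \<Longrightarrow> 2 * \<delta> \<le> \<bar>q - c\<bar>"
    using finite_separation[OF fin \<eta>] by metis
  have lin: "shadow g (c + r) = shadow g c + r *\<^sub>R b"
    if c: "c \<in> {t, t'}" and b: "(shadow g has_vector_derivative b) (at c)" and r: "\<bar>r\<bar> \<le> \<delta>" for c b r
  proof -
    have c01: "c \<in> {0<..<1}" using c kD(7)[OF cr] by blast
    have in01: "0 \<le> c - \<delta>" "c + \<delta> \<le> 1" using sep[OF c, of 0] sep[OF c, of 1] c01 \<delta> unfolding P_def by auto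
    have noB: "q \<notin> B" if "q \<noteq> c" "\<bar>q - c\<bar> < 2 * \<delta>" for q using sep[OF c, of q] that unfolding P_def by force
    have aff: "affine_on g {c..c + \<delta>}" "affine_on g {c - \<delta>..c}"
      using noB in01 c01 \<delta>(1) by (auto intro!: B(2))
    obtain b1 where b1: "\<And>x. 0 \<le> x \<Longrightarrow> x \<le> c + \<delta> - c \<Longrightarrow> shadow g (c + x) = shadow g c + x *\<^sub>R b1"
      by (rule affine_on_right[OF affine_on_shadow[OF aff(1)]]) (use \<delta> in auto)
    obtain b2 where b2: "\<And>x. 0 \<le> x \<Longrightarrow> x \<le> c - (c - \<delta>) \<Longrightarrow> shadow g (c - x) = shadow g c - x *\<^sub>R b2"
      by (rule affine_on_left[OF affine_on_shadow[OF aff(2)]]) (use \<delta> in auto)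
    have "b1 = b" using right_derivative_affine[OF b \<delta>(1), of b1] b1 by simp
    moreover have "b2 = b" using left_derivative_affine[OF b \<delta>(1), of b2] b2 by simp
    ultimately show ?thesis using b1[of r] b2[of "- r"] r by (cases "r \<ge> 0") auto
  qed
  have tt: "shadow g t' = shadow g t" using coincD(4)[OF cr] by simp
  have 1: "shadow g (t + r) = shadow g t + r *\<^sub>R d \<and> shadow g (t' + r) = shadow g t + r *\<^sub>R d'"
    if r: "\<bar>r\<bar> \<le> \<delta>" for r using lin[OF _ d r] lin[OF _ d' r] tt by simp
  have 2: "(x \<noteq> t \<longrightarrow> \<delta> < \<bar>x - t\<bar>) \<and> (x \<noteq> t' \<longrightarrow> \<delta> < \<bar>x - t'\<bar>)" if x: "x \<in> {0, 1} \<union> crossing_times g" for x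
  proof -
    have xP: "x \<in> P" using x unfolding P_def by blast
    show ?thesis using sep[of t x] sep[of t' x] xP \<delta>(1) by auto
  qed
  show ?thesis by (rule exI[of _ \<delta>], rule exI[of _ d], rule exI[of _ d']) (intro conjI \<delta> nc allI impI ballI 1 2)
qed

text \<open>Compactness: the times away from \<open>t\<close> and \<open>t'\<close> project to a
  closed set, which misses the crossing because only two times project there.\<close>

lemma crossing_isolated:
  assumes kd: "knot_diagram g" and cr: "(t, t') \<in> coinc g" and \<delta>: "\<delta> > 0"
  shows "\<exists>\<rho>>0. \<forall>\<tau>\<in>{0..1}. dist (shadow g t) (shadow g \<tau>) < \<rho> \<longrightarrow> \<bar>\<tau> - t\<bar> < \<delta> \<or> \<bar>\<tau> - t'\<bar> < \<delta>"
proof -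
  note kD = knot_diagramD[OF kd]
  let ?R = "{0..1} - ball t \<delta> - ball t' \<delta>"
  have "continuous_on {0..1} g" using kD(1) unfolding piecewise_linear_path_def path_def by blast
  then have cont: "continuous_on {0..1} (shadow g)"
    unfolding shadow_def[abs_def] by (intro continuous_on_fst)
  have "compact ?R" by (intro compact_diff) auto
  then have "compact (shadow g ` ?R)"
    by (intro compact_continuous_image continuous_on_subset[OF cont]) auto
  then have cl: "closed (shadow g ` ?R)" by (rule compact_imp_closed)
  have "shadow g t \<notin> shadow g ` ?R"
  proof
    assume "shadow g t \<in> shadow g ` ?R"
    then obtain \<tau> where \<tau>: "\<tau> \<in> ?R" "shadow g t = shadow g \<tau>" by blast
    have t0: "t \<noteq> 0" using kD(7)[OF cr] by auto
    have \<tau>1: "\<tau> \<noteq> 1"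
    proof
      assume "\<tau> = 1"
      then have "shadow g t = shadow g 0" using \<tau>(2) kD(2) by (simp add: shadow_def)
      then have "(0, t) \<in> coinc g" using coincD(1)[OF cr] t0 by (intro coincI) auto
      from kD(7)[OF this] show False by simp
    qed
    have "\<tau> \<noteq> t" "\<tau> \<noteq> t'" using \<tau>(1) \<delta> by auto
    then have "(t, \<tau>) \<in> coinc g" using \<tau> \<tau>1 coincD(1)[OF cr] by (intro coincI) auto
    then have "\<tau> = t'" using kD(5) cr by blast
    then show False using \<open>\<tau> \<noteq> t'\<close> by blast
  qed
  then obtain \<rho> where \<rho>: "\<rho> > 0" "\<forall>y\<in>shadow g ` ?R. \<rho> \<le> dist (shadow g t) y"
    using separate_point_closed[OF cl] by blast
  have "\<bar>\<tau> - t\<bar> < \<delta> \<or> \<bar>\<tau> - t'\<bar> < \<delta>" if \<tau>: "\<tau> \<in> {0..1}" "dist (shadow g t) (shadow g \<tau>) < \<rho>" for \<tau>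
  proof (rule ccontr)
    assume "\<not> ?thesis"
    then have "\<tau> \<in> ?R" using \<tau>(1) by (auto simp: dist_real_def)
    then have "\<rho> \<le> dist (shadow g t) (shadow g \<tau>)" using \<rho>(2) by blast
    then show False using \<tau>(2) by simp
  qed
  then show ?thesis using \<rho>(1) by blast
qed

lemma fst_segment: "fst ` closed_segment a b = closed_segment (fst a) (fst b)"
  by (rule closed_segment_linear_image[symmetric]) (rule linear_fst)

section \<open>Removing a loop\<close>

text \<open>Induction on the number of break points; the first one splits off an edge.\<close>

lemma chain_of_path:
  fixes g :: "real \<Rightarrow> space3"
  assumes pl: "piecewise_linear_path g" and st: "0 \<le> s" "s < t" "t \<le> 1" and inj: "inj_on (shadow g) {s..t}"
  shows "\<exists>b L. chain (g s # b # L) = g ` {s..t} \<and> simple_chain (g s # b # L) \<and> last (b # L) = g t"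
proof -
  obtain B where B: "finite B" "\<And>s t. 0 \<le> s \<Longrightarrow> s < t \<Longrightarrow> t \<le> 1 \<Longrightarrow> {s<..<t} \<inter> B = {} \<Longrightarrow> affine_on g {s..t}"
    using piecewise_linear_path_breaks[OF pl] by blast
  have "\<exists>b L. chain (g s # b # L) = g ` {s..t} \<and> simple_chain (g s # b # L) \<and> last (b # L) = g t"
    if "card ({s<..<t} \<inter> B) = k" "0 \<le> s" "s < t" "inj_on (shadow g) {s..t}" for k s
    using that
  proof (induction k arbitrary: s rule: less_induct)
    case (less k)
    have fin: "finite ({s<..<t} \<inter> B)" using B(1) by simp
    show ?case
    proof (cases "{s<..<t} \<inter> B = {}")
      case True
      then have "affine_on g {s..t}" using less(3,4) st by (intro B(2)) auto
      then have "g ` {s..t} = closed_segment (g s) (g t)" using less(4) by (intro affine_on_image) auto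
      moreover have "fst (g s) \<noteq> fst (g t)"
        using inj_onD[OF less(5), of s t] less(4) by (auto simp: shadow_def)
      ultimately show ?thesis by (intro exI[of _ "g t"] exI[of _ "[]"]) auto
    next
      case False
      define m where "m = Min ({s<..<t} \<inter> B)"
      have m: "m \<in> {s<..<t} \<inter> B" unfolding m_def using fin False by (rule Min_in)
      have before: "{s<..<m} \<inter> B = {}"
      proof (rule ccontr)
        assume "{s<..<m} \<inter> B \<noteq> {}"
        then obtain x where x: "x \<in> {s<..<m} \<inter> B" by blast
        then have "x \<in> {s<..<t} \<inter> B" using m by auto
        then have "m \<le> x" unfolding m_def by (rule Min_le[OF fin])
        then show False using x by auto
      qed
      have aff: "affine_on g {s..m}" using less(3) m st before by (intro B(2)) auto
      have img: "g ` {s..m} = closed_segment (g s) (g m)" using aff m by (intro affine_on_image) auto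
      have "card ({m<..<t} \<inter> B) < card ({s<..<t} \<inter> B)"
        by (rule psubset_card_mono[OF fin]) (use m in auto)
      then have "card ({m<..<t} \<inter> B) < k" using less(2) by simp
      moreover have "inj_on (shadow g) {m..t}" by (rule inj_on_subset[OF less(5)]) (use m in auto)
      ultimately obtain b L where bL: "chain (g m # b # L) = g ` {m..t}" "simple_chain (g m # b # L)" "last (b # L) = g t"
        using less(1)[of "card ({m<..<t} \<inter> B)" m] less(3) m by auto
      have "{s..t} = {s..m} \<union> {m..t}" using m by auto
      then have 1: "chain (g s # g m # b # L) = g ` {s..t}"
        unfolding chain.simps(1)[of "g s"] bL(1) img[symmetric] by (simp only: image_Un)
      have "fst (g s) \<noteq> fst (g m)"
        using inj_onD[OF less(5), of s m] m by (auto simp: shadow_def)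
      moreover have "fst ` closed_segment (g s) (g m) \<inter> fst ` chain (g m # b # L) \<subseteq> {fst (g m)}"
        unfolding bL(1) img[symmetric]
      proof
        fix z assume "z \<in> fst ` g ` {s..m} \<inter> fst ` g ` {m..t}"
        then obtain x y where xy: "x \<in> {s..m}" "z = fst (g x)" "y \<in> {m..t}" "z = fst (g y)" by blast
        then have "x = y" using m by (intro inj_onD[OF less(5)]) (auto simp: shadow_def)
        then have "x = m" using xy by auto
        then show "z \<in> {fst (g m)}" using xy by simp
      qed
      ultimately have 2: "simple_chain (g s # g m # b # L)" using bL(2) by simp
      show ?thesis using 1 2 bL(3) by (intro exI[of _ "g m"] exI[of _ "b # L"]) simp
    qed
  qed
  from this[OF refl st(1,2) inj] show ?thesis .
qed

text \<open>The arc from just after \<open>t\<close> to just after \<open>t'\<close> crosses the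
  rest of the knot only at \<open>t'\<close>, where it is on top, so it is an over-arc. It may be
  replaced by any over-arc with the same ends, in particular by one that cuts the corner between the
  two outgoing strands and crosses nothing.\<close>

lemma remove_loop_over:
  assumes kd: "knot_diagram g" and cr: "(t, t') \<in> coinc g" and tt: "t < t'"
    and none: "\<And>x. x \<in> crossing_times g \<Longrightarrow> x \<notin> {t<..<t'}" and over: "snd (g t) < snd (g t')"
  shows "\<exists>g'. isotopic3 (path_image g) (path_image g') \<and> knot_diagram g' \<and> num_crossings g' < num_crossings g"
proof -
  note kD = knot_diagramD[OF kd]
  have t01: "t \<in> {0<..<1}" "t' \<in> {0<..<1}" using kD(7)[OF cr] by blast+
  have ct: "t \<in> crossing_times g" "t' \<in> crossing_times g"
    unfolding crossing_times_eq using cr coinc_sym[of t t'] by blast+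
  obtain \<delta> d d' where \<delta>: "0 < \<delta>" and nc: "\<not> collinear {0, d, d'}"
    and lin: "\<And>r. \<bar>r\<bar> \<le> \<delta> \<Longrightarrow> shadow g (t + r) = shadow g t + r *\<^sub>R d"
      "\<And>r. \<bar>r\<bar> \<le> \<delta> \<Longrightarrow> shadow g (t' + r) = shadow g t + r *\<^sub>R d'"
    and sep: "\<And>x. x \<in> {0, 1} \<union> crossing_times g \<Longrightarrow> x \<noteq> t \<Longrightarrow> \<delta> < \<bar>x - t\<bar>"
      "\<And>x. x \<in> {0, 1} \<union> crossing_times g \<Longrightarrow> x \<noteq> t' \<Longrightarrow> \<delta> < \<bar>x - t'\<bar>"
    using crossing_local[OF kd cr zero_less_one] by metis
  obtain \<rho> where \<rho>: "\<rho> > 0" "\<And>\<tau>. \<tau> \<in> {0..1} \<Longrightarrow> dist (shadow g t) (shadow g \<tau>) < \<rho> \<Longrightarrow> \<bar>\<tau> - t\<bar> < \<delta> \<or> \<bar>\<tau> - t'\<bar> < \<delta>"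
    using crossing_isolated[OF kd cr \<delta>] by blast
  \<comment> \<open>Small enough for the whole shortcut to lie where only times close to
    \<open>t\<close> or \<open>t'\<close> project; its points are within
    \<open>2 * \<epsilon> * norm d + \<epsilon> * norm d'\<close> of the crossing.\<close>
  define \<epsilon> where "\<epsilon> = min (\<delta> / 2) (\<rho> / (2 * (2 * norm d + norm d' + 1)))"
  have \<epsilon>: "0 < \<epsilon>" "2 * \<epsilon> \<le> \<delta>" unfolding \<epsilon>_def using \<delta> \<rho>(1) by (auto intro!: divide_pos_pos simp: add_nonneg_pos)
  have \<epsilon>\<rho>: "2 * \<epsilon> * norm d + \<epsilon> * norm d' < \<rho>"
  proof -
    have pos: "0 < 2 * norm d + norm d' + 1" by (simp add: add_nonneg_pos)
    have "\<epsilon> * (2 * norm d + norm d' + 1) \<le> \<rho> / (2 * (2 * norm d + norm d' + 1)) * (2 * norm d + norm d' + 1)"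
      by (intro mult_right_mono) (use pos in \<open>auto simp: \<epsilon>_def\<close>)
    also have "\<dots> = \<rho> / 2" using pos by (simp add: field_simps)
    finally show ?thesis using \<epsilon>(1) \<rho>(1) by (simp add: algebra_simps)
  qed
  obtain X Y :: "complex \<Rightarrow> real" where XY: "linear X" "linear Y" "X d = 1" "X d' = 0" "Y d = 0" "Y d' = 1"
    using plane_coordinates[OF nc] by blast
  note linXY = linear_add[OF XY(1)] linear_add[OF XY(2)] linear_diff[OF XY(1)] linear_diff[OF XY(2)]
    linear_cmul[OF XY(1)] linear_cmul[OF XY(2)] XY(3-6)
  define s0 where "s0 = t + \<epsilon>"
  define t0 where "t0 = t' + \<epsilon>"
  \<comment> \<open>\<open>bend\<close> needs two edges that are not collinear. The corner is
    therefore placed on the arc itself, a bit beyond its start, so that the first edge of the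
    shortcut follows the old strand in the projection.\<close>
  define w where "w = g (t + 2 * \<epsilon>)"
  let ?c = "shadow g t"
  have su: "shadow g s0 = ?c + \<epsilon> *\<^sub>R d" unfolding s0_def using lin(1)[of \<epsilon>] \<epsilon> by simp
  have sw: "fst w = ?c + (2 * \<epsilon>) *\<^sub>R d" unfolding w_def using lin(1)[of "2 * \<epsilon>"] \<epsilon> by (simp add: shadow_def)
  have sv: "shadow g t0 = ?c + \<epsilon> *\<^sub>R d'" unfolding t0_def using lin(2)[of \<epsilon>] \<epsilon> by simp
  have tt\<delta>: "\<delta> < t' - t" using sep(1)[of t'] ct tt by simp
  have st: "0 < s0" "s0 < t0" "t0 < 1" and ins: "s0 < t'" "t' < t0"
    using t01 \<epsilon> tt\<delta> sep(2)[of 1] unfolding s0_def t0_def by auto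
  have mem: "?c + x *\<^sub>R d + y *\<^sub>R d' = ?c + x' *\<^sub>R d + y' *\<^sub>R d' \<Longrightarrow> x = x' \<and> y = y'" for x y x' y'
  proof -
    assume "?c + x *\<^sub>R d + y *\<^sub>R d' = ?c + x' *\<^sub>R d + y' *\<^sub>R d'"
    then have "x *\<^sub>R d + y *\<^sub>R d' = x' *\<^sub>R d + y' *\<^sub>R d'" by simp
    then have "X (x *\<^sub>R d + y *\<^sub>R d') = X (x' *\<^sub>R d + y' *\<^sub>R d')" "Y (x *\<^sub>R d + y *\<^sub>R d') = Y (x' *\<^sub>R d + y' *\<^sub>R d')" by simp_all
    then show ?thesis by (simp only: linXY; simp)
  qed
  define S where "S = closed_segment (shadow g s0) (fst w) \<union> closed_segment (fst w) (shadow g t0)"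
  have Sform: "(\<exists>x. z = ?c + x *\<^sub>R d \<and> \<epsilon> \<le> x \<and> x \<le> 2 * \<epsilon>) \<or>
      (\<exists>k. z = ?c + (2 * \<epsilon> * (1 - k)) *\<^sub>R d + (\<epsilon> * k) *\<^sub>R d' \<and> 0 \<le> k \<and> k \<le> 1)" if z: "z \<in> S" for z
  proof (cases "z \<in> closed_segment (shadow g s0) (fst w)")
    case True
    then obtain k where k: "0 \<le> k" "k \<le> 1" "z = (1 - k) *\<^sub>R shadow g s0 + k *\<^sub>R fst w" unfolding in_segment by blast
    have "z = ?c + (\<epsilon> + \<epsilon> * k) *\<^sub>R d" unfolding k(3) su sw by (simp add: algebra_simps scaleR_conv_of_real)
    moreover have "0 \<le> \<epsilon> * k" "\<epsilon> * k \<le> \<epsilon>" using k \<epsilon> by (auto simp: mult_le_cancel_left1)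
    ultimately show ?thesis by (intro disjI1 exI[of _ "\<epsilon> + \<epsilon> * k"]) auto
  next
    case False
    then have "z \<in> closed_segment (fst w) (shadow g t0)" using z unfolding S_def by blast
    then obtain k where k: "0 \<le> k" "k \<le> 1" "z = (1 - k) *\<^sub>R fst w + k *\<^sub>R shadow g t0" unfolding in_segment by blast
    have "z = ?c + (2 * \<epsilon> * (1 - k)) *\<^sub>R d + (\<epsilon> * k) *\<^sub>R d'" unfolding k(3) sv sw by (simp add: algebra_simps scaleR_conv_of_real)
    then show ?thesis using k by blast
  qed
  \<comment> \<open>The shortcut lies in the sector between the outgoing strands, so it can meet the
    knot only on the bounding rays: along its own first edge or at its end
    \<open>t0\<close>.\<close>
  have key: "\<tau> \<in> {s0..t + 2 * \<epsilon>} \<or> \<tau> = t0" if z: "shadow g \<tau> \<in> S" and \<tau>: "\<tau> \<in> {0..1}" for \<tau>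
  proof -
    let ?z = "shadow g \<tau>"
    obtain x y where xy: "?z = ?c + x *\<^sub>R d + y *\<^sub>R d'" "0 \<le> x" "x \<le> 2 * \<epsilon>" "0 \<le> y" "y \<le> \<epsilon>"
      and c: "(\<epsilon> \<le> x \<and> y = 0) \<or> (\<exists>k. x = 2 * \<epsilon> * (1 - k) \<and> y = \<epsilon> * k)"
    proof -
      note w = that
      from Sform[OF z] show thesis
      proof
        assume "\<exists>x. ?z = ?c + x *\<^sub>R d \<and> \<epsilon> \<le> x \<and> x \<le> 2 * \<epsilon>"
        then obtain x where "?z = ?c + x *\<^sub>R d" "\<epsilon> \<le> x" "x \<le> 2 * \<epsilon>" by blast
        then show thesis using \<epsilon> by (intro w[of x 0]) auto
      next
        assume "\<exists>k. ?z = ?c + (2 * \<epsilon> * (1 - k)) *\<^sub>R d + (\<epsilon> * k) *\<^sub>R d' \<and> 0 \<le> k \<and> k \<le> 1"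
        then obtain k where k: "?z = ?c + (2 * \<epsilon> * (1 - k)) *\<^sub>R d + (\<epsilon> * k) *\<^sub>R d'" "0 \<le> k" "k \<le> 1" by blast
        have "0 \<le> \<epsilon> * k" "\<epsilon> * k \<le> \<epsilon>" using k \<epsilon> by (auto simp: mult_le_cancel_left1)
        then show thesis using k by (intro w[of "2 * \<epsilon> * (1 - k)" "\<epsilon> * k"]) (auto simp: algebra_simps)
      qed
    qed
    have "dist ?c ?z = norm (x *\<^sub>R d + y *\<^sub>R d')" unfolding xy(1) by (simp add: dist_norm norm_minus_commute add.commute)
    also have "\<dots> \<le> norm (x *\<^sub>R d) + norm (y *\<^sub>R d')" by (rule norm_triangle_ineq)
    also have "\<dots> \<le> 2 * \<epsilon> * norm d + \<epsilon> * norm d'" using xy by (intro add_mono) (auto intro!: mult_right_mono)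
    also have "\<dots> < \<rho>" by (rule \<epsilon>\<rho>)
    finally have "\<bar>\<tau> - t\<bar> < \<delta> \<or> \<bar>\<tau> - t'\<bar> < \<delta>" using \<rho>(2)[OF \<tau>] by simp
    then show ?thesis
    proof
      assume "\<bar>\<tau> - t\<bar> < \<delta>"
      then have "?z = ?c + (\<tau> - t) *\<^sub>R d + 0 *\<^sub>R d'" using lin(1)[of "\<tau> - t"] by simp
      then have "\<tau> - t = x" "y = 0" using mem[of "\<tau> - t" 0 x y] xy(1) by auto
      moreover have "\<epsilon> \<le> x" using c \<open>y = 0\<close> \<epsilon> by auto
      ultimately show ?thesis using xy(3) unfolding s0_def by auto
    next
      assume "\<bar>\<tau> - t'\<bar> < \<delta>"
      then have "?z = ?c + 0 *\<^sub>R d + (\<tau> - t') *\<^sub>R d'" using lin(2)[of "\<tau> - t'"] by simp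
      then have *: "\<tau> - t' = y" "x = 0" using mem[of 0 "\<tau> - t'" x y] xy(1) by auto
      then have "y = \<epsilon>" using c \<epsilon> by auto
      then show ?thesis using * unfolding t0_def by auto
    qed
  qed
  have ncs: "s0 \<notin> crossing_times g" "t0 \<notin> crossing_times g"
    using sep(1)[of s0] sep(2)[of t0] \<epsilon> unfolding s0_def t0_def by auto
  have ncol: "\<not> collinear {shadow g s0, fst w, shadow g t0}"
  proof
    assume "collinear {shadow g s0, fst w, shadow g t0}"
    then have "collinear {0, shadow g s0 - fst w, shadow g t0 - fst w}" by (subst (asm) collinear_3) auto
    moreover have e: "shadow g s0 - fst w = (- \<epsilon>) *\<^sub>R d" "shadow g t0 - fst w = (- 2 * \<epsilon>) *\<^sub>R d + \<epsilon> *\<^sub>R d'"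
      unfolding su sw sv by (simp_all add: algebra_simps scaleR_conv_of_real)
    moreover have "d \<noteq> 0" using nc by auto
    moreover have "Y ((- 2 * \<epsilon>) *\<^sub>R d + \<epsilon> *\<^sub>R d') = \<epsilon>" by (simp only: linXY; simp)
    then have "(- 2 * \<epsilon>) *\<^sub>R d + \<epsilon> *\<^sub>R d' \<noteq> 0" using \<epsilon> linear_0[OF XY(2)] by (metis less_irrefl)
    ultimately obtain k where "(- 2 * \<epsilon>) *\<^sub>R d + \<epsilon> *\<^sub>R d' = k *\<^sub>R ((- \<epsilon>) *\<^sub>R d)"
      using \<epsilon> unfolding collinear_lemma by auto
    then have "Y ((- 2 * \<epsilon>) *\<^sub>R d + \<epsilon> *\<^sub>R d') = Y (k *\<^sub>R ((- \<epsilon>) *\<^sub>R d))" by (rule arg_cong)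
    then have "\<epsilon> = 0" by (simp only: linXY; simp)
    then show False using \<epsilon> by simp
  qed
  let ?g = "bend g s0 t0 w"
  have bendS: "shadow ?g \<sigma> \<in> S" if "\<sigma> \<in> {s0..t0}" for \<sigma>
  proof -
    have "?g \<sigma> \<in> closed_segment (g s0) w \<union> closed_segment w (g t0)"
    proof (cases "\<sigma> \<le> (s0 + t0) / 2")
      case True
      then have "?g \<sigma> \<in> ?g ` {s0..(s0 + t0) / 2}" using that by (intro imageI) auto
      then show ?thesis using bend_image_left[OF st(2)] by blast
    next
      case False
      then have "?g \<sigma> \<in> ?g ` {(s0 + t0) / 2..t0}" using that by (intro imageI) auto
      then show ?thesis using bend_image_right[OF st(2)] by blast
    qed
    then have "fst (?g \<sigma>) \<in> fst ` (closed_segment (g s0) w \<union> closed_segment w (g t0))" by (rule imageI)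
    then show ?thesis unfolding S_def image_Un fst_segment shadow_def .
  qed
  have N: "shadow ?g \<sigma> = shadow g \<tau> \<longleftrightarrow> (\<sigma>, \<tau>) \<in> {}" if \<sigma>: "\<sigma> \<in> {s0<..<t0}" and \<tau>: "\<tau> \<in> {0..<1} - {s0<..<t0}" for \<sigma> \<tau>
  proof -
    have "shadow ?g \<sigma> \<noteq> shadow g \<tau>"
    proof
      assume eq: "shadow ?g \<sigma> = shadow g \<tau>"
      have "shadow g \<tau> \<in> S" using bendS[of \<sigma>] \<sigma> eq by simp
      then have "\<tau> = s0 \<or> \<tau> = t0" using key[of \<tau>] \<tau> st tt\<delta> \<epsilon> unfolding s0_def t0_def by auto
      then have e: "\<tau> = s0 \<or> \<tau> = t0" and "shadow g \<tau> = shadow ?g \<tau>"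
        using bend_outside[OF st(2), of \<tau> g w] by (auto simp: shadow_def)
      then have "bend (shadow g) s0 t0 (fst w) \<sigma> = bend (shadow g) s0 t0 (fst w) \<tau>"
        using eq unfolding shadow_bend by simp
      from bend_inj[OF st(2) ncol _ _ this] have "\<sigma> = \<tau>" using \<sigma> e st by auto
      then show False using \<sigma> \<tau> by blast
    qed
    then show ?thesis by simp
  qed
  \<comment> \<open>With no new crossings allowed, the crossing of \<open>t\<close> and
    \<open>t'\<close> is lost, because \<open>t'\<close> lies on the removed piece.\<close>
  note bd = bend_diagram[OF kd st ncs ncol, of "{}", OF N]
  have co: "coinc ?g = coinc g \<inter> (- {s0<..<t0}) \<times> (- {s0<..<t0})" and kdg: "knot_diagram ?g"
    using bd by (simp_all add: single_valued_def)
  have "coinc ?g \<subset> coinc g"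
  proof
    show "coinc ?g \<subseteq> coinc g" unfolding co by blast
    have "(t, t') \<notin> coinc ?g" unfolding co using ins by auto
    then show "coinc ?g \<noteq> coinc g" using cr by metis
  qed
  then have "card (coinc ?g) < card (coinc g)" by (rule psubset_card_mono[OF kD(3)])
  then have num: "num_crossings ?g < num_crossings g" unfolding card_coinc[OF kd] card_coinc[OF kdg] by simp
  let ?X = "g ` {0..s0} \<union> g ` {t0..1}"
  have polX: "polyhedral ?X"
    using polyhedral_piecewise_linear_image[OF kD(1), of 0 s0] polyhedral_piecewise_linear_image[OF kD(1), of t0 1] st by auto
  have only: "x = t'" if "x \<in> crossing_times g" "x \<in> {s0..t0}" for x
  proof (rule ccontr)
    assume "x \<noteq> t'"
    then have "\<delta> < \<bar>x - t'\<bar>" using sep(2)[of x] that by simp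
    moreover have "x \<notin> {t<..<t'}" by (rule none[OF that(1)])
    ultimately show False using that(2) \<epsilon> unfolding s0_def t0_def by auto
  qed
  have inj: "inj_on (shadow g) {s0..t0}"
  proof (rule inj_onI, rule ccontr)
    fix x y assume xy: "x \<in> {s0..t0}" "y \<in> {s0..t0}" "shadow g x = shadow g y" "x \<noteq> y"
    then have "(x, y) \<in> coinc g" using st by (intro coincI) auto
    moreover from this have "(y, x) \<in> coinc g" using coinc_sym by blast
    ultimately have "x \<in> crossing_times g" "y \<in> crossing_times g" unfolding crossing_times_eq by (blast intro: DomainI)+
    then show False using only xy by blast
  qed
  obtain b L where bL: "chain (g s0 # b # L) = g ` {s0..t0}" "simple_chain (g s0 # b # L)" "last (b # L) = g t0"
    using chain_of_path[OF kD(1) _ st(2) _ inj] st by auto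
  have X01: thesis if x: "x \<in> ?X" and th: "\<And>\<tau>. \<tau> \<in> {0..s0} \<union> {t0..<1} \<Longrightarrow> x = g \<tau> \<Longrightarrow> thesis" for x thesis
  proof -
    obtain \<tau> where \<tau>: "\<tau> \<in> {0..s0} \<union> {t0..1}" "x = g \<tau>" using x by blast
    show thesis
    proof (cases "\<tau> = 1")
      case True
      then show ?thesis using th[of 0] \<tau>(2) kD(2) st by simp
    next
      case False
      then show ?thesis using th[of \<tau>] \<tau> by auto
    qed
  qed
  have wv: "chain [g s0, w, g t0] = closed_segment (g s0) w \<union> closed_segment w (g t0)" by auto
  have "isotopic3 (?X \<union> chain (g s0 # b # L)) (?X \<union> chain [g s0, w, g t0])"
  proof (rule over_arcs_isotopic[OF polX bL(2)])
    show "simple_chain [g s0, w, g t0]"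
    proof -
      have "closed_segment (shadow g s0) (fst w) \<inter> closed_segment (fst w) (shadow g t0) \<subseteq> {fst w}"
      proof
        fix z assume z: "z \<in> closed_segment (shadow g s0) (fst w) \<inter> closed_segment (fst w) (shadow g t0)"
        from IntD1[OF z] obtain k where k: "z = (1 - k) *\<^sub>R shadow g s0 + k *\<^sub>R fst w" unfolding in_segment by blast
        have z1: "z = ?c + (\<epsilon> + \<epsilon> * k) *\<^sub>R d + 0 *\<^sub>R d'" unfolding k su sw by (simp add: algebra_simps scaleR_conv_of_real)
        from IntD2[OF z] obtain l where l: "z = (1 - l) *\<^sub>R fst w + l *\<^sub>R shadow g t0" unfolding in_segment by blast
        have z2: "z = ?c + (2 * \<epsilon> * (1 - l)) *\<^sub>R d + (\<epsilon> * l) *\<^sub>R d'" unfolding l sv sw by (simp add: algebra_simps scaleR_conv_of_real)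
        have "0 = \<epsilon> * l" using mem[OF z1[unfolded z2, symmetric]] by simp
        then show "z \<in> {fst w}" using l \<epsilon> by simp
      qed
      moreover have "shadow g s0 \<noteq> fst w" "fst w \<noteq> shadow g t0" using ncol by auto
      ultimately show ?thesis by (simp add: fst_segment shadow_def insert_absorb)
    qed
    show "last (b # L) = last [w, g t0]" using bL(3) by simp
  next
    fix x p assume xp: "x \<in> ?X" "p \<in> chain (g s0 # b # L)" "fst x = fst p"
    obtain \<tau> where \<tau>: "\<tau> \<in> {0..s0} \<union> {t0..<1}" "x = g \<tau>" by (rule X01[OF xp(1)])
    obtain \<sigma> where \<sigma>: "\<sigma> \<in> {s0..t0}" "p = g \<sigma>" using xp(2) unfolding bL(1) by blast
    show "snd x < snd p \<or> x = g s0 \<or> x = last (b # L)"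
    proof (cases "\<sigma> = \<tau>")
      case True
      then have "\<tau> = s0 \<or> \<tau> = t0" using \<sigma>(1) \<tau>(1) by auto
      then show ?thesis using \<tau>(2) bL(3) by auto
    next
      case False
      have "(\<sigma>, \<tau>) \<in> coinc g" by (rule coincI) (use \<sigma> \<tau> st xp(3) False in \<open>auto simp: shadow_def\<close>)
      moreover from this have "\<sigma> \<in> crossing_times g" unfolding crossing_times_eq by (rule DomainI)
      then have "\<sigma> = t'" using only \<sigma>(1) by blast
      moreover have "(t', t) \<in> coinc g" using cr coinc_sym by blast
      ultimately have "\<tau> = t" using kD(5) by blast
      then show ?thesis using over \<open>\<sigma> = t'\<close> \<sigma> \<tau> by simp
    qed
  next
    fix x p assume xp: "x \<in> ?X" "p \<in> chain [g s0, w, g t0]" "fst x = fst p"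
    obtain \<tau> where \<tau>: "\<tau> \<in> {0..s0} \<union> {t0..<1}" "x = g \<tau>" by (rule X01[OF xp(1)])
    have "fst p \<in> fst ` (closed_segment (g s0) w \<union> closed_segment w (g t0))" using xp(2) unfolding wv by (rule imageI)
    then have "shadow g \<tau> \<in> S" using xp(3) \<tau>(2) unfolding S_def image_Un fst_segment shadow_def by simp
    then have "\<tau> = s0 \<or> \<tau> = t0" using key[of \<tau>] \<tau> st tt\<delta> \<epsilon> unfolding s0_def t0_def by auto
    then show "snd x < snd p \<or> x = g s0 \<or> x = last (b # L)" using \<tau>(2) bL(3) by auto
  qed
  moreover have "?X \<union> chain (g s0 # b # L) = path_image g"
    unfolding bL(1) path_image_def image_Un[symmetric] using st by (intro arg_cong[of _ _ "(`) g"]) auto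
  moreover have "?X \<union> chain [g s0, w, g t0] = path_image ?g"
    unfolding wv using bend_image[OF st(2), of g w] st by (simp add: Un_assoc)
  ultimately have "isotopic3 (path_image g) (path_image ?g)" by simp
  then show ?thesis using kdg num by blast
qed

text \<open>Reversal exchanges the two ends of the loop, so the strand on top may be taken to be the
  one at which the loop closes.\<close>

lemma remove_loop:
  assumes kd: "knot_diagram g" and cr: "(t, t') \<in> coinc g" and tt: "t < t'"
    and none: "\<And>x. x \<in> crossing_times g \<Longrightarrow> x \<notin> {t<..<t'}"
  shows "\<exists>g'. isotopic3 (path_image g) (path_image g') \<and> knot_diagram g' \<and> num_crossings g' < num_crossings g"
proof -
  note kD = knot_diagramD[OF kd]
  have "g t \<noteq> g t'" "fst (g t) = fst (g t')" using kD(8)[OF cr] coincD(4)[OF cr] by (auto simp: shadow_def)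
  then have "snd (g t) \<noteq> snd (g t')" by (simp add: prod_eq_iff)
  then consider "snd (g t) < snd (g t')" | "snd (g t') < snd (g t)" by linarith
  then show ?thesis
  proof cases
    case 1
    show ?thesis by (rule remove_loop_over[OF kd cr tt none 1])
  next
    case 2
    let ?h = "reversepath g"
    note co = coinc_reversepath[OF kd]
    have kdh: "knot_diagram ?h" by (rule knot_diagram_reversepath[OF kd])
    have crh: "(1 - t', 1 - t) \<in> coinc ?h" unfolding co using cr coinc_sym[of t t'] by simp
    have noneh: "x \<notin> {1 - t'<..<1 - t}" if "x \<in> crossing_times ?h" for x
    proof -
      obtain y where "(x, y) \<in> coinc ?h" using \<open>x \<in> crossing_times ?h\<close> unfolding crossing_times_eq by (elim DomainE)
      then have "(1 - x, 1 - y) \<in> coinc g" unfolding co .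
      then have "1 - x \<in> crossing_times g" unfolding crossing_times_eq by (rule DomainI)
      from none[OF this] show ?thesis by auto
    qed
    have "coinc ?h = (\<lambda>z. (1 - fst z, 1 - snd z)) ` coinc g"
    proof (rule set_eqI)
      fix z :: "real \<times> real"
      show "z \<in> coinc ?h \<longleftrightarrow> z \<in> (\<lambda>z. (1 - fst z, 1 - snd z)) ` coinc g"
      proof
        assume "z \<in> coinc ?h"
        then have "(1 - fst z, 1 - snd z) \<in> coinc g" using co[of "fst z" "snd z"] by simp
        then show "z \<in> (\<lambda>z. (1 - fst z, 1 - snd z)) ` coinc g" by (rule rev_image_eqI) simp
      next
        assume "z \<in> (\<lambda>z. (1 - fst z, 1 - snd z)) ` coinc g"
        then obtain y where y: "y \<in> coinc g" "z = (1 - fst y, 1 - snd y)" by (elim imageE)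
        then show "z \<in> coinc ?h" using co[of "fst z" "snd z"] by simp
      qed
    qed
    moreover have "inj_on (\<lambda>z::real \<times> real. (1 - fst z, 1 - snd z)) (coinc g)"
      by (rule inj_onI) (simp add: prod_eq_iff)
    ultimately have "card (coinc ?h) = card (coinc g)" by (simp add: card_image)
    then have num: "num_crossings ?h = num_crossings g" unfolding card_coinc[OF kd] card_coinc[OF kdh] by simp
    have "snd (?h (1 - t')) < snd (?h (1 - t))" using 2 by (simp add: reversepath_def)
    from remove_loop_over[OF kdh crh _ noneh this] show ?thesis using tt unfolding num by simp
  qed
qed

section \<open>The alternating word\<close>

text \<open>The part of the curve from \<open>\<tau>0\<close> to \<open>\<tau>2\<close> is a simple closed curve; the rest crosses it only once,
  at \<open>\<tau>3\<close>, because at its corner the two strands of the rest leave on the same side.\<close>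

lemma no_alternating_word:
  assumes kd: "knot_diagram g" and ord: "\<tau>0 < \<tau>1" "\<tau>1 < \<tau>2" "\<tau>2 < \<tau>3"
    and ct: "crossing_times g = {\<tau>0, \<tau>1, \<tau>2, \<tau>3}"
    and c02: "(\<tau>0, \<tau>2) \<in> coinc g" and c13: "(\<tau>1, \<tau>3) \<in> coinc g"
  shows False
proof -
  note kD = knot_diagramD[OF kd]
  have t01: "0 < \<tau>0" "\<tau>3 < 1" using kD(7)[OF c02] kD(7)[OF c13] by auto
  have pg: "path g" using kD(1) unfolding piecewise_linear_path_def by blast
  have cont: "continuous_on {0..1} (shadow g)"
    using pg unfolding path_def shadow_def[abs_def] by (intro continuous_on_fst)
  define C where "C = shadow g ` {\<tau>0..\<tau>2}"
  have one: "a = a'" if "(a, b) \<in> coinc g" "(a', b) \<in> coinc g" for a a' b using kD(6) that by blast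
  have pairs: "(a = \<tau>0 \<and> b = \<tau>2) \<or> (a = \<tau>2 \<and> b = \<tau>0) \<or> (a = \<tau>1 \<and> b = \<tau>3) \<or> (a = \<tau>3 \<and> b = \<tau>1)"
    if ab: "(a, b) \<in> coinc g" for a b
  proof -
    have "a \<in> {\<tau>0, \<tau>1, \<tau>2, \<tau>3}" unfolding ct[symmetric] crossing_times_eq using ab by (rule DomainI)
    moreover have "(\<tau>2, \<tau>0) \<in> coinc g" "(\<tau>3, \<tau>1) \<in> coinc g" using c02 c13 coinc_sym by blast+
    ultimately show ?thesis using kD(5)[OF ab] c02 c13 by blast
  qed
  have avoid: "shadow g \<tau> \<notin> C" if \<tau>: "\<tau> \<in> {0..1}" "\<tau> \<notin> {\<tau>0..\<tau>2}" "\<tau> \<noteq> \<tau>3" for \<tau>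
  proof
    assume "shadow g \<tau> \<in> C"
    then obtain \<sigma> where \<sigma>: "\<sigma> \<in> {\<tau>0..\<tau>2}" "shadow g \<tau> = shadow g \<sigma>" unfolding C_def by blast
    define \<tau>' where "\<tau>' = (if \<tau> = 1 then 0 else \<tau>)"
    have "shadow g \<tau>' = shadow g \<sigma>" using \<sigma>(2) kD(2) unfolding \<tau>'_def by (cases "\<tau> = 1") (simp_all add: shadow_def)
    then have "(\<tau>', \<sigma>) \<in> coinc g" using \<tau> \<sigma> ord t01 unfolding \<tau>'_def by (intro coincI) auto
    then show False using pairs[of \<tau>' \<sigma>] \<tau> \<sigma>(1) ord t01 unfolding \<tau>'_def by (auto split: if_splits)
  qed
  \<comment> \<open>Closed because \<open>\<tau>0\<close> and \<open>\<tau>2\<close> project to one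
    point, and simple because the only other crossing time in between, \<open>\<tau>1\<close>, has
    its partner outside.\<close>
  let ?\<gamma> = "subpath \<tau>0 \<tau>2 (shadow g)"
  have pathS: "path (shadow g)" using cont unfolding path_def .
  have imgC: "path_image ?\<gamma> = C" unfolding C_def path_image_subpath using ord by simp
  have fin: "pathfinish ?\<gamma> = pathstart ?\<gamma>" using coincD(4)[OF c02] by simp
  have "simple_path ?\<gamma>" unfolding simple_path_subpath_eq
  proof (intro conjI allI impI)
    show "path ?\<gamma>" by (rule path_subpath[OF pathS]) (use ord t01 in auto)
    show "\<tau>0 \<noteq> \<tau>2" using ord by simp
    fix x y assume xy: "x \<in> closed_segment \<tau>0 \<tau>2 \<and> y \<in> closed_segment \<tau>0 \<tau>2 \<and> shadow g x = shadow g y"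
    then have xy': "x \<in> {\<tau>0..\<tau>2}" "y \<in> {\<tau>0..\<tau>2}" "shadow g x = shadow g y"
      using ord by (auto simp: closed_segment_eq_real_ivl)
    show "x = y \<or> x = \<tau>0 \<and> y = \<tau>2 \<or> x = \<tau>2 \<and> y = \<tau>0"
    proof (cases "x = y")
      case False
      then have "(x, y) \<in> coinc g" using xy' ord t01 by (intro coincI) auto
      then show ?thesis using pairs[of x y] xy' ord by auto
    qed simp
  qed
  from Jordan_inside_outside[OF this fin] have
    front: "frontier (inside C) = C" "frontier (outside C) = C" unfolding imgC by blast+
  obtain \<delta> d d' where \<delta>: "0 < \<delta>" and nc: "\<not> collinear {0, d, d'}"
    and lin: "\<And>r. \<bar>r\<bar> \<le> \<delta> \<Longrightarrow> shadow g (\<tau>0 + r) = shadow g \<tau>0 + r *\<^sub>R d"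
      "\<And>r. \<bar>r\<bar> \<le> \<delta> \<Longrightarrow> shadow g (\<tau>2 + r) = shadow g \<tau>0 + r *\<^sub>R d'"
    and sep: "\<And>x. x \<in> {0, 1} \<union> crossing_times g \<Longrightarrow> x \<noteq> \<tau>0 \<Longrightarrow> \<delta> < \<bar>x - \<tau>0\<bar>"
      "\<And>x. x \<in> {0, 1} \<union> crossing_times g \<Longrightarrow> x \<noteq> \<tau>2 \<Longrightarrow> \<delta> < \<bar>x - \<tau>2\<bar>"
    using crossing_local[OF kd c02 zero_less_one] by metis
  obtain \<rho> where \<rho>: "\<rho> > 0" "\<And>\<tau>. \<tau> \<in> {0..1} \<Longrightarrow> dist (shadow g \<tau>0) (shadow g \<tau>) < \<rho> \<Longrightarrow> \<bar>\<tau> - \<tau>0\<bar> < \<delta> \<or> \<bar>\<tau> - \<tau>2\<bar> < \<delta>"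
    using crossing_isolated[OF kd c02 \<delta>] by blast
  obtain X Y :: "complex \<Rightarrow> real" where XY: "linear X" "linear Y" "X d = 1" "X d' = 0" "Y d = 0" "Y d' = 1"
    using plane_coordinates[OF nc] by blast
  note linXY = linear_add[OF XY(1)] linear_add[OF XY(2)] linear_diff[OF XY(1)] linear_diff[OF XY(2)]
    linear_cmul[OF XY(1)] linear_cmul[OF XY(2)] XY(3-6)
  define \<epsilon> where "\<epsilon> = min \<delta> (\<rho> / (2 * (norm d + norm d' + 1)))"
  have \<epsilon>: "0 < \<epsilon>" "\<epsilon> \<le> \<delta>" unfolding \<epsilon>_def using \<delta> \<rho>(1) by (auto intro!: divide_pos_pos simp: add_nonneg_pos)
  have \<epsilon>\<rho>: "\<epsilon> * norm d + \<epsilon> * norm d' < \<rho>"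
  proof -
    have pos: "0 < norm d + norm d' + 1" by (simp add: add_nonneg_pos)
    have "\<epsilon> * (norm d + norm d' + 1) \<le> \<rho> / (2 * (norm d + norm d' + 1)) * (norm d + norm d' + 1)"
      by (intro mult_right_mono) (use pos in \<open>auto simp: \<epsilon>_def\<close>)
    also have "\<dots> = \<rho> / 2" using pos by (simp add: field_simps)
    finally show ?thesis using \<epsilon>(1) \<rho>(1) by (simp add: algebra_simps)
  qed
  \<comment> \<open>Points on the two strands of the rest next to the corner. From the corner,
    \<open>C\<close> leaves in the directions \<open>d\<close> and \<open>- d'\<close> and the rest
    in the directions \<open>d'\<close> and \<open>- d\<close>; so the segment between these points
    cuts across the corner without meeting \<open>C\<close>.\<close>
  let ?p1 = "shadow g (\<tau>2 + \<epsilon>)" and ?p2 = "shadow g (\<tau>0 - \<epsilon>)"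
  have p: "?p1 = shadow g \<tau>0 + \<epsilon> *\<^sub>R d'" "?p2 = shadow g \<tau>0 - \<epsilon> *\<^sub>R d"
    using lin(2)[of \<epsilon>] lin(1)[of "- \<epsilon>"] \<epsilon> by simp_all
  have seg: "closed_segment ?p1 ?p2 \<inter> C = {}"
  proof (rule equals0I)
    fix z assume z: "z \<in> closed_segment ?p1 ?p2 \<inter> C"
    from IntD1[OF z] obtain k where k: "0 \<le> k" "k \<le> 1" "z = (1 - k) *\<^sub>R ?p1 + k *\<^sub>R ?p2" unfolding in_segment by blast
    from IntD2[OF z] obtain \<tau> where \<tau>: "\<tau> \<in> {\<tau>0..\<tau>2}" "z = shadow g \<tau>" unfolding C_def by blast
    have zf: "z - shadow g \<tau>0 = (\<epsilon> * (1 - k)) *\<^sub>R d' - (\<epsilon> * k) *\<^sub>R d" unfolding k(3) p by (simp add: algebra_simps)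
    have XYz: "X (z - shadow g \<tau>0) = - (\<epsilon> * k)" "Y (z - shadow g \<tau>0) = \<epsilon> * (1 - k)"
      unfolding zf by (simp_all only: linXY) simp_all
    have "dist (shadow g \<tau>0) z = norm (z - shadow g \<tau>0)" by (simp add: dist_norm norm_minus_commute)
    also have "\<dots> \<le> norm ((\<epsilon> * (1 - k)) *\<^sub>R d') + norm ((\<epsilon> * k) *\<^sub>R d)" unfolding zf by (rule norm_triangle_ineq4)
    also have "\<dots> \<le> \<epsilon> * norm d' + \<epsilon> * norm d"
      using k \<epsilon> by (intro add_mono) (simp_all add: abs_mult mult.assoc mult_left_le_one_le)
    also have "\<dots> < \<rho>" using \<epsilon>\<rho> by simp
    finally have "\<bar>\<tau> - \<tau>0\<bar> < \<delta> \<or> \<bar>\<tau> - \<tau>2\<bar> < \<delta>" using \<rho>(2)[of \<tau>] \<tau> ord t01 by auto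
    then show False
    proof
      assume "\<bar>\<tau> - \<tau>0\<bar> < \<delta>"
      then have "z - shadow g \<tau>0 = (\<tau> - \<tau>0) *\<^sub>R d" using lin(1)[of "\<tau> - \<tau>0"] \<tau>(2) by simp
      then have "X (z - shadow g \<tau>0) = \<tau> - \<tau>0" "Y (z - shadow g \<tau>0) = 0" by (simp_all only: linXY) simp_all
      then have "\<tau> - \<tau>0 = - (\<epsilon> * k)" "k = 1" using XYz \<epsilon> by auto
      then show False using \<tau>(1) \<epsilon> by simp
    next
      assume "\<bar>\<tau> - \<tau>2\<bar> < \<delta>"
      then have "z - shadow g \<tau>0 = (\<tau> - \<tau>2) *\<^sub>R d'" using lin(2)[of "\<tau> - \<tau>2"] \<tau>(2) by simp
      then have "X (z - shadow g \<tau>0) = 0" "Y (z - shadow g \<tau>0) = \<tau> - \<tau>2" by (simp_all only: linXY) simp_all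
      then have "\<tau> - \<tau>2 = \<epsilon> * (1 - k)" "k = 0" using XYz \<epsilon> by auto
      then show False using \<tau>(1) \<epsilon> by simp
    qed
  qed
  obtain \<delta>' f e where \<delta>': "0 < \<delta>'" and nc': "\<not> collinear {0, f, e}"
    and lin': "\<And>r. \<bar>r\<bar> \<le> \<delta>' \<Longrightarrow> shadow g (\<tau>1 + r) = shadow g \<tau>1 + r *\<^sub>R f"
      "\<And>r. \<bar>r\<bar> \<le> \<delta>' \<Longrightarrow> shadow g (\<tau>3 + r) = shadow g \<tau>1 + r *\<^sub>R e"
    and sep': "\<And>x. x \<in> {0, 1} \<union> crossing_times g \<Longrightarrow> x \<noteq> \<tau>1 \<Longrightarrow> \<delta>' < \<bar>x - \<tau>1\<bar>"
      "\<And>x. x \<in> {0, 1} \<union> crossing_times g \<Longrightarrow> x \<noteq> \<tau>3 \<Longrightarrow> \<delta>' < \<bar>x - \<tau>3\<bar>"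
    using crossing_local[OF kd c13 zero_less_one] by metis
  obtain \<rho>' where \<rho>': "\<rho>' > 0" "\<And>\<tau>. \<tau> \<in> {0..1} \<Longrightarrow> dist (shadow g \<tau>1) (shadow g \<tau>) < \<rho>' \<Longrightarrow> \<bar>\<tau> - \<tau>1\<bar> < \<delta>' \<or> \<bar>\<tau> - \<tau>3\<bar> < \<delta>'"
    using crossing_isolated[OF kd c13 \<delta>'] by blast
  obtain U V :: "complex \<Rightarrow> real" where UV: "linear U" "linear V" "U f = 1" "U e = 0" "V f = 0" "V e = 1"
    and UVz: "\<And>z. z = U z *\<^sub>R f + V z *\<^sub>R e"
    using plane_coordinates[OF nc'] by blast
  note linUV = linear_add[OF UV(1)] linear_add[OF UV(2)] linear_diff[OF UV(1)] linear_diff[OF UV(2)]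
    linear_cmul[OF UV(1)] linear_cmul[OF UV(2)] UV(3-6)
  have "bounded_linear U" using UV(1) linear_conv_bounded_linear by blast
  then obtain K where K: "K > 0" "\<And>z. norm (U z) \<le> norm z * K" using bounded_linear.pos_bounded by blast
  let ?x = "shadow g \<tau>1"
  \<comment> \<open>The first bound ensures that only times near \<open>\<tau>1\<close> or
    \<open>\<tau>3\<close> project into the disc, the second that the line through its centre in the
    direction \<open>f\<close> belongs to \<open>C\<close> within the disc.\<close>
  define r where "r = min \<rho>' (\<delta>' / K)"
  have r: "0 < r" "r \<le> \<rho>'" "r * K \<le> \<delta>'"
    unfolding r_def using \<rho>'(1) \<delta>' K(1) by (auto simp: min_def field_simps)
  \<comment> \<open>The two halves into which \<open>C\<close> cuts a small disc around the other
    crossing.\<close>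
  define Hp where "Hp = ball ?x r \<inter> {z. V (z - ?x) > 0}"
  define Hm where "Hm = ball ?x r \<inter> {z. V (z - ?x) < 0}"
  have s1: "\<delta>' < \<tau>1 - \<tau>0" "\<delta>' < \<tau>2 - \<tau>1" "\<delta>' < \<tau>3 - \<tau>2" "\<delta>' < 1 - \<tau>3"
    using sep'(1)[of \<tau>0] sep'(1)[of \<tau>2] sep'(2)[of \<tau>2] sep'(2)[of 1] ct ord t01 by auto
  have s0: "\<delta> < \<tau>0" "\<delta> < \<tau>3 - \<tau>2" using sep(1)[of 0] sep(2)[of \<tau>3] ct ord t01 by auto
  have inC: "z \<in> C \<longleftrightarrow> V (z - ?x) = 0" if z: "z \<in> ball ?x r" for z
  proof
    assume "z \<in> C"
    then obtain \<tau> where \<tau>: "\<tau> \<in> {\<tau>0..\<tau>2}" "z = shadow g \<tau>" unfolding C_def by blast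
    then have "\<bar>\<tau> - \<tau>1\<bar> < \<delta>' \<or> \<bar>\<tau> - \<tau>3\<bar> < \<delta>'" using \<rho>'(2)[of \<tau>] z r ord t01 by auto
    then have "\<bar>\<tau> - \<tau>1\<bar> < \<delta>'" using \<tau>(1) s1 by auto
    then have "z - ?x = (\<tau> - \<tau>1) *\<^sub>R f" using lin'(1)[of "\<tau> - \<tau>1"] \<tau>(2) by simp
    then show "V (z - ?x) = 0" by (simp only: linUV) simp
  next
    assume "V (z - ?x) = 0"
    then have zx: "z = ?x + U (z - ?x) *\<^sub>R f" using UVz[of "z - ?x"] by (simp add: algebra_simps)
    have "\<bar>U (z - ?x)\<bar> \<le> norm (z - ?x) * K" using K(2)[of "z - ?x"] by simp
    also have "\<dots> \<le> r * K" using z K(1) by (intro mult_right_mono) (auto simp: dist_norm norm_minus_commute)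
    finally have u: "\<bar>U (z - ?x)\<bar> \<le> \<delta>'" using r(3) by simp
    then have "z = shadow g (\<tau>1 + U (z - ?x))" using lin'(1) zx by simp
    moreover have "\<tau>1 + U (z - ?x) \<in> {\<tau>0..\<tau>2}" using u s1 by auto
    ultimately show "z \<in> C" unfolding C_def by (rule image_eqI)
  qed
  have conH: "connected Hp" "connected Hm"
  proof -
    have V: "V (z - ?x) = V z - V ?x" for z by (rule linear_diff[OF UV(2)])
    have "{z. V (z - ?x) > 0} = V -` {V ?x<..}" "{z. V (z - ?x) < 0} = V -` {..<V ?x}" unfolding V by auto
    then have "convex {z. V (z - ?x) > 0}" "convex {z. V (z - ?x) < 0}"
      using convex_linear_vimage[OF UV(2)] by (metis convex_real_interval(3), metis convex_real_interval(4))
    then show "connected Hp" "connected Hm" unfolding Hp_def Hm_def by (auto intro!: convex_connected convex_Int)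
  qed
  have HC: "Hp \<inter> C = {}" "Hm \<inter> C = {}" unfolding Hp_def Hm_def using inC by auto
  \<comment> \<open>The rest of the curve, cut at \<open>\<tau>3\<close>, its only passage through
    \<open>C\<close>; the second part runs through the base point.\<close>
  define E1 where "E1 = shadow g ` {\<tau>2<..<\<tau>3}"
  define E2 where "E2 = shadow g ` {\<tau>3<..1} \<union> shadow g ` {0..<\<tau>0}"
  have conE: "connected E1" "connected E2"
  proof -
    show "connected E1" unfolding E1_def
      by (intro connected_continuous_image continuous_on_subset[OF cont]) (use ord t01 in auto)
    have "shadow g 1 \<in> shadow g ` {\<tau>3<..1}" using t01 by (intro imageI) auto
    moreover have "shadow g 1 \<in> shadow g ` {0..<\<tau>0}"
      using t01 kD(2) by (intro image_eqI[of _ _ 0]) (auto simp: shadow_def)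
    ultimately have "shadow g ` {\<tau>3<..1} \<inter> shadow g ` {0..<\<tau>0} \<noteq> {}" by blast
    then show "connected E2" unfolding E2_def
      by (intro connected_Un connected_continuous_image continuous_on_subset[OF cont]) (use ord t01 in auto)
  qed
  have EC: "E1 \<inter> C = {}" "E2 \<inter> C = {}"
    unfolding E1_def E2_def using avoid ord t01 by auto
  have p1: "?p1 \<in> E1" and p2: "?p2 \<in> E2" unfolding E1_def E2_def using \<epsilon> s0 by auto
  obtain q where q: "0 < q" "q \<le> \<delta>'" "q * norm e < r"
  proof (rule that[of "min \<delta>' (r / (2 * (norm e + 1)))"])
    have pos: "0 < norm e + 1" by (simp add: add_nonneg_pos)
    show "0 < min \<delta>' (r / (2 * (norm e + 1)))" using \<delta>' r(1) pos by simp
    have "min \<delta>' (r / (2 * (norm e + 1))) * norm e \<le> r / (2 * (norm e + 1)) * norm e" by (intro mult_right_mono) auto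
    also have "\<dots> \<le> r / (2 * (norm e + 1)) * (norm e + 1)" using r(1) by (intro mult_left_mono) auto
    also have "\<dots> = r / 2" using pos by (simp add: field_simps)
    also have "\<dots> < r" using r(1) by simp
    finally show "min \<delta>' (r / (2 * (norm e + 1))) * norm e < r" .
  qed simp
  have q1: "shadow g (\<tau>3 - q) = ?x - q *\<^sub>R e" "shadow g (\<tau>3 + q) = ?x + q *\<^sub>R e"
    using lin'(2)[of "- q"] lin'(2)[of q] q by simp_all
  have "V ((?x - q *\<^sub>R e) - ?x) = - q" "V ((?x + q *\<^sub>R e) - ?x) = q"
    by (simp_all only: linUV) simp_all
  then have "shadow g (\<tau>3 - q) \<in> Hm" "shadow g (\<tau>3 + q) \<in> Hp"
    unfolding q1 Hp_def Hm_def using q by (auto simp: dist_norm)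
  moreover have "shadow g (\<tau>3 - q) \<in> E1" "shadow g (\<tau>3 + q) \<in> E2" unfolding E1_def E2_def using q s1 by auto
  ultimately have meet: "Hm \<inter> E1 \<noteq> {}" "Hp \<inter> E2 \<noteq> {}" by blast+
  \<comment> \<open>A connected set off \<open>C\<close>: from one half disc along the curve to the
    corner, across the corner, and along the curve to the other half disc. Inside and outside of
    \<open>C\<close> both come arbitrarily close to the centre of the disc, so the set meets both,
    which is impossible.\<close>
  define T where "T = (closed_segment ?p1 ?p2 \<union> (Hm \<union> E1)) \<union> (Hp \<union> E2)"
  have m: "connected (Hm \<union> E1)" by (rule connected_Un[OF conH(2) conE(1) meet(1)])
  have n: "connected (Hp \<union> E2)" by (rule connected_Un[OF conH(1) conE(2) meet(2)])
  have "?p1 \<in> closed_segment ?p1 ?p2 \<inter> (Hm \<union> E1)" using p1 by simp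
  then have "connected (closed_segment ?p1 ?p2 \<union> (Hm \<union> E1))"
    by (intro connected_Un[OF connected_segment m]) (metis empty_iff)
  moreover have "?p2 \<in> (closed_segment ?p1 ?p2 \<union> (Hm \<union> E1)) \<inter> (Hp \<union> E2)" using p2 by simp
  then have "(closed_segment ?p1 ?p2 \<union> (Hm \<union> E1)) \<inter> (Hp \<union> E2) \<noteq> {}" by (metis empty_iff)
  ultimately have conT: "connected T" unfolding T_def by (rule connected_Un[OF _ n])
  have TC: "C \<inter> T = {}" unfolding T_def using seg HC EC by blast
  have xC: "?x \<in> C" unfolding C_def using ord by auto
  have "S \<inter> T \<noteq> {}" if S: "frontier S = C" "S \<inter> C = {}" for S
  proof -
    have "?x \<in> closure S" using S(1) xC unfolding frontier_def by blast
    then obtain y where y: "y \<in> S" "dist y ?x < r" using r(1) unfolding closure_approachable by blast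
    then have yb: "y \<in> ball ?x r" by (simp add: dist_commute)
    have "y \<notin> C" using y(1) S(2) by blast
    then have "V (y - ?x) \<noteq> 0" using inC[OF yb] by blast
    then have "y \<in> Hp \<union> Hm" using yb unfolding Hp_def Hm_def by auto
    then show ?thesis using y(1) unfolding T_def by blast
  qed
  from this[OF front(1)] this[OF front(2)] have "inside C \<inter> T \<noteq> {}" "outside C \<inter> T \<noteq> {}"
    using inside_no_overlap[of C] outside_no_overlap[of C] by blast+
  from inside_outside_intersect_connected[OF conT this] show False using TC by blast
qed

section \<open>Minimal diagrams\<close>

lemma card_coinc_split:
  assumes sd: "split_diagram g p q"
  shows "2 * num_crossings g = 2 * card (mixed (coinc g) {p<..<q}) + card (internal (coinc g) {p<..<q})"
proof -
  note kd = sd[unfolded split_diagram_def]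
  note kD = knot_diagramD[OF conjunct1[OF kd]]
  let ?M = "mixed (coinc g) {p<..<q}" and ?I = "internal (coinc g) {p<..<q}"
  have eq: "coinc g = ?M \<union> ?M\<inverse> \<union> ?I"
  proof (rule set_eqI)
    fix z :: "real \<times> real" obtain a b where z: "z = (a, b)" by (cases z)
    have "(a, b) \<in> coinc g \<Longrightarrow> a \<in> {p<..<q} \<or> b \<in> {p<..<q}" using kd by blast
    then show "z \<in> coinc g \<longleftrightarrow> z \<in> ?M \<union> ?M\<inverse> \<union> ?I"
      unfolding z mixed_def internal_def using coinc_sym[of a b g] by blast
  qed
  have fin: "finite ?M" "finite (?M\<inverse>)" "finite ?I" using finite_mixed[OF kD(3)] finite_internal[OF kD(3)] by simp_all
  have d: "?M \<inter> ?M\<inverse> = {}" "(?M \<union> ?M\<inverse>) \<inter> ?I = {}" unfolding mixed_def internal_def by blast+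
  have "card (coinc g) = card (?M \<union> ?M\<inverse>) + card ?I"
    by (subst eq, rule card_Un_disjoint[OF _ fin(3) d(2)]) (use fin in simp)
  also have "card (?M \<union> ?M\<inverse>) = card ?M + card ?M" using card_Un_disjoint[OF fin(1,2) d(1)] by simp
  finally show ?thesis using card_coinc[OF conjunct1[OF kd]] by simp
qed

text \<open>The diagram is rotated so that the interval from \<open>b\<close> to \<open>c\<close>
  becomes the complementary, simple arc. With m mixed among n crossings, untangling leaves fewer
  than \<open>2 ^ (n - m) * (m + 1)\<close> crossings. Since \<open>m + 1 \<le> 2 ^ (m - 1)\<close>
  for \<open>m \<ge> 3\<close>, this is at most \<open>2 ^ (n - 1)\<close>; the inequality fails for
  m = 1 and m = 2, which is the origin of the three passages.\<close>

lemma straighten_arc: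
  assumes kd: "knot_diagram g" and bc: "0 \<le> b" "b < c" "c < 1" and nb: "b \<notin> crossing_times g" "c \<notin> crossing_times g"
    and card: "3 \<le> card (crossing_times g \<inter> {b..c})"
    and free: "\<And>x y. (x, y) \<in> coinc g \<Longrightarrow> x \<in> {b..c} \<Longrightarrow> y \<notin> {b..c}"
  shows "\<exists>g'. isotopic3 (path_image g) (path_image g') \<and> straight_diagram g' \<and>
    num_crossings g' \<le> 2 ^ (num_crossings g - 1) - 1"
proof -
  note kD = knot_diagramD[OF kd]
  have c01: "c \<in> {0..<1}" using bc by auto
  let ?h = "shiftpath c g"
  \<comment> \<open>The time at which the rotated path reaches \<open>b\<close>.\<close>
  define q where "q = b + 1 - c"
  let ?R = "{0<..<q}"
  have q: "0 < q" "q < 1" using bc unfolding q_def by auto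
  note co = coinc_shiftpath[of g, OF kD(2) c01]
  have kdh: "knot_diagram ?h" by (rule knot_diagram_shiftpath[OF kd c01 nb(2)])
  note kH = knot_diagramD[OF kdh]
  have R: "x \<in> ?R \<longleftrightarrow> unrot c x \<notin> {b..c}" if "x \<in> {0..<1}" for x
    using that bc unfolding unrot_def q_def by auto
  have ct: "unrot c x \<in> crossing_times g" if "x \<in> crossing_times ?h" for x
    using that unfolding crossing_times_eq Domain_iff co by blast
  have "unrot c q = b" using bc unfolding unrot_def q_def by auto
  then have nq: "q \<notin> crossing_times ?h" using ct[of q] nb(1) by auto
  have n0: "0 \<notin> crossing_times ?h" using kH(7) unfolding crossing_times_eq Domain_iff by fastforce
  have sd: "split_diagram ?h 0 q" unfolding split_diagram_def
  proof (intro conjI allI impI kdh nq n0)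
    fix x y assume xy: "(x, y) \<in> coinc ?h"
    then have "x \<in> {0..<1}" "y \<in> {0..<1}" "(unrot c x, unrot c y) \<in> coinc g" unfolding co by blast+
    then show "x \<in> ?R \<or> y \<in> ?R" using R free by blast
  qed (use q in auto)
  let ?M = "mixed (coinc ?h) ?R" and ?I = "internal (coinc ?h) ?R"
  have "crossing_times g \<inter> {b..c} \<subseteq> (\<lambda>z. unrot c (snd z)) ` ?M"
  proof
    fix z assume z: "z \<in> crossing_times g \<inter> {b..c}"
    from IntD1[OF z] obtain z' where zz: "(z', z) \<in> coinc g" unfolding crossing_times_eq using coinc_sym by blast
    obtain x where x: "x \<in> {0..<1}" "unrot c x = z" using unrot_surj[OF c01 coincD(2)[OF zz]] by blast
    obtain y where y: "y \<in> {0..<1}" "unrot c y = z'" using unrot_surj[OF c01 coincD(1)[OF zz]] by blast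
    have "(z, z') \<in> coinc g" using zz coinc_sym by blast
    then have "z' \<notin> {b..c}" using free z by blast
    moreover have "(y, x) \<in> coinc ?h" unfolding co using x y zz by simp
    ultimately have "(y, x) \<in> ?M" using R[OF x(1)] R[OF y(1)] x y z unfolding mixed_def by blast
    then show "z \<in> (\<lambda>z. unrot c (snd z)) ` ?M" by (rule rev_image_eqI) (simp add: x)
  qed
  then have "card (crossing_times g \<inter> {b..c}) \<le> card ?M"
    by (rule surj_card_le[OF finite_mixed[OF kH(3)]])
  then have m: "3 \<le> card ?M" using card by simp
  have "card (coinc ?h) \<le> card (coinc g)"
    by (rule card_inj_on_le[OF coinc_shiftpath_inj(2,1)[OF kD(2) c01] kD(3)])
  then have hn: "num_crossings ?h \<le> num_crossings g" using card_coinc[OF kd] card_coinc[OF kdh] by simp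
  obtain g' p' q' where g': "isotopic3 (path_image ?h) (path_image g')" "split_diagram g' p' q'"
    "internal (coinc g') {p'<..<q'} = {}"
    "card (mixed (coinc g') {p'<..<q'}) + 1 \<le> 2 ^ (card ?I div 2) * (card ?M + 1)"
    using untangle[OF sd] by (elim exE conjE) (erule that, assumption+)
  note st = straight_of_split[OF g'(2,3)]
  have img: "path_image ?h = path_image g"
    by (rule path_image_shiftpath) (use kD(2) c01 in \<open>auto simp: pathfinish_def pathstart_def\<close>)
  let ?N = "num_crossings g" and ?m = "card ?M"
  have I: "card ?I div 2 = num_crossings ?h - ?m" "?m \<le> num_crossings ?h" using card_coinc_split[OF sd] by auto
  have pow: "k + 4 \<le> 2 ^ (k + 2)" for k :: nat by (induction k) auto
  obtain k where k: "?m = 3 + k" using le_Suc_ex[OF m] by blast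
  have "?m + 1 = k + 4" "?m - 1 = k + 2" using k by simp_all
  then have "?m + 1 \<le> 2 ^ (?m - 1)" using pow[of k] by simp
  have "num_crossings g' + 1 \<le> 2 ^ (num_crossings ?h - ?m) * (?m + 1)" using g'(4) unfolding st(2) I(1) .
  also have "\<dots> \<le> 2 ^ (num_crossings ?h - ?m) * 2 ^ (?m - 1)" by (intro mult_left_mono) (use \<open>?m + 1 \<le> _\<close> in auto)
  also have "\<dots> = 2 ^ (num_crossings ?h - 1)" unfolding power_add[symmetric] using I(2) m by simp
  also have "\<dots> \<le> 2 ^ (?N - 1)" using hn by (intro power_increasing) auto
  finally have "num_crossings g' \<le> 2 ^ (?N - 1) - 1" by simp
  then show ?thesis using g'(1) st(1) unfolding img by blast
qed

text \<open>Minimality enters only through the absence of removable loops.\<close>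

lemma straighten_minimal:
  assumes kd: "knot_diagram g"
    and min: "\<And>g'. isotopic3 (path_image g) (path_image g') \<Longrightarrow> knot_diagram g' \<Longrightarrow> num_crossings g \<le> num_crossings g'"
  shows "\<exists>g'. isotopic3 (path_image g) (path_image g') \<and> straight_diagram g' \<and>
    num_crossings g' \<le> 2 ^ (num_crossings g - 1) - 1"
proof -
  note kD = knot_diagramD[OF kd]
  let ?S = "crossing_times g" and ?n = "num_crossings g"
  have S01: "x \<in> {0<..<1}" if "x \<in> ?S" for x using that kD(7) unfolding crossing_times_eq Domain_iff by blast
  have "inj_on fst (coinc g)"
  proof (rule inj_onI)
    fix y z :: "real \<times> real" assume yz: "y \<in> coinc g" "z \<in> coinc g" "fst y = fst z"
    then have "(fst y, snd y) \<in> coinc g" "(fst y, snd z) \<in> coinc g" by (metis prod.collapse)+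
    then show "y = z" using kD(5) yz(3) by (intro prod_eqI) auto
  qed
  then have cS: "card ?S = 2 * ?n" unfolding crossing_times_eq Domain_fst by (simp add: card_image card_coinc[OF kd])
  define xs where "xs = sorted_list_of_set ?S"
  have xs: "set xs = ?S" "length xs = 2 * ?n" "sorted_wrt (<) xs"
    unfolding xs_def using kD(4) cS by (simp_all add: strict_sorted_list_of_set)
  define \<tau> where "\<tau> = (!) xs"
  have less: "\<tau> i < \<tau> j" if "i < j" "j < 2 * ?n" for i j
    unfolding \<tau>_def by (rule sorted_wrt_nth_less[OF xs(3) that(1)]) (use xs(2) that in simp)
  have less_iff: "\<tau> i < \<tau> j \<longleftrightarrow> i < j" if "i < 2 * ?n" "j < 2 * ?n" for i j
    using less[of i j] less[of j i] that by (cases i j rule: linorder_cases) auto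
  have ix: "\<exists>i<2 * ?n. x = \<tau> i" if "x \<in> ?S" for x
    using that unfolding xs(1)[symmetric] in_set_conv_nth \<tau>_def xs(2) by blast
  have \<tau>S: "\<tau> i \<in> ?S" if "i < 2 * ?n" for i using that nth_mem[of i xs] xs unfolding \<tau>_def by simp
  have partner: "\<exists>j<2 * ?n. j \<noteq> i \<and> (\<tau> i, \<tau> j) \<in> coinc g" if i: "i < 2 * ?n" for i
  proof -
    obtain y where y: "(\<tau> i, y) \<in> coinc g" using \<tau>S[OF i] unfolding crossing_times_eq by (elim DomainE)
    have "(y, \<tau> i) \<in> coinc g" using y coinc_sym by blast
    then have "y \<in> ?S" unfolding crossing_times_eq by (rule DomainI)
    then obtain j where "j < 2 * ?n" "y = \<tau> j" using ix by blast
    then show ?thesis using y coincD(3)[OF y] by blast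
  qed
  have uniq: "j = k" if "(\<tau> i, \<tau> j) \<in> coinc g" "(\<tau> i, \<tau> k) \<in> coinc g" "j < 2 * ?n" "k < 2 * ?n" for i j k
    using kD(5)[OF that(1,2)] less_iff[OF that(3,4)] less_iff[OF that(4,3)] by simp
  have sym: "(\<tau> j, \<tau> i) \<in> coinc g" if "(\<tau> i, \<tau> j) \<in> coinc g" for i j using that coinc_sym by blast
  \<comment> \<open>There is no crossing time between consecutive ones, so such a pair would bound a
    removable loop.\<close>
  have noloop: "(\<tau> i, \<tau> (Suc i)) \<notin> coinc g" if i: "Suc i < 2 * ?n" for i
  proof
    assume cr: "(\<tau> i, \<tau> (Suc i)) \<in> coinc g"
    have "x \<notin> {\<tau> i<..<\<tau> (Suc i)}" if x: "x \<in> ?S" for x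
    proof -
      obtain k where "k < 2 * ?n" "x = \<tau> k" using ix[OF x] by blast
      then show ?thesis using less_iff[of i k] less_iff[of k "Suc i"] i by auto
    qed
    from remove_loop[OF kd cr less[OF lessI i] this] obtain g' where
      "isotopic3 (path_image g) (path_image g')" "knot_diagram g'" "num_crossings g' < num_crossings g" by blast
    then show False using min[of g'] by simp
  qed
  consider "?n = 0" | "?n = 1" | "?n = 2" | "?n \<ge> 3" by linarith
  then show ?thesis
  proof cases
    \<comment> \<open>With truncated subtraction the bound is \<open>2 ^ 0 - 1 = 0\<close>, and a
      diagram without crossings is straight as it stands.\<close>
    case 1
    then have "?S = {}" using cS kD(4) by simp
    then have ce: "coinc g = {}" unfolding crossing_times_eq Domain_empty_iff .
    have sd: "split_diagram g 0 1" unfolding split_diagram_def using kd \<open>?S = {}\<close> ce by simp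
    have "internal (coinc g) {0<..<1} = {}" unfolding ce internal_def by simp
    from straight_of_split[OF sd this] have "straight_diagram g" by blast
    then show ?thesis using 1 isotopic3_refl by (intro exI[of _ g]) simp
  next
    case 2
    \<comment> \<open>The two passages of a single crossing are consecutive.\<close>
    obtain j where "j < 2" "j \<noteq> 0" "(\<tau> 0, \<tau> j) \<in> coinc g" using partner[of 0] 2 by auto
    moreover from this have "j = Suc 0" by simp
    ultimately show ?thesis using noloop[of 0] 2 by simp
  next
    case 3
    have n1: "(\<tau> 0, \<tau> 1) \<notin> coinc g" "(\<tau> 1, \<tau> 2) \<notin> coinc g" using noloop[of 0] noloop[of 1] 3 by (simp_all add: numeral_2_eq_2)
    obtain j where j: "j < 4" "j \<noteq> 0" "(\<tau> 0, \<tau> j) \<in> coinc g" using partner[of 0] 3 by auto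
    obtain k where k: "k < 4" "k \<noteq> 1" "(\<tau> 1, \<tau> k) \<in> coinc g" using partner[of 1] 3 by auto
    have "j \<noteq> 1" "k \<noteq> 2" using j k n1 by auto
    moreover have "k \<noteq> 0" using k n1 sym by metis
    moreover have "j \<noteq> k" using uniq[of j 0 1] sym[OF j(3)] sym[OF k(3)] 3 by auto
    \<comment> \<open>Since neighbours are not partners, four passages can only be paired as 0 with
      2 and 1 with 3.\<close>
    ultimately have jk: "k = 3" "j = 2" using j k by auto
    have "?S = {\<tau> 0, \<tau> 1, \<tau> 2, \<tau> 3}"
    proof
      show "?S \<subseteq> {\<tau> 0, \<tau> 1, \<tau> 2, \<tau> 3}"
      proof
        fix x assume "x \<in> ?S"
        then obtain i where "i < 4" "x = \<tau> i" using ix 3 by fastforce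
        moreover from this have "i = 0 \<or> i = 1 \<or> i = 2 \<or> i = 3" by linarith
        ultimately show "x \<in> {\<tau> 0, \<tau> 1, \<tau> 2, \<tau> 3}" by blast
      qed
    qed (use \<tau>S 3 in auto)
    from no_alternating_word[OF kd _ _ _ this] show ?thesis using j(3) k(3) jk less 3 by auto
  next
    case 4
    \<comment> \<open>Neighbours are never partners, so three consecutive passages belong to
      distinct crossings if the outer two are not partners. A further passage \<open>i + 3\<close>
      is asked for, so that the arc can end between it and the third one.\<close>
    have ex: ?thesis if b: "0 \<le> b" "b < \<tau> i" "b \<notin> ?S" and i: "i + 3 < 2 * ?n"
      and first: "\<And>k. k < i \<Longrightarrow> \<tau> k < b" and nc: "(\<tau> i, \<tau> (i + 2)) \<notin> coinc g" for b i
    proof -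
      define c where "c = (\<tau> (i + 2) + \<tau> (i + 3)) / 2"
      have c: "\<tau> (i + 2) < c" "c < \<tau> (i + 3)" using less[of "i + 2" "i + 3"] i unfolding c_def by auto
      have T: "?S \<inter> {b..c} = \<tau> ` {i, i + 1, i + 2}"
      proof
        show "?S \<inter> {b..c} \<subseteq> \<tau> ` {i, i + 1, i + 2}"
        proof
          fix x assume x: "x \<in> ?S \<inter> {b..c}"
          then obtain k where k: "k < 2 * ?n" "x = \<tau> k" using ix by blast
          have "\<tau> k < \<tau> (i + 3)" using x k c by auto
          then have "k < i + 3" using less_iff k i by simp
          moreover have "\<not> k < i" using first[of k] x k by auto
          ultimately have "k \<in> {i, i + 1, i + 2}" by auto
          then show "x \<in> \<tau> ` {i, i + 1, i + 2}" unfolding k(2) by (rule imageI)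
        qed
        have "\<tau> i < \<tau> (i + 1)" "\<tau> (i + 1) < \<tau> (i + 2)" using less i by auto
        then show "\<tau> ` {i, i + 1, i + 2} \<subseteq> ?S \<inter> {b..c}" using \<tau>S b c i by auto
      qed
      have ncS: "c \<notin> ?S"
      proof
        assume "c \<in> ?S"
        moreover have "c \<in> {b..c}" using b c less[of i "i + 2"] i by simp
        ultimately have "c \<in> \<tau> ` {i, i + 1, i + 2}" unfolding T[symmetric] by (rule IntI)
        then obtain k where k: "k \<in> {i, i + 1, i + 2}" "c = \<tau> k" by (elim imageE)
        then have "\<not> \<tau> (i + 2) < \<tau> k" using less_iff[of "i + 2" k] i by auto
        then show False using c k by simp
      qed
      show ?thesis
      proof (rule straighten_arc[OF kd b(1) _ _ b(3) ncS])
        show "b < c" using b c less[of i "i + 2"] i by simp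
        show "c < 1" using c S01[OF \<tau>S[of "i + 3"]] i by simp
        have "inj_on \<tau> {i, i + 1, i + 2}"
          using less[of i "i + 1"] less[of "i + 1" "i + 2"] less[of i "i + 2"] i by (auto simp: inj_on_def)
        then show "3 \<le> card (?S \<inter> {b..c})" unfolding T by (simp add: card_image)
        fix x y assume xy: "(x, y) \<in> coinc g" "x \<in> {b..c}"
        have yx: "(y, x) \<in> coinc g" using xy(1) coinc_sym by blast
        have S: "x \<in> ?S" "y \<in> ?S" unfolding crossing_times_eq using DomainI[OF xy(1)] DomainI[OF yx] .
        show "y \<notin> {b..c}"
        proof
          assume "y \<in> {b..c}"
          then obtain k l where kl: "k \<in> {i, i + 1, i + 2}" "x = \<tau> k" "l \<in> {i, i + 1, i + 2}" "y = \<tau> l"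
            using S xy(2) T by blast
          have "(\<tau> i, \<tau> (i + 1)) \<notin> coinc g" "(\<tau> (i + 1), \<tau> (i + 2)) \<notin> coinc g"
            using noloop[of i] noloop[of "i + 1"] i by simp_all
          moreover have "k \<noteq> l" using coincD(3)[OF xy(1)] kl by auto
          ultimately show False using xy(1) yx nc kl by auto
        qed
      qed
    qed
    show ?thesis
    proof (cases "(\<tau> 0, \<tau> 2) \<in> coinc g")
      case False
      show ?thesis
      proof (rule ex[of 0 0])
        show "0 < \<tau> 0" using S01[OF \<tau>S[of 0]] 4 by simp
        show "0 \<notin> ?S" using S01 by force
        show "0 + 3 < 2 * ?n" using 4 by simp
        show "(\<tau> 0, \<tau> (0 + 2)) \<notin> coinc g" using False unfolding add_0 .
      qed simp_all
    next
      case True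
      \<comment> \<open>If the passages 0 and 2 belong to one crossing, then 2 and 4 do not, so the
        arc may start with passage 2. The passages 2 to 5 are available because three crossings have
        six passages.\<close>
      define b where "b = (\<tau> 1 + \<tau> 2) / 2"
      have b: "\<tau> 1 < b" "b < \<tau> 2" using less[of 1 2] 4 unfolding b_def by auto
      show ?thesis
      proof (rule ex[of b 2])
        show "0 \<le> b" using S01[OF \<tau>S[of 1]] b 4 by auto
        show "b < \<tau> 2" by (rule b)
        show "b \<notin> ?S"
        proof
          assume "b \<in> ?S"
          then obtain k where k: "k < 2 * ?n" "b = \<tau> k" using ix by blast
          have "1 < k" "k < 2" using b less_iff[of 1 k] less_iff[of k 2] k 4 by auto
          then show False by simp
        qed
        show "2 + 3 < 2 * ?n" using 4 by simp
        show "\<tau> k < b" if "k < 2" for k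
          using that b less[of 0 1] 4 by (cases "k = 0") (auto simp: less_Suc_eq numeral_2_eq_2)
        show "(\<tau> 2, \<tau> (2 + 2)) \<notin> coinc g"
        proof
          assume "(\<tau> 2, \<tau> (2 + 2)) \<in> coinc g"
          from uniq[OF this sym[OF True]] show False using 4 by simp
        qed
      qed
    qed
  qed
qed

lemma represents_isotopic:
  assumes "represents g K" "isotopic3 (path_image g) (path_image g')"
  shows "represents g' K"
proof -
  have "isotopic3 (path_image g') (path_image g)" by (rule isotopic3_sym[OF assms(2)])
  then show ?thesis using assms(1) inv_stereo_in_S3 unfolding represents_def isotopic3_def
    by (blast intro: ambient_isotopic_trans)
qed

theorem theorem3p2:
  fixes K :: "space4 set" and n :: nat
  assumes "knot K"
    and "crossing_number K = enat n"
  shows "straight_number K \<le> enat (2 ^ (n - 1) - 1)"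
proof -
  let ?A = "{enat (num_crossings g) | g. knot_diagram g \<and> represents g K}"
  \<comment> \<open>The infimum of the empty set is infinite, so the set is nonempty, and the
    minimum is attained because \<open>enat\<close> is well-ordered.\<close>
  have "?A \<noteq> {}" using assms(2) unfolding crossing_number_def by (metis Inf_enat_def enat.distinct(1) infinity_enat_def)
  then have "Inf ?A \<in> ?A" unfolding Inf_enat_def by (metis (no_types, lifting) LeastI_ex ex_in_conv)
  then obtain g where g: "knot_diagram g" "represents g K" "num_crossings g = n"
    using assms(2) unfolding crossing_number_def by auto
  \<comment> \<open>Isotopic diagrams represent the same knot, so a diagram that attains the
    crossing number is minimal in its isotopy class.\<close>
  have "num_crossings g \<le> num_crossings g'" if "isotopic3 (path_image g) (path_image g')" "knot_diagram g'" for g'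
  proof -
    have "enat (num_crossings g') \<in> ?A" using that represents_isotopic[OF g(2)] by blast
    then have "crossing_number K \<le> enat (num_crossings g')" unfolding crossing_number_def by (rule Inf_lower)
    then show ?thesis using assms(2) g(3) by simp
  qed
  from straighten_minimal[OF g(1) this] obtain g' where
    g': "isotopic3 (path_image g) (path_image g')" "straight_diagram g'" "num_crossings g' \<le> 2 ^ (n - 1) - 1"
    unfolding g(3) by blast
  have "straight_number K \<le> enat (num_crossings g')" unfolding straight_number_def
    by (rule Inf_lower) (use g'(2) represents_isotopic[OF g(2) g'(1)] in blast)
  also have "\<dots> \<le> enat (2 ^ (n - 1) - 1)" using g'(3) by simp
  finally show ?thesis .
qed

end
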